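(* Let $s>\frac32$, $c\in\mathbb R\setminus\{0\}$, $\lambda\in(0,1)$, and let $(u,\gamma,\mathbf t)$ be the unique local maximal pathwise solution, with respect to $\mathcal F_0$-measurable initial data $(u_0,\gamma_0)\in L^2(\Omega;\mathbb H^s(\mathbb T))$, of the system on $t\ge0$, $x\in\mathbb T$ $$\begin{cases}\mathrm du+\Big(uu_x+\partial_xG\star\big(u^2+\tfrac12u_x^2+\tfrac12\gamma^2-\tfrac12\gamma_x^2\big)\Big)\mathrm dt=c\,u\,\mathrm dW,\\ \mathrm d\gamma+\Big(u\gamma_x+G\star\big((u_x\gamma_x)_x+u_x\gamma\big)\Big)\mathrm dt=c\,\gamma\,\mathrm dW,\\ u|_{t=0}=u_0,\quad\gamma|_{t=0}=\gamma_0.\end{cases}$$ Suppose there exists a point $x_0\in\mathbb T$ such that $$\mathbb P\left\{(\partial_xu_0)(x_0)<-\frac{c^2}{2\lambda}-\sqrt{\frac{c^4}{4\lambda^2}+\|u_0\|_{H^1}^2+\|\gamma_0\|_{H^1}^2}\right\}=1.$$ Then the solution $(u,\gamma,\mathbf t)$ will blow up in finite time. Moreover, the wave breaking phenomenon occurs with positive probability: $$\mathbb P\left\{\lim_{t\to\mathbf t}\inf_{x\in\mathbb T}u_x(t,x)=-\infty\right\}>0.$$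
   Context: $\mathbb T=\mathbb R/2\pi\mathbb Z$; $u,\gamma$ are real-valued. $\Lambda^r=(1-\partial_x^2)^{r/2}$, $(f,g)_{H^r}=(\Lambda^rf,\Lambda^rg)_{L^2}$; in particular $\|f\|_{H^1}^2=\int_{\mathbb T}(f^2+f_x^2)\,\mathrm dx$. $\mathbb H^r(\mathbb T)=H^r(\mathbb T)\times H^r(\mathbb T)$, $\mathbb W^{1,\infty}(\mathbb T)=W^{1,\infty}(\mathbb T)\times W^{1,\infty}(\mathbb T)$, with product norms. $\star$ is spatial convolution and $G(x)=\dfrac{\cosh(x-2\pi[\frac{x}{2\pi}]-\pi)}{2\sinh\pi}$ ($[\cdot]$ the integer part) is the Green's function of $(1-\partial_x^2)^{-1}$, i.e. $(1-\partial_x^2)^{-1}f=G\star f$ for $f\in L^2(\mathbb T)$. $W$ is a standard one-dimensional Brownian motion on a fixed complete filtered probability space $(\Omega,\mathcal F,\mathbb P,(\mathcal F_t)_{t\ge0})$. A *local strong pathwise solution* is a pair $(\mathbf y,\mathbf t)$, $\mathbf y=(u,\gamma)$, where $\mathbf t$ is a stopping time with $\mathbb P\{\mathbf t>0\}=1$ and $\mathbf y$ is an $\mathbb H^s$-valued $\mathcal F_t$-predictable process with $\mathbf y(\cdot\wedge\mathbf t)\in L^2(\Omega;\mathcal C([0,\infty);\mathbb H^s))$ which satisfies the time-integrated system on $[0,t\wedge\mathbf t]$ for all $t>0$, $\mathbb P$-a.s. The solution $(\mathbf y,\bar{\mathbf t})$ is *maximal* if $\mathbb P\{\bar{\mathbf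 t}>0\}=1$ and there are stopping times $\mathbf t_n$ increasing to $\bar{\mathbf t}$ such that each $(\mathbf y,\mathbf t_n)$ is a local strong pathwise solution and $\sup_{t\in[0,\mathbf t_n]}\|\mathbf y(t)\|_{\mathbb W^{1,\infty}}>n$ on $\{\bar{\mathbf t}<\infty\}$.
   Formalization: "Will blow up in finite time" is stated as blow-up in finite time with positive probability; almost sure blow-up is false, since the random clock ∫exp(cW−c²t/2)dt stays below the deterministic lifespan with positive probability. *)

theory Defs
  imports "HOL-Probability.Probability"
begin

section \<open>Sobolev spaces on the torus\<close>

text \<open>Functions on \<open>\<real> / 2\<pi>\<int>\<close> are \<open>2\<pi>\<close>-periodic functions on the line; integrals over the torus
  are integrals over \<open>[0, 2\<pi>]\<close>.\<close>

definition torus_L2 :: "(real \<Rightarrow> real) set" where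
  "torus_L2 = {f. (\<forall>x. f (x + 2 * pi) = f x) \<and> f \<in> borel_measurable borel \<and>
     set_integrable lborel {0..2 * pi} (\<lambda>x. (f x)\<^sup>2)}"

definition fourier_coeff :: "(real \<Rightarrow> real) \<Rightarrow> int \<Rightarrow> complex" where
  "fourier_coeff f k =
     (LBINT x:{0..2 * pi}. complex_of_real (f x) * cis (- (of_int k * x))) / complex_of_real (2 * pi)"

text \<open>\<open>is_bessel r f g\<close> says that \<open>g = \<Lambda>\<^sup>r f\<close> is in \<open>L\<^sup>2\<close>, where \<open>\<Lambda>\<^sup>r = (1 - \<partial>\<^sub>x\<^sup>2)\<^bsup>r/2\<^esup>\<close> is the
  Fourier multiplier with symbol \<open>(1 + k\<^sup>2)\<^bsup>r/2\<^esup>\<close>. This determines \<open>g\<close> up to null sets.\<close>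

definition is_bessel :: "real \<Rightarrow> (real \<Rightarrow> real) \<Rightarrow> (real \<Rightarrow> real) \<Rightarrow> bool" where
  "is_bessel r f g \<longleftrightarrow> g \<in> torus_L2 \<and>
     (\<forall>k. fourier_coeff g k = complex_of_real ((1 + (of_int k)\<^sup>2) powr (r / 2)) * fourier_coeff f k)"

definition bessel :: "real \<Rightarrow> (real \<Rightarrow> real) \<Rightarrow> real \<Rightarrow> real" where
  "bessel r f = (SOME g. is_bessel r f g)"

text \<open>For \<open>r > 1/2\<close> (the only case in which the set below is used) every class in \<open>H\<^sup>r\<close> has exactly
  one continuous representative, so \<open>H\<^sup>r\<close> is the following set of genuine functions. For \<open>r > 3/2\<close>
  its elements are continuously differentiable.\<close>

definition sobolev_space :: "real \<Rightarrow> (real \<Rightarrow> real) set" where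
  "sobolev_space r = {f \<in> torus_L2. continuous_on UNIV f \<and> (\<exists>g. is_bessel r f g)}"

definition sobolev_inner :: "real \<Rightarrow> (real \<Rightarrow> real) \<Rightarrow> (real \<Rightarrow> real) \<Rightarrow> real" where
  "sobolev_inner r f g = (LBINT x:{0..2 * pi}. bessel r f x * bessel r g x)"

definition sobolev_norm :: "real \<Rightarrow> (real \<Rightarrow> real) \<Rightarrow> real" where
  "sobolev_norm r f = sqrt (sobolev_inner r f f)"

definition sobolev_dist :: "real \<Rightarrow> (real \<Rightarrow> real) \<Rightarrow> (real \<Rightarrow> real) \<Rightarrow> real" where
  "sobolev_dist r f g = sobolev_norm r (\<lambda>x. f x - g x)"

definition sobolev_borel :: "real \<Rightarrow> (real \<Rightarrow> real) measure" where
  "sobolev_borel r = sigma (sobolev_space r)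
     {U. openin (Metric_space.mtopology (sobolev_space r) (sobolev_dist r)) U}"

text \<open>Used only for \<open>C\<^sup>1\<close> functions, for which the weak derivative is the classical one and
  essential suprema are suprema.\<close>

definition W1inf_norm :: "(real \<Rightarrow> real) \<Rightarrow> ennreal" where
  "W1inf_norm f = (SUP x. ennreal \<bar>f x\<bar>) + (SUP x. ennreal \<bar>deriv f x\<bar>)"


section \<open>The nonlocal drift\<close>

definition green :: "real \<Rightarrow> real" where
  "green x = cosh (x - 2 * pi * of_int \<lfloor>x / (2 * pi)\<rfloor> - pi) / (2 * sinh pi)"

definition green_conv :: "(real \<Rightarrow> real) \<Rightarrow> real \<Rightarrow> real" where
  "green_conv f x = (LBINT y:{0..2 * pi}. green (x - y) * f y)"

definition drift_u :: "(real \<Rightarrow> real) \<Rightarrow> (real \<Rightarrow> real) \<Rightarrow> real \<Rightarrow> real" where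
  "drift_u u g x = u x * deriv u x +
     deriv (green_conv (\<lambda>y. (u y)\<^sup>2 + (deriv u y)\<^sup>2 / 2 + (g y)\<^sup>2 / 2 - (deriv g y)\<^sup>2 / 2)) x"

text \<open>For \<open>s\<close> close to \<open>3/2\<close> the term \<open>(u\<^sub>x \<gamma>\<^sub>x)\<^sub>x\<close> is only a distribution (an element of \<open>H\<^bsup>s-2\<^esup>\<close>);
  its convolution with the kernel is, by definition, the derivative of the convolution with the
  continuous function \<open>u\<^sub>x \<gamma>\<^sub>x\<close>.\<close>

definition drift_g :: "(real \<Rightarrow> real) \<Rightarrow> (real \<Rightarrow> real) \<Rightarrow> real \<Rightarrow> real" where
  "drift_g u g x = u x * deriv g x +
     (deriv (green_conv (\<lambda>y. deriv u y * deriv g y)) x + green_conv (\<lambda>y. deriv u y * g y) x)"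


section \<open>Stochastic basis and Brownian motion\<close>

text \<open>Times of the filtration and values of stopping times are of type \<open>ennreal\<close>, i.e. in
  \<open>[0, \<infinity>]\<close>, so that the library notions of filtration and stopping time apply to stopping times
  which may be infinite. \<open>F \<infinity>\<close> is an otherwise irrelevant sub-\<open>\<sigma>\<close>-algebra of \<open>M\<close> containing all
  \<open>F t\<close> (any filtration indexed by \<open>[0, \<infinity>)\<close> extends by \<open>F \<infinity> = M\<close>). Brownian motion and the
  solution processes are indexed by \<open>real\<close>; only times \<open>t \<ge> 0\<close> matter.\<close>

locale brownian_basis =
  prob_space M + complete_measure M + filtration "space M" F
  for M :: "'w measure" and F :: "ennreal \<Rightarrow> 'w measure" +
  fixes W :: "real \<Rightarrow> 'w \<Rightarrow> real"
  assumes F_subalgebra: "\<And>t. subalgebra M (F t)"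
    and F_complete: "null_sets M \<subseteq> sets (F 0)"
    and W_adapted: "\<And>t. 0 \<le> t \<Longrightarrow> W t \<in> borel_measurable (F (ennreal t))"
    and W_zero: "AE \<omega> in M. W 0 \<omega> = 0"
    and W_continuous: "AE \<omega> in M. continuous_on {0..} (\<lambda>t. W t \<omega>)"
    and W_increment: "\<And>a b. 0 \<le> a \<Longrightarrow> a < b \<Longrightarrow>
      distributed M lborel (\<lambda>\<omega>. W b \<omega> - W a \<omega>) (normal_density 0 (sqrt (b - a)))"
    and W_indep: "\<And>a b. 0 \<le> a \<Longrightarrow> a < b \<Longrightarrow>
      indep_set (sets (F (ennreal a)))
        (sets (vimage_algebra (space M) (\<lambda>\<omega>. W b \<omega> - W a \<omega>) borel))"

definition predictable_sigma :: "(ennreal \<Rightarrow> 'w measure) \<Rightarrow> (real \<times> 'w) measure" where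
  "predictable_sigma F = sigma ({0..} \<times> space (F 0))
     ({{0} \<times> A | A. A \<in> sets (F 0)} \<union>
      {{a<..b} \<times> A | a b A. 0 \<le> a \<and> a \<le> b \<and> A \<in> sets (F (ennreal a))})"

text \<open>Predictable processes with values in \<open>H\<^sup>r\<close>.\<close>

definition sobolev_predictable ::
  "(ennreal \<Rightarrow> 'w measure) \<Rightarrow> real \<Rightarrow> (real \<Rightarrow> 'w \<Rightarrow> real \<Rightarrow> real) \<Rightarrow> bool" where
  "sobolev_predictable F r X \<longleftrightarrow>
     (\<lambda>(t, \<omega>). X t \<omega>) \<in> measurable (predictable_sigma F) (sobolev_borel r)"

text \<open>\<open>stopped T t \<omega>\<close> is \<open>t \<and> T \<omega>\<close>.\<close>

definition stopped :: "('w \<Rightarrow> ennreal) \<Rightarrow> real \<Rightarrow> 'w \<Rightarrow> real" where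
  "stopped T t \<omega> = enn2real (min (ennreal t) (T \<omega>))"


section \<open>Stochastic integral of processes with values in a Sobolev space\<close>

text \<open>Convergence to \<open>0\<close> in probability. The exceptional sets are enlarged to events, so that the
  notion is not vacuous for non-measurable \<open>Z n\<close>.\<close>

definition tends_to_0_in_prob :: "'w measure \<Rightarrow> (nat \<Rightarrow> 'w \<Rightarrow> ennreal) \<Rightarrow> bool" where
  "tends_to_0_in_prob M Z \<longleftrightarrow> (\<forall>e::real. 0 < e \<longrightarrow>
     (\<exists>A. (\<forall>n. A n \<in> sets M \<and> {\<omega> \<in> space M. ennreal e < Z n \<omega>} \<subseteq> A n) \<and>
          (\<lambda>n. measure M (A n)) \<longlonglongrightarrow> 0))"

text \<open>Elementary predictable processes \<open>\<Sum>\<^sub>i \<xi>\<^sub>i \<one>\<^bsub>(p\<^sub>i, p\<^sub>i\<^sub>+\<^sub>1]\<^esub>\<close>.\<close>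

definition elementary ::
  "(ennreal \<Rightarrow> 'w measure) \<Rightarrow> real \<Rightarrow> nat \<Rightarrow> (nat \<Rightarrow> real) \<Rightarrow> (nat \<Rightarrow> 'w \<Rightarrow> real \<Rightarrow> real) \<Rightarrow> bool" where
  "elementary F r n p \<xi> \<longleftrightarrow> 0 \<le> p 0 \<and> (\<forall>i<n. p i \<le> p (Suc i)) \<and>
     (\<forall>i<n. \<xi> i \<in> measurable (F (ennreal (p i))) (sobolev_borel r)) \<and>
     (\<exists>C. \<forall>i<n. \<forall>\<omega>\<in>space (F 0). sobolev_norm r (\<xi> i \<omega>) \<le> C)"

definition elementary_process ::
  "nat \<Rightarrow> (nat \<Rightarrow> real) \<Rightarrow> (nat \<Rightarrow> 'w \<Rightarrow> real \<Rightarrow> real) \<Rightarrow> real \<Rightarrow> 'w \<Rightarrow> real \<Rightarrow> real" where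
  "elementary_process n p \<xi> t \<omega> x = (\<Sum>i<n. indicator {p i<..p (Suc i)} t * \<xi> i \<omega> x)"

definition elementary_integral :: "(real \<Rightarrow> 'w \<Rightarrow> real) \<Rightarrow>
    nat \<Rightarrow> (nat \<Rightarrow> real) \<Rightarrow> (nat \<Rightarrow> 'w \<Rightarrow> real \<Rightarrow> real) \<Rightarrow> real \<Rightarrow> 'w \<Rightarrow> real \<Rightarrow> real" where
  "elementary_integral W n p \<xi> t \<omega> x =
     (\<Sum>i<n. (W (min (p (Suc i)) t) \<omega> - W (min (p i) t) \<omega>) * \<xi> i \<omega> x)"

text \<open>\<open>is_ito_integral M F W r X I\<close>: the adapted \<open>H\<^sup>r\<close>-valued process \<open>I\<close> is (a version of) the Ito
  integral process \<open>\<integral>\<^sub>0\<^sup>t X dW\<close>, i.e. the limit, uniformly on compact time intervals in probability,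
  of the integrals of elementary processes which approximate \<open>X\<close> in \<open>L\<^sup>2([0,T]; H\<^sup>r)\<close> in
  probability. It exists iff \<open>X\<close> is square integrable in time almost surely, and is unique up to
  indistinguishability.\<close>

definition is_ito_integral :: "'w measure \<Rightarrow> (ennreal \<Rightarrow> 'w measure) \<Rightarrow> (real \<Rightarrow> 'w \<Rightarrow> real) \<Rightarrow>
    real \<Rightarrow> (real \<Rightarrow> 'w \<Rightarrow> real \<Rightarrow> real) \<Rightarrow> (real \<Rightarrow> 'w \<Rightarrow> real \<Rightarrow> real) \<Rightarrow> bool" where
  "is_ito_integral M F W r X I \<longleftrightarrow>
     sobolev_predictable F r X \<and>
     (\<forall>t\<ge>0. I t \<in> measurable (F (ennreal t)) (sobolev_borel r)) \<and>
     (\<exists>N p \<xi>. (\<forall>n. elementary F r (N n) (p n) (\<xi> n)) \<and>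
       (\<forall>T>0.
         tends_to_0_in_prob M (\<lambda>n \<omega>. \<integral>\<^sup>+t\<in>{0..T}.
           ennreal ((sobolev_dist r (elementary_process (N n) (p n) (\<xi> n) t \<omega>) (X t \<omega>))\<^sup>2) \<partial>lborel) \<and>
         tends_to_0_in_prob M (\<lambda>n \<omega>. SUP t\<in>{0..T}.
           ennreal (sobolev_dist r (elementary_integral W (N n) (p n) (\<xi> n) t \<omega>) (I t \<omega>)))))"


section \<open>Pathwise solutions\<close>

text \<open>\<open>y(\<cdot> \<and> T) \<in> L\<^sup>2(\<Omega>; C([0,\<infinity>); H\<^sup>s \<times> H\<^sup>s))\<close> for \<open>y = (u, g)\<close>. \<open>C([0,\<infinity>); H)\<close> is the space of
  continuous paths with the topology of uniform convergence on compact intervals, hence the second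
  moments of the supremum over each \<open>[0,R]\<close>.\<close>

definition stopped_L2_continuous :: "'w measure \<Rightarrow> real \<Rightarrow>
    (real \<Rightarrow> 'w \<Rightarrow> real \<Rightarrow> real) \<Rightarrow> (real \<Rightarrow> 'w \<Rightarrow> real \<Rightarrow> real) \<Rightarrow> ('w \<Rightarrow> ennreal) \<Rightarrow> bool" where
  "stopped_L2_continuous M s u g T \<longleftrightarrow>
     (AE \<omega> in M. \<forall>t\<ge>0.
        ((\<lambda>r. sobolev_dist s (u (stopped T r \<omega>) \<omega>) (u (stopped T t \<omega>) \<omega>)) \<longlongrightarrow> 0) (at t within {0..}) \<and>
        ((\<lambda>r. sobolev_dist s (g (stopped T r \<omega>) \<omega>) (g (stopped T t \<omega>) \<omega>)) \<longlongrightarrow> 0) (at t within {0..})) \<and>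
     (\<forall>R\<ge>0. (\<integral>\<^sup>+\<omega>. (SUP t\<in>{0..R}. ennreal ((sobolev_norm s (u (stopped T t \<omega>) \<omega>))\<^sup>2 +
        (sobolev_norm s (g (stopped T t \<omega>) \<omega>))\<^sup>2)) \<partial>M) < \<infinity>)"

text \<open>The stochastic integrals are those of \<open>c u\<close> and \<open>c \<gamma>\<close> up to time \<open>T\<close>. The remaining terms of
  the time-integrated system are continuous functions of \<open>x\<close> (elements of \<open>H\<^bsup>s-1\<^esup>\<close> with
  \<open>s - 1 > 1/2\<close>), so that the equation in \<open>H\<^bsup>s-1\<^esup>\<close> is the equation at every \<open>x\<close>.\<close>

definition local_solution :: "'w measure \<Rightarrow> (ennreal \<Rightarrow> 'w measure) \<Rightarrow> (real \<Rightarrow> 'w \<Rightarrow> real) \<Rightarrow>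
    real \<Rightarrow> real \<Rightarrow> ('w \<Rightarrow> real \<Rightarrow> real) \<Rightarrow> ('w \<Rightarrow> real \<Rightarrow> real) \<Rightarrow>
    (real \<Rightarrow> 'w \<Rightarrow> real \<Rightarrow> real) \<Rightarrow> (real \<Rightarrow> 'w \<Rightarrow> real \<Rightarrow> real) \<Rightarrow> ('w \<Rightarrow> ennreal) \<Rightarrow> bool" where
  "local_solution M F W s c u0 g0 u g T \<longleftrightarrow>
     stopping_time F T \<and> measure M {\<omega> \<in> space M. 0 < T \<omega>} = 1 \<and>
     sobolev_predictable F s u \<and> sobolev_predictable F s g \<and>
     stopped_L2_continuous M s u g T \<and>
     (\<exists>Iu Ig.
       is_ito_integral M F W s (\<lambda>t \<omega> x. if ennreal t \<le> T \<omega> then c * u t \<omega> x else 0) Iu \<and>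
       is_ito_integral M F W s (\<lambda>t \<omega> x. if ennreal t \<le> T \<omega> then c * g t \<omega> x else 0) Ig \<and>
       (AE \<omega> in M. \<forall>t\<ge>0. \<forall>x.
          u (stopped T t \<omega>) \<omega> x - u0 \<omega> x + (LBINT r:{0..stopped T t \<omega>}. drift_u (u r \<omega>) (g r \<omega>) x)
            = Iu t \<omega> x \<and>
          g (stopped T t \<omega>) \<omega> x - g0 \<omega> x + (LBINT r:{0..stopped T t \<omega>}. drift_g (u r \<omega>) (g r \<omega>) x)
            = Ig t \<omega> x))"

definition maximal_solution :: "'w measure \<Rightarrow> (ennreal \<Rightarrow> 'w measure) \<Rightarrow> (real \<Rightarrow> 'w \<Rightarrow> real) \<Rightarrow>
    real \<Rightarrow> real \<Rightarrow> ('w \<Rightarrow> real \<Rightarrow> real) \<Rightarrow> ('w \<Rightarrow> real \<Rightarrow> real) \<Rightarrow>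
    (real \<Rightarrow> 'w \<Rightarrow> real \<Rightarrow> real) \<Rightarrow> (real \<Rightarrow> 'w \<Rightarrow> real \<Rightarrow> real) \<Rightarrow> ('w \<Rightarrow> ennreal) \<Rightarrow> bool" where
  "maximal_solution M F W s c u0 g0 u g T \<longleftrightarrow>
     stopping_time F T \<and> measure M {\<omega> \<in> space M. 0 < T \<omega>} = 1 \<and>
     (\<exists>\<tau> :: nat \<Rightarrow> 'w \<Rightarrow> ennreal.
       (\<forall>n. local_solution M F W s c u0 g0 u g (\<tau> n)) \<and>
       (AE \<omega> in M. incseq (\<lambda>n. \<tau> n \<omega>) \<and> (\<lambda>n. \<tau> n \<omega>) \<longlonglongrightarrow> T \<omega>) \<and>
       (AE \<omega> in M. T \<omega> < \<infinity> \<longrightarrow> (\<forall>n.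
          (SUP t\<in>{t. 0 \<le> t \<and> ennreal t \<le> \<tau> n \<omega>}. W1inf_norm (u t \<omega>) + W1inf_norm (g t \<omega>)) > of_nat n)))"

end

theory Submission
  imports Defs
begin

text \<open>With \<open>Z = exp (- c W + c\<^sup>2 t / 2)\<close> and \<open>\<beta> = 1 / Z\<close>, the product rule turns the stochastic system, path by
  path, into the deterministic system with time-dependent coefficient \<open>\<beta>\<close> for \<open>v = Z u\<close> and \<open>e = Z \<gamma>\<close>. The
  energy of \<open>(v, e)\<close> in \<open>H\<^sup>1 \<times> H\<^sup>1\<close> stays below its initial value \<open>N\<close>, and the minimal slope \<open>m\<close> of \<open>v\<close>
  satisfies \<open>m' \<le> - \<beta> (m\<^sup>2 - N) / 2\<close>. With \<open>a = c\<^sup>2 / (2 \<lambda>)\<close> the assumption on \<open>u\<^sub>0\<close> reads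
  \<open>m < - a - sqrt (a\<^sup>2 + N)\<close> at time \<open>0\<close>, so that \<open>m\<close> explodes before \<open>\<integral> \<beta>\<close> exceeds \<open>1 / a\<close>. Since
  \<open>\<integral>\<^sub>0\<^sup>R \<beta>\<close> has expectation \<open>R\<close>, the lifespan cannot be infinite almost surely. Along a path with finite
  lifespan \<open>v\<close>, \<open>e\<close>, \<open>e\<^sub>x\<close> are bounded and \<open>v\<^sub>x\<close> is bounded above, so the continuation criterion makes
  \<open>inf v\<^sub>x\<close> unbounded below; a bound on the growth of the minimal slope makes it tend to \<open>-\<infinity>\<close>.

  For \<open>s\<close> close to \<open>3/2\<close> the equation cannot be differentiated in \<open>x\<close>, so slopes are replaced by
  difference quotients in the comparison arguments. The product rule is proved pointwise in \<open>x\<close>, by passing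
  to the limit in time-discrete sums in mean square.\<close>

section \<open>Fourier series on the torus\<close>

text \<open>The constant in front of \<open>N\<close> comes from the Green's function:
  \<open>v\<^sup>2 - G * (v\<^sup>2 + v\<^sub>x\<^sup>2 / 2)\<close> and
  \<open>e\<^sup>2 / 2 - G * (e\<^sup>2 / 2 - e\<^sub>x\<^sup>2 / 2)\<close> are each at most half
  the \<open>H\<^sup>1\<close> energy of \<open>v\<close> and of \<open>e\<close>. Only with these
  two halves does the inequality for \<open>m\<close> become the stated Riccati inequality. The Ito
  integral is given only as a limit in probability of elementary integrals in
  \<open>H\<^sup>s\<close>. Evaluation at a point is Lipschitz on \<open>H\<^sup>s\<close>, so each
  \<open>x\<close> yields a real process, and countably many times and points suffice. Neither
  \<open>Z\<close> nor the solution is bounded; the sums are therefore cut off before second moments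
  are taken, and the cutoff is removed path by path. A non-measurable set has measure zero, so a
  positive probability of wave breaking includes the claim that the event is measurable, also on
  paths with infinite lifespan. There the limit at infinity is rewritten with rational times and
  points, and completeness of the measure absorbs the null sets.\<close>

definition torus :: "real measure" where
  "torus = restrict_space lborel {0..2 * pi}"

lemma space_torus [simp]: "space torus = {0..2 * pi}"
  by (simp add: torus_def space_restrict_space)

lemma measurable_torus [measurable (raw)]:
  "f \<in> borel_measurable borel \<Longrightarrow> f \<in> borel_measurable torus"
  unfolding torus_def by (intro measurable_restrict_space1) simp

lemma emeasure_torus_UNIV: "emeasure torus (space torus) = ennreal (2 * pi)"
  by (simp add: torus_def emeasure_restrict_space space_restrict_space)

lemma finite_measure_torus [simp]: "finite_measure torus"
  by (rule finite_measureI) (simp add: emeasure_torus_UNIV del: space_torus)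

lemma measure_torus: "measure torus {0..2 * pi} = 2 * pi"
  using emeasure_torus_UNIV by (simp add: measure_def)

lemma integral_torus:
  fixes f :: "real \<Rightarrow> 'a::{banach, second_countable_topology}"
  shows "(LBINT x:{0..2 * pi}. f x) = (\<integral>x. f x \<partial>torus)"
  unfolding torus_def set_lebesgue_integral_def by (simp add: integral_restrict_space)

lemma integrable_torus_iff:
  fixes f :: "real \<Rightarrow> 'a::{banach, second_countable_topology}"
  shows "integrable torus f \<longleftrightarrow> set_integrable lborel {0..2 * pi} f"
  unfolding torus_def set_integrable_def by (simp add: integrable_restrict_space)

lemma integrable_torus_cont:
  fixes f :: "real \<Rightarrow> 'a::{banach, second_countable_topology}"
  assumes "continuous_on UNIV f"
  shows "integrable torus f"
  unfolding integrable_torus_iff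
  by (rule borel_integrable_atLeastAtMost') (rule continuous_on_subset[OF assms subset_UNIV])

lemma integral_torus_FTC:
  fixes F :: "real \<Rightarrow> 'a::euclidean_space"
  assumes "\<And>x. (F has_vector_derivative f x) (at x)" and "continuous_on UNIV f"
  shows "(\<integral>x. f x \<partial>torus) = F (2 * pi) - F 0"
proof -
  have "(\<integral>x. indicator {0..2 * pi} x *\<^sub>R f x \<partial>lborel) = F (2 * pi) - F 0"
    by (rule integral_FTC_Icc)
      (auto intro: has_vector_derivative_at_within[OF assms(1)] continuous_on_subset[OF assms(2)])
  then show ?thesis
    by (simp add: integral_torus[symmetric] set_lebesgue_integral_def)
qed

lemma integral_torus_cis:
  "(\<integral>x. cis (of_int k * x) \<partial>torus) = (if k = 0 then of_real (2 * pi) else 0)"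
proof (cases "k = 0")
  case True
  then show ?thesis using measure_torus by (simp add: scaleR_conv_of_real)
next
  case False
  define F where "F x = cis (of_int k * x) / (\<i> * of_int k)" for x :: real
  have 1: "(F has_vector_derivative cis (of_int k * x)) (at x)" for x
    unfolding F_def using False
    by (auto intro!: derivative_eq_intros simp: has_vector_derivative_def scaleR_conv_of_real fun_eq_iff complex_eq_iff)
  have 2: "continuous_on UNIV (\<lambda>x. cis (of_int k * x))"
    by (intro continuous_intros)
  have "cis (of_int k * (2 * pi)) = 1"
    using cis_multiple_2pi[of "of_int k"] by (simp add: mult.commute mult.left_commute)
  then show ?thesis
    using integral_torus_FTC[OF 1 2] False by (simp add: F_def)
qed

lemma fourier_coeff_torus:
  "fourier_coeff f k = (\<integral>x. of_real (f x) * cis (- (of_int k * x)) \<partial>torus) / of_real (2 * pi)"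
  by (simp add: fourier_coeff_def integral_torus)

lemma integrable_fourier:
  assumes "integrable torus f" "f \<in> borel_measurable borel"
  shows "integrable torus (\<lambda>x. complex_of_real (f x) * cis (- (of_int k * x)))"
  by (rule Bochner_Integration.integrable_bound[OF assms(1)]) (use assms(2) in \<open>auto simp: norm_mult cis_conv_exp\<close>)

text \<open>Vanishing coefficients make \<open>f\<close> orthogonal to all trigonometric
  polynomials. Powers of \<open>q = 1 - cos \<delta> + cos (x - x0)\<close> concentrate at
  \<open>x0\<close>: \<open>q\<close> is at least \<open>\<rho> > 1\<close> close to
  \<open>x0\<close> and has modulus at most 1 at distance more than \<open>\<delta>\<close>, so
  \<open>f x0 > 0\<close> would force the integral of \<open>f * q ^ n\<close> to grow without
  bound.\<close>

lemma fourier_unique_aux: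
  fixes f :: "real \<Rightarrow> real"
  assumes meas [measurable]: "f \<in> borel_measurable borel" and intf: "integrable torus f"
    and cont: "isCont f x0" and x0: "0 < x0" "x0 < 2 * pi" "f x0 > 0"
    and coeff: "\<And>k. fourier_coeff f k = 0"
  shows False
proof -
  obtain d where d: "d > 0" "\<And>x. \<bar>x - x0\<bar> < d \<Longrightarrow> \<bar>f x - f x0\<bar> < f x0 / 2"
    using x0(3) cont unfolding continuous_at_eps_delta dist_real_def by (metis half_gt_zero)
  define e where "e = f x0 / 2"
  \<comment> \<open>Small enough for the window to stay inside the period, for \<open>f\<close> to
    be bounded below on it, and for the cosine to be monotone on it.\<close>
  define \<delta> where "\<delta> = min (d / 2) (min x0 (2 * pi - x0)) / 2"
  have \<delta>: "0 < \<delta>" "\<delta> < d" "\<delta> < x0" "\<delta> < 2 * pi - x0" "\<delta> < pi"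
    using d(1) x0 by (auto simp: \<delta>_def)
  have fe: "f x \<ge> e" if "\<bar>x - x0\<bar> \<le> \<delta>" for x
    using d(2)[of x] that \<delta> unfolding e_def by linarith
  have e0: "e > 0" using x0 by (simp add: e_def)
  define a where "a = 1 - cos \<delta>"
  define q where "q x = a + cos (x - x0)" for x
  define \<rho> where "\<rho> = a + cos (\<delta> / 2)"
  have "cos \<delta> < cos (\<delta> / 2)" using \<delta> by (intro cos_monotone_0_pi) auto
  then have \<rho>: "\<rho> > 1" by (simp add: \<rho>_def a_def)
  have q1: "q x \<ge> 1" if "\<bar>x - x0\<bar> \<le> \<delta>" for x
  proof -
    have "cos \<delta> \<le> cos \<bar>x - x0\<bar>" using that \<delta> by (intro cos_monotone_0_pi_le) auto
    then show ?thesis by (simp add: q_def a_def)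
  qed
  have q2: "q x \<ge> \<rho>" if "\<bar>x - x0\<bar> \<le> \<delta> / 2" for x
  proof -
    have "cos (\<delta> / 2) \<le> cos \<bar>x - x0\<bar>" using that \<delta> by (intro cos_monotone_0_pi_le) auto
    then show ?thesis by (simp add: q_def \<rho>_def)
  qed
  have q3: "\<bar>q x\<bar> \<le> 1" if "\<delta> < \<bar>x - x0\<bar>" "x \<in> {0..2 * pi}" for x
  proof -
    let ?y = "\<bar>x - x0\<bar>"
    have "cos ?y \<le> cos \<delta>"
    proof (cases "?y \<le> pi")
      case True
      then show ?thesis using that \<delta> by (intro cos_monotone_0_pi_le) auto
    next
      case False
      have "cos ?y = cos (2 * pi - ?y)" by simp
      also have "\<dots> \<le> cos \<delta>"
        using that \<delta> False by (intro cos_monotone_0_pi_le) auto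
      finally show ?thesis .
    qed
    moreover have "cos \<delta> < 1" using \<delta> cos_monotone_0_pi[of 0 \<delta>] by simp
    moreover have "cos ?y \<ge> -1" by simp
    ultimately show ?thesis by (simp add: q_def a_def abs_le_iff) (smt (verit) cos_ge_minus_one)
  qed
  have q4: "\<bar>q x\<bar> \<le> 3" for x
    using cos_ge_minus_one[of \<delta>] cos_le_one[of \<delta>] cos_ge_minus_one[of "x - x0"] cos_le_one[of "x - x0"]
    unfolding q_def a_def by linarith
  have fq: "integrable torus (\<lambda>x. f x * q x ^ n)" "(\<lambda>x. f x * q x ^ n) \<in> borel_measurable borel" for n
  proof -
    show m: "(\<lambda>x. f x * q x ^ n) \<in> borel_measurable borel" unfolding q_def by measurable
    show "integrable torus (\<lambda>x. f x * q x ^ n)"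
    proof (rule Bochner_Integration.integrable_bound[where f="\<lambda>x. 3 ^ n * f x"])
      show "AE x in torus. norm (f x * q x ^ n) \<le> norm (3 ^ n * f x)"
      proof (intro AE_I2)
        fix x
        have "\<bar>q x\<bar> ^ n \<le> 3 ^ n" by (intro power_mono q4) auto
        then have "\<bar>f x\<bar> * \<bar>q x\<bar> ^ n \<le> \<bar>f x\<bar> * 3 ^ n" by (intro mult_left_mono) auto
        then show "norm (f x * q x ^ n) \<le> norm (3 ^ n * f x)" by (simp add: abs_mult power_abs mult.commute)
      qed
    qed (use intf m in auto)
  qed
  \<comment> \<open>Multiplication by \<open>q\<close> mixes the frequency \<open>k\<close> only
    with \<open>k - 1\<close> and \<open>k + 1\<close>, so an induction on \<open>n\<close> with
    \<open>k\<close> arbitrary goes through.\<close>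
  have int0: "(\<integral>x. of_real (f x * q x ^ n) * cis (- (of_int k * x)) \<partial>torus) = 0" for n k
  proof (induction n arbitrary: k)
    case 0
    then show ?case using coeff[of k] by (simp add: fourier_coeff_torus)
  next
    case (Suc n)
    have I: "integrable torus (\<lambda>x. of_real (f x * q x ^ n) * cis (- (of_int k * x)))" for k
      by (rule integrable_fourier[OF fq])
    have c: "complex_of_real (cos (x - x0)) = (cis (x - x0) + cis (-(x - x0))) / 2" for x
      by (simp add: complex_eq_iff cos_diff sin_diff)
    have s: "cis (x - x0) * cis (- (of_int k * x)) = cis (- x0) * cis (- (of_int (k - 1) * x))"
            "cis (-(x - x0)) * cis (- (of_int k * x)) = cis x0 * cis (- (of_int (k + 1) * x))" for x
      by (simp_all add: cis_mult algebra_simps)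
    have "of_real (f x * q x ^ Suc n) * cis (- (of_int k * x)) =
       of_real a * (of_real (f x * q x ^ n) * cis (- (of_int k * x))) +
       cis (- x0) / 2 * (of_real (f x * q x ^ n) * cis (- (of_int (k - 1) * x))) +
       cis x0 / 2 * (of_real (f x * q x ^ n) * cis (- (of_int (k + 1) * x)))" for x
    proof -
      have "of_real (q x) * cis (- (of_int k * x)) = of_real a * cis (- (of_int k * x)) +
         (cis (x - x0) * cis (- (of_int k * x)) + cis (-(x - x0)) * cis (- (of_int k * x))) / 2"
        unfolding q_def of_real_add c by (simp add: algebra_simps add_divide_distrib)
      moreover have "of_real (f x * q x ^ Suc n) * cis (- (of_int k * x)) =
          of_real (f x * q x ^ n) * (of_real (q x) * cis (- (of_int k * x)))"
        by (simp add: mult.assoc mult.left_commute)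
      ultimately show ?thesis unfolding s by (simp only:) (simp add: algebra_simps add_divide_distrib)
    qed
    then show ?case
      using Suc.IH[of k] Suc.IH[of "k - 1"] Suc.IH[of "k + 1"] I[of k] I[of "k - 1"] I[of "k + 1"]
      by (simp del: of_real_mult of_real_power of_int_diff of_int_add)
  qed
  have int1: "(\<integral>x. f x * q x ^ n \<partial>torus) = 0" for n
  proof -
    have "complex_of_real (\<integral>x. f x * q x ^ n \<partial>torus) = 0"
      using int0[of n 0] by (simp del: of_real_mult of_real_power flip: integral_complex_of_real)
    then show ?thesis by simp
  qed
  let ?J = "{x0 - \<delta> / 2 .. x0 + \<delta> / 2}"
  \<comment> \<open>The half window contributes at least \<open>e * \<rho> ^ n * \<delta>\<close>,
    the ring between half and full window is nonnegative, and the remaining points lose at most the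
    integral of the modulus of \<open>f\<close>.\<close>
  have bnd: "e * \<rho> ^ n * \<delta> \<le> (\<integral>x. \<bar>f x\<bar> \<partial>torus)" for n
  proof -
    have J: "indicator {0..2*pi} x * indicator ?J x = (indicator ?J x :: real)" for x :: real
      using \<delta> by (auto simp: indicator_def)
    have "(\<integral>x. indicator ?J x \<partial>torus) = (\<integral>x. indicator ?J x \<partial>lborel :: real)"
      unfolding integral_torus[symmetric] set_lebesgue_integral_def real_scaleR_def J ..
    also have "\<dots> = \<delta>" using \<delta> by simp
    finally have Jint: "(\<integral>x. indicator ?J x \<partial>torus) = \<delta>" .
    have iJ: "integrable torus (\<lambda>x. indicator ?J x :: real)"
      by (intro finite_measure.integrable_const_bound[OF finite_measure_torus, of _ 1]) auto
    have "(\<integral>x. e * \<rho> ^ n * indicator ?J x - \<bar>f x\<bar> \<partial>torus) \<le> (\<integral>x. f x * q x ^ n \<partial>torus)"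
    proof (rule integral_mono)
      show "integrable torus (\<lambda>x. e * \<rho> ^ n * indicator ?J x - \<bar>f x\<bar>)"
        using iJ intf by auto
      show "integrable torus (\<lambda>x. f x * q x ^ n)" by (rule fq)
      fix x assume "x \<in> space torus"
      then have x: "x \<in> {0..2 * pi}" by simp
      consider "\<bar>x - x0\<bar> \<le> \<delta> / 2" | "\<delta> / 2 < \<bar>x - x0\<bar>" "\<bar>x - x0\<bar> \<le> \<delta>" | "\<delta> < \<bar>x - x0\<bar>" by linarith
      then show "e * \<rho> ^ n * indicator ?J x - \<bar>f x\<bar> \<le> f x * q x ^ n"
      proof cases
        case 1
        have "e * \<rho> ^ n \<le> f x * q x ^ n"
          using fe[of x] q2[OF 1] 1 \<delta> e0 \<rho> by (intro mult_mono power_mono) auto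
        moreover
        have "x0 - \<delta> / 2 \<le> x" "x \<le> x0 + \<delta> / 2" using 1 by linarith+
        then have "indicator ?J x = (1::real)" by (simp add: indicator_def)
        ultimately show ?thesis by simp
      next
        case 2
        have "0 \<le> f x * q x ^ n" using fe[of x] q1[of x] 2 e0 by simp
        moreover have "\<not> (x0 - \<delta> / 2 \<le> x \<and> x \<le> x0 + \<delta> / 2)" using 2 by linarith
        then have "indicator ?J x = (0::real)" by (auto simp: indicator_def)
        ultimately show ?thesis by simp
      next
        case 3
        have "\<bar>f x * q x ^ n\<bar> \<le> \<bar>f x\<bar> * 1"
          unfolding abs_mult power_abs
          using q3[OF 3 x] by (intro mult_mono power_le_one) auto
        moreover have "\<not> (x0 - \<delta> / 2 \<le> x \<and> x \<le> x0 + \<delta> / 2)" using 3 \<delta> by linarith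
        then have "indicator ?J x = (0::real)" by (auto simp: indicator_def)
        ultimately show ?thesis by simp
      qed
    qed
    also have "(\<integral>x. f x * q x ^ n \<partial>torus) = 0" by (rule int1)
    also have "(\<integral>x. e * \<rho> ^ n * indicator ?J x - \<bar>f x\<bar> \<partial>torus) =
        e * \<rho> ^ n * (\<integral>x. indicator ?J x \<partial>torus) - (\<integral>x. \<bar>f x\<bar> \<partial>torus)"
      using iJ intf by simp
    finally show ?thesis unfolding Jint by simp
  qed
  obtain n where "(\<integral>x. \<bar>f x\<bar> \<partial>torus) / (e * \<delta>) < \<rho> ^ n" using real_arch_pow[OF \<rho>] by blast
  then have "\<exists>n. (\<integral>x. \<bar>f x\<bar> \<partial>torus) < e * \<delta> * \<rho> ^ n"
    using e0 \<delta>(1) by (auto simp: pos_divide_less_eq mult_ac)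
  then show False using bnd by (metis mult.assoc mult.commute not_le)
qed

abbreviation joint_cont :: "real set \<Rightarrow> (real \<Rightarrow> real \<Rightarrow> real) \<Rightarrow> bool" where
  "joint_cont A \<phi> \<equiv> continuous_on (A \<times> UNIV) (\<lambda>(t, x). \<phi> t x)"

lemma periodic_int:
  fixes f :: "real \<Rightarrow> 'a"
  assumes per: "\<And>x. f (x + 2 * pi) = f x"
  shows "f (x + 2 * pi * of_int k) = f x"
proof (induction k rule: int_induct[of _ 0])
  case base then show ?case by simp
next
  case (step1 i)
  then show ?case using per[of "x + 2 * pi * of_int i"] by (simp add: algebra_simps)
next
  case (step2 i)
  then show ?case using per[of "x + 2 * pi * of_int (i - 1)"] by (simp add: algebra_simps)
qed

lemma periodic_reduce:
  fixes f :: "real \<Rightarrow> 'a"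
  assumes per: "\<And>x. f (x + 2 * pi) = f x"
  obtains y where "y \<in> {0..2 * pi}" "f y = f x"
proof -
  define k where "k = \<lfloor>x / (2 * pi)\<rfloor>"
  have "of_int k \<le> x / (2 * pi)" "x / (2 * pi) < of_int k + 1" unfolding k_def by linarith+
  then have "x - 2 * pi * of_int k \<in> {0..2 * pi}" by (auto simp: field_simps)
  moreover have "f (x - 2 * pi * of_int k) = f x" using periodic_int[of f, OF per, of "x - 2 * pi * of_int k" k] by simp
  ultimately show thesis using that by blast
qed

lemma fourier_unique_cont:
  fixes f :: "real \<Rightarrow> real"
  assumes cont: "continuous_on UNIV f" and per: "\<And>x. f (x + 2 * pi) = f x"
    and coeff: "\<And>k. fourier_coeff f k = 0"
  shows "f x = 0"
proof -
  have m: "f \<in> borel_measurable borel" and i: "integrable torus f"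
    using cont by (auto intro: borel_measurable_continuous_onI integrable_torus_cont)
  have c: "isCont f x" for x using cont continuous_on_eq_continuous_at by blast
  have z: "f x = 0" if "0 < x" "x < 2 * pi" for x
  proof (rule ccontr)
    assume "f x \<noteq> 0"
    then consider "f x > 0" | "- f x > 0" by linarith
    then show False
    proof cases
      case 1
      then show ?thesis using fourier_unique_aux[OF m i c that _ coeff] by simp
    next
      case 2
      show ?thesis
        by (rule fourier_unique_aux[of "\<lambda>x. - f x", OF _ _ _ that 2])
          (use coeff m i c in \<open>auto simp: fourier_coeff_torus\<close>)
    qed
  qed
  have "f y = 0" if "y \<in> closure {0<..<2 * pi}" for y
    by (rule continuous_constant_on_closure[OF continuous_on_subset[OF cont subset_UNIV] _ that]) (use z in auto)
  then have "f y = 0" if "y \<in> {0..2 * pi}" for y using that by simp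
  then show ?thesis using periodic_reduce[of f x] per by metis
qed

text \<open>The positive and the negative part of \<open>h\<close> are densities of two measures
  with equal finite values on half-lines, hence of equal measures; densities are unique almost
  everywhere.\<close>

lemma AE_zero_if_integral_greaterThan_zero:
  fixes h :: "real \<Rightarrow> real"
  assumes int: "integrable lborel h" and zero: "\<And>x. (LBINT y:{x<..}. h y) = 0"
  shows "AE x in lborel. h x = 0"
proof -
  have [measurable]: "h \<in> borel_measurable borel" using borel_measurable_integrable[OF int] by simp
  let ?p = "\<lambda>x. ennreal (h x)" and ?n = "\<lambda>x. ennreal (- h x)"
  have eq: "emeasure (density lborel ?p) {x<..} = emeasure (density lborel ?n) {x<..}"
    and fin: "emeasure (density lborel ?p) {x<..} < \<infinity>" for x
  proof -
    have i: "integrable lborel (\<lambda>y. indicator {x<..} y * h y)"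
      using integrable_mult_indicator[OF _ int, of "{x<..}"] by simp
    have ep: "emeasure (density lborel ?p) {x<..} = (\<integral>\<^sup>+y. ennreal (indicator {x<..} y * h y) \<partial>lborel)"
      by (subst emeasure_density) (auto intro!: nn_integral_cong simp: indicator_def)
    have en: "emeasure (density lborel ?n) {x<..} = (\<integral>\<^sup>+y. ennreal (- (indicator {x<..} y * h y)) \<partial>lborel)"
      by (subst emeasure_density) (auto intro!: nn_integral_cong simp: indicator_def)
    have f1: "(\<integral>\<^sup>+y. ennreal (indicator {x<..} y * h y) \<partial>lborel) < \<infinity>"
      and f2: "(\<integral>\<^sup>+y. ennreal (- (indicator {x<..} y * h y)) \<partial>lborel) < \<infinity>"
      using i unfolding real_integrable_def by (auto simp: less_top)
    show "emeasure (density lborel ?p) {x<..} < \<infinity>" using ep f1 by simp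
    have "0 = enn2real (\<integral>\<^sup>+y. ennreal (indicator {x<..} y * h y) \<partial>lborel) -
              enn2real (\<integral>\<^sup>+y. ennreal (- (indicator {x<..} y * h y)) \<partial>lborel)"
      using zero[of x] real_lebesgue_integral_def[OF i]
      by (simp add: set_lebesgue_integral_def)
    then show "emeasure (density lborel ?p) {x<..} = emeasure (density lborel ?n) {x<..}"
      unfolding ep en using f1 f2 by (simp add: enn2real_eq_posreal_iff) (metis ennreal_enn2real)
  qed
  have "density lborel ?p = density lborel ?n"
    by (rule measure_eqI_lessThan) (use eq fin in auto)
  then have "AE x in lborel. ?p x = ?n x"
    by (intro sigma_finite_measure.density_unique[OF lborel.sigma_finite_measure_axioms]) auto
  then show ?thesis
  proof eventually_elim
    case (elim x)
    then show ?case
      by (cases "h x \<ge> 0") (auto simp: ennreal_neg ennreal_eq_0_iff)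
  qed
qed

text \<open>Reduction to points of continuity through the primitive \<open>P\<close> of
  \<open>g\<close>. Its coefficients vanish except possibly at frequency 0, so \<open>P\<close>
  minus its mean is zero inside the period. As \<open>P\<close> starts at 0, it vanishes
  identically, and \<open>g\<close> integrates to zero over every half-line.\<close>

lemma fourier_unique_L1:
  fixes g :: "real \<Rightarrow> real"
  assumes [measurable]: "g \<in> borel_measurable borel" and int: "integrable torus g"
    and coeff: "\<And>k. fourier_coeff g k = 0"
  shows "AE x in torus. g x = 0"
proof -
  interpret torus: finite_measure torus by simp
  interpret pair_sigma_finite torus torus ..
  have int0: "(\<integral>y. of_real (g y) * cis (- (of_int k * y)) \<partial>torus) = 0" for k
    using coeff[of k] by (simp add: fourier_coeff_torus)
  have int00: "(\<integral>y. g y \<partial>torus) = 0"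
  proof -
    have "complex_of_real (\<integral>y. g y \<partial>torus) = 0"
      using int0[of 0] by (simp flip: integral_complex_of_real)
    then show ?thesis by simp
  qed
  define P where "P x = (\<integral>y. indicator {..x} y * g y \<partial>torus)" for x
  have Pmeas [measurable]: "P \<in> borel_measurable borel"
  proof -
    have "(\<lambda>(x, y). indicator {..x} y * g y) \<in> borel_measurable (borel \<Otimes>\<^sub>M torus)"
    proof -
      have "(\<lambda>(x, y). indicator {..x} y * g y) = (\<lambda>(x, y). (if y \<le> x then g y else 0))"
        by (auto simp: fun_eq_iff)
      moreover have [measurable]: "(\<lambda>y. y) \<in> measurable torus borel" by measurable
      have "(\<lambda>(x, y). if y \<le> x then g y else 0) \<in> borel_measurable (borel \<Otimes>\<^sub>M torus)"
        by measurable
      ultimately show ?thesis by simp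
    qed
    then show ?thesis unfolding P_def by (intro torus.borel_measurable_lebesgue_integral) (simp add: case_prod_beta')
  qed
  have nullpt: "AE y in torus. y \<noteq> x" for x
    unfolding torus_def by (subst AE_restrict_space_iff) (auto intro: AE_I2 AE_lborel_singleton eventually_mono[OF AE_lborel_singleton[of x]])
  have Pcont: "isCont P x" for x
    unfolding continuous_at_sequentially comp_def P_def
  proof (intro allI impI, rule integral_dominated_convergence[where w="\<lambda>y. \<bar>g y\<bar>"])
    fix X assume X: "X \<longlonglongrightarrow> x"
    show "AE y in torus. (\<lambda>i. indicator {..X i} y * g y) \<longlonglongrightarrow> indicator {..x} y * g y"
      using nullpt[of x]
    proof eventually_elim
      case (elim y)
      then consider "y < x" | "x < y" by linarith
      then have "\<forall>\<^sub>F i in sequentially. indicator {..X i} y * g y = indicator {..x} y * g y"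
      proof cases
        case 1
        then have "\<forall>\<^sub>F i in sequentially. y < X i" using X by (simp add: order_tendsto_iff)
        then show ?thesis by eventually_elim (use 1 in \<open>auto simp: indicator_def\<close>)
      next
        case 2
        then have "\<forall>\<^sub>F i in sequentially. X i < y" using X by (simp add: order_tendsto_iff)
        then show ?thesis by eventually_elim (use 2 in \<open>auto simp: indicator_def\<close>)
      qed
      then show ?case by (rule tendsto_eventually)
    qed
  qed (use int in \<open>auto simp: indicator_def\<close>)
  have Pbound: "\<bar>P x\<bar> \<le> (\<integral>y. \<bar>g y\<bar> \<partial>torus)" for x
    unfolding P_def
    by (rule order_trans[OF integral_abs_bound integral_mono'])
       (use int in \<open>auto simp: indicator_def\<close>)
  have Pint: "integrable torus P"
    by (rule torus.integrable_const_bound[where B="\<integral>y. \<bar>g y\<bar> \<partial>torus"]) (use Pbound in auto)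
  \<comment> \<open>Fubini turns the coefficient of \<open>P\<close> into a multiple of the
    difference between the coefficients of \<open>g\<close> at \<open>0\<close> and at
    \<open>k\<close>.\<close>
  have Pcoeff: "fourier_coeff P k = 0" if k: "k \<noteq> 0" for k
  proof -
    let ?f = "\<lambda>x y. indicator {..x} y * complex_of_real (g y) * cis (- (of_int k * x))"
    have m: "(\<lambda>(x, y). ?f x y) \<in> borel_measurable (torus \<Otimes>\<^sub>M torus)"
    proof -
      have "(\<lambda>(x, y). ?f x y) = (\<lambda>(x, y). if y \<le> x then complex_of_real (g y) * cis (- (of_int k * x)) else 0)"
        by (auto simp: fun_eq_iff)
      moreover have [measurable]: "(\<lambda>y. y) \<in> measurable torus borel" by measurable
      have "(\<lambda>(x, y). if y \<le> x then complex_of_real (g y) * cis (- (of_int k * x)) else 0) \<in> borel_measurable (torus \<Otimes>\<^sub>M torus)"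
        unfolding cis_conv_exp by measurable
      ultimately show ?thesis by simp
    qed
    have intp: "integrable (torus \<Otimes>\<^sub>M torus) (\<lambda>(x, y). ?f x y)"
    proof (rule Bochner_Integration.integrable_bound)
      show "integrable (torus \<Otimes>\<^sub>M torus) (\<lambda>(x, y). g y)"
        by (rule Fubini_integrable) (use int in auto)
    qed (use m in \<open>auto simp: norm_mult indicator_def\<close>)
    have inner: "(\<integral>x. ?f x y \<partial>torus) = of_real (g y) * (1 - cis (- (of_int k * y))) / (- \<i> * of_int k)"
      if y: "y \<in> {0..2 * pi}" for y
    proof -
      define F where "F x = cis (- (of_int k * x)) / (- \<i> * of_int k)" for x :: real
      have 1: "(F has_vector_derivative cis (- (of_int k * x))) (at x within S)" for x S
        unfolding F_def using k
        by (auto intro!: derivative_eq_intros simp: has_vector_derivative_def scaleR_conv_of_real fun_eq_iff complex_eq_iff)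
      have "(\<integral>x. indicator {y..2 * pi} x *\<^sub>R cis (- (of_int k * x)) \<partial>lborel) = F (2 * pi) - F y"
        using y by (intro integral_FTC_Icc 1 continuous_intros) auto
      also have "(\<integral>x. indicator {y..2 * pi} x *\<^sub>R cis (- (of_int k * x)) \<partial>lborel) =
          (\<integral>x. indicator {..x} y * cis (- (of_int k * x)) \<partial>torus)"
        unfolding integral_torus[symmetric] set_lebesgue_integral_def
        using y by (intro Bochner_Integration.integral_cong) (auto simp: indicator_def)
      also have "cis (- (of_int k * (2 * pi))) = 1"
        using cis_multiple_2pi[of "- of_int k"] by (simp add: mult.commute mult.left_commute)
      then have "F (2 * pi) - F y = (1 - cis (- (of_int k * y))) / (- \<i> * of_int k)"
        by (simp add: F_def diff_divide_distrib)
      finally have "(\<integral>x. indicator {..x} y * cis (- (of_int k * x)) \<partial>torus) = (1 - cis (- (of_int k * y))) / (- \<i> * of_int k)" .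
      moreover have "(\<integral>x. ?f x y \<partial>torus) = (\<integral>x. of_real (g y) * (indicator {..x} y * cis (- (of_int k * x))) \<partial>torus)"
        by (intro Bochner_Integration.integral_cong) (auto simp: algebra_simps)
      ultimately show ?thesis by simp
    qed
    have "(\<integral>x. of_real (P x) * cis (- (of_int k * x)) \<partial>torus) = (\<integral>x. (\<integral>y. ?f x y \<partial>torus) \<partial>torus)"
    proof (intro Bochner_Integration.integral_cong refl)
      fix x
      have "of_real (P x) = (\<integral>y. indicator {..x} y * complex_of_real (g y) \<partial>torus)"
        unfolding P_def by (subst integral_complex_of_real[symmetric])
          (auto intro!: Bochner_Integration.integral_cong simp: indicator_def)
      then show "of_real (P x) * cis (- (of_int k * x)) = (\<integral>y. ?f x y \<partial>torus)"
        by simp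
    qed
    also have "\<dots> = (\<integral>y. (\<integral>x. ?f x y \<partial>torus) \<partial>torus)"
      using Fubini_integral[OF intp] by simp
    also have "\<dots> = (\<integral>y. of_real (g y) * (1 - cis (- (of_int k * y))) / (- \<i> * of_int k) \<partial>torus)"
      by (intro Bochner_Integration.integral_cong refl inner) simp
    also have "\<dots> = ((\<integral>y. of_real (g y) \<partial>torus) - (\<integral>y. of_real (g y) * cis (- (of_int k * y)) \<partial>torus)) / (- \<i> * of_int k)"
    proof -
      have "integrable torus (\<lambda>y. complex_of_real (g y) * cis (- (of_int k * y)))"
        by (rule Bochner_Integration.integrable_bound[OF int]) (auto simp: norm_mult cis_conv_exp)
      moreover have "integrable torus (\<lambda>y. complex_of_real (g y))" using int by simp
      ultimately show ?thesis
        by (simp add: algebra_simps diff_divide_distrib)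
    qed
    also have "\<dots> = 0" using int0[of 0] int0[of k] by simp
    finally show ?thesis by (simp add: fourier_coeff_torus)
  qed
  define p where "p = (\<integral>x. P x \<partial>torus) / (2 * pi)"
  have Qcoeff: "fourier_coeff (\<lambda>x. P x - p) k = 0" for k
  proof -
    have i: "integrable torus (\<lambda>y. complex_of_real (P y) * cis (- (of_int k * y)))"
      by (rule Bochner_Integration.integrable_bound[OF Pint]) (auto simp: norm_mult cis_conv_exp)
    have i2: "integrable torus (\<lambda>y. complex_of_real p * cis (- (of_int k * y)))"
      by (intro integrable_torus_cont continuous_intros)
    have c: "(\<integral>y. cis (- (of_int k * y)) \<partial>torus) = (if k = 0 then of_real (2 * pi) else 0)"
      using integral_torus_cis[of "- k"] by simp
    have "fourier_coeff (\<lambda>x. P x - p) k = fourier_coeff P k - p * (if k = 0 then 1 else 0)"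
      unfolding fourier_coeff_torus of_real_diff left_diff_distrib
      by (subst Bochner_Integration.integral_diff[OF i i2]) (simp add: c diff_divide_distrib)
    also have "\<dots> = 0"
      using Pcoeff[of k] by (auto simp: fourier_coeff_torus p_def simp flip: integral_complex_of_real)
    finally show ?thesis .
  qed
  have Pp: "P x = p" if "0 < x" "x < 2 * pi" for x
  proof (rule ccontr)
    assume "P x \<noteq> p"
    then consider "P x - p > 0" | "- (P x - p) > 0" by linarith
    then show False
    proof cases
      case 1
      show ?thesis
        by (rule fourier_unique_aux[of "\<lambda>x. P x - p", OF _ _ _ that 1])
           (use Pint Pcont Qcoeff torus.integrable_const in \<open>auto intro!: continuous_intros\<close>)
    next
      case 2
      have "fourier_coeff (\<lambda>x. - (P x - p)) k = 0" for k
        using Qcoeff[of k] by (simp add: fourier_coeff_torus del: of_real_diff minus_diff_eq)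
      then show ?thesis
        by (intro fourier_unique_aux[of "\<lambda>x. - (P x - p)", OF _ _ _ that 2])
           (use Pint Pcont torus.integrable_const in \<open>auto intro!: continuous_intros\<close>)
    qed
  qed
  have P0: "P x = 0" if "x \<le> 0" for x
  proof -
    have "P x = (\<integral>y. 0 \<partial>torus)"
      unfolding P_def
    proof (rule integral_cong_AE)
      show "AE y in torus. indicator {..x} y * g y = 0"
        using nullpt[of 0] AE_space by eventually_elim (use that in \<open>auto simp: indicator_def\<close>)
    qed auto
    then show ?thesis by simp
  qed
  have P2: "P x = 0" if "2 * pi \<le> x" for x
  proof -
    have "P x = (\<integral>y. g y \<partial>torus)"
      unfolding P_def by (intro Bochner_Integration.integral_cong) (use that in \<open>auto simp: indicator_def\<close>)
    then show ?thesis using int00 by simp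
  qed
  \<comment> \<open>\<open>P\<close> is continuous and zero at \<open>0\<close>, so its constant
    value on the open period is its limit there.\<close>
  have "p = 0"
  proof (rule tendsto_unique)
    show "(P \<longlongrightarrow> 0) (at_right 0)"
      using Pcont[of 0] P0[of 0] unfolding isCont_def by (auto intro: tendsto_mono[OF at_le])
    show "(P \<longlongrightarrow> p) (at_right 0)"
    proof (rule tendsto_eventually)
      show "\<forall>\<^sub>F x in at_right 0. P x = p"
        unfolding eventually_at_right_field by (rule exI[of _ "2 * pi"]) (use Pp in auto)
    qed
  qed simp
  then have P0: "P x = 0" for x
    using Pp[of x] P0[of x] P2[of x] by (cases "x \<le> 0"; cases "2 * pi \<le> x") auto
  let ?h = "\<lambda>x. indicator {0..2 * pi} x * g x"
  have hint: "integrable lborel ?h"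
    using int by (simp add: integrable_torus_iff set_integrable_def)
  have "AE x in lborel. ?h x = 0"
  proof (rule AE_zero_if_integral_greaterThan_zero[OF hint])
    fix x
    have "(LBINT y:{x<..}. ?h y) = (\<integral>y. g y - indicator {..x} y * g y \<partial>torus)"
      unfolding integral_torus[symmetric] set_lebesgue_integral_def
      by (intro Bochner_Integration.integral_cong) (auto simp: indicator_def)
    also have "\<dots> = 0"
    proof -
      have "integrable torus (\<lambda>y. indicator {..x} y * g y)"
        by (rule Bochner_Integration.integrable_bound[OF int]) (auto simp: indicator_def)
      then show ?thesis using int P0[of x] int00 by (simp add: P_def)
    qed
    finally show "(LBINT y:{x<..}. ?h y) = 0" .
  qed
  then show ?thesis
    unfolding torus_def by (subst AE_restrict_space_iff) (auto elim: eventually_mono)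
qed

section \<open>Square-integrable functions and linearity of Fourier coefficients\<close>

lemma torus_L2D:
  assumes "f \<in> torus_L2"
  shows "f \<in> borel_measurable borel" "integrable torus (\<lambda>x. (f x)\<^sup>2)" "integrable torus f"
    "f (x + 2 * pi) = f x"
proof -
  interpret torus: finite_measure torus by simp
  show m [measurable]: "f \<in> borel_measurable borel" and i: "integrable torus (\<lambda>x. (f x)\<^sup>2)"
    and "f (x + 2 * pi) = f x"
    using assms by (auto simp: torus_L2_def integrable_torus_iff)
  show "integrable torus f"
  proof (rule Bochner_Integration.integrable_bound)
    show "integrable torus (\<lambda>x. 1 + (f x)\<^sup>2)" using i by auto
    have "\<bar>y\<bar> \<le> 1 + y\<^sup>2" for y :: real
      using zero_le_power2[of "\<bar>y\<bar> - 1 / 2"] by (simp add: power2_diff power_divide)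
    then show "AE x in torus. norm (f x) \<le> norm (1 + (f x)\<^sup>2)"
      by (auto intro!: AE_I2 simp: abs_of_nonneg add_nonneg_nonneg)
  qed auto
qed

lemma torus_L2_integrable_mult:
  assumes "f \<in> torus_L2" "g \<in> torus_L2"
  shows "integrable torus (\<lambda>x. f x * g x)"
proof (rule Bochner_Integration.integrable_bound)
  show "integrable torus (\<lambda>x. (f x)\<^sup>2 + (g x)\<^sup>2)" using torus_L2D(2)[OF assms(1)] torus_L2D(2)[OF assms(2)] by auto
  show "(\<lambda>x. f x * g x) \<in> borel_measurable torus"
    using torus_L2D(1)[OF assms(1)] torus_L2D(1)[OF assms(2)] by measurable
  have "\<bar>a * b\<bar> \<le> a\<^sup>2 + b\<^sup>2" for a b :: real
    using zero_le_power2[of "\<bar>a\<bar> - \<bar>b\<bar>"] zero_le_power2[of a] zero_le_power2[of b]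
    unfolding abs_mult power2_diff power2_abs by linarith
  then show "AE x in torus. norm (f x * g x) \<le> norm ((f x)\<^sup>2 + (g x)\<^sup>2)"
    by (auto intro!: AE_I2 simp: abs_of_nonneg add_nonneg_nonneg)
qed

lemma torus_L2_lincomb:
  assumes f: "f \<in> torus_L2" and g: "g \<in> torus_L2"
  shows "(\<lambda>x. a * f x + b * g x) \<in> torus_L2"
proof -
  have "integrable torus (\<lambda>x. (a * f x + b * g x)\<^sup>2)"
  proof -
    have "integrable torus (\<lambda>x. a\<^sup>2 * (f x)\<^sup>2 + 2 * a * b * (f x * g x) + b\<^sup>2 * (g x)\<^sup>2)"
      using torus_L2D(2)[OF f] torus_L2D(2)[OF g] torus_L2_integrable_mult[OF f g] by auto
    then show ?thesis by (simp add: power2_eq_square algebra_simps)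
  qed
  then show ?thesis
    using torus_L2D[OF f] torus_L2D[OF g] by (auto simp: torus_L2_def integrable_torus_iff)
qed

lemma torus_L2_cont:
  assumes "continuous_on UNIV f" "\<And>x. f (x + 2 * pi) = f x"
  shows "f \<in> torus_L2"
proof -
  have "integrable torus (\<lambda>x. (f x)\<^sup>2)"
    by (intro integrable_torus_cont continuous_intros assms)
  then show ?thesis
    using assms by (auto simp: torus_L2_def integrable_torus_iff borel_measurable_continuous_onI)
qed

lemma fourier_coeff_lincomb:
  assumes f: "f \<in> torus_L2" and g: "g \<in> torus_L2"
  shows "fourier_coeff (\<lambda>x. a * f x + b * g x) k = a * fourier_coeff f k + b * fourier_coeff g k"
proof -
  note i = integrable_fourier[OF torus_L2D(3,1)[OF f]] integrable_fourier[OF torus_L2D(3,1)[OF g]]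
  have "(\<integral>x. of_real (a * f x + b * g x) * cis (- (of_int k * x)) \<partial>torus) =
     (\<integral>x. of_real a * (of_real (f x) * cis (- (of_int k * x))) + of_real b * (of_real (g x) * cis (- (of_int k * x))) \<partial>torus)"
    by (intro Bochner_Integration.integral_cong) (auto simp: algebra_simps)
  also have "\<dots> = of_real a * (\<integral>x. of_real (f x) * cis (- (of_int k * x)) \<partial>torus) +
      of_real b * (\<integral>x. of_real (g x) * cis (- (of_int k * x)) \<partial>torus)"
    using i by simp
  finally show ?thesis by (simp add: fourier_coeff_torus add_divide_distrib)
qed

lemma fourier_coeff_scale: "fourier_coeff (\<lambda>x. a * f x) k = a * fourier_coeff f k"
  by (simp add: fourier_coeff_torus mult.assoc)

lemma fourier_coeff_uminus: "fourier_coeff f (- k) = cnj (fourier_coeff f k)"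
proof -
  have "(\<integral>x. of_real (f x) * cis (- (of_int (- k) * x)) \<partial>torus) =
    (\<integral>x. cnj (of_real (f x) * cis (- (of_int k * x))) \<partial>torus)"
    by (intro Bochner_Integration.integral_cong) (auto simp: cis_cnj)
  also have "\<dots> = cnj (\<integral>x. of_real (f x) * cis (- (of_int k * x)) \<partial>torus)"
    by (rule Bochner_Integration.integral_cnj)
  finally show ?thesis by (simp only: fourier_coeff_torus complex_cnj_divide complex_cnj_complex_of_real)
qed

text \<open>The real Fourier series with coefficients \<open>c\<^sub>n\<close> for \<open>n \<ge> 0\<close> and \<open>c\<^sub>-\<^sub>n\<close> the conjugate of \<open>c\<^sub>n\<close>.\<close>

definition fterm :: "(nat \<Rightarrow> complex) \<Rightarrow> nat \<Rightarrow> real \<Rightarrow> real" where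
  "fterm c n x = (if n = 0 then 1 else 2) * Re (c n * cis (real n * x))"

definition fseries :: "(nat \<Rightarrow> complex) \<Rightarrow> real \<Rightarrow> real" where
  "fseries c x = (\<Sum>n. fterm c n x)"

lemma fterm_bound: "\<bar>fterm c n x\<bar> \<le> 2 * cmod (c n)"
proof -
  have *: "\<bar>Re (c n * cis (real n * x))\<bar> \<le> cmod (c n)"
    using abs_Re_le_cmod[of "c n * cis (real n * x)"] by (simp add: norm_mult)
  have "\<bar>fterm c n x\<bar> \<le> 2 * \<bar>Re (c n * cis (real n * x))\<bar>"
    unfolding fterm_def by (cases "n = 0") (simp_all only: abs_mult, simp_all)
  with * show ?thesis by linarith
qed

lemma fterm_cont: "continuous_on UNIV (fterm c n)"
  unfolding fterm_def by (intro continuous_intros)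

lemma fterm_periodic: "fterm c n (x + 2 * pi) = fterm c n x"
proof -
  have "cis (real n * (x + 2 * pi)) = cis (real n * x) * cis (2 * pi * real n)"
    by (simp add: cis_mult algebra_simps)
  also have "cis (2 * pi * real n) = 1" using cis_multiple_2pi[of "real n"] by simp
  finally show ?thesis by (simp add: fterm_def)
qed

lemma fterm_complex:
  "complex_of_real (fterm c n x) = (if n = 0 then 1 else 2) / 2 *
     (c n * cis (of_int (int n) * x) + cnj (c n) * cis (of_int (- int n) * x))"
proof -
  have "complex_of_real (Re (c n * cis (real n * x))) =
      (c n * cis (real n * x) + cnj (c n * cis (real n * x))) / 2"
    by (simp add: complex_eq_iff)
  also have "cnj (c n * cis (real n * x)) = cnj (c n) * cis (of_int (- int n) * x)"
    by (simp add: cis_cnj)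
  finally have "complex_of_real (Re (c n * cis (real n * x))) =
      (c n * cis (of_int (int n) * x) + cnj (c n) * cis (of_int (- int n) * x)) / 2"
    by simp
  then show ?thesis by (simp only: fterm_def of_real_mult) simp
qed

context
  fixes c :: "nat \<Rightarrow> complex"
  assumes summable_c: "summable (\<lambda>n. cmod (c n))"
begin

lemma fterm_summable: "summable (\<lambda>n. \<bar>fterm c n x\<bar>)"
  by (rule summable_comparison_test'[of "\<lambda>n. 2 * cmod (c n)" 0])
    (use summable_c fterm_bound in \<open>auto intro: summable_mult\<close>)

lemma fseries_sums: "(\<lambda>n. fterm c n x) sums fseries c x"
  unfolding fseries_def by (rule summable_sums[OF summable_rabs_cancel[OF fterm_summable]])

lemma fseries_bound: "\<bar>fseries c x\<bar> \<le> 2 * (\<Sum>n. cmod (c n))"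
proof -
  have "\<bar>fseries c x\<bar> \<le> (\<Sum>n. \<bar>fterm c n x\<bar>)"
    unfolding fseries_def by (rule summable_rabs[OF fterm_summable])
  also have "\<dots> \<le> (\<Sum>n. 2 * cmod (c n))"
    by (intro suminf_le fterm_bound fterm_summable summable_mult summable_c)
  also have "\<dots> = 2 * (\<Sum>n. cmod (c n))" by (rule suminf_mult[OF summable_c])
  finally show ?thesis .
qed

lemma fseries_uniform: "uniform_limit UNIV (\<lambda>n x. \<Sum>i<n. fterm c i x) (fseries c) sequentially"
  unfolding fseries_def
  by (rule Weierstrass_m_test[of _ _ "\<lambda>n. 2 * cmod (c n)"])
    (use fterm_bound summable_c in \<open>auto intro: summable_mult\<close>)

lemma fseries_cont: "continuous_on UNIV (fseries c)"
  by (rule uniform_limit_theorem[OF _ fseries_uniform])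
    (auto intro!: always_eventually continuous_on_sum fterm_cont)

lemma fseries_periodic: "fseries c (x + 2 * pi) = fseries c x"
  unfolding fseries_def by (simp add: fterm_periodic)

lemma fseries_integral_sums:
  fixes h :: "real \<Rightarrow> complex"
  assumes h: "integrable torus h"
  shows "(\<lambda>n. \<integral>x. complex_of_real (fterm c n x) * h x \<partial>torus) sums (\<integral>x. of_real (fseries c x) * h x \<partial>torus)"
proof -
  have hm [measurable]: "h \<in> borel_measurable torus" using h by auto
  have fm [measurable]: "fterm c n \<in> borel_measurable borel" for n
    by (intro borel_measurable_continuous_onI fterm_cont)
  have b: "norm (complex_of_real (fterm c n x) * h x) \<le> 2 * cmod (c n) * cmod (h x)" for n x
    using fterm_bound[of c n x] by (simp add: norm_mult mult_right_mono)
  have i: "integrable torus (\<lambda>x. complex_of_real (fterm c n x) * h x)" for n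
  proof (rule Bochner_Integration.integrable_bound[where f="\<lambda>x. 2 * cmod (c n) * cmod (h x)"])
    show "AE x in torus. norm (complex_of_real (fterm c n x) * h x) \<le> norm (2 * cmod (c n) * cmod (h x))"
      using b[of n] by (intro AE_I2) (simp add: abs_mult)
  qed (use h in auto)
  have "(\<lambda>n. \<integral>x. complex_of_real (fterm c n x) * h x \<partial>torus) sums
      (\<integral>x. (\<Sum>n. complex_of_real (fterm c n x) * h x) \<partial>torus)"
  proof (rule sums_integral[OF i])
    show "AE x in torus. summable (\<lambda>i. norm (complex_of_real (fterm c i x) * h x))"
      by (intro AE_I2) (simp add: norm_mult summable_mult2 fterm_summable)
    show "summable (\<lambda>n. \<integral>x. norm (complex_of_real (fterm c n x) * h x) \<partial>torus)"
    proof (rule summable_comparison_test'[of "\<lambda>n. 2 * cmod (c n) * (\<integral>x. cmod (h x) \<partial>torus)" 0])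
      show "summable (\<lambda>n. 2 * cmod (c n) * (\<integral>x. cmod (h x) \<partial>torus))"
        by (intro summable_mult2 summable_mult summable_c)
      fix n :: nat
      have "(\<integral>x. norm (complex_of_real (fterm c n x) * h x) \<partial>torus) \<le> (\<integral>x. 2 * cmod (c n) * cmod (h x) \<partial>torus)"
        by (intro integral_mono integrable_norm i b) (use h in auto)
      then show "norm (\<integral>x. norm (complex_of_real (fterm c n x) * h x) \<partial>torus) \<le> 2 * cmod (c n) * (\<integral>x. cmod (h x) \<partial>torus)"
        by simp
    qed
  qed
  moreover have "(\<Sum>n. complex_of_real (fterm c n x) * h x) = of_real (fseries c x) * h x" for x
  proof -
    have "(\<lambda>n. complex_of_real (fterm c n x) * h x) sums (of_real (fseries c x) * h x)"
      by (intro sums_mult2 sums_of_real fseries_sums)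
    then show ?thesis by (simp add: sums_iff)
  qed
  ultimately show ?thesis by simp
qed

text \<open>Orthogonality of the exponentials. The constant term of the series sees only
  \<open>Re (c 0)\<close>, so \<open>c 0\<close> has to be real to be recovered.\<close>

lemma fseries_coeff:
  assumes "Im (c 0) = 0"
  shows "fourier_coeff (fseries c) (int k) = c k"
proof -
  have c0: "cnj (c 0) = c 0" using assms by (simp add: complex_eq_iff)
  have tm: "(\<integral>x. complex_of_real (fterm c n x) * cis (- (of_int (int k) * x)) \<partial>torus) =
      (if n = k then of_real (2 * pi) * c n else 0)" for n
  proof -
    have ic: "integrable torus (\<lambda>x. cis (of_int j * x))" for j
      by (intro integrable_torus_cont continuous_intros)
    have "complex_of_real (fterm c n x) * cis (- (of_int (int k) * x)) =
      (if n = 0 then 1 else 2) / 2 * c n * cis (of_int (int n - int k) * x) +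
      (if n = 0 then 1 else 2) / 2 * cnj (c n) * cis (of_int (- int n - int k) * x)" for x
    proof -
      have "cis (of_int (int n) * x) * cis (- (of_int (int k) * x)) = cis (of_int (int n - int k) * x)"
        "cis (of_int (- int n) * x) * cis (- (of_int (int k) * x)) = cis (of_int (- int n - int k) * x)"
        unfolding cis_mult by (rule arg_cong[where f=cis], simp add: algebra_simps)+
      then show ?thesis unfolding fterm_complex by (simp only: distrib_left distrib_right mult.assoc)
    qed
    then have "(\<integral>x. complex_of_real (fterm c n x) * cis (- (of_int (int k) * x)) \<partial>torus) =
      (\<integral>x. (if n = 0 then 1 else 2) / 2 * c n * cis (of_int (int n - int k) * x) +
      (if n = 0 then 1 else 2) / 2 * cnj (c n) * cis (of_int (- int n - int k) * x) \<partial>torus)"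
      by (simp only:)
    also have "\<dots> =
      (if n = 0 then 1 else 2) / 2 * c n * (\<integral>x. cis (of_int (int n - int k) * x) \<partial>torus) +
      (if n = 0 then 1 else 2) / 2 * cnj (c n) * (\<integral>x. cis (of_int (- int n - int k) * x) \<partial>torus)"
      by (subst Bochner_Integration.integral_add)
         (simp_all only: integrable_mult_right[OF ic] integral_mult_right_zero)
    finally have "(\<integral>x. complex_of_real (fterm c n x) * cis (- (of_int (int k) * x)) \<partial>torus) =
      (if n = 0 then 1 else 2) / 2 * c n * (\<integral>x. cis (of_int (int n - int k) * x) \<partial>torus) +
      (if n = 0 then 1 else 2) / 2 * cnj (c n) * (\<integral>x. cis (of_int (- int n - int k) * x) \<partial>torus)" .
    moreover have "int n - int k = 0 \<longleftrightarrow> n = k" "- int n - int k = 0 \<longleftrightarrow> n = 0 \<and> k = 0" by auto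
    ultimately show ?thesis unfolding integral_torus_cis using c0 by (cases "n = 0"; cases "n = k") simp_all
  qed
  have "(\<lambda>n. if n = k then of_real (2 * pi) * c n else 0) sums (of_real (2 * pi) * c k)"
    by (rule sums_single)
  moreover have "integrable torus (\<lambda>x. cis (- (of_int (int k) * x)))"
    by (intro integrable_torus_cont continuous_intros)
  note fseries_integral_sums[OF this, unfolded tm]
  ultimately have "(\<integral>x. of_real (fseries c x) * cis (- (of_int (int k) * x)) \<partial>torus) = of_real (2 * pi) * c k"
    using sums_unique2 by blast
  then show ?thesis by (simp add: fourier_coeff_torus)
qed

text \<open>The contributions of \<open>n\<close> and \<open>- n\<close> are conjugate to each other
  and are counted together, whence the weight 2 for positive \<open>n\<close>.\<close>

lemma fseries_inner_sums:
  fixes h :: "real \<Rightarrow> real"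
  assumes h: "integrable torus h" and [measurable]: "h \<in> borel_measurable borel"
  shows "(\<lambda>n. 2 * pi * (if n = 0 then 1 else 2) * Re (c n * cnj (fourier_coeff h (int n)))) sums
     (\<integral>x. fseries c x * h x \<partial>torus)"
proof -
  have tm: "(\<integral>x. complex_of_real (fterm c n x) * of_real (h x) \<partial>torus) =
    of_real (2 * pi * (if n = 0 then 1 else 2) * Re (c n * cnj (fourier_coeff h (int n))))" for n
  proof -
    define w where "w = (if n = 0 then 1 else 2 :: complex) / 2"
    have "complex_of_real (fterm c n x) * of_real (h x) =
       w * c n * (of_real (h x) * cis (- (of_int (- int n) * x))) +
       w * cnj (c n) * (of_real (h x) * cis (- (of_int (int n) * x)))" for x
      unfolding fterm_complex w_def[symmetric] by (simp add: algebra_simps)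
    then have "(\<integral>x. complex_of_real (fterm c n x) * of_real (h x) \<partial>torus) =
      (\<integral>x. w * c n * (of_real (h x) * cis (- (of_int (- int n) * x))) +
           w * cnj (c n) * (of_real (h x) * cis (- (of_int (int n) * x))) \<partial>torus)"
      by (simp only:)
    also have "\<dots> = w * c n * (\<integral>x. of_real (h x) * cis (- (of_int (- int n) * x)) \<partial>torus) +
       w * cnj (c n) * (\<integral>x. of_real (h x) * cis (- (of_int (int n) * x)) \<partial>torus)"
      by (subst Bochner_Integration.integral_add)
         (simp_all only: integrable_mult_right[OF integrable_fourier[OF assms]] integral_mult_right_zero)
    also have "\<dots> = w * c n * (of_real (2 * pi) * fourier_coeff h (- int n)) +
       w * cnj (c n) * (of_real (2 * pi) * fourier_coeff h (int n))"
      unfolding fourier_coeff_torus by simp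
    also have "\<dots> = of_real (2 * pi) * w *
        (c n * cnj (fourier_coeff h (int n)) + cnj (c n * cnj (fourier_coeff h (int n))))"
      unfolding fourier_coeff_uminus complex_cnj_mult complex_cnj_cnj by (simp add: algebra_simps)
    also have "c n * cnj (fourier_coeff h (int n)) + cnj (c n * cnj (fourier_coeff h (int n))) =
        2 * of_real (Re (c n * cnj (fourier_coeff h (int n))))"
      by (simp only: complex_add_cnj) simp
    also have "of_real (2 * pi) * w * (2 * of_real (Re (c n * cnj (fourier_coeff h (int n))))) =
        of_real (2 * pi * (if n = 0 then 1 else 2) * Re (c n * cnj (fourier_coeff h (int n))))"
      by (simp only: w_def of_real_mult if_distrib[of complex_of_real] of_real_1 of_real_numeral) simp
    finally show ?thesis .
  qed
  have "(\<lambda>n. complex_of_real (2 * pi * (if n = 0 then 1 else 2) * Re (c n * cnj (fourier_coeff h (int n))))) sums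
     (\<integral>x. of_real (fseries c x) * complex_of_real (h x) \<partial>torus)"
    using fseries_integral_sums[of "\<lambda>x. of_real (h x)"] h unfolding tm by simp
  then have "(\<lambda>n. complex_of_real (2 * pi * (if n = 0 then 1 else 2) * Re (c n * cnj (fourier_coeff h (int n))))) sums
     complex_of_real (\<integral>x. fseries c x * h x \<partial>torus)"
    by (simp flip: of_real_mult integral_complex_of_real)
  then show ?thesis by (simp only: sums_of_real_iff)
qed

lemma fseries_parseval:
  assumes "Im (c 0) = 0"
  shows "(\<lambda>n. 2 * pi * (if n = 0 then 1 else 2) * (cmod (c n))\<^sup>2) sums (\<integral>x. (fseries c x)\<^sup>2 \<partial>torus)"
proof -
  have "Re (z * cnj z) = (cmod z)\<^sup>2" for z
    by (simp add: complex_mult_cnj cmod_power2)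
  then show ?thesis
    using fseries_inner_sums[OF integrable_torus_cont[OF fseries_cont] borel_measurable_continuous_onI[OF fseries_cont]]
    unfolding fseries_coeff[OF assms] power2_eq_square[of "fseries c _"] by (simp only:)
qed

end

lemma fourier_coeff_0_real: "Im (fourier_coeff f 0) = 0"
  using fourier_coeff_uminus[of f 0] by (simp add: complex_eq_iff)

text \<open>The truncated series \<open>p\<close> has the same inner product with \<open>g\<close>
  as with itself, and the square of \<open>g - p\<close> has nonnegative integral. The weight 2 of
  the positive frequencies is given away.\<close>

lemma bessel_inequality:
  assumes g: "g \<in> torus_L2"
  shows "2 * pi * (\<Sum>n<N. (cmod (fourier_coeff g (int n)))\<^sup>2) \<le> (\<integral>x. (g x)\<^sup>2 \<partial>torus)"
proof -
  define c where "c n = (if n < N then fourier_coeff g (int n) else 0)" for n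
  have sc: "summable (\<lambda>n. cmod (c n))"
    by (rule summable_finite[of "{..<N}"]) (auto simp: c_def)
  have c0: "Im (c 0) = 0" by (simp add: c_def fourier_coeff_0_real)
  define p where "p = fseries c"
  have p: "p \<in> torus_L2"
    unfolding p_def by (intro torus_L2_cont fseries_cont fseries_periodic sc)
  have "Re (z * cnj z) = (cmod z)\<^sup>2" for z
    by (simp add: complex_mult_cnj cmod_power2)
  then have t: "Re (c n * cnj (fourier_coeff g (int n))) = (cmod (c n))\<^sup>2" for n
    by (simp add: c_def)
  have s1: "(\<lambda>n. 2 * pi * (if n = 0 then 1 else 2) * (cmod (c n))\<^sup>2) sums (\<integral>x. p x * g x \<partial>torus)"
    using fseries_inner_sums[OF sc torus_L2D(3,1)[OF g]] unfolding t p_def .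
  have s2: "(\<lambda>n. 2 * pi * (if n = 0 then 1 else 2) * (cmod (c n))\<^sup>2) sums (\<integral>x. (p x)\<^sup>2 \<partial>torus)"
    using fseries_parseval[OF sc c0] by (simp add: p_def)
  have eq: "(\<integral>x. p x * g x \<partial>torus) = (\<integral>x. (p x)\<^sup>2 \<partial>torus)"
    by (rule sums_unique2[OF s1 s2])
  have "0 \<le> (\<integral>x. (g x - p x)\<^sup>2 \<partial>torus)" by simp
  also have "(\<integral>x. (g x - p x)\<^sup>2 \<partial>torus) = (\<integral>x. (g x)\<^sup>2 - 2 * (p x * g x) + (p x)\<^sup>2 \<partial>torus)"
    by (simp add: power2_diff algebra_simps)
  also have "\<dots> = (\<integral>x. (g x)\<^sup>2 \<partial>torus) - (\<integral>x. (p x)\<^sup>2 \<partial>torus)"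
    using torus_L2D(2)[OF g] torus_L2D(2)[OF p] torus_L2_integrable_mult[OF p g] eq by simp
  finally have "(\<integral>x. (p x)\<^sup>2 \<partial>torus) \<le> (\<integral>x. (g x)\<^sup>2 \<partial>torus)" by simp
  moreover have "2 * pi * (\<Sum>n<N. (cmod (fourier_coeff g (int n)))\<^sup>2) \<le> (\<integral>x. (p x)\<^sup>2 \<partial>torus)"
  proof -
    have "2 * pi * (\<Sum>n<N. (cmod (fourier_coeff g (int n)))\<^sup>2) \<le>
      (\<Sum>n<N. 2 * pi * (if n = 0 then 1 else 2) * (cmod (c n))\<^sup>2)"
      unfolding sum_distrib_left by (intro sum_mono) (auto simp: c_def)
    also have "\<dots> \<le> (\<Sum>n. 2 * pi * (if n = 0 then 1 else 2) * (cmod (c n))\<^sup>2)"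
      using s2 by (intro sum_le_suminf) (auto simp: sums_iff)
    also have "\<dots> = (\<integral>x. (p x)\<^sup>2 \<partial>torus)" using s2 by (simp add: sums_iff)
    finally show ?thesis .
  qed
  ultimately show ?thesis by linarith
qed

section \<open>The Sobolev spaces as metric spaces\<close>

text \<open>Cauchy-Schwarz comes from expanding the square of \<open>b * f - a * g\<close>. The
  norms are enlarged by \<open>e / 2\<close> so that \<open>a\<close> and \<open>b\<close> are
  positive even when a function is null.\<close>

lemma torus_L2_norm_triangle:
  assumes f: "f \<in> torus_L2" and g: "g \<in> torus_L2"
  shows "sqrt (\<integral>x. (f x + g x)\<^sup>2 \<partial>torus) \<le> sqrt (\<integral>x. (f x)\<^sup>2 \<partial>torus) + sqrt (\<integral>x. (g x)\<^sup>2 \<partial>torus)"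
proof (rule field_le_epsilon)
  fix e :: real assume e: "e > 0"
  define A where "A = (\<integral>x. (f x)\<^sup>2 \<partial>torus)"
  define B where "B = (\<integral>x. (g x)\<^sup>2 \<partial>torus)"
  define I where "I = (\<integral>x. f x * g x \<partial>torus)"
  define a where "a = sqrt A + e / 2"
  define b where "b = sqrt B + e / 2"
  have AB: "0 \<le> A" "0 \<le> B" by (simp_all add: A_def B_def)
  have ab: "0 < a" "0 < b" using e AB by (simp_all add: a_def b_def add_nonneg_pos)
  have a2: "A \<le> a\<^sup>2"
    using power_mono[of "sqrt A" a 2] AB e by (simp add: a_def)
  have b2: "B \<le> b\<^sup>2"
    using power_mono[of "sqrt B" b 2] AB e by (simp add: b_def)
  note i = torus_L2D(2)[OF f] torus_L2D(2)[OF g] torus_L2_integrable_mult[OF f g]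
  have "0 \<le> (\<integral>x. (b * f x - a * g x)\<^sup>2 \<partial>torus)" by simp
  also have "(\<integral>x. (b * f x - a * g x)\<^sup>2 \<partial>torus) = (\<integral>x. b\<^sup>2 * (f x)\<^sup>2 - 2 * a * b * (f x * g x) + a\<^sup>2 * (g x)\<^sup>2 \<partial>torus)"
    by (intro Bochner_Integration.integral_cong) (auto simp: power2_eq_square algebra_simps)
  also have "\<dots> = b\<^sup>2 * A - 2 * a * b * I + a\<^sup>2 * B"
    using i by (simp add: A_def B_def I_def)
  finally have "2 * (a * b) * I \<le> b\<^sup>2 * A + a\<^sup>2 * B" by simp
  also have "\<dots> \<le> b\<^sup>2 * a\<^sup>2 + a\<^sup>2 * b\<^sup>2"
    by (intro add_mono mult_left_mono a2 b2) auto
  also have "\<dots> = 2 * (a * b) * (a * b)" by (simp add: power2_eq_square)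
  finally have I: "I \<le> a * b" using ab by (simp add: mult_le_cancel_left)
  have "(\<integral>x. (f x + g x)\<^sup>2 \<partial>torus) = (\<integral>x. (f x)\<^sup>2 + 2 * (f x * g x) + (g x)\<^sup>2 \<partial>torus)"
    by (intro Bochner_Integration.integral_cong) (auto simp: power2_eq_square algebra_simps)
  also have "\<dots> = A + 2 * I + B" using i by (simp add: A_def B_def I_def)
  also have "\<dots> \<le> (a + b)\<^sup>2" using a2 b2 I by (simp add: power2_eq_square algebra_simps)
  finally have "sqrt (\<integral>x. (f x + g x)\<^sup>2 \<partial>torus) \<le> a + b"
    using ab by (intro real_le_lsqrt) auto
  then show "sqrt (\<integral>x. (f x + g x)\<^sup>2 \<partial>torus) \<le> sqrt (\<integral>x. (f x)\<^sup>2 \<partial>torus) + sqrt (\<integral>x. (g x)\<^sup>2 \<partial>torus) + e"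
    by (simp add: a_def b_def A_def B_def)
qed

lemma fourier_unique_L2:
  assumes f: "f \<in> torus_L2" and g: "g \<in> torus_L2" and eq: "\<And>k. fourier_coeff f k = fourier_coeff g k"
  shows "AE x in torus. f x = g x"
proof -
  have d: "(\<lambda>x. 1 * f x + (- 1) * g x) \<in> torus_L2" by (rule torus_L2_lincomb[OF f g])
  have "AE x in torus. 1 * f x + (- 1) * g x = 0"
  proof (rule fourier_unique_L1[OF torus_L2D(1)[OF d] torus_L2D(3)[OF d]])
    show "fourier_coeff (\<lambda>x. 1 * f x + (- 1) * g x) k = 0" for k
      unfolding fourier_coeff_lincomb[OF f g] eq by simp
  qed
  then show ?thesis by simp
qed

lemma is_bessel_AE:
  assumes "is_bessel r f g" "is_bessel r f h"
  shows "AE x in torus. g x = h x"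
  using assms by (intro fourier_unique_L2) (auto simp: is_bessel_def)

lemma is_bessel_bessel: "is_bessel r f g \<Longrightarrow> is_bessel r f (bessel r f)"
  unfolding bessel_def by (rule someI[where P="is_bessel r f"])

lemma sobolev_norm_torus: "sobolev_norm r f = sqrt (\<integral>x. (bessel r f x)\<^sup>2 \<partial>torus)"
  by (simp add: sobolev_norm_def sobolev_inner_def integral_torus power2_eq_square)

text \<open>\<open>bessel\<close> picks one of many functions that agree almost everywhere. The norm
  does not see the choice, so any convenient representative may be used.\<close>

lemma sobolev_norm_eq:
  assumes g: "is_bessel r f g"
  shows "sobolev_norm r f = sqrt (\<integral>x. (g x)\<^sup>2 \<partial>torus)"
proof -
  note b = is_bessel_bessel[OF g]
  have m: "bessel r f \<in> borel_measurable torus" "g \<in> borel_measurable torus"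
    using b g by (auto simp: is_bessel_def intro!: measurable_torus torus_L2D(1))
  have "(\<integral>x. (bessel r f x)\<^sup>2 \<partial>torus) = (\<integral>x. (g x)\<^sup>2 \<partial>torus)"
  proof (rule integral_cong_AE)
    show "AE x in torus. (bessel r f x)\<^sup>2 = (g x)\<^sup>2"
      using is_bessel_AE[OF b g] by eventually_elim simp
  qed (use m in auto)
  then show ?thesis by (simp add: sobolev_norm_torus)
qed

lemma sobolev_norm_nonneg [simp]: "0 \<le> sobolev_norm r f"
  by (simp add: sobolev_norm_torus)

lemma is_bessel_lincomb:
  assumes f: "f \<in> torus_L2" "is_bessel r f g" and f': "f' \<in> torus_L2" "is_bessel r f' g'"
  shows "is_bessel r (\<lambda>x. a * f x + b * f' x) (\<lambda>x. a * g x + b * g' x)"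
  using assms unfolding is_bessel_def
  by (auto simp: fourier_coeff_lincomb torus_L2_lincomb algebra_simps)

lemma is_bessel_uminus: "is_bessel r f g \<Longrightarrow> is_bessel r (\<lambda>x. - f x) (\<lambda>x. - g x)"
  using torus_L2_lincomb[of g g "-1" 0] fourier_coeff_scale[of "-1" f] fourier_coeff_scale[of "-1" g]
  by (auto simp: is_bessel_def)

text \<open>Symmetry of a metric is demanded of all pairs of functions, also of those outside the
  Sobolev space. For these the predicates behind the two choices are both identically false, so
  \<open>bessel\<close> returns the same function for \<open>f\<close> and for its negative.\<close>

lemma sobolev_norm_uminus: "sobolev_norm r (\<lambda>x. - f x) = sobolev_norm r f"
proof (cases "\<exists>g. is_bessel r f g")
  case True
  then obtain g where g: "is_bessel r f g" by blast
  show ?thesis unfolding sobolev_norm_eq[OF g] sobolev_norm_eq[OF is_bessel_uminus[OF g]] by simp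
next
  case False
  moreover have "\<not> (\<exists>g. is_bessel r (\<lambda>x. - f x) g)"
    using False is_bessel_uminus[of r "\<lambda>x. - f x"] by auto
  ultimately have "bessel r f = bessel r (\<lambda>x. - f x)" by (simp add: bessel_def)
  then show ?thesis by (simp add: sobolev_norm_torus)
qed

lemma sobolev_space_lincomb:
  assumes "f \<in> sobolev_space r" "g \<in> sobolev_space r"
  shows "(\<lambda>x. a * f x + b * g x) \<in> sobolev_space r"
  using assms is_bessel_lincomb[of f r _ g _ a b] torus_L2_lincomb[of f g a b]
  unfolding sobolev_space_def by (auto intro!: continuous_intros)

lemma sobolev_space_diff:
  assumes "f \<in> sobolev_space r" "g \<in> sobolev_space r"
  shows "(\<lambda>x. f x - g x) \<in> sobolev_space r"
  using sobolev_space_lincomb[OF assms, of 1 "-1"] by simp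

lemma sobolev_spaceD:
  assumes "f \<in> sobolev_space r"
  shows "f \<in> torus_L2" "continuous_on UNIV f" "f (x + 2 * pi) = f x" "is_bessel r f (bessel r f)"
    "bessel r f \<in> torus_L2"
proof -
  show "f \<in> torus_L2" "continuous_on UNIV f" "f (x + 2 * pi) = f x"
    using assms by (auto simp: sobolev_space_def torus_L2_def)
  show b: "is_bessel r f (bessel r f)"
    using assms is_bessel_bessel by (auto simp: sobolev_space_def)
  then show "bessel r f \<in> torus_L2" by (simp add: is_bessel_def)
qed

lemma sobolev_norm_triangle:
  assumes f: "f \<in> sobolev_space r" and g: "g \<in> sobolev_space r"
  shows "sobolev_norm r (\<lambda>x. f x + g x) \<le> sobolev_norm r f + sobolev_norm r g"
proof -
  have "is_bessel r (\<lambda>x. 1 * f x + 1 * g x) (\<lambda>x. 1 * bessel r f x + 1 * bessel r g x)"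
    by (rule is_bessel_lincomb[OF sobolev_spaceD(1)[OF f] sobolev_spaceD(4)[OF f] sobolev_spaceD(1)[OF g] sobolev_spaceD(4)[OF g]])
  then have "is_bessel r (\<lambda>x. f x + g x) (\<lambda>x. bessel r f x + bessel r g x)" by simp
  from sobolev_norm_eq[OF this] show ?thesis
    using torus_L2_norm_triangle[OF sobolev_spaceD(5)[OF f] sobolev_spaceD(5)[OF g]]
    by (simp only: sobolev_norm_torus[of r f] sobolev_norm_torus[of r g])
qed

lemma sobolev_norm_0: "sobolev_norm r (\<lambda>x. 0) = 0"
proof -
  have "is_bessel r (\<lambda>x. 0) (\<lambda>x. 0)"
    using torus_L2_cont[of "\<lambda>x. 0"] by (simp add: is_bessel_def fourier_coeff_torus)
  then show ?thesis using sobolev_norm_eq by fastforce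
qed

lemma sobolev_norm_eq_0:
  assumes f: "f \<in> sobolev_space r" and 0: "sobolev_norm r f = 0"
  shows "f x = 0"
proof -
  note b = sobolev_spaceD[OF f]
  have "(\<integral>x. (bessel r f x)\<^sup>2 \<partial>torus) = 0" using 0 by (simp add: sobolev_norm_torus)
  then have ae: "AE x in torus. bessel r f x = 0"
    using integral_nonneg_eq_0_iff_AE[OF torus_L2D(2)[OF b(5)]] by simp
  have "fourier_coeff (bessel r f) k = 0" for k
  proof -
    have [measurable]: "bessel r f \<in> borel_measurable borel" using torus_L2D(1)[OF b(5)] .
    have "(\<integral>x. of_real (bessel r f x) * cis (- (of_int k * x)) \<partial>torus) = (\<integral>x. 0 \<partial>torus)"
    proof (rule integral_cong_AE)
      show "AE x in torus. of_real (bessel r f x) * cis (- (of_int k * x)) = 0"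
        using ae by eventually_elim simp
    qed (auto simp: cis_conv_exp)
    then show ?thesis by (simp add: fourier_coeff_torus)
  qed
  then have "complex_of_real ((1 + (of_int k)\<^sup>2) powr (r / 2)) * fourier_coeff f k = 0" for k
    using b(4) by (simp add: is_bessel_def)
  moreover have "(1 + (of_int k)\<^sup>2) powr (r / 2) \<noteq> (0::real)" for k :: int
    using zero_le_power2[of "of_int k :: real"] by (simp add: add_nonneg_eq_0_iff)
  ultimately have "fourier_coeff f k = 0" for k by (metis mult_eq_0_iff of_real_eq_0_iff)
  then show ?thesis by (intro fourier_unique_cont[OF b(2) b(3)])
qed

lemma sobolev_metric_space: "Metric_space (sobolev_space r) (sobolev_dist r)"
proof
  fix f g h
  show "0 \<le> sobolev_dist r f g" by (simp add: sobolev_dist_def)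
  show "sobolev_dist r f g = sobolev_dist r g f"
    using sobolev_norm_uminus[of r "\<lambda>x. f x - g x"] by (simp add: sobolev_dist_def)
  assume f: "f \<in> sobolev_space r" and g: "g \<in> sobolev_space r"
  show "sobolev_dist r f g = 0 \<longleftrightarrow> f = g"
    using sobolev_norm_eq_0[OF sobolev_space_diff[OF f g]]
    by (auto simp: sobolev_dist_def sobolev_norm_0)
  assume h: "h \<in> sobolev_space r"
  show "sobolev_dist r f h \<le> sobolev_dist r f g + sobolev_dist r g h"
    using sobolev_norm_triangle[OF sobolev_space_diff[OF f g] sobolev_space_diff[OF g h]]
    by (simp add: sobolev_dist_def)
qed

lemma space_sobolev_borel: "space (sobolev_borel r) = sobolev_space r"
  unfolding sobolev_borel_def by (simp add: space_measure_of_conv)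

text \<open>Strict sublevel sets of a Lipschitz functional are open. This serves evaluation and
  differentiation at a point, the only functionals through which \<open>H\<^sup>s\<close>-valued
  processes become real ones.\<close>

lemma measurable_sobolev_borel_Lipschitz:
  fixes \<phi> :: "(real \<Rightarrow> real) \<Rightarrow> real"
  assumes "\<And>f g. f \<in> sobolev_space r \<Longrightarrow> g \<in> sobolev_space r \<Longrightarrow> \<bar>\<phi> f - \<phi> g\<bar> \<le> C * sobolev_dist r f g"
  shows "\<phi> \<in> borel_measurable (sobolev_borel r)"
proof -
  interpret Metric_space "sobolev_space r" "sobolev_dist r" by (rule sobolev_metric_space)
  have sets: "sets (sobolev_borel r) = sigma_sets (sobolev_space r) {U. openin mtopology U}"
    unfolding sobolev_borel_def
    by (rule sets_measure_of) (auto dest!: openin_subset)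
  show ?thesis
  proof (rule borel_measurableI_less)
    fix a
    have "openin mtopology {f \<in> sobolev_space r. \<phi> f < a}"
      unfolding openin_mtopology
    proof (intro conjI allI impI)
      fix f assume "f \<in> {f \<in> sobolev_space r. \<phi> f < a}"
      then have f: "f \<in> sobolev_space r" "\<phi> f < a" by auto
      define e where "e = (a - \<phi> f) / (\<bar>C\<bar> + 1)"
      have e: "e > 0" using f by (simp add: e_def add_nonneg_pos)
      have "\<phi> g < a" if g: "g \<in> sobolev_space r" "sobolev_dist r f g < e" for g
      proof -
        have "\<phi> g - \<phi> f \<le> C * sobolev_dist r f g" using assms[OF f(1) g(1)] by linarith
        also have "\<dots> \<le> (\<bar>C\<bar> + 1) * sobolev_dist r f g" by (intro mult_right_mono) auto
        also have "\<dots> < (\<bar>C\<bar> + 1) * e" using g(2) by (intro mult_strict_left_mono) auto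
        also have "\<dots> = a - \<phi> f" by (simp add: e_def)
        finally show ?thesis by simp
      qed
      then show "\<exists>e>0. mball f e \<subseteq> {f \<in> sobolev_space r. \<phi> f < a}"
        using e by (intro exI[of _ e]) auto
    qed auto
    then show "{f \<in> space (sobolev_borel r). \<phi> f < a} \<in> sets (sobolev_borel r)"
      unfolding space_sobolev_borel sets by (intro sigma_sets.Basic) simp
  qed
qed

section \<open>The Sobolev embedding\<close>

text \<open>A Cauchy-Schwarz constant: the summands behave like \<open>n powr (2 - 2 * s)\<close>,
  which is summable exactly for \<open>s > 3 / 2\<close>. The factor 2 accounts for the conjugate
  frequencies and \<open>sqrt (2 * pi)\<close> for the normalisation of the coefficients.\<close>

definition sobolev_const :: "real \<Rightarrow> real" where
  "sobolev_const s = 2 * sqrt (\<Sum>n. ((real n + 1) * (1 + (real n)\<^sup>2) powr (- s / 2))\<^sup>2) / sqrt (2 * pi)"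

lemma sobolev_const_summable:
  assumes s: "s > 3 / 2"
  shows "summable (\<lambda>n. ((real n + 1) * (1 + (real n)\<^sup>2) powr (- s / 2))\<^sup>2)"
proof (rule summable_comparison_test_ev)
  show "summable (\<lambda>n. 4 * real n powr (2 - 2 * s))"
    using s by (intro summable_mult) (simp add: summable_real_powr_iff)
  show "\<forall>\<^sub>F n in sequentially. norm (((real n + 1) * (1 + (real n)\<^sup>2) powr (- s / 2))\<^sup>2) \<le> 4 * real n powr (2 - 2 * s)"
    using eventually_gt_at_top[of 0]
  proof eventually_elim
    case (elim n)
    have "(1 + (real n)\<^sup>2) powr (- s / 2) \<le> ((real n)\<^sup>2) powr (- s / 2)"
      using s elim by (intro powr_mono2') auto
    also have "((real n)\<^sup>2) powr (- s / 2) = real n powr (- s)"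
    proof -
      have sq: "(real n)\<^sup>2 = real n powr 2" using elim by simp
      show ?thesis unfolding sq powr_powr by simp
    qed
    finally have 1: "(1 + (real n)\<^sup>2) powr (- s / 2) \<le> real n powr (- s)" .
    have "(real n + 1) * (1 + (real n)\<^sup>2) powr (- s / 2) \<le> (2 * real n) * real n powr (- s)"
      using elim by (intro mult_mono 1) auto
    then have "((real n + 1) * (1 + (real n)\<^sup>2) powr (- s / 2))\<^sup>2 \<le> ((2 * real n) * real n powr (- s))\<^sup>2"
      by (intro power_mono) auto
    also have "\<dots> = 4 * (real n powr 1 * real n powr (- s))\<^sup>2"
      using elim by (simp add: power_mult_distrib)
    also have "\<dots> = 4 * real n powr (2 - 2 * s)"
      unfolding power2_eq_square powr_add[symmetric] by (simp add: algebra_simps)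
    finally show ?case by simp
  qed
qed

context
  fixes s :: real and f :: "real \<Rightarrow> real"
  assumes s: "s > 3 / 2" and f: "f \<in> sobolev_space s"
begin

private definition c where "c n = fourier_coeff f (int n)" for n

text \<open>Cauchy-Schwarz against the coefficients of \<open>bessel s f\<close>, which Bessel's
  inequality controls. The weight \<open>n + 1\<close> pays for one derivative, so one bound serves
  both \<open>f\<close> and its derivative.\<close>

lemma sobolev_coeff_sum:
  "(\<Sum>n<N. (real n + 1) * cmod (c n)) \<le> sobolev_const s * sobolev_norm s f / 2"
proof -
  let ?a = "\<lambda>n. cmod (fourier_coeff (bessel s f) (int n))"
  let ?b = "\<lambda>n. (real n + 1) * (1 + (real n)\<^sup>2) powr (- s / 2)"
  have pos: "1 + (real n)\<^sup>2 > 0" for n by (simp add: add_pos_nonneg)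
  have a: "?a n = (1 + (real n)\<^sup>2) powr (s / 2) * cmod (c n)" for n
    using sobolev_spaceD(4)[OF f] by (simp add: is_bessel_def c_def norm_mult)
  have ab: "\<bar>?a n\<bar> * \<bar>?b n\<bar> = (real n + 1) * cmod (c n)" for n
  proof -
    have "(1 + (real n)\<^sup>2) powr (s / 2) * (1 + (real n)\<^sup>2) powr (- s / 2) = 1"
      unfolding powr_add[symmetric] using pos[of n] by simp
    moreover have "\<bar>?a n\<bar> * \<bar>?b n\<bar> = ((1 + (real n)\<^sup>2) powr (s / 2) * (1 + (real n)\<^sup>2) powr (- s / 2)) * ((real n + 1) * cmod (c n))"
      unfolding a abs_mult by (simp only: abs_of_nonneg[OF powr_ge_zero] abs_of_nonneg[OF norm_ge_zero] abs_of_nonneg[OF add_nonneg_nonneg[OF of_nat_0_le_iff zero_le_one]] mult_ac)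
    ultimately show ?thesis by simp
  qed
  have "2 * pi * (\<Sum>n<N. (?a n)\<^sup>2) \<le> (\<integral>x. (bessel s f x)\<^sup>2 \<partial>torus)"
    by (rule bessel_inequality[OF sobolev_spaceD(5)[OF f]])
  then have "sqrt (2 * pi * (\<Sum>n<N. (?a n)\<^sup>2)) \<le> sobolev_norm s f"
    unfolding sobolev_norm_torus by simp
  then have A: "L2_set ?a {..<N} \<le> sobolev_norm s f / sqrt (2 * pi)"
    by (simp add: L2_set_def real_sqrt_mult field_simps)
  have B: "L2_set ?b {..<N} \<le> sqrt (\<Sum>n. (?b n)\<^sup>2)"
    unfolding L2_set_def by (intro real_sqrt_le_mono sum_le_suminf sobolev_const_summable s) auto
  have "(\<Sum>n<N. (real n + 1) * cmod (c n)) = (\<Sum>n<N. \<bar>?a n\<bar> * \<bar>?b n\<bar>)"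
    unfolding ab ..
  also have "\<dots> \<le> L2_set ?a {..<N} * L2_set ?b {..<N}" by (rule L2_set_mult_ineq)
  also have "\<dots> \<le> (sobolev_norm s f / sqrt (2 * pi)) * sqrt (\<Sum>n. (?b n)\<^sup>2)"
    by (intro mult_mono A B) auto
  also have "\<dots> = sobolev_const s * sobolev_norm s f / 2"
    unfolding sobolev_const_def by simp
  finally show ?thesis .
qed

lemma sobolev_coeff_summable: "summable (\<lambda>n. (real n + 1) * cmod (c n))"
  and sobolev_coeff_suminf: "2 * (\<Sum>n. (real n + 1) * cmod (c n)) \<le> sobolev_const s * sobolev_norm s f"
proof -
  show s: "summable (\<lambda>n. (real n + 1) * cmod (c n))"
  proof (rule bounded_imp_summable[of _ "sobolev_const s * sobolev_norm s f / 2"])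
    show "(\<Sum>k\<le>n. (real k + 1) * cmod (c k)) \<le> sobolev_const s * sobolev_norm s f / 2" for n
      using sobolev_coeff_sum[of "Suc n"] unfolding lessThan_Suc_atMost .
  qed simp
  show "2 * (\<Sum>n. (real n + 1) * cmod (c n)) \<le> sobolev_const s * sobolev_norm s f"
    using suminf_le_const[OF s sobolev_coeff_sum] by simp
qed

lemma summable_c_le:
  assumes "\<And>n. cmod (d n) \<le> (real n + 1) * cmod (c n)"
  shows "summable (\<lambda>n. cmod (d n))" and "2 * (\<Sum>n. cmod (d n)) \<le> sobolev_const s * sobolev_norm s f"
proof -
  show *: "summable (\<lambda>n. cmod (d n))"
    by (rule summable_comparison_test'[OF sobolev_coeff_summable, of 0]) (use assms in auto)
  have "(\<Sum>n. cmod (d n)) \<le> (\<Sum>n. (real n + 1) * cmod (c n))"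
    by (rule suminf_le[OF assms * sobolev_coeff_summable])
  then show "2 * (\<Sum>n. cmod (d n)) \<le> sobolev_const s * sobolev_norm s f"
    using sobolev_coeff_suminf by linarith
qed

lemma c_le: "cmod (c n) \<le> (real n + 1) * cmod (c n)"
  using mult_right_mono[of 1 "real n + 1" "cmod (c n)"] by simp

private definition c' where "c' n = \<i> * of_nat n * c n" for n

lemma c'_le: "cmod (c' n) \<le> (real n + 1) * cmod (c n)"
  by (simp add: c'_def norm_mult mult_right_mono)

text \<open>The absolutely convergent series is continuous and has the coefficients of
  \<open>f\<close>. Uniqueness for continuous functions gives equality at every point, not merely
  almost everywhere.\<close>

lemma sobolev_fseries: "f x = fseries c x"
proof -
  note sc = summable_c_le(1)[OF c_le]
  have c0: "Im (c 0) = 0" by (simp add: c_def fourier_coeff_0_real)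
  have L: "fseries c \<in> torus_L2"
    by (intro torus_L2_cont fseries_cont fseries_periodic sc)
  have co: "fourier_coeff (fseries c) k = fourier_coeff f k" for k
  proof (cases "k \<ge> 0")
    case True
    then obtain n where "k = int n" using nonneg_int_cases by blast
    then show ?thesis using fseries_coeff[OF sc c0, of n] by (simp add: c_def[of n])
  next
    case False
    then obtain n where "k = - int n" by (metis int_cases2 nle_le of_nat_0_le_iff)
    then show ?thesis using fseries_coeff[OF sc c0, of n] by (simp add: c_def[of n] fourier_coeff_uminus)
  qed
  have "1 * f x + (- 1) * fseries c x = 0"
  proof (rule fourier_unique_cont[of "\<lambda>x. 1 * f x + (- 1) * fseries c x"])
    show "continuous_on UNIV (\<lambda>x. 1 * f x + (- 1) * fseries c x)"
      by (intro continuous_intros sobolev_spaceD(2)[OF f] fseries_cont sc)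
    show "1 * f (x + 2 * pi) + (- 1) * fseries c (x + 2 * pi) = 1 * f x + (- 1) * fseries c x" for x
      using sobolev_spaceD(3)[OF f] fseries_periodic[OF sc] by simp
    show "fourier_coeff (\<lambda>x. 1 * f x + (- 1) * fseries c x) k = 0" for k
      unfolding fourier_coeff_lincomb[OF sobolev_spaceD(1)[OF f] L] co by simp
  qed
  then show ?thesis by simp
qed

lemma sobolev_bound: "\<bar>f x\<bar> \<le> sobolev_const s * sobolev_norm s f"
  using fseries_bound[OF summable_c_le(1)[OF c_le], of x] summable_c_le(2)[OF c_le] sobolev_fseries[of x]
  by linarith

lemma sobolev_deriv: "(f has_real_derivative fseries c' x) (at x)"
proof -
  have "\<exists>g. \<forall>x\<in>UNIV. (\<lambda>n. fterm c n x) sums g x \<and> (g has_field_derivative fseries c' x) (at x within UNIV)"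
  proof (rule has_field_derivative_series)
    show "(fterm c n has_field_derivative fterm c' n x) (at x within UNIV)" for n x
    proof -
      have 1: "fterm c n = (\<lambda>x. (if n = 0 then 1 else 2) * (Re (c n) * cos (real n * x) - Im (c n) * sin (real n * x)))"
        by (rule ext) (simp add: fterm_def)
      have 2: "fterm c' n x = (if n = 0 then 1 else 2) * (- (Re (c n) * (sin (real n * x) * real n)) - Im (c n) * (cos (real n * x) * real n))"
        by (simp add: fterm_def c'_def algebra_simps)
      have "((\<lambda>x. w * (Re (c n) * cos (real n * x) - Im (c n) * sin (real n * x))) has_field_derivative
          w * (- (Re (c n) * (sin (real n * x) * real n)) - Im (c n) * (cos (real n * x) * real n))) (at x within UNIV)" for w
        by (auto intro!: derivative_eq_intros)
      then show ?thesis unfolding 1 2 .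
    qed
    show "uniform_limit UNIV (\<lambda>n x. \<Sum>i<n. fterm c' i x) (fseries c') sequentially"
      by (rule fseries_uniform[OF summable_c_le(1)[OF c'_le]])
    show "summable (\<lambda>n. fterm c n 0)"
      using fseries_sums[OF summable_c_le(1)[OF c_le], of 0] by (simp add: sums_iff)
  qed auto
  then obtain g where g: "\<And>x. (\<lambda>n. fterm c n x) sums g x" "\<And>x. (g has_field_derivative fseries c' x) (at x)"
    by auto
  have "g = f"
    by (rule ext) (simp only: sobolev_fseries sums_unique2[OF g(1) fseries_sums[OF summable_c_le(1)[OF c_le]]])
  then show ?thesis using g(2)[of x] by simp
qed

lemma sobolev_deriv_eq: "deriv f x = fseries c' x"
  by (rule DERIV_imp_deriv[OF sobolev_deriv])

lemma sobolev_has_deriv: "(f has_real_derivative deriv f x) (at x)"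
  unfolding sobolev_deriv_eq by (rule sobolev_deriv)

lemma sobolev_deriv_cont: "continuous_on UNIV (deriv f)"
proof -
  have "deriv f = fseries c'" by (rule ext) (rule sobolev_deriv_eq)
  then show ?thesis using fseries_cont[OF summable_c_le(1)[OF c'_le]] by (simp only:)
qed

lemma sobolev_deriv_periodic: "deriv f (x + 2 * pi) = deriv f x"
  unfolding sobolev_deriv_eq by (rule fseries_periodic[OF summable_c_le(1)[OF c'_le]])

lemma sobolev_deriv_bound: "\<bar>deriv f x\<bar> \<le> sobolev_const s * sobolev_norm s f"
  using fseries_bound[OF summable_c_le(1)[OF c'_le], of x] summable_c_le(2)[OF c'_le] sobolev_deriv_eq[of x]
  by linarith

text \<open>Parseval with \<open>cmod (d n)\<^sup>2 = cmod (c n)\<^sup>2 + cmod (c'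
  n)\<^sup>2\<close>. The coefficients \<open>d\<close> of the multiplier image of \<open>f\<close>
  are still absolutely summable because \<open>sqrt (1 + n\<^sup>2) \<le> n + 1\<close>, so a
  continuous representative is available.\<close>

lemma sobolev_norm_1: "(sobolev_norm 1 f)\<^sup>2 = (\<integral>x. (f x)\<^sup>2 \<partial>torus) + (\<integral>x. (deriv f x)\<^sup>2 \<partial>torus)"
proof -
  note sc = summable_c_le(1)[OF c_le] and sc' = summable_c_le(1)[OF c'_le]
  define d where "d n = of_real (sqrt (1 + (real n)\<^sup>2)) * c n" for n
  have c0: "Im (c 0) = 0" "Im (c' 0) = 0" "Im (d 0) = 0"
    by (simp_all add: c_def c'_def d_def fourier_coeff_0_real)
  have "sqrt (1 + (real n)\<^sup>2) \<le> real n + 1" for n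
    by (intro real_le_lsqrt) (auto simp: power2_eq_square algebra_simps)
  then have sd: "summable (\<lambda>n. cmod (d n))"
    by (intro summable_c_le(1)) (auto simp: d_def norm_mult intro!: mult_right_mono)
  have "is_bessel 1 f (fseries d)"
    unfolding is_bessel_def
  proof (intro conjI allI)
    show "fseries d \<in> torus_L2" by (intro torus_L2_cont fseries_cont fseries_periodic sd)
    fix k :: int
    have pw: "(1 + (real_of_int k)\<^sup>2) powr (1 / 2) = sqrt (1 + (real_of_int k)\<^sup>2)"
      by (simp add: powr_half_sqrt)
    show "fourier_coeff (fseries d) k = complex_of_real ((1 + (real_of_int k)\<^sup>2) powr (1 / 2)) * fourier_coeff f k"
    proof (cases "k \<ge> 0")
      case True
      then obtain n where "k = int n" using nonneg_int_cases by blast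
      then show ?thesis unfolding pw using fseries_coeff[OF sd c0(3), of n] by (simp add: c_def[of n] d_def[of n])
    next
      case False
      then obtain n where "k = - int n" by (metis int_cases2 nle_le of_nat_0_le_iff)
      then show ?thesis unfolding pw using fseries_coeff[OF sd c0(3), of n] by (simp add: c_def[of n] d_def[of n] fourier_coeff_uminus)
    qed
  qed
  then have "(sobolev_norm 1 f)\<^sup>2 = (\<integral>x. (fseries d x)\<^sup>2 \<partial>torus)"
    by (simp add: sobolev_norm_eq)
  moreover have "(\<lambda>n. 2 * pi * (if n = 0 then 1 else 2) * (cmod (c n))\<^sup>2 + 2 * pi * (if n = 0 then 1 else 2) * (cmod (c' n))\<^sup>2)
     sums ((\<integral>x. (fseries c x)\<^sup>2 \<partial>torus) + (\<integral>x. (fseries c' x)\<^sup>2 \<partial>torus))"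
    by (intro sums_add fseries_parseval sc sc' c0)
  moreover have "2 * pi * (if n = 0 then 1 else 2) * (cmod (c n))\<^sup>2 + 2 * pi * (if n = 0 then 1 else 2) * (cmod (c' n))\<^sup>2
     = 2 * pi * (if n = 0 then 1 else 2) * (cmod (d n))\<^sup>2" for n
  proof -
    have "(cmod (d n))\<^sup>2 = (cmod (c n))\<^sup>2 + (cmod (c' n))\<^sup>2"
      by (simp add: d_def c'_def norm_mult power_mult_distrib algebra_simps)
    then show ?thesis by (simp only: distrib_left)
  qed
  ultimately have "(\<integral>x. (fseries c x)\<^sup>2 \<partial>torus) + (\<integral>x. (fseries c' x)\<^sup>2 \<partial>torus) = (sobolev_norm 1 f)\<^sup>2"
    using sums_unique2[OF fseries_parseval[OF sd c0(3)]] by simp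
  then show ?thesis by (simp add: sobolev_deriv_eq flip: sobolev_fseries)
qed

end

lemma sobolev_eval_measurable:
  assumes "s > 3 / 2"
  shows "(\<lambda>f. f x) \<in> borel_measurable (sobolev_borel s)"
  by (rule measurable_sobolev_borel_Lipschitz[where C="sobolev_const s"])
    (use sobolev_bound[OF assms sobolev_space_diff] in \<open>auto simp: sobolev_dist_def\<close>)

section \<open>Convolution with the Green's function\<close>

text \<open>This is \<open>green\<close> on one period, free of the integer part. In
  \<open>Gc\<close> the kernel is fixed and the argument \<open>x + z\<close> of the function moves
  instead, which keeps the jump of the kernel's derivative at the ends of the interval of
  integration.\<close>

definition ker :: "real \<Rightarrow> real" where "ker z = cosh (z - pi) / (2 * sinh pi)"
definition ker' :: "real \<Rightarrow> real" where "ker' z = sinh (z - pi) / (2 * sinh pi)"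

definition Gc :: "(real \<Rightarrow> real) \<Rightarrow> real \<Rightarrow> real" where
  "Gc f x = integral {0..2 * pi} (\<lambda>z. ker z * f (x + z))"

text \<open>The derivative of \<open>Gc f\<close> after integration by parts. The boundary terms
  cancel because \<open>ker\<close> has equal values at both ends of the period; the minus sign
  comes from moving the derivative to the kernel.\<close>

definition Gd :: "(real \<Rightarrow> real) \<Rightarrow> real \<Rightarrow> real" where
  "Gd f x = - integral {0..2 * pi} (\<lambda>z. ker' z * f (x + z))"

lemma sinh_pi_pos: "sinh pi > 0"
  using sinh_real_pos_iff[of pi] by simp

lemma ker_nonneg: "0 \<le> ker z"
  unfolding ker_def using sinh_pi_pos cosh_real_nonneg by simp

lemma ker'_deriv: "(ker' has_real_derivative ker z) (at z within S)"
  unfolding ker_def ker'_def using sinh_pi_pos by (auto intro!: derivative_eq_intros)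

lemma ker_cont [continuous_intros]: "continuous_on S g \<Longrightarrow> continuous_on S (\<lambda>x. ker (g x))"
  and ker'_cont [continuous_intros]: "continuous_on S g \<Longrightarrow> continuous_on S (\<lambda>x. ker' (g x))"
  unfolding ker_def ker'_def using sinh_pi_pos by (auto intro!: continuous_intros)

lemma ker'_ends: "ker' 0 = - 1 / 2" "ker' (2 * pi) = 1 / 2"
  using sinh_pi_pos by (simp_all add: ker'_def)

lemma ker'_bound:
  assumes "z \<in> {0..2 * pi}"
  shows "\<bar>ker' z\<bar> \<le> 1 / 2"
proof -
  have "sinh (z - pi) \<le> sinh pi" "sinh (- pi) \<le> sinh (z - pi)"
    using assms by (auto simp del: sinh_minus)
  then show ?thesis using sinh_pi_pos by (simp add: ker'_def abs_le_iff field_simps)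
qed

text \<open>The value \<open>3 / 4\<close> matters: with the bound \<open>1 / 2\<close> for
  \<open>ker'\<close> it yields \<open>ker'\<^sup>2 + ker \<le> 1\<close>, on which
  \<open>square_bound_2\<close> rests. It reduces to \<open>exp (2 * pi) \<ge> 5\<close>.\<close>

lemma ker_bound:
  assumes "z \<in> {0..2 * pi}"
  shows "ker z \<le> 3 / 4"
proof -
  have "cosh (z - pi) = cosh \<bar>z - pi\<bar>" by (simp add: abs_if cosh_minus[symmetric, of "z - pi"] del: cosh_minus)
  also have "\<dots> \<le> cosh pi" using assms by (subst cosh_real_nonneg_le_iff) auto
  also have "2 * cosh pi \<le> 3 * sinh pi"
  proof -
    have "5 \<le> 1 + 2 * pi" using pi_gt3 by simp
    also have "\<dots> \<le> exp (2 * pi)" by (rule exp_ge_add_one_self)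
    also have "\<dots> = exp pi * exp pi" by (simp flip: exp_add)
    finally have "5 * exp (- pi) \<le> exp pi * (exp pi * exp (- pi))"
      by (metis exp_ge_zero mult.assoc mult_right_mono)
    then have "5 * exp (- pi) \<le> exp pi" by (simp flip: exp_add)
    then show ?thesis by (simp add: cosh_field_def sinh_field_def)
  qed
  ultimately have "2 * cosh (z - pi) \<le> 3 * sinh pi" by linarith
  then show ?thesis using sinh_pi_pos by (simp add: ker_def field_simps)
qed

lemma integral_moving_window:
  fixes h :: "real \<Rightarrow> real"
  assumes h: "continuous_on UNIV h" and L: "L \<ge> 0"
  shows "((\<lambda>x. integral {x..x + L} h) has_real_derivative h (x + L) - h x) (at x)"
proof -
  define a where "a = x - 1"
  define b where "b = x + L + 1"
  have ha: "continuous_on {a..b} h" "continuous_on {a..b'} h" for b' using h continuous_on_subset by blast+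
  define \<Phi> where "\<Phi> t = integral {a..t} h" for t
  have d: "(\<Phi> has_real_derivative h t) (at t)" if "t \<in> {a<..<b}" for t
  proof -
    have "(\<Phi> has_real_derivative h t) (at t within {a..b})"
      unfolding \<Phi>_def by (rule integral_has_real_derivative[OF ha(1)]) (use that in auto)
    then show ?thesis using that at_within_interior[of t "{a..b}"] by (simp add: interior_atLeastAtMost_real)
  qed
  have "((\<lambda>x. \<Phi> (x + L) - \<Phi> x) has_real_derivative h (x + L) - h x) (at x)"
  proof (rule DERIV_diff)
    show "(\<Phi> has_real_derivative h x) (at x)" using L by (intro d) (auto simp: a_def b_def)
    have "(\<Phi> has_real_derivative h (x + L)) (at (x + L))" using L by (intro d) (auto simp: a_def b_def)
    then show "((\<lambda>x. \<Phi> (x + L)) has_real_derivative h (x + L)) (at x)"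
      by (simp add: DERIV_shift)
  qed
  moreover have "\<forall>\<^sub>F t in nhds x. \<Phi> (t + L) - \<Phi> t = integral {t..t + L} h"
  proof -
    have "\<forall>\<^sub>F t in nhds x. t \<in> {a<..}" by (rule eventually_nhds_in_open) (auto simp: a_def)
    then show ?thesis
    proof eventually_elim
      case (elim t)
      have "integral {a..t} h + integral {t..t + L} h = integral {a..t + L} h"
        using elim L by (intro Henstock_Kurzweil_Integration.integral_combine integrable_continuous_real ha) auto
      then show ?case by (simp add: \<Phi>_def)
    qed
  qed
  ultimately show ?thesis by (subst (asm) DERIV_cong_ev[OF refl _ refl])
qed

lemma integral_shift_real:
  fixes h :: "real \<Rightarrow> real"
  assumes "continuous_on UNIV h"
  shows "integral {a..b} (\<lambda>z. h (x + z)) = integral {x + a..x + b} h"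
  using integral_shift[of a x b h] assms
  by (simp add: comp_def add.commute continuous_on_subset)

lemma integral_period:
  fixes h :: "real \<Rightarrow> real"
  assumes "continuous_on UNIV h" and per: "\<And>x. h (x + 2 * pi) = h x"
  shows "integral {x..x + 2 * pi} h = integral {0..2 * pi} h"
proof -
  have "((\<lambda>x. integral {x..x + 2 * pi} h) has_real_derivative 0) (at x)" for x
    using integral_moving_window[OF assms(1), of "2 * pi" x] per by simp
  from DERIV_isconst_all[OF allI[OF this], of x 0] show ?thesis by simp
qed

lemma integral_shift_period:
  fixes h :: "real \<Rightarrow> real"
  assumes "continuous_on UNIV h" and per: "\<And>x. h (x + 2 * pi) = h x"
  shows "integral {0..2 * pi} (\<lambda>z. h (x + z)) = integral {0..2 * pi} h"
  using integral_shift_real[OF assms(1), of 0 "2 * pi" x] integral_period[OF assms] by simp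

lemma integral_deriv_period:
  fixes F :: "real \<Rightarrow> real"
  assumes "\<And>x. (F has_real_derivative F' x) (at x)" and per: "\<And>x. F (x + 2 * pi) = F x"
  shows "(F' has_integral 0) {0..2 * pi}"
proof -
  have "(F' has_integral (F (2 * pi) - F 0)) {0..2 * pi}"
    by (rule fundamental_theorem_of_calculus)
       (simp_all add: has_field_derivative_at_within[OF assms(1)] flip: has_real_derivative_iff_has_vector_derivative)
  then show ?thesis using per[of 0] by simp
qed

context
  fixes f :: "real \<Rightarrow> real"
  assumes f: "continuous_on UNIV f" and per: "\<And>x. f (x + 2 * pi) = f x"
begin

text \<open>Splitting the hyperbolic kernels into exponentials moves \<open>x\<close> out of the
  integrand. What remains are integrals over a moving period, whose derivatives are explicit even
  when \<open>f\<close> is merely continuous.\<close>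

private definition J1 where "J1 x = integral {x..x + 2 * pi} (\<lambda>z. exp (z - pi) * f z)"
private definition J2 where "J2 x = integral {x..x + 2 * pi} (\<lambda>z. exp (pi - z) * f z)"

lemma f_cont: "continuous_on S f" using f continuous_on_subset by blast

lemma f_comp_cont: "continuous_on S g \<Longrightarrow> continuous_on S (\<lambda>x. f (g x))"
  using continuous_on_compose2[OF f] by auto

lemma Gc_J: "Gc f x = (exp (- x) * J1 x + exp x * J2 x) / (4 * sinh pi)"
proof -
  have "Gc f x = integral {0..2 * pi} (\<lambda>z. (\<lambda>y. ker (y - x) * f y) (x + z))"
    unfolding Gc_def by simp
  also have "\<dots> = integral {x..x + 2 * pi} (\<lambda>y. ker (y - x) * f y)"
  proof -
    have "continuous_on UNIV (\<lambda>y. ker (y - x) * f y)" by (intro continuous_intros f_cont)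
    from integral_shift_real[OF this, of 0 "2 * pi" x] show ?thesis by simp
  qed
  also have "(\<lambda>y. ker (y - x) * f y) =
      (\<lambda>y. exp (- x) / (4 * sinh pi) * (exp (y - pi) * f y) + exp x / (4 * sinh pi) * (exp (pi - y) * f y))"
  proof
    fix y
    have "cosh (y - x - pi) = (exp (- x) * exp (y - pi) + exp x * exp (pi - y)) / 2"
      by (simp add: cosh_field_def algebra_simps flip: exp_add)
    then show "ker (y - x) * f y = exp (- x) / (4 * sinh pi) * (exp (y - pi) * f y) + exp x / (4 * sinh pi) * (exp (pi - y) * f y)"
      using sinh_pi_pos by (simp add: ker_def field_simps)
  qed
  also have "integral {x..x + 2 * pi} \<dots> = exp (- x) / (4 * sinh pi) * J1 x + exp x / (4 * sinh pi) * J2 x"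
    unfolding J1_def J2_def
    by (subst Henstock_Kurzweil_Integration.integral_add)
       (auto intro!: integrable_continuous_real continuous_intros f_cont)
  finally show ?thesis by (simp add: add_divide_distrib)
qed

lemma Gd_J: "Gd f x = (- exp (- x) * J1 x + exp x * J2 x) / (4 * sinh pi)"
proof -
  have "Gd f x = - integral {0..2 * pi} (\<lambda>z. (\<lambda>y. ker' (y - x) * f y) (x + z))"
    unfolding Gd_def by simp
  also have "integral {0..2 * pi} (\<lambda>z. (\<lambda>y. ker' (y - x) * f y) (x + z)) = integral {x..x + 2 * pi} (\<lambda>y. ker' (y - x) * f y)"
  proof -
    have "continuous_on UNIV (\<lambda>y. ker' (y - x) * f y)" by (intro continuous_intros f_cont)
    from integral_shift_real[OF this, of 0 "2 * pi" x] show ?thesis by simp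
  qed
  also have "(\<lambda>y. ker' (y - x) * f y) =
      (\<lambda>y. exp (- x) / (4 * sinh pi) * (exp (y - pi) * f y) - exp x / (4 * sinh pi) * (exp (pi - y) * f y))"
  proof
    fix y
    have "sinh (y - x - pi) = (exp (- x) * exp (y - pi) - exp x * exp (pi - y)) / 2"
      by (simp add: sinh_field_def algebra_simps flip: exp_add)
    then show "ker' (y - x) * f y = exp (- x) / (4 * sinh pi) * (exp (y - pi) * f y) - exp x / (4 * sinh pi) * (exp (pi - y) * f y)"
      unfolding ker'_def using sinh_pi_pos by (simp only:) (simp add: field_simps)
  qed
  also have "integral {x..x + 2 * pi} \<dots> = exp (- x) / (4 * sinh pi) * J1 x - exp x / (4 * sinh pi) * J2 x"
    unfolding J1_def J2_def
    by (subst Henstock_Kurzweil_Integration.integral_diff)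
       (auto intro!: integrable_continuous_real continuous_intros f_cont)
  finally show ?thesis by (simp add: add_divide_distrib diff_divide_distrib)
qed

lemma J1_deriv: "(J1 has_real_derivative (exp (x + pi) - exp (x - pi)) * f x) (at x)"
proof -
  have "(J1 has_real_derivative exp (x + 2 * pi - pi) * f (x + 2 * pi) - exp (x - pi) * f x) (at x)"
    unfolding J1_def by (intro integral_moving_window continuous_intros f_cont) auto
  moreover have "x + 2 * pi - pi = x + pi" by simp
  ultimately show ?thesis by (simp only: per left_diff_distrib)
qed

lemma J2_deriv: "(J2 has_real_derivative (exp (- x - pi) - exp (pi - x)) * f x) (at x)"
proof -
  have "(J2 has_real_derivative exp (pi - (x + 2 * pi)) * f (x + 2 * pi) - exp (pi - x) * f x) (at x)"
    unfolding J2_def by (intro integral_moving_window continuous_intros f_cont) auto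
  moreover have "pi - (x + 2 * pi) = - x - pi" by simp
  ultimately show ?thesis by (simp only: per left_diff_distrib)
qed

lemma Gc_deriv: "(Gc f has_real_derivative Gd f x) (at x)"
proof -
  have "((\<lambda>x. (exp (- x) * J1 x + exp x * J2 x) / (4 * sinh pi)) has_real_derivative
      ((- exp (- x)) * J1 x + ((exp (x + pi) - exp (x - pi)) * f x) * exp (- x) +
       (exp x * J2 x + ((exp (- x - pi) - exp (pi - x)) * f x) * exp x)) / (4 * sinh pi)) (at x)"
    by (intro DERIV_cdivide DERIV_add DERIV_mult J1_deriv J2_deriv) (auto intro!: derivative_eq_intros)
  moreover have "((exp (x + pi) - exp (x - pi)) * f x) * exp (- x) + ((exp (- x - pi) - exp (pi - x)) * f x) * exp x = 0"
  proof -
    have e: "exp (x + pi) * exp (- x) = exp pi" "exp (x - pi) * exp (- x) = exp (- pi)"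
      "exp (- x - pi) * exp x = exp (- pi)" "exp (pi - x) * exp x = exp pi"
      by (simp_all flip: exp_add)
    have "((A - B) * g) * C + ((D - E) * g) * F = (A * C) * g - (B * C) * g + (D * F) * g - (E * F) * g" for A B C D E F g :: real
      by (simp add: algebra_simps)
    then show ?thesis by (simp only: e diff_add_cancel diff_self)
  qed
  moreover have "Gc f = (\<lambda>x. (exp (- x) * J1 x + exp x * J2 x) / (4 * sinh pi))"
    using Gc_J by auto
  ultimately show ?thesis
    by (simp add: Gd_J algebra_simps)
qed

text \<open>This says that \<open>G\<close> inverts \<open>1 - \<partial>\<^sub>x\<^sup>2\<close>.
  The endpoint contributions of \<open>J1\<close> and \<open>J2\<close>, which cancel in the
  derivative of \<open>Gc f\<close>, now add up to \<open>- 4 * sinh pi * f x\<close>.\<close>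

lemma Gd_deriv: "(Gd f has_real_derivative Gc f x - f x) (at x)"
proof -
  have "((\<lambda>x. (- exp (- x) * J1 x + exp x * J2 x) / (4 * sinh pi)) has_real_derivative
      ((exp (- x)) * J1 x + ((exp (x + pi) - exp (x - pi)) * f x) * (- exp (- x)) +
       (exp x * J2 x + ((exp (- x - pi) - exp (pi - x)) * f x) * exp x)) / (4 * sinh pi)) (at x)"
    by (intro DERIV_cdivide DERIV_add DERIV_mult J1_deriv J2_deriv) (auto intro!: derivative_eq_intros)
  moreover have "((exp (x + pi) - exp (x - pi)) * f x) * (- exp (- x)) + ((exp (- x - pi) - exp (pi - x)) * f x) * exp x = - (4 * sinh pi) * f x"
  proof -
    have e: "exp (x + pi) * exp (- x) = exp pi" "exp (x - pi) * exp (- x) = exp (- pi)"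
      "exp (- x - pi) * exp x = exp (- pi)" "exp (pi - x) * exp x = exp pi"
      by (simp_all flip: exp_add)
    have "((A - B) * g) * (- C) + ((D - E) * g) * F = - (A * C) * g + (B * C) * g + (D * F) * g - (E * F) * g" for A B C D E F g :: real
      by (simp add: algebra_simps)
    then have "((exp (x + pi) - exp (x - pi)) * f x) * (- exp (- x)) + ((exp (- x - pi) - exp (pi - x)) * f x) * exp x =
        - (2 * exp pi - 2 * exp (- pi)) * f x"
      by (simp only: e) (simp add: algebra_simps)
    moreover have "4 * sinh pi = 2 * exp pi - 2 * exp (- pi)" by (simp add: sinh_field_def)
    ultimately show ?thesis by (simp only:)
  qed
  moreover have "Gd f = (\<lambda>x. (- exp (- x) * J1 x + exp x * J2 x) / (4 * sinh pi))"
    using Gd_J by auto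
  moreover have "(A + B + (C + D)) / (4 * sinh pi) = (A + C) / (4 * sinh pi) - g" if "B + D = - (4 * sinh pi) * g" for A B C D g :: real
  proof -
    have "A + B + (C + D) = (A + C) - (4 * sinh pi) * g" using that by simp
    moreover have "4 * sinh pi \<noteq> 0" using sinh_pi_pos by simp
    ultimately show ?thesis by (simp only: diff_divide_distrib nonzero_mult_div_cancel_left not_False_eq_True)
  qed
  ultimately show ?thesis unfolding Gc_J by (simp only:)
qed

lemma Gc_periodic: "Gc f (x + 2 * pi) = Gc f x" and Gd_periodic: "Gd f (x + 2 * pi) = Gd f x"
proof -
  have "f (x + 2 * pi + z) = f (x + z)" for z using per[of "x + z"] by (simp add: algebra_simps)
  then show "Gc f (x + 2 * pi) = Gc f x" "Gd f (x + 2 * pi) = Gd f x"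
    by (simp_all add: Gc_def Gd_def)
qed

lemma Gc_abs_bound: "\<bar>Gc f x\<bar> \<le> 3 / 4 * integral {0..2 * pi} (\<lambda>y. \<bar>f y\<bar>)"
proof -
  have "\<bar>Gc f x\<bar> \<le> integral {0..2 * pi} (\<lambda>z. 3 / 4 * \<bar>f (x + z)\<bar>)"
    unfolding Gc_def real_norm_def[symmetric]
  proof (rule Henstock_Kurzweil_Integration.integral_norm_bound_integral)
    fix z assume "z \<in> {0..2 * pi}"
    then show "norm (ker z * f (x + z)) \<le> 3 / 4 * norm (f (x + z))"
      using mult_right_mono[OF ker_bound[of z], of "\<bar>f (x + z)\<bar>"] ker_nonneg[of z] by (simp add: abs_mult)
  qed (auto intro!: integrable_continuous_real continuous_intros f_comp_cont)
  also have "\<dots> = 3 / 4 * integral {0..2 * pi} (\<lambda>z. \<bar>f (x + z)\<bar>)" by simp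
  also have "integral {0..2 * pi} (\<lambda>z. \<bar>f (x + z)\<bar>) = integral {0..2 * pi} (\<lambda>y. \<bar>f y\<bar>)"
    by (rule integral_shift_period[of "\<lambda>y. \<bar>f y\<bar>"]) (auto intro!: continuous_intros f simp: per)
  finally show ?thesis .
qed

lemma Gd_abs_bound: "\<bar>Gd f x\<bar> \<le> 1 / 2 * integral {0..2 * pi} (\<lambda>y. \<bar>f y\<bar>)"
proof -
  have "\<bar>Gd f x\<bar> \<le> integral {0..2 * pi} (\<lambda>z. 1 / 2 * \<bar>f (x + z)\<bar>)"
    unfolding Gd_def real_norm_def[symmetric] norm_minus_cancel
  proof (rule Henstock_Kurzweil_Integration.integral_norm_bound_integral)
    fix z assume "z \<in> {0..2 * pi}"
    then show "norm (ker' z * f (x + z)) \<le> 1 / 2 * norm (f (x + z))"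
      using mult_right_mono[OF ker'_bound[of z], of "\<bar>f (x + z)\<bar>"] by (simp add: abs_mult)
  qed (auto intro!: integrable_continuous_real continuous_intros f_comp_cont)
  also have "\<dots> = 1 / 2 * integral {0..2 * pi} (\<lambda>z. \<bar>f (x + z)\<bar>)" by simp
  also have "integral {0..2 * pi} (\<lambda>z. \<bar>f (x + z)\<bar>) = integral {0..2 * pi} (\<lambda>y. \<bar>f y\<bar>)"
    by (rule integral_shift_period[of "\<lambda>y. \<bar>f y\<bar>"]) (auto intro!: continuous_intros f simp: per)
  finally show ?thesis .
qed

text \<open>After reducing \<open>x\<close> to \<open>x'\<close> in one period, the integer part in
  \<open>green (x - y)\<close> takes different values on the two sides of \<open>y = x'\<close>. The
  left piece is shifted by a period, and together the pieces form the window that starts at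
  \<open>x'\<close>.\<close>

lemma green_conv_eq: "green_conv f x = Gc f x"
proof -
  define k where "k = \<lfloor>x / (2 * pi)\<rfloor>"
  define x' where "x' = x - 2 * pi * of_int k"
  have "of_int k \<le> x / (2 * pi)" "x / (2 * pi) < of_int k + 1" unfolding k_def by linarith+
  then have x': "0 \<le> x'" "x' < 2 * pi" by (auto simp: field_simps x'_def)
  have green: "green (x - y) = ker \<bar>x' - y\<bar>" if y: "y \<in> {0..2 * pi}" for y
  proof (cases "y \<le> x'")
    case True
    have "\<lfloor>(x - y) / (2 * pi)\<rfloor> = k"
      using True x' y by (intro floor_unique) (auto simp: field_simps x'_def)
    then show ?thesis using True by (simp add: green_def ker_def x'_def algebra_simps)
  next
    case False
    have "\<lfloor>(x - y) / (2 * pi)\<rfloor> = k - 1"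
      using False x' y by (intro floor_unique) (auto simp: field_simps x'_def)
    moreover have "cosh (x - y - 2 * pi * (of_int k - 1) - pi) = cosh (y - x' - pi)"
      using cosh_minus[of "y - x' - pi"] by (simp add: x'_def algebra_simps)
    ultimately show ?thesis using False by (simp add: green_def ker_def)
  qed
  have c: "continuous_on {0..2 * pi} (\<lambda>y. ker \<bar>x' - y\<bar> * f y)"
    by (intro continuous_intros f_cont)
  have "green_conv f x = (LBINT y:{0..2 * pi}. ker \<bar>x' - y\<bar> * f y)"
    unfolding green_conv_def by (intro set_lebesgue_integral_cong) (auto simp: green)
  also have "\<dots> = integral {0..2 * pi} (\<lambda>y. ker \<bar>x' - y\<bar> * f y)"
    by (intro set_borel_integral_eq_integral borel_integrable_atLeastAtMost' c)
  also have "\<dots> = integral {0..x'} (\<lambda>y. ker \<bar>x' - y\<bar> * f y) + integral {x'..2 * pi} (\<lambda>y. ker \<bar>x' - y\<bar> * f y)"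
    using x' by (intro Henstock_Kurzweil_Integration.integral_combine[symmetric] integrable_continuous_real c) auto
  also have "integral {x'..2 * pi} (\<lambda>y. ker \<bar>x' - y\<bar> * f y) = integral {x'..2 * pi} (\<lambda>y. ker (y - x') * f y)"
    by (intro integral_cong) auto
  also have "integral {0..x'} (\<lambda>y. ker \<bar>x' - y\<bar> * f y) = integral {0..x'} (\<lambda>y. (\<lambda>z. ker (z - x') * f z) (2 * pi + y))"
  proof (intro integral_cong)
    fix y assume y: "y \<in> {0..x'}"
    have "cosh (x' - y - pi) = cosh (2 * pi + y - x' - pi)"
      using cosh_minus[of "x' - y - pi"] by (simp add: algebra_simps)
    then show "ker \<bar>x' - y\<bar> * f y = (\<lambda>z. ker (z - x') * f z) (2 * pi + y)"
      using y per[of y] by (simp add: ker_def add.commute)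
  qed
  also have "\<dots> = integral {2 * pi..2 * pi + x'} (\<lambda>z. ker (z - x') * f z)"
    using integral_shift_real[of "\<lambda>z. ker (z - x') * f z" 0 x' "2 * pi"] by (simp add: continuous_intros f_cont)
  also have "\<dots> + integral {x'..2 * pi} (\<lambda>y. ker (y - x') * f y) = integral {x'..2 * pi + x'} (\<lambda>z. ker (z - x') * f z)"
    using x' Henstock_Kurzweil_Integration.integral_combine[of x' "2 * pi" "2 * pi + x'" "\<lambda>z. ker (z - x') * f z"]
    by (simp add: integrable_continuous_real continuous_intros f_cont add.commute)
  also have "\<dots> = integral {0..2 * pi} (\<lambda>z. (\<lambda>z. ker (z - x') * f z) (x' + z))"
    using integral_shift_real[of "\<lambda>z. ker (z - x') * f z" 0 "2 * pi" x']
    by (simp add: continuous_intros f_cont add.commute)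
  also have "\<dots> = Gc f x"
    unfolding Gc_def using periodic_int[of f, OF per, of "x' + _" k] by (auto intro!: integral_cong simp: x'_def algebra_simps)
  finally show ?thesis .
qed

lemma deriv_green_conv: "deriv (green_conv f) x = Gd f x"
proof -
  have "green_conv f = Gc f" using green_conv_eq by auto
  then show ?thesis using DERIV_imp_deriv[OF Gc_deriv] by simp
qed

end

lemma Gc_mono:
  assumes "continuous_on UNIV f" "continuous_on UNIV g" "\<And>y. f y \<le> g y"
  shows "Gc f x \<le> Gc g x"
  unfolding Gc_def
  by (intro integral_le integrable_continuous_real continuous_intros mult_left_mono ker_nonneg assms
      continuous_on_compose2[OF assms(1)] continuous_on_compose2[OF assms(2)]) auto

section \<open>Pointwise bounds by the energy\<close>

context
  fixes v vx :: "real \<Rightarrow> real"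
  assumes v: "\<And>x. (v has_real_derivative vx x) (at x)" and vx: "continuous_on UNIV vx"
    and per: "\<And>x. v (x + 2 * pi) = v x" and perx: "\<And>x. vx (x + 2 * pi) = vx x"
begin

lemma v_cont: "continuous_on UNIV v"
  by (rule DERIV_continuous_on) (rule v)

lemma v_cont': "continuous_on S (\<lambda>z. v (x + z))" "continuous_on S (\<lambda>z. vx (x + z))"
  by (intro continuous_on_compose2[OF v_cont] continuous_on_compose2[OF vx] continuous_intros; simp)+

text \<open>The fundamental theorem for \<open>ker' z * (v (x + z))\<^sup>2\<close> over one period:
  the end values \<open>- 1 / 2\<close> and \<open>1 / 2\<close> of \<open>ker'\<close> combine to
  exactly one copy of \<open>(v x)\<^sup>2\<close>.\<close>

lemma square_representation:
  "(v x)\<^sup>2 = Gc (\<lambda>y. (v y)\<^sup>2) x + integral {0..2 * pi} (\<lambda>z. 2 * ker' z * v (x + z) * vx (x + z))"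
proof -
  have "((\<lambda>z. ker z * (v (x + z))\<^sup>2 + 2 * ker' z * v (x + z) * vx (x + z)) has_integral
      (ker' (2 * pi) * (v (x + 2 * pi))\<^sup>2 - ker' 0 * (v (x + 0))\<^sup>2)) {0..2 * pi}"
  proof (rule fundamental_theorem_of_calculus)
    fix z :: real
    have "((\<lambda>z. v (x + z)) has_real_derivative vx (x + z)) (at z)"
      using DERIV_shift[of v "vx (x + z)" z x] v[of "x + z"] by (simp add: add.commute)
    then have "((\<lambda>z. v (x + z)) has_real_derivative vx (x + z)) (at z within {0..2 * pi})"
      by (rule has_field_derivative_at_within)
    then have "((\<lambda>z. ker' z * (v (x + z))\<^sup>2) has_real_derivative
         ker z * (v (x + z))\<^sup>2 + 2 * ker' z * v (x + z) * vx (x + z)) (at z within {0..2 * pi})"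
      by (auto intro!: derivative_eq_intros ker'_deriv simp: algebra_simps)
    then show "((\<lambda>z. ker' z * (v (x + z))\<^sup>2) has_vector_derivative
         ker z * (v (x + z))\<^sup>2 + 2 * ker' z * v (x + z) * vx (x + z)) (at z within {0..2 * pi})"
      by (simp only: has_real_derivative_iff_has_vector_derivative)
  qed simp
  then have "(v x)\<^sup>2 = integral {0..2 * pi} (\<lambda>z. ker z * (v (x + z))\<^sup>2 + 2 * ker' z * v (x + z) * vx (x + z))"
    by (simp add: per ker'_ends integral_unique)
  also have "\<dots> = Gc (\<lambda>y. (v y)\<^sup>2) x + integral {0..2 * pi} (\<lambda>z. 2 * ker' z * v (x + z) * vx (x + z))"
    unfolding Gc_def
    by (rule Henstock_Kurzweil_Integration.integral_add) (intro integrable_continuous_real continuous_intros v_cont')+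
  finally show ?thesis .
qed

lemma sq_period: "continuous_on UNIV (\<lambda>y. a * (v y)\<^sup>2 + b * (vx y)\<^sup>2)"
  "a * (v (y + 2 * pi))\<^sup>2 + b * (vx (y + 2 * pi))\<^sup>2 = a * (v y)\<^sup>2 + b * (vx y)\<^sup>2"
  by (intro continuous_intros v_cont vx) (simp add: per perx)

text \<open>With \<open>ker'\<close> bounded by \<open>1 / 2\<close>, the remainder of the
  representation is at most the integral of \<open>\<bar>v\<bar> * \<bar>vx\<bar>\<close>, hence
  half the energy of \<open>v\<close>.\<close>

lemma square_bound_1:
  "(v x)\<^sup>2 - Gc (\<lambda>y. (v y)\<^sup>2 + (vx y)\<^sup>2 / 2) x \<le> 1 / 2 * integral {0..2 * pi} (\<lambda>y. (v y)\<^sup>2 + (vx y)\<^sup>2)"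
proof -
  have "integral {0..2 * pi} (\<lambda>z. 2 * ker' z * v (x + z) * vx (x + z)) \<le>
      integral {0..2 * pi} (\<lambda>z. (\<lambda>y. 1 / 2 * (v y)\<^sup>2 + 1 / 2 * (vx y)\<^sup>2) (x + z))"
  proof (rule integral_le)
    fix z assume z: "z \<in> {0..2 * pi}"
    have "2 * ker' z * v (x + z) * vx (x + z) \<le> \<bar>2 * ker' z\<bar> * (\<bar>v (x + z)\<bar> * \<bar>vx (x + z)\<bar>)"
      by (metis abs_ge_self abs_mult mult.assoc)
    also have "\<dots> \<le> 1 * (\<bar>v (x + z)\<bar> * \<bar>vx (x + z)\<bar>)"
      using ker'_bound[OF z] by (intro mult_right_mono) (auto simp: abs_mult)
    also have "\<dots> \<le> 1 / 2 * (v (x + z))\<^sup>2 + 1 / 2 * (vx (x + z))\<^sup>2"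
      using zero_le_power2[of "\<bar>v (x + z)\<bar> - \<bar>vx (x + z)\<bar>"] by (simp add: power2_diff)
    finally show "2 * ker' z * v (x + z) * vx (x + z) \<le> (\<lambda>y. 1 / 2 * (v y)\<^sup>2 + 1 / 2 * (vx y)\<^sup>2) (x + z)" .
  qed (intro integrable_continuous_real continuous_intros v_cont')+
  also have "\<dots> = integral {0..2 * pi} (\<lambda>y. 1 / 2 * (v y)\<^sup>2 + 1 / 2 * (vx y)\<^sup>2)"
    by (rule integral_shift_period[OF sq_period])
  also have "\<dots> = 1 / 2 * integral {0..2 * pi} (\<lambda>y. (v y)\<^sup>2 + (vx y)\<^sup>2)"
    by (simp flip: Henstock_Kurzweil_Integration.integral_mult_right add: distrib_left)
  moreover have "Gc (\<lambda>y. (v y)\<^sup>2) x \<le> Gc (\<lambda>y. (v y)\<^sup>2 + (vx y)\<^sup>2 / 2) x"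
    by (intro Gc_mono continuous_intros v_cont vx) auto
  ultimately show ?thesis using square_representation[of x] by linarith
qed

text \<open>The minus sign in front of \<open>(vx y)\<^sup>2\<close> puts an additional term
  \<open>ker z * vx\<^sup>2\<close> on the unfavourable side. Completing the square absorbs it,
  because \<open>ker'\<^sup>2 + ker \<le> 1 / 4 + 3 / 4\<close>.\<close>

lemma square_bound_2:
  "(v x)\<^sup>2 / 2 - Gc (\<lambda>y. (v y)\<^sup>2 / 2 - (vx y)\<^sup>2 / 2) x \<le> 1 / 2 * integral {0..2 * pi} (\<lambda>y. (v y)\<^sup>2 + (vx y)\<^sup>2)"
proof -
  have "integral {0..2 * pi} (\<lambda>z. 2 * ker' z * v (x + z) * vx (x + z) + ker z * (vx (x + z))\<^sup>2) \<le>
      integral {0..2 * pi} (\<lambda>z. (\<lambda>y. 1 * (v y)\<^sup>2 + 1 * (vx y)\<^sup>2) (x + z))"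
  proof (rule integral_le)
    fix z assume z: "z \<in> {0..2 * pi}"
    have "(ker' z)\<^sup>2 \<le> 1 / 4"
      using power_mono[OF ker'_bound[OF z], of 2] by (simp add: power2_eq_square)
    then have "(ker' z)\<^sup>2 + ker z \<le> 1" using ker_bound[OF z] by linarith
    then have "((ker' z)\<^sup>2 + ker z) * (vx (x + z))\<^sup>2 \<le> 1 * (vx (x + z))\<^sup>2"
      by (intro mult_right_mono) auto
    moreover have "0 \<le> (v (x + z) - ker' z * vx (x + z))\<^sup>2" by simp
    ultimately show "2 * ker' z * v (x + z) * vx (x + z) + ker z * (vx (x + z))\<^sup>2 \<le> (\<lambda>y. 1 * (v y)\<^sup>2 + 1 * (vx y)\<^sup>2) (x + z)"
      by (simp add: power2_diff power_mult_distrib algebra_simps)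
  qed (intro integrable_continuous_real continuous_intros v_cont')+
  also have "\<dots> = integral {0..2 * pi} (\<lambda>y. 1 * (v y)\<^sup>2 + 1 * (vx y)\<^sup>2)"
    by (rule integral_shift_period[OF sq_period])
  finally have 1: "integral {0..2 * pi} (\<lambda>z. 2 * ker' z * v (x + z) * vx (x + z) + ker z * (vx (x + z))\<^sup>2)
     \<le> integral {0..2 * pi} (\<lambda>y. (v y)\<^sup>2 + (vx y)\<^sup>2)" by simp
  have 2: "integral {0..2 * pi} (\<lambda>z. 2 * ker' z * v (x + z) * vx (x + z) + ker z * (vx (x + z))\<^sup>2) =
     integral {0..2 * pi} (\<lambda>z. 2 * ker' z * v (x + z) * vx (x + z)) + Gc (\<lambda>y. (vx y)\<^sup>2) x"
    unfolding Gc_def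
    by (rule Henstock_Kurzweil_Integration.integral_add) (intro integrable_continuous_real continuous_intros v_cont')+
  have "Gc (\<lambda>y. (v y)\<^sup>2 / 2 - (vx y)\<^sup>2 / 2) x =
     integral {0..2 * pi} (\<lambda>z. 1 / 2 * (ker z * (v (x + z))\<^sup>2) - 1 / 2 * (ker z * (vx (x + z))\<^sup>2))"
    unfolding Gc_def by (simp add: algebra_simps)
  also have "\<dots> = 1 / 2 * Gc (\<lambda>y. (v y)\<^sup>2) x - 1 / 2 * Gc (\<lambda>y. (vx y)\<^sup>2) x"
    unfolding Gc_def
    by (subst Henstock_Kurzweil_Integration.integral_diff) (auto intro!: integrable_continuous_real continuous_intros v_cont')
  finally show ?thesis using 1 2 square_representation[of x] by linarith
qed

lemma sup_bound: "(v x)\<^sup>2 \<le> 2 * integral {0..2 * pi} (\<lambda>y. (v y)\<^sup>2 + (vx y)\<^sup>2)"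
proof -
  have "Gc (\<lambda>y. 1 * (v y)\<^sup>2 + (1 / 2) * (vx y)\<^sup>2) x \<le>
      3 / 4 * integral {0..2 * pi} (\<lambda>y. \<bar>1 * (v y)\<^sup>2 + (1 / 2) * (vx y)\<^sup>2\<bar>)"
    using Gc_abs_bound[OF sq_period(1)[of 1 "1 / 2"] sq_period(2)[of 1 _ "1 / 2"], of x] by linarith
  also have "\<dots> \<le> 3 / 4 * integral {0..2 * pi} (\<lambda>y. (v y)\<^sup>2 + (vx y)\<^sup>2)"
    by (intro mult_left_mono integral_le integrable_continuous_real continuous_intros
       continuous_on_subset[OF v_cont] continuous_on_subset[OF vx]) auto
  finally have "Gc (\<lambda>y. (v y)\<^sup>2 + (vx y)\<^sup>2 / 2) x \<le> 3 / 4 * integral {0..2 * pi} (\<lambda>y. (v y)\<^sup>2 + (vx y)\<^sup>2)" by simp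
  moreover have "0 \<le> integral {0..2 * pi} (\<lambda>y. (v y)\<^sup>2 + (vx y)\<^sup>2)"
    by (intro Henstock_Kurzweil_Integration.integral_nonneg integrable_continuous_real continuous_intros
       continuous_on_subset[OF v_cont] continuous_on_subset[OF vx]) auto
  ultimately show ?thesis using square_bound_1[of x] by linarith
qed

end

lemma Gc_joint_cont:
  fixes f :: "real \<Rightarrow> real \<Rightarrow> real"
  assumes "joint_cont U f"
  shows "joint_cont U (\<lambda>t x. Gc (f t) x)"
    and "joint_cont U (\<lambda>t x. Gd (f t) x)"
proof -
  have *: "continuous_on ((U \<times> UNIV) \<times> {0..2 * pi}) (\<lambda>(p, z). f (fst p) (snd p + z))"
  proof -
    have "continuous_on ((U \<times> UNIV) \<times> {0..2 * pi}) (\<lambda>q. (fst (fst q), snd (fst q) + snd q) :: real \<times> real)"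
      by (intro continuous_intros)
    moreover have "(\<lambda>q. (fst (fst q), snd (fst q) + snd q)) ` ((U \<times> UNIV) \<times> {0..2 * pi}) \<subseteq> U \<times> (UNIV :: real set)"
      by auto
    ultimately have "continuous_on ((U \<times> UNIV) \<times> {0..2 * pi}) (\<lambda>q. case (fst (fst q), snd (fst q) + snd q) of (t, x) \<Rightarrow> f t x)"
      by (rule continuous_on_compose2[OF assms])
    then show ?thesis by (simp add: case_prod_beta')
  qed
  have "continuous_on ((U \<times> UNIV) \<times> cbox 0 (2 * pi)) (\<lambda>(p, z). ker z * f (fst p) (snd p + z))"
    "continuous_on ((U \<times> UNIV) \<times> cbox 0 (2 * pi)) (\<lambda>(p, z). ker' z * f (fst p) (snd p + z))"
    using * by (auto simp: case_prod_beta' intro!: continuous_intros)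
  from this[THEN integral_continuous_on_param]
  show "joint_cont U (\<lambda>t x. Gc (f t) x)" "joint_cont U (\<lambda>t x. Gd (f t) x)"
    by (auto simp: Gc_def Gd_def case_prod_beta' intro!: continuous_intros)
qed

section \<open>Comparison principles\<close>

lemma jcont:
  fixes \<phi> :: "real \<Rightarrow> real \<Rightarrow> real"
  assumes "joint_cont U \<phi>" "continuous_on S f" "continuous_on S g" "\<And>s. s \<in> S \<Longrightarrow> f s \<in> U"
  shows "continuous_on S (\<lambda>s. \<phi> (f s) (g s))"
proof -
  have "continuous_on S (\<lambda>s. case (f s, g s) of (t, x) \<Rightarrow> \<phi> t x)"
    by (rule continuous_on_compose2[OF assms(1)]) (auto intro!: continuous_intros assms)
  then show ?thesis by simp
qed

text \<open>At the first time \<open>s\<close> at which \<open>w\<close> meets \<open>\<psi>\<close>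
  anywhere, the meeting point is a spatial maximum. A time derivative of \<open>w\<close> below that
  of \<open>\<psi>\<close> would put \<open>w\<close> above \<open>\<psi>\<close> shortly before
  \<open>s\<close>. Periodicity makes the set of meeting points compact, so a first time
  exists.\<close>

lemma barrier_max:
  fixes w :: "real \<Rightarrow> real \<Rightarrow> real"
  assumes cont: "joint_cont {a..c} w"
    and per: "\<And>t x. t \<in> {a..c} \<Longrightarrow> w t (x + 2 * pi) = w t x"
    and \<psi>: "\<And>t. t \<in> {a..c} \<Longrightarrow> (\<psi> has_real_derivative \<psi>' t) (at t within {a..c})"
    and init: "\<And>x. w a x < \<psi> a"
    and touch: "\<And>t x. t \<in> {a<..c} \<Longrightarrow> w t x = \<psi> t \<Longrightarrow> (\<And>y. w t y \<le> \<psi> t) \<Longrightarrow>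
      \<exists>d. ((\<lambda>t. w t x) has_real_derivative d) (at t within {a..c}) \<and> d < \<psi>' t"
    and t: "t \<in> {a..c}"
  shows "w t x < \<psi> t"
proof (rule ccontr)
  assume neg: "\<not> w t x < \<psi> t"
  have \<psi>c: "continuous_on {a..c} \<psi>" using \<psi> by (intro DERIV_continuous_on) auto
  define A where "A = {p \<in> {a..c} \<times> {0..2 * pi}. \<psi> (fst p) \<le> w (fst p) (snd p)}"
  have "closed A"
    unfolding A_def
    by (rule continuous_on_closed_Collect_le) (auto intro!: closed_Times continuous_on_compose2[OF \<psi>c] jcont[OF cont] continuous_intros)
  moreover have "A = ({a..c} \<times> {0..2 * pi}) \<inter> A" unfolding A_def by blast
  ultimately have "compact A" by (metis compact_Icc compact_Int_closed compact_Times)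
  then have cA: "compact (fst ` A)" by (intro compact_continuous_image continuous_intros)
  obtain y where y: "y \<in> {0..2 * pi}" "w t y = w t x"
    using periodic_reduce[of "w t" x] per[OF t] by auto
  have "(t, y) \<in> A" using neg y t by (auto simp: A_def)
  then have tA: "t \<in> fst ` A" by force
  then obtain s where s: "s \<in> fst ` A" "\<And>r. r \<in> fst ` A \<Longrightarrow> s \<le> r"
    using compact_attains_inf[OF cA] by blast
  then obtain z where z: "(s, z) \<in> A" by auto
  have sac: "s \<in> {a..c}" using z by (auto simp: A_def)
  have "s \<noteq> a" using z init[of z] by (auto simp: A_def)
  then have sa: "s \<in> {a<..c}" using sac by auto
  have before: "w r y < \<psi> r" if r: "r \<in> {a..<s}" for r y
  proof (rule ccontr)
    assume "\<not> w r y < \<psi> r"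
    have "r \<in> {a..c}" using r sac by auto
    obtain y' where "y' \<in> {0..2 * pi}" "w r y' = w r y"
      using periodic_reduce[of "w r" y] per[OF \<open>r \<in> {a..c}\<close>] by auto
    then have "(r, y') \<in> A" using \<open>\<not> w r y < \<psi> r\<close> \<open>r \<in> {a..c}\<close> by (auto simp: A_def)
    then have "s \<le> r" using s(2)[of r] by force
    then show False using r by auto
  qed
  have le: "w s y \<le> \<psi> s" for y
  proof -
    have "continuous_on {a..c} (\<lambda>r. \<psi> r - w r y)"
      by (intro continuous_intros \<psi>c jcont[OF cont]) auto
    then have "((\<lambda>r. \<psi> r - w r y) \<longlongrightarrow> \<psi> s - w s y) (at s within {a..c})"
      using sac by (simp add: continuous_on_def)
    then have lim: "((\<lambda>r. \<psi> r - w r y) \<longlongrightarrow> \<psi> s - w s y) (at s within {a..<s})"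
      by (rule tendsto_within_subset) (use sac in auto)
    have "at s within {a..<s} \<noteq> bot" using sa by (simp add: at_within_eq_bot_iff) 
    moreover have "\<forall>\<^sub>F r in at s within {a..<s}. 0 \<le> \<psi> r - w r y"
      using before[of _ y] by (auto simp: eventually_at_filter less_imp_le)
    ultimately have "0 \<le> \<psi> s - w s y" using tendsto_lowerbound[OF lim] by blast
    then show ?thesis by simp
  qed
  have eq: "w s z = \<psi> s" using z le[of z] by (auto simp: A_def)
  obtain d where d: "((\<lambda>t. w t z) has_real_derivative d) (at s within {a..c})" "d < \<psi>' s"
    using touch[OF sa eq le] by blast
  have "((\<lambda>t. w t z - \<psi> t) has_real_derivative d - \<psi>' s) (at s within {a..c})"
    by (intro DERIV_diff d \<psi> sac)
  then obtain \<delta> where \<delta>: "\<delta> > 0" "\<And>h. h > 0 \<Longrightarrow> s - h \<in> {a..c} \<Longrightarrow> h < \<delta> \<Longrightarrow> w s z - \<psi> s < w (s - h) z - \<psi> (s - h)"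
    using has_real_derivative_neg_dec_left[of "\<lambda>t. w t z - \<psi> t" "d - \<psi>' s" s "{a..c}"] d(2) by auto
  define h where "h = min (\<delta> / 2) (s - a)"
  have h: "h > 0" "h < \<delta>" "s - h \<in> {a..<s}" using \<delta>(1) sa by (auto simp: h_def)
  then have "w s z - \<psi> s < w (s - h) z - \<psi> (s - h)" using sac by (intro \<delta>(2)) auto
  then show False using before[OF h(3), of z] eq by simp
qed

text \<open>The dual argument uses the last time at which the minimum of \<open>w\<close> is at most
  \<open>\<psi>\<close>. There \<open>w\<close> touches \<open>\<psi>\<close> from above, and a
  smaller time derivative would push it below \<open>\<psi>\<close> immediately afterwards. As the
  contact examined is the last one, equality at the initial time is harmless.\<close>

lemma barrier_min:
  fixes w :: "real \<Rightarrow> real \<Rightarrow> real"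
  assumes cont: "joint_cont {a..c} w"
    and per: "\<And>t x. t \<in> {a..c} \<Longrightarrow> w t (x + 2 * pi) = w t x"
    and \<psi>: "\<And>t. t \<in> {a..c} \<Longrightarrow> (\<psi> has_real_derivative \<psi>' t) (at t within {a..c})"
    and init: "w a x0 \<le> \<psi> a"
    and touch: "\<And>t x. t \<in> {a..<c} \<Longrightarrow> w t x = \<psi> t \<Longrightarrow> (\<And>y. w t y \<ge> \<psi> t) \<Longrightarrow>
      \<exists>d. ((\<lambda>t. w t x) has_real_derivative d) (at t within {a..c}) \<and> d < \<psi>' t"
    and t: "t \<in> {a..c}"
  shows "\<exists>x. w t x \<le> \<psi> t"
proof (rule ccontr)
  assume neg: "\<nexists>x. w t x \<le> \<psi> t"
  have \<psi>c: "continuous_on {a..c} \<psi>" using \<psi> by (intro DERIV_continuous_on) auto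
  have \<psi>c': "continuous_on {a..t} \<psi>" by (rule continuous_on_subset[OF \<psi>c]) (use t in auto)
  have cont': "joint_cont {a..t} w"
    by (rule continuous_on_subset[OF cont]) (use t in auto)
  define A where "A = {p \<in> {a..t} \<times> {0..2 * pi}. w (fst p) (snd p) \<le> \<psi> (fst p)}"
  have "closed A"
    unfolding A_def
    by (rule continuous_on_closed_Collect_le) (auto intro!: closed_Times continuous_on_compose2[OF \<psi>c'] jcont[OF cont'] continuous_intros)
  moreover have "A = ({a..t} \<times> {0..2 * pi}) \<inter> A" unfolding A_def by blast
  ultimately have "compact A" by (metis compact_Icc compact_Int_closed compact_Times)
  then have cA: "compact (fst ` A)" by (intro compact_continuous_image continuous_intros)
  have a: "a \<in> {a..c}" using t by auto
  obtain y where y: "y \<in> {0..2 * pi}" "w a y = w a x0"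
    using periodic_reduce[of "w a" x0] per[OF a] by auto
  have "(a, y) \<in> A" using init y t by (auto simp: A_def)
  then have aA: "a \<in> fst ` A" by force
  then obtain s where s: "s \<in> fst ` A" "\<And>r. r \<in> fst ` A \<Longrightarrow> r \<le> s"
    using compact_attains_sup[OF cA] by blast
  then obtain z where z: "(s, z) \<in> A" by auto
  have sat: "s \<in> {a..t}" using z by (auto simp: A_def)
  have "s \<noteq> t" using z neg by (auto simp: A_def)
  then have sa: "s \<in> {a..<t}" using sat by auto
  have sac: "s \<in> {a..c}" using sat t by auto
  have after: "\<psi> r < w r y" if r: "r \<in> {s<..t}" for r y
  proof (rule ccontr)
    assume neg': "\<not> \<psi> r < w r y"
    have r': "r \<in> {a..c}" using r sac t by auto
    obtain y' where "y' \<in> {0..2 * pi}" "w r y' = w r y"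
      using periodic_reduce[of "w r" y] per[OF r'] by auto
    then have "(r, y') \<in> A" using neg' r r' by (auto simp: A_def)
    then have "r \<le> s" using s(2)[of r] by force
    then show False using r by auto
  qed
  have le: "\<psi> s \<le> w s y" for y
  proof -
    have "continuous_on {a..c} (\<lambda>r. w r y - \<psi> r)"
      by (intro continuous_intros \<psi>c jcont[OF cont]) auto
    then have "((\<lambda>r. w r y - \<psi> r) \<longlongrightarrow> w s y - \<psi> s) (at s within {a..c})"
      using sac by (simp add: continuous_on_def)
    then have lim: "((\<lambda>r. w r y - \<psi> r) \<longlongrightarrow> w s y - \<psi> s) (at s within {s<..t})"
      by (rule tendsto_within_subset) (use sac t in auto)
    have "at s within {s<..t} \<noteq> bot" using sa by (simp add: at_within_eq_bot_iff)
    moreover have "\<forall>\<^sub>F r in at s within {s<..t}. 0 \<le> w r y - \<psi> r"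
      using after[of _ y] by (auto simp: eventually_at_filter less_imp_le)
    ultimately have "0 \<le> w s y - \<psi> s" using tendsto_lowerbound[OF lim] by blast
    then show ?thesis by simp
  qed
  have eq: "w s z = \<psi> s" using z le[of z] by (auto simp: A_def)
  have "s \<in> {a..<c}" using sa t by auto
  then obtain d where d: "((\<lambda>t. w t z) has_real_derivative d) (at s within {a..c})" "d < \<psi>' s"
    using touch[OF _ eq le] by blast
  have "((\<lambda>t. w t z - \<psi> t) has_real_derivative d - \<psi>' s) (at s within {a..c})"
    by (intro DERIV_diff d \<psi> sac)
  then obtain \<delta> where \<delta>: "\<delta> > 0" "\<And>h. h > 0 \<Longrightarrow> s + h \<in> {a..c} \<Longrightarrow> h < \<delta> \<Longrightarrow> w (s + h) z - \<psi> (s + h) < w s z - \<psi> s"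
    using has_real_derivative_neg_dec_right[of "\<lambda>t. w t z - \<psi> t" "d - \<psi>' s" s "{a..c}"] d(2) by auto
  define h where "h = min (\<delta> / 2) (t - s)"
  have h: "h > 0" "h < \<delta>" "s + h \<in> {s<..t}" using \<delta>(1) sa by (auto simp: h_def)
  then have "w (s + h) z - \<psi> (s + h) < w s z - \<psi> s" using sac t by (intro \<delta>(2)) auto
  then show False using after[OF h(3), of z] eq by simp
qed

text \<open>Uniform continuity on a compact set carries an inequality at \<open>h = 0\<close> over
  to all small \<open>h\<close> with an error \<open>e\<close> that is uniform in \<open>k\<close>.
  It transfers identities for derivatives to difference quotients.\<close>

lemma small_parameter:
  fixes R :: "real \<Rightarrow> 'a::metric_space \<Rightarrow> real"
  assumes K: "compact K" and cont: "continuous_on ({0..1} \<times> K) (\<lambda>(h, k). R h k)"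
    and R0: "\<And>k. k \<in> K \<Longrightarrow> R 0 k \<le> 0" and e: "e > 0"
  shows "\<exists>h0>0. h0 \<le> 1 \<and> (\<forall>h\<in>{0..h0}. \<forall>k\<in>K. R h k \<le> e)"
proof -
  have "uniformly_continuous_on ({0..1} \<times> K) (\<lambda>(h, k). R h k)"
    by (intro compact_uniformly_continuous cont compact_Times K) simp
  then obtain d where d: "d > 0" "\<And>p q. p \<in> {0..1} \<times> K \<Longrightarrow> q \<in> {0..1} \<times> K \<Longrightarrow> dist q p < d \<Longrightarrow>
      dist (case q of (h, k) \<Rightarrow> R h k) (case p of (h, k) \<Rightarrow> R h k) < e"
    using e unfolding uniformly_continuous_on_def by metis
  show ?thesis
  proof (intro exI[of _ "min 1 (d / 2)"] conjI ballI)
    fix h k assume h: "h \<in> {0..min 1 (d / 2)}" and k: "k \<in> K"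
    have "dist (h, k) (0, k) < d" using h d(1) by (simp add: dist_Pair_Pair)
    then have "dist (R h k) (R 0 k) < e" using d(2)[of "(0, k)" "(h, k)"] h k by auto
    then show "R h k \<le> e" using R0[OF k] by (simp add: dist_real_def)
  qed (use d(1) in auto)
qed

section \<open>Averages\<close>

text \<open>For \<open>h > 0\<close> the average of a derivative is a difference quotient. The averages depend
  continuously on \<open>h\<close> up to \<open>h = 0\<close> and, unlike \<open>u\<^sub>x\<close> itself, they are differentiable in time.\<close>

definition avg :: "real \<Rightarrow> (real \<Rightarrow> real) \<Rightarrow> real \<Rightarrow> real" where
  "avg h \<phi> x = integral {0..1} (\<lambda>\<theta>. \<phi> (x + \<theta> * h))"

lemma avg_0 [simp]: "avg 0 \<phi> x = \<phi> x"
  by (simp add: avg_def)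

lemma avg_diff_quotient:
  assumes "\<And>x. (w has_real_derivative w' x) (at x)" "h \<noteq> 0"
  shows "avg h w' x = (w (x + h) - w x) / h"
proof -
  have "((\<lambda>\<theta>. w' (x + \<theta> * h)) has_integral (w (x + 1 * h) / h - w (x + 0 * h) / h)) {0..1}"
  proof (rule fundamental_theorem_of_calculus)
    fix \<theta> :: real
    have "((\<lambda>\<theta>. w (x + \<theta> * h) / h) has_real_derivative w' (x + \<theta> * h)) (at \<theta> within {0..1})"
      using assms(2) by (auto intro!: derivative_eq_intros DERIV_chain2[OF assms(1)])
    then show "((\<lambda>\<theta>. w (x + \<theta> * h) / h) has_vector_derivative w' (x + \<theta> * h)) (at \<theta> within {0..1})"
      by (simp only: has_real_derivative_iff_has_vector_derivative)
  qed simp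
  then show ?thesis by (simp add: avg_def integral_unique diff_divide_distrib)
qed

text \<open>The spatial derivative of the average of \<open>w'\<close> is the difference quotient of
  \<open>w'\<close> itself, and it vanishes at an extremum. This removes the transport term from the
  evolution of the averages, without any second derivative.\<close>

lemma avg_extremum:
  assumes w: "\<And>x. (w has_real_derivative w' x) (at x)" and h: "h \<noteq> 0"
    and ext: "(\<forall>y. avg h w' y \<le> avg h w' x) \<or> (\<forall>y. avg h w' x \<le> avg h w' y)"
  shows "w' (x + h) = w' x"
proof -
  have *: "((\<lambda>x. avg h w' x) has_real_derivative (w' (x + h) - w' x) / h) (at x)"
    unfolding avg_diff_quotient[of w w', OF w h]
    using DERIV_shift[of w "w' (x + h)" x h] w[of "x + h"] by (intro DERIV_cdivide DERIV_diff w) simp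
  have "(w' (x + h) - w' x) / h = 0"
    using ext DERIV_local_max[OF *, of 1] DERIV_local_min[OF *, of 1] by auto
  then show ?thesis using h by simp
qed

lemma avg_cont:
  fixes \<phi> :: "real \<Rightarrow> real \<Rightarrow> real"
  assumes c: "joint_cont U \<phi>" and f: "continuous_on S f" and g: "continuous_on S g"
    and h: "continuous_on S h" and U: "\<And>s. s \<in> S \<Longrightarrow> f s \<in> U"
  shows "continuous_on S (\<lambda>s. avg (h s) (\<phi> (f s)) (g s))"
proof -
  have "continuous_on (S \<times> cbox 0 1) (\<lambda>p. \<phi> (f (fst p)) (g (fst p) + snd p * h (fst p)))"
    by (intro jcont[OF c] continuous_intros continuous_on_compose2[OF f] continuous_on_compose2[OF g]
        continuous_on_compose2[OF h]) (auto intro: U)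
  then have "continuous_on (S \<times> cbox 0 1) (\<lambda>(s, \<theta>). \<phi> (f s) (g s + \<theta> * h s))"
    by (simp add: case_prod_beta')
  from integral_continuous_on_param[OF this] show ?thesis by (simp add: avg_def)
qed

lemma avg_le:
  assumes "continuous_on UNIV \<phi>" "\<And>x. \<phi> x \<le> c"
  shows "avg h \<phi> x \<le> c"
proof -
  have "avg h \<phi> x \<le> integral {0..1::real} (\<lambda>_. c)"
    unfolding avg_def
  proof (rule integral_le)
    show "(\<lambda>\<theta>. \<phi> (x + \<theta> * h)) integrable_on {0..1}"
      by (intro integrable_continuous_real continuous_on_compose2[OF assms(1)] continuous_intros) auto
  qed (auto intro: assms)
  then show ?thesis by simp
qed

lemma avg_le_ex:
  assumes "continuous_on UNIV \<phi>" "avg h \<phi> x \<le> c"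
  shows "\<exists>y. \<phi> y \<le> c"
proof (rule ccontr)
  assume n: "\<nexists>y. \<phi> y \<le> c"
  have ct: "continuous_on {0..1} (\<lambda>\<theta>. \<phi> (x + \<theta> * h))"
    by (intro continuous_on_compose2[OF assms(1)] continuous_intros) auto
  obtain m where m: "m \<in> {0..1}" "\<And>\<theta>. \<theta> \<in> {0..1} \<Longrightarrow> \<phi> (x + m * h) \<le> \<phi> (x + \<theta> * h)"
    using continuous_attains_inf[OF compact_Icc _ ct] by auto
  have "integral {0..1::real} (\<lambda>_. \<phi> (x + m * h)) \<le> avg h \<phi> x"
    unfolding avg_def
  proof (rule integral_le)
    show "(\<lambda>\<theta>. \<phi> (x + \<theta> * h)) integrable_on {0..1}"
      by (rule integrable_continuous_real[OF ct])
  qed (auto intro: m(2))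
  then show False using n assms(2) by (simp add: not_le) (meson not_le order.trans)
qed

section \<open>The deterministic system with a time-dependent coefficient\<close>

text \<open>If \<open>u = \<beta> v\<close> and \<open>\<gamma> = \<beta> e\<close> with \<open>\<beta> = exp (c W - c\<^sup>2 t / 2)\<close>, then the pair \<open>(v, e)\<close> solves,
  path by path, the system below; \<open>vx\<close> and \<open>ex\<close> are the spatial derivatives and \<open>b\<close> bounds \<open>\<beta>\<close>.\<close>

locale torus_flow =
  fixes T b :: real and \<beta> :: "real \<Rightarrow> real" and v vx e ex :: "real \<Rightarrow> real \<Rightarrow> real"
  assumes T_pos: "0 < T"
    and \<beta>_cont: "continuous_on {0..T} \<beta>"
    and \<beta>_pos: "\<And>t. t \<in> {0..T} \<Longrightarrow> 0 < \<beta> t"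
    and \<beta>_le: "\<And>t. t \<in> {0..T} \<Longrightarrow> \<beta> t \<le> b"
    and v_deriv: "\<And>t x. t \<in> {0..T} \<Longrightarrow> (v t has_real_derivative vx t x) (at x)"
    and e_deriv: "\<And>t x. t \<in> {0..T} \<Longrightarrow> (e t has_real_derivative ex t x) (at x)"
    and v_per: "\<And>t x. t \<in> {0..T} \<Longrightarrow> v t (x + 2 * pi) = v t x"
    and vx_per: "\<And>t x. t \<in> {0..T} \<Longrightarrow> vx t (x + 2 * pi) = vx t x"
    and e_per: "\<And>t x. t \<in> {0..T} \<Longrightarrow> e t (x + 2 * pi) = e t x"
    and ex_per: "\<And>t x. t \<in> {0..T} \<Longrightarrow> ex t (x + 2 * pi) = ex t x"
    and v_cont: "joint_cont {0..T} v"
    and vx_cont: "joint_cont {0..T} vx"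
    and e_cont: "joint_cont {0..T} e"
    and ex_cont: "joint_cont {0..T} ex"
    and v_eq: "\<And>t x. t \<in> {0..T} \<Longrightarrow> ((\<lambda>t. v t x) has_real_derivative
      - \<beta> t * (v t x * vx t x +
        Gd (\<lambda>y. (v t y)\<^sup>2 + (vx t y)\<^sup>2 / 2 + (e t y)\<^sup>2 / 2 - (ex t y)\<^sup>2 / 2) x)) (at t within {0..T})"
    and e_eq: "\<And>t x. t \<in> {0..T} \<Longrightarrow> ((\<lambda>t. e t x) has_real_derivative
      - \<beta> t * (v t x * ex t x +
        (Gd (\<lambda>y. vx t y * ex t y) x + Gc (\<lambda>y. vx t y * e t y) x))) (at t within {0..T})"
begin

definition fP where "fP t y = (v t y)\<^sup>2 + (vx t y)\<^sup>2 / 2 + (e t y)\<^sup>2 / 2 - (ex t y)\<^sup>2 / 2"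
definition fa where "fa t y = vx t y * ex t y"
definition fb where "fb t y = vx t y * e t y"
definition Px where "Px t x = Gd (fP t) x"
text \<open>By \<open>Gd_deriv\<close> this is the derivative of \<open>Px\<close>. The form avoids
  differentiating \<open>fP\<close>, which is only continuous; the same holds for
  \<open>Qx\<close>.\<close>

definition Pxx where "Pxx t x = Gc (fP t) x - fP t x"
definition Q where "Q t x = Gd (fa t) x + Gc (fb t) x"
definition Qx where "Qx t x = Gc (fa t) x - fa t x + Gd (fb t) x"

lemmas cts0 = jcont[OF v_cont] jcont[OF vx_cont] jcont[OF e_cont] jcont[OF ex_cont]

lemma joint: "joint_cont {0..T} fP"
  "joint_cont {0..T} fa"
  "joint_cont {0..T} fb"
  unfolding fP_def fa_def fb_def case_prod_beta'
  by (intro continuous_intros cts0; auto)+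

lemma joint':
  "joint_cont {0..T} Px"
  "joint_cont {0..T} Pxx"
  "joint_cont {0..T} Q"
  "joint_cont {0..T} Qx"
  unfolding Px_def Pxx_def Q_def Qx_def
  using joint joint[THEN Gc_joint_cont(1)] joint[THEN Gc_joint_cont(2)]
  by (auto simp: case_prod_beta' intro!: continuous_intros)

lemmas cts = cts0 jcont[OF joint'(1)] jcont[OF joint'(2)] jcont[OF joint'(3)] jcont[OF joint'(4)]
  avg_cont[OF vx_cont] avg_cont[OF ex_cont] avg_cont[OF joint'(2)] avg_cont[OF joint'(4)]
  continuous_on_compose2[OF \<beta>_cont]

context
  fixes t assumes t: "t \<in> {0..T}"
begin

lemma slice_cont: "continuous_on S (v t)" "continuous_on S (vx t)" "continuous_on S (e t)" "continuous_on S (ex t)"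
  "continuous_on S (fP t)" "continuous_on S (fa t)" "continuous_on S (fb t)"
  "continuous_on S (Px t)" "continuous_on S (Pxx t)" "continuous_on S (Q t)" "continuous_on S (Qx t)"
  using t by (intro cts jcont[OF joint(1)] jcont[OF joint(2)] jcont[OF joint(3)] continuous_intros; simp)+

lemma slice_per: "fP t (x + 2 * pi) = fP t x" "fa t (x + 2 * pi) = fa t x" "fb t (x + 2 * pi) = fb t x"
  by (simp_all add: fP_def fa_def fb_def v_per[OF t] vx_per[OF t] e_per[OF t] ex_per[OF t])

lemma slice_per': "Px t (x + 2 * pi) = Px t x" "Pxx t (x + 2 * pi) = Pxx t x"
  "Q t (x + 2 * pi) = Q t x" "Qx t (x + 2 * pi) = Qx t x"
  unfolding Px_def Pxx_def Q_def Qx_def slice_per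
  using Gc_periodic[OF slice_cont(5) slice_per(1)] Gd_periodic[OF slice_cont(5) slice_per(1)]
    Gc_periodic[OF slice_cont(6) slice_per(2)] Gd_periodic[OF slice_cont(6) slice_per(2)]
    Gc_periodic[OF slice_cont(7) slice_per(3)] Gd_periodic[OF slice_cont(7) slice_per(3)]
  by simp_all

lemma avg_per: "avg h (vx t) (x + 2 * pi) = avg h (vx t) x" "avg h (ex t) (x + 2 * pi) = avg h (ex t) x"
  "avg h (Pxx t) (x + 2 * pi) = avg h (Pxx t) x" "avg h (Qx t) (x + 2 * pi) = avg h (Qx t) x"
proof -
  have "x + 2 * pi + \<theta> * h = x + \<theta> * h + 2 * pi" for \<theta> by simp
  then show "avg h (vx t) (x + 2 * pi) = avg h (vx t) x" "avg h (ex t) (x + 2 * pi) = avg h (ex t) x"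
    "avg h (Pxx t) (x + 2 * pi) = avg h (Pxx t) x" "avg h (Qx t) (x + 2 * pi) = avg h (Qx t) x"
    by (simp_all only: avg_def vx_per[OF t] ex_per[OF t] slice_per')
qed

lemma Px_deriv: "(Px t has_real_derivative Pxx t x) (at x)"
  unfolding Px_def Pxx_def by (rule Gd_deriv[OF slice_cont(5) slice_per(1)])

lemma Q_deriv: "(Q t has_real_derivative Qx t x) (at x)"
  unfolding Q_def Qx_def
  by (intro DERIV_add Gd_deriv[OF slice_cont(6) slice_per(2)] Gc_deriv[OF slice_cont(7) slice_per(3)])

lemma v_eq': "((\<lambda>t. v t x) has_real_derivative - \<beta> t * (v t x * vx t x + Px t x)) (at t within {0..T})"
  using v_eq[OF t] by (simp add: Px_def fP_def[abs_def])

lemma e_eq': "((\<lambda>t. e t x) has_real_derivative - \<beta> t * (v t x * ex t x + Q t x)) (at t within {0..T})"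
  using e_eq[OF t] by (simp add: Q_def fa_def[abs_def] fb_def[abs_def])

lemma avg_v: "h \<noteq> 0 \<Longrightarrow> avg h (vx t) x = (v t (x + h) - v t x) / h"
  and avg_e: "h \<noteq> 0 \<Longrightarrow> avg h (ex t) x = (e t (x + h) - e t x) / h"
  and avg_P: "h \<noteq> 0 \<Longrightarrow> avg h (Pxx t) x = (Px t (x + h) - Px t x) / h"
  and avg_Q: "h \<noteq> 0 \<Longrightarrow> avg h (Qx t) x = (Q t (x + h) - Q t x) / h"
  by (intro avg_diff_quotient v_deriv[OF t] e_deriv[OF t] Px_deriv Q_deriv; assumption)+

end

text \<open>For \<open>h \<noteq> 0\<close> the average is a difference quotient of
  \<open>v\<close>, so the equation for \<open>v\<close> suffices. The difference of the products
  \<open>v * vx\<close> is grouped so that the transport term carries the quotient of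
  \<open>vx\<close>, which vanishes at extrema of the average.\<close>

lemma avg_v_time:
  assumes t: "t \<in> {0..T}" and h: "h \<noteq> 0"
  shows "((\<lambda>t. avg h (vx t) x) has_real_derivative
    - \<beta> t * (v t (x + h) * ((vx t (x + h) - vx t x) / h) + avg h (vx t) x * vx t x + avg h (Pxx t) x)) (at t within {0..T})"
proof -
  have "((\<lambda>t. (v t (x + h) - v t x) / h) has_real_derivative
    (- \<beta> t * (v t (x + h) * vx t (x + h) + Px t (x + h)) - - \<beta> t * (v t x * vx t x + Px t x)) / h) (at t within {0..T})"
    by (intro DERIV_cdivide DERIV_diff v_eq'[OF t])
  also have "(- \<beta> t * (v t (x + h) * vx t (x + h) + Px t (x + h)) - - \<beta> t * (v t x * vx t x + Px t x)) / h =
    - \<beta> t * (v t (x + h) * ((vx t (x + h) - vx t x) / h) + avg h (vx t) x * vx t x + avg h (Pxx t) x)"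
    unfolding avg_v[OF t h] avg_P[OF t h] using h by (simp add: field_simps)
  finally show ?thesis
    by (rule has_field_derivative_transform_within[where d=1]) (use t in \<open>auto simp: avg_v[OF _ h]\<close>)
qed

lemma avg_e_time:
  assumes t: "t \<in> {0..T}" and h: "h \<noteq> 0"
  shows "((\<lambda>t. avg h (ex t) x) has_real_derivative
    - \<beta> t * (v t (x + h) * ((ex t (x + h) - ex t x) / h) + avg h (vx t) x * ex t x + avg h (Qx t) x)) (at t within {0..T})"
proof -
  have "((\<lambda>t. (e t (x + h) - e t x) / h) has_real_derivative
    (- \<beta> t * (v t (x + h) * ex t (x + h) + Q t (x + h)) - - \<beta> t * (v t x * ex t x + Q t x)) / h) (at t within {0..T})"
    by (intro DERIV_cdivide DERIV_diff e_eq'[OF t])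
  also have "(- \<beta> t * (v t (x + h) * ex t (x + h) + Q t (x + h)) - - \<beta> t * (v t x * ex t x + Q t x)) / h =
    - \<beta> t * (v t (x + h) * ((ex t (x + h) - ex t x) / h) + avg h (vx t) x * ex t x + avg h (Qx t) x)"
    unfolding avg_v[OF t h] avg_Q[OF t h] using h by (simp add: field_simps)
  finally show ?thesis
    by (rule has_field_derivative_transform_within[where d=1]) (use t in \<open>auto simp: avg_e[OF _ h]\<close>)
qed

subsection \<open>Conservation of energy\<close>

definition energy where
  "energy t = integral {0..2 * pi} (\<lambda>y. (v t y)\<^sup>2 + (vx t y)\<^sup>2) + integral {0..2 * pi} (\<lambda>y. (e t y)\<^sup>2 + (ex t y)\<^sup>2)"

definition energyh where
  "energyh h t = integral {0..2 * pi} (\<lambda>x. (v t x)\<^sup>2 + (avg h (vx t) x)\<^sup>2 + (e t x)\<^sup>2 + (avg h (ex t) x)\<^sup>2)"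

text \<open>The integrand of the time derivative of \<open>energyh h\<close>, without the factor
  \<open>- \<beta> t\<close>, after the transport terms have been integrated by parts; this produces
  the terms with \<open>- vx t (x + h)\<close>. No division by \<open>h\<close> is left, so the
  expression is continuous down to \<open>h = 0\<close>.\<close>

definition defect where
  "defect h t x = 2 * v t x * (v t x * vx t x + Px t x) - vx t (x + h) * (avg h (vx t) x)\<^sup>2
     + 2 * avg h (vx t) x * (avg h (vx t) x * vx t x + avg h (Pxx t) x)
     + 2 * e t x * (v t x * ex t x + Q t x) - vx t (x + h) * (avg h (ex t) x)\<^sup>2
     + 2 * avg h (ex t) x * (avg h (vx t) x * ex t x + avg h (Qx t) x)"

lemma energyh_0: "t \<in> {0..T} \<Longrightarrow> energyh 0 t = energy t"
  unfolding energyh_def energy_def avg_0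
  by (subst Henstock_Kurzweil_Integration.integral_add[symmetric])
     (auto intro!: integrable_continuous_real continuous_intros slice_cont simp: add.assoc)

text \<open>Without averaging, the integrand is the derivative of a periodic flux, which is the
  local conservation law of the energy.\<close>

lemma defect_0:
  assumes t: "t \<in> {0..T}"
  shows "integral {0..2 * pi} (defect 0 t) = 0"
proof -
  note G = Gc_deriv[OF slice_cont(5)[OF t] slice_per(1)[OF t]] Gc_deriv[OF slice_cont(6)[OF t] slice_per(2)[OF t]]
    Gd_deriv[OF slice_cont(7)[OF t] slice_per(3)[OF t]]
  note P = Gc_periodic[OF slice_cont(5)[OF t] slice_per(1)[OF t]] Gc_periodic[OF slice_cont(6)[OF t] slice_per(2)[OF t]]
    Gd_periodic[OF slice_cont(7)[OF t] slice_per(3)[OF t]]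
  \<comment> \<open>The flux. Its first three terms pair \<open>v\<close> and \<open>e\<close> with
    their nonlocal potentials; the last one compensates the cubic terms in \<open>e\<close> that
    come from \<open>fP\<close> and \<open>fb\<close>.\<close>
  define F where "F x = 2 * (v t x * Gc (fP t) x) + 2 * (e t x * Gc (fa t) x) + 2 * (e t x * Gd (fb t) x) + v t x * (e t x)\<^sup>2" for x
  have "(F has_real_derivative defect 0 t x) (at x)" for x
  proof -
    have "(F has_real_derivative
       2 * (vx t x * Gc (fP t) x + Gd (fP t) x * v t x) + 2 * (ex t x * Gc (fa t) x + Gd (fa t) x * e t x)
       + 2 * (ex t x * Gd (fb t) x + (Gc (fb t) x - fb t x) * e t x)
       + (vx t x * (e t x)\<^sup>2 + (2 * e t x * ex t x) * v t x)) (at x)"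
      unfolding F_def
      by (intro DERIV_add DERIV_mult DERIV_cmult G v_deriv[OF t] e_deriv[OF t])
         (auto intro!: derivative_eq_intros e_deriv[OF t])
    also have "2 * (vx t x * Gc (fP t) x + Gd (fP t) x * v t x) + 2 * (ex t x * Gc (fa t) x + Gd (fa t) x * e t x)
       + 2 * (ex t x * Gd (fb t) x + (Gc (fb t) x - fb t x) * e t x)
       + (vx t x * (e t x)\<^sup>2 + (2 * e t x * ex t x) * v t x) = defect 0 t x"
      unfolding defect_def avg_0 Px_def Pxx_def Q_def Qx_def
      by (simp add: fP_def[of t x] fa_def[of t x] fb_def[of t x] power2_eq_square field_simps)
    finally show ?thesis .
  qed
  moreover have "F (x + 2 * pi) = F x" for x
    by (simp add: F_def P v_per[OF t] e_per[OF t])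
  ultimately show ?thesis by (intro integral_unique integral_deriv_period)
qed

lemma energyh_deriv:
  assumes t: "t \<in> {0..T}" and h: "h \<noteq> 0"
  shows "(energyh h has_real_derivative - \<beta> t * integral {0..2 * pi} (defect h t)) (at t within {0..T})"
proof -
  define D where "D t x = 2 * v t x * (- \<beta> t * (v t x * vx t x + Px t x))
     + 2 * avg h (vx t) x * (- \<beta> t * (v t (x + h) * ((vx t (x + h) - vx t x) / h) + avg h (vx t) x * vx t x + avg h (Pxx t) x))
     + 2 * e t x * (- \<beta> t * (v t x * ex t x + Q t x))
     + 2 * avg h (ex t) x * (- \<beta> t * (v t (x + h) * ((ex t (x + h) - ex t x) / h) + avg h (vx t) x * ex t x + avg h (Qx t) x))" for t x
  have "((\<lambda>t. integral (cbox 0 (2 * pi)) (\<lambda>x. (v t x)\<^sup>2 + (avg h (vx t) x)\<^sup>2 + (e t x)\<^sup>2 + (avg h (ex t) x)\<^sup>2))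
      has_real_derivative integral (cbox 0 (2 * pi)) (D t)) (at t within {0..T})"
  proof (rule leibniz_rule_field_derivative[OF _ _ _ t])
    fix t x assume t: "t \<in> {0..T}"
    show "((\<lambda>t. (v t x)\<^sup>2 + (avg h (vx t) x)\<^sup>2 + (e t x)\<^sup>2 + (avg h (ex t) x)\<^sup>2) has_real_derivative D t x) (at t within {0..T})"
      unfolding D_def
      by (intro DERIV_add) (rule DERIV_power[THEN DERIV_cong], (rule v_eq'[OF t] avg_v_time[OF t h] e_eq'[OF t] avg_e_time[OF t h]), simp)+
  next
    fix t assume t: "t \<in> {0..T}"
    show "(\<lambda>x. (v t x)\<^sup>2 + (avg h (vx t) x)\<^sup>2 + (e t x)\<^sup>2 + (avg h (ex t) x)\<^sup>2) integrable_on cbox 0 (2 * pi)"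
      unfolding cbox_interval using t by (intro integrable_continuous_real continuous_intros cts) auto
  next
    show "continuous_on ({0..T} \<times> cbox 0 (2 * pi)) (\<lambda>(t, x). D t x)"
      unfolding D_def case_prod_beta' using h by (intro continuous_intros cts) auto
  qed simp
  moreover have "integral {0..2 * pi} (D t) = - \<beta> t * integral {0..2 * pi} (defect h t)"
  proof -
    let ?w = "\<lambda>x. avg h (vx t) x" and ?z = "\<lambda>x. avg h (ex t) x"
    \<comment> \<open>The derivative of this periodic function contains precisely the two terms
      divided by \<open>h\<close>, so these can be exchanged under the integral for terms with
      \<open>vx t (x + h)\<close>.\<close>
    define F where "F x = v t (x + h) * ((?w x)\<^sup>2 + (?z x)\<^sup>2)" for x
    define F' where "F' x = vx t (x + h) * ((?w x)\<^sup>2 + (?z x)\<^sup>2) + (2 * ?w x * ((vx t (x + h) - vx t x) / h) + 2 * ?z x * ((ex t (x + h) - ex t x) / h)) * v t (x + h)" for x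
    have dv: "((\<lambda>x. v t (x + h)) has_real_derivative vx t (x + h)) (at x)"
      and de: "((\<lambda>x. e t (x + h)) has_real_derivative ex t (x + h)) (at x)" for x
      using DERIV_shift[of "v t" "vx t (x + h)" x h] DERIV_shift[of "e t" "ex t (x + h)" x h]
        v_deriv[OF t, of "x + h"] e_deriv[OF t, of "x + h"] by auto
    have dw: "(?w has_real_derivative (vx t (x + h) - vx t x) / h) (at x)"
      and dz: "(?z has_real_derivative (ex t (x + h) - ex t x) / h) (at x)" for x
      unfolding avg_v[OF t h] avg_e[OF t h] by (intro DERIV_cdivide DERIV_diff dv de v_deriv[OF t] e_deriv[OF t])+
    have "(F has_real_derivative F' x) (at x)" for x
      unfolding F_def F'_def
      by (intro DERIV_mult DERIV_add dv)
         (rule DERIV_power[THEN DERIV_cong], (rule dw dz), simp)+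
    moreover have "F (x + 2 * pi) = F x" for x
    proof -
      have "v t (x + 2 * pi + h) = v t (x + h)" using v_per[OF t, of "x + h"] by (simp add: algebra_simps)
      then show ?thesis by (simp add: F_def avg_per[OF t])
    qed
    ultimately have F0: "(F' has_integral 0) {0..2 * pi}" by (rule integral_deriv_period)
    have di: "defect h t integrable_on {0..2 * pi}"
      unfolding defect_def[abs_def] using t by (intro integrable_continuous_real continuous_intros cts) auto
    have eq: "D t x = - \<beta> t * defect h t x + - \<beta> t * F' x" for x
      unfolding D_def defect_def F'_def by (simp add: power2_eq_square algebra_simps add_divide_distrib diff_divide_distrib)
    have "((\<lambda>x. - \<beta> t * defect h t x + - \<beta> t * F' x) has_integral (- \<beta> t * integral {0..2 * pi} (defect h t) + - \<beta> t * 0)) {0..2 * pi}"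
      by (intro has_integral_add has_integral_mult_right integrable_integral[OF di] F0)
    then show ?thesis unfolding eq by (simp add: integral_unique)
  qed
  ultimately show ?thesis by (simp add: energyh_def[abs_def])
qed

text \<open>The energy itself cannot be differentiated in time, but its averaged version can, and
  its rate tends to zero uniformly in time as \<open>h\<close> tends to zero by
  \<open>defect_0\<close>.\<close>

lemma energy_le:
  assumes t: "t \<in> {0..T}"
  shows "energy t \<le> energy 0"
proof (rule field_le_epsilon)
  fix \<epsilon> :: real assume \<epsilon>: "\<epsilon> > 0"
  \<comment> \<open>The total error is \<open>\<eta> * T\<close> for the drift of the averaged
    energy plus \<open>\<eta>\<close> at each of the two times for the passage between the two
    energies.\<close>
  define \<eta> where "\<eta> = \<epsilon> / (T + 2)"
  have \<eta>: "\<eta> > 0" using \<epsilon> T_pos by (simp add: \<eta>_def)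
  have c1: "continuous_on ({0..1} \<times> {0..T}) (\<lambda>(h, t). \<bar>\<beta> t * integral {0..2 * pi} (defect h t)\<bar>)"
  proof -
    have "continuous_on (({0..1} \<times> {0..T}) \<times> cbox 0 (2 * pi)) (\<lambda>(p, x). defect (fst p) (snd p) x)"
      unfolding defect_def case_prod_beta' by (intro continuous_intros cts) auto
    from integral_continuous_on_param[OF this] show ?thesis
      unfolding case_prod_beta' by (intro continuous_intros cts) auto
  qed
  obtain h1 where h1: "h1 > 0" "h1 \<le> 1" "\<And>h t. h \<in> {0..h1} \<Longrightarrow> t \<in> {0..T} \<Longrightarrow> \<bar>\<beta> t * integral {0..2 * pi} (defect h t)\<bar> \<le> \<eta>"
    using small_parameter[OF compact_Icc c1 _ \<eta>] defect_0 by auto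
  have c2: "continuous_on ({0..1} \<times> {0..T}) (\<lambda>(h, t). \<bar>energyh h t - energyh 0 t\<bar>)"
  proof -
    have "continuous_on (({0..1} \<times> {0..T}) \<times> cbox 0 (2 * pi)) (\<lambda>(p, x). (v (snd p) x)\<^sup>2 + (avg (fst p) (vx (snd p)) x)\<^sup>2 + (e (snd p) x)\<^sup>2 + (avg (fst p) (ex (snd p)) x)\<^sup>2)"
      "continuous_on (({0..1::real} \<times> {0..T}) \<times> cbox 0 (2 * pi)) (\<lambda>(p, x). (v (snd p) x)\<^sup>2 + (avg 0 (vx (snd p)) x)\<^sup>2 + (e (snd p) x)\<^sup>2 + (avg 0 (ex (snd p)) x)\<^sup>2)"
      unfolding case_prod_beta' by (intro continuous_intros cts; auto)+
    from this[THEN integral_continuous_on_param] show ?thesis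
      unfolding case_prod_beta' energyh_def by (intro continuous_intros) auto
  qed
  obtain h2 where h2: "h2 > 0" "h2 \<le> 1" "\<And>h t. h \<in> {0..h2} \<Longrightarrow> t \<in> {0..T} \<Longrightarrow> \<bar>energyh h t - energyh 0 t\<bar> \<le> \<eta>"
    using small_parameter[OF compact_Icc c2 _ \<eta>] by auto
  define h where "h = min h1 h2"
  have h: "h > 0" "h \<in> {0..h1}" "h \<in> {0..h2}" using h1 h2 by (auto simp: h_def)
  have "norm (energyh h t - energyh h 0) \<le> \<eta> * norm (t - 0)"
  proof (rule field_differentiable_bound[of "{0..T}"])
    fix s assume s: "s \<in> {0..T}"
    show "(energyh h has_field_derivative - \<beta> s * integral {0..2 * pi} (defect h s)) (at s within {0..T})"
      using energyh_deriv[OF s] h by simp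
    show "norm (- \<beta> s * integral {0..2 * pi} (defect h s)) \<le> \<eta>" using h1(3)[OF h(2) s] by simp
  qed (use t in auto)
  also have "\<dots> \<le> \<eta> * T" using t \<eta> by (intro mult_left_mono) auto
  finally have "\<bar>energyh h t - energyh h 0\<bar> \<le> \<eta> * T" by simp
  then have "energy t - energy 0 \<le> \<eta> * T + 2 * \<eta>"
    using h2(3)[OF h(3) t] h2(3)[OF h(3), of 0] T_pos t by (simp add: energyh_0)
  also have "\<dots> = \<eta> * (T + 2)" by (simp add: algebra_simps)
  also have "\<dots> = \<epsilon>" using T_pos by (simp add: \<eta>_def)
  finally show "energy t \<le> energy 0 + \<epsilon>" by simp
qed

end

lemma Gc_add:
  assumes "continuous_on UNIV f" "continuous_on UNIV g"
  shows "Gc (\<lambda>y. f y + g y) x = Gc f x + Gc g x"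
  unfolding Gc_def distrib_left
  by (rule Henstock_Kurzweil_Integration.integral_add)
     (intro integrable_continuous_real continuous_intros continuous_on_compose2[OF assms(1)] continuous_on_compose2[OF assms(2)]; simp)+

section \<open>Pointwise bounds along the flow and the evolution of extremal slopes\<close>

context torus_flow
begin

lemma energy_nonneg:
  assumes t: "t \<in> {0..T}"
  shows "0 \<le> integral {0..2 * pi} (\<lambda>y. (v t y)\<^sup>2 + (vx t y)\<^sup>2)" "0 \<le> integral {0..2 * pi} (\<lambda>y. (e t y)\<^sup>2 + (ex t y)\<^sup>2)"
  by (intro Henstock_Kurzweil_Integration.integral_nonneg integrable_continuous_real continuous_intros slice_cont t; simp)+

lemma sup_v: "t \<in> {0..T} \<Longrightarrow> (v t x)\<^sup>2 \<le> 2 * energy 0"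
  and sup_e: "t \<in> {0..T} \<Longrightarrow> (e t x)\<^sup>2 \<le> 2 * energy 0"
  using sup_bound[OF v_deriv slice_cont(2) v_per vx_per, of t x] sup_bound[OF e_deriv slice_cont(4) e_per ex_per, of t x]
    energy_nonneg[of t] energy_le[of t] unfolding energy_def[of t] by linarith+

text \<open>\<open>square_bound_1\<close> for \<open>v\<close> and \<open>square_bound_2\<close> for
  \<open>e\<close> each cost half an energy, and \<open>- (ex t x)\<^sup>2 / 2\<close> has the good
  sign. With the \<open>- vx\<^sup>2\<close> of the transport term this leaves
  \<open>- vx\<^sup>2 / 2\<close> and half the energy, the Riccati inequality.\<close>

lemma fP_bound:
  assumes t: "t \<in> {0..T}"
  shows "fP t x - Gc (fP t) x \<le> (vx t x)\<^sup>2 / 2 + energy 0 / 2"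
proof -
  have "Gc (fP t) x = Gc (\<lambda>y. ((v t y)\<^sup>2 + (vx t y)\<^sup>2 / 2) + ((e t y)\<^sup>2 / 2 - (ex t y)\<^sup>2 / 2)) x"
    by (simp add: fP_def[abs_def] add_diff_eq)
  also have "\<dots> = Gc (\<lambda>y. (v t y)\<^sup>2 + (vx t y)\<^sup>2 / 2) x + Gc (\<lambda>y. (e t y)\<^sup>2 / 2 - (ex t y)\<^sup>2 / 2) x"
    by (rule Gc_add) (intro continuous_intros slice_cont t; simp)+
  finally have "Gc (fP t) x = Gc (\<lambda>y. (v t y)\<^sup>2 + (vx t y)\<^sup>2 / 2) x + Gc (\<lambda>y. (e t y)\<^sup>2 / 2 - (ex t y)\<^sup>2 / 2) x" .
  moreover note square_bound_1[OF v_deriv slice_cont(2) v_per vx_per, OF t t t t, of x]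
    square_bound_2[OF e_deriv slice_cont(4) e_per ex_per, OF t t t t, of x] energy_le[OF t]
  moreover have "0 \<le> (ex t x)\<^sup>2" by simp
  ultimately show ?thesis unfolding energy_def[of t] fP_def[of t x] by linarith
qed

text \<open>Where \<open>vx t (x + h) = vx t x\<close> the transport term is zero. The other terms
  satisfy the Riccati inequality at \<open>h = 0\<close> by \<open>fP_bound\<close>, and
  \<open>small_parameter\<close> extends it to small \<open>h\<close> at the price
  \<open>\<epsilon>\<close>.\<close>

lemma touch_v:
  assumes \<epsilon>: "\<epsilon> > 0"
  shows "\<exists>h0>0. \<forall>h\<in>{0<..h0}. \<forall>t\<in>{0..T}. \<forall>x. vx t (x + h) = vx t x \<longrightarrow>
    (\<exists>d. ((\<lambda>t. avg h (vx t) x) has_real_derivative d) (at t within {0..T}) \<and>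
      d \<le> - \<beta> t * (avg h (vx t) x)\<^sup>2 / 2 + \<beta> t * energy 0 / 2 + \<epsilon>)"
proof -
  define R where "R h k = (case k of (t, x) \<Rightarrow> - \<beta> t * (avg h (vx t) x * vx t x + avg h (Pxx t) x) + \<beta> t * (avg h (vx t) x)\<^sup>2 / 2 - \<beta> t * energy 0 / 2)" for h k
  have c: "continuous_on ({0..1} \<times> {0..T} \<times> {0..2 * pi}) (\<lambda>(h, k). R h k)"
    unfolding R_def case_prod_beta' by (intro continuous_intros cts) auto
  have R0: "R 0 k \<le> 0" if "k \<in> {0..T} \<times> {0..2 * pi}" for k
  proof -
    obtain t x where k: "k = (t, x)" "t \<in> {0..T}" using \<open>k \<in> _\<close> by auto
    have "R 0 k = \<beta> t * (fP t x - Gc (fP t) x - (vx t x)\<^sup>2 / 2 - energy 0 / 2)"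
      by (simp add: R_def k Pxx_def algebra_simps power2_eq_square)
    also have "\<dots> \<le> 0"
      using fP_bound[OF k(2), of x] \<beta>_pos[OF k(2)] by (intro mult_nonneg_nonpos) auto
    finally show ?thesis .
  qed
  obtain h0 where h0: "h0 > 0" "\<And>h k. h \<in> {0..h0} \<Longrightarrow> k \<in> {0..T} \<times> {0..2 * pi} \<Longrightarrow> R h k \<le> \<epsilon>"
    using small_parameter[OF compact_Times[OF compact_Icc compact_Icc] c R0 \<epsilon>] by auto
  show ?thesis
  proof (rule exI[of _ h0], intro conjI ballI allI impI)
    show "h0 > 0" by fact
    fix h t x assume h: "h \<in> {0<..h0}" and t: "t \<in> {0..T}" and eq: "vx t (x + h) = vx t x"
    have "R h (t, x + 2 * pi) = R h (t, x)" for x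
      by (simp add: R_def avg_per[OF t] vx_per[OF t])
    then obtain y where y: "y \<in> {0..2 * pi}" "R h (t, y) = R h (t, x)"
      using periodic_reduce[of "\<lambda>x. R h (t, x)" x] by metis
    have "R h (t, x) \<le> \<epsilon>" using h0(2)[of h "(t, y)"] h t y by auto
    then show "\<exists>d. ((\<lambda>t. avg h (vx t) x) has_real_derivative d) (at t within {0..T}) \<and>
      d \<le> - \<beta> t * (avg h (vx t) x)\<^sup>2 / 2 + \<beta> t * energy 0 / 2 + \<epsilon>"
      using avg_v_time[OF t, of h x] h eq by (intro exI conjI) (auto simp: R_def)
  qed
qed

text \<open>In contrast to \<open>vx\<close>, the slope \<open>ex\<close> has no local quadratic
  source: at \<open>h = 0\<close> the product \<open>vx * ex\<close> from transport cancels against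
  \<open>- fa\<close> in \<open>Qx\<close>. Only nonlocal terms remain, and these are bounded by the
  energy.\<close>

lemma touch_e:
  assumes \<epsilon>: "\<epsilon> > 0"
  shows "\<exists>h0>0. \<forall>h\<in>{0<..h0}. \<forall>t\<in>{0..T}. \<forall>x. ex t (x + h) = ex t x \<longrightarrow>
    (\<exists>d. ((\<lambda>t. avg h (ex t) x) has_real_derivative d) (at t within {0..T}) \<and> \<bar>d\<bar> \<le> b * energy 0 + \<epsilon>)"
proof -
  define R where "R h k = (case k of (t, x) \<Rightarrow> \<bar>- \<beta> t * (avg h (vx t) x * ex t x + avg h (Qx t) x)\<bar> - b * energy 0)" for h k
  have c: "continuous_on ({0..1} \<times> {0..T} \<times> {0..2 * pi}) (\<lambda>(h, k). R h k)"
    unfolding R_def case_prod_beta' by (intro continuous_intros cts) auto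
  have R0: "R 0 k \<le> 0" if "k \<in> {0..T} \<times> {0..2 * pi}" for k
  proof -
    obtain t x where k: "k = (t, x)" and t: "t \<in> {0..T}" using \<open>k \<in> _\<close> by auto
    have a: "\<bar>Gc (fa t) x\<bar> \<le> 3 / 4 * integral {0..2 * pi} (\<lambda>y. \<bar>fa t y\<bar>)"
      by (rule Gc_abs_bound[OF slice_cont(6)[OF t] slice_per(2)[OF t]])
    have b: "\<bar>Gd (fb t) x\<bar> \<le> 1 / 2 * integral {0..2 * pi} (\<lambda>y. \<bar>fb t y\<bar>)"
      by (rule Gd_abs_bound[OF slice_cont(7)[OF t] slice_per(3)[OF t]])
    have ab: "\<bar>p * q\<bar> \<le> 1 / 2 * p\<^sup>2 + 1 / 2 * q\<^sup>2" for p q :: real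
      using zero_le_power2[of "\<bar>p\<bar> - \<bar>q\<bar>"] by (simp add: power2_diff abs_mult)
    have "integral {0..2 * pi} (\<lambda>y. \<bar>fa t y\<bar>) + integral {0..2 * pi} (\<lambda>y. \<bar>fb t y\<bar>) \<le>
       integral {0..2 * pi} (\<lambda>y. 1 / 2 * (vx t y)\<^sup>2 + 1 / 2 * (ex t y)\<^sup>2) + integral {0..2 * pi} (\<lambda>y. 1 / 2 * (vx t y)\<^sup>2 + 1 / 2 * (e t y)\<^sup>2)"
      unfolding fa_def fb_def
      by (intro add_mono integral_le integrable_continuous_real continuous_intros slice_cont t ab)
    also have "\<dots> = integral {0..2 * pi} (\<lambda>y. (vx t y)\<^sup>2 + 1 / 2 * ((e t y)\<^sup>2 + (ex t y)\<^sup>2))"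
      by (subst Henstock_Kurzweil_Integration.integral_add[symmetric])
         (auto intro!: integrable_continuous_real continuous_intros slice_cont t arg_cong2[where f=integral] simp: algebra_simps)
    also have "\<dots> \<le> integral {0..2 * pi} (\<lambda>y. ((v t y)\<^sup>2 + (vx t y)\<^sup>2) + ((e t y)\<^sup>2 + (ex t y)\<^sup>2))"
      by (intro integral_le integrable_continuous_real continuous_intros slice_cont t) auto
    also have "\<dots> = energy t"
      unfolding energy_def
      by (subst Henstock_Kurzweil_Integration.integral_add)
         (auto intro!: integrable_continuous_real continuous_intros slice_cont t)
    also have "\<dots> \<le> energy 0" by (rule energy_le[OF t])
    finally have "integral {0..2 * pi} (\<lambda>y. \<bar>fa t y\<bar>) + integral {0..2 * pi} (\<lambda>y. \<bar>fb t y\<bar>) \<le> energy 0" .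
    moreover have "0 \<le> integral {0..2 * pi} (\<lambda>y. \<bar>fa t y\<bar>)" "0 \<le> integral {0..2 * pi} (\<lambda>y. \<bar>fb t y\<bar>)"
      by (intro Henstock_Kurzweil_Integration.integral_nonneg integrable_continuous_real continuous_intros slice_cont t; simp)+
    ultimately have g: "\<bar>Gc (fa t) x + Gd (fb t) x\<bar> \<le> energy 0" using a b by linarith
    have "\<bar>- \<beta> t * (avg 0 (vx t) x * ex t x + avg 0 (Qx t) x)\<bar> = \<beta> t * \<bar>Gc (fa t) x + Gd (fb t) x\<bar>"
      using \<beta>_pos[OF t] by (simp add: Qx_def fa_def[of t x] abs_mult)
    also have "\<dots> \<le> b * energy 0"
      using \<beta>_pos[OF t] \<beta>_le[OF t] g by (intro mult_mono) auto
    finally show ?thesis by (simp add: R_def k)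
  qed
  obtain h0 where h0: "h0 > 0" "\<And>h k. h \<in> {0..h0} \<Longrightarrow> k \<in> {0..T} \<times> {0..2 * pi} \<Longrightarrow> R h k \<le> \<epsilon>"
    using small_parameter[OF compact_Times[OF compact_Icc compact_Icc] c R0 \<epsilon>] by auto
  show ?thesis
  proof (rule exI[of _ h0], intro conjI ballI allI impI)
    show "h0 > 0" by fact
    fix h t x assume h: "h \<in> {0<..h0}" and t: "t \<in> {0..T}" and eq: "ex t (x + h) = ex t x"
    have "R h (t, x + 2 * pi) = R h (t, x)" for x
      by (simp add: R_def avg_per[OF t] ex_per[OF t])
    then obtain y where y: "y \<in> {0..2 * pi}" "R h (t, y) = R h (t, x)"
      using periodic_reduce[of "\<lambda>x. R h (t, x)" x] by metis
    have "R h (t, x) \<le> \<epsilon>" using h0(2)[of h "(t, y)"] h t y by auto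
    then show "\<exists>d. ((\<lambda>t. avg h (ex t) x) has_real_derivative d) (at t within {0..T}) \<and> \<bar>d\<bar> \<le> b * energy 0 + \<epsilon>"
      using avg_e_time[OF t, of h x] h eq by (intro exI conjI) (auto simp: R_def)
  qed
qed

lemma extremum_v:
  assumes t: "t \<in> {0..T}" and h: "h \<noteq> 0"
    and ext: "(\<forall>y. avg h (vx t) y \<le> avg h (vx t) x) \<or> (\<forall>y. avg h (vx t) x \<le> avg h (vx t) y)"
  shows "vx t (x + h) = vx t x"
  by (rule avg_extremum[OF v_deriv[OF t] h ext])

lemma extremum_e:
  assumes t: "t \<in> {0..T}" and h: "h \<noteq> 0"
    and ext: "(\<forall>y. avg h (ex t) y \<le> avg h (ex t) x) \<or> (\<forall>y. avg h (ex t) x \<le> avg h (ex t) y)"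
  shows "ex t (x + h) = ex t x"
  by (rule avg_extremum[OF e_deriv[OF t] h ext])

lemma avg_limit:
  fixes \<phi> :: "real \<Rightarrow> real \<Rightarrow> real"
  assumes c: "joint_cont {0..T} \<phi>" and t: "t \<in> {0..T}" and h0: "h0 > 0"
    and le: "\<And>h. h \<in> {0<..h0} \<Longrightarrow> avg h (\<phi> t) x \<le> C"
  shows "\<phi> t x \<le> C"
proof -
  have "continuous_on {0..1::real} (\<lambda>h. avg h (\<phi> t) x)"
    using t by (intro avg_cont[OF c] continuous_intros) auto
  then have "((\<lambda>h. avg h (\<phi> t) x) \<longlongrightarrow> avg 0 (\<phi> t) x) (at 0 within {0..1})"
    unfolding continuous_on_def by (rule bspec) simp
  then have lim: "((\<lambda>h. avg h (\<phi> t) x) \<longlongrightarrow> \<phi> t x) (at 0 within {0<..1})"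
    unfolding avg_0 by (rule tendsto_within_subset) auto
  have "\<forall>\<^sub>F h in at 0 within {0<..1}. avg h (\<phi> t) x \<le> C"
    using h0 le unfolding eventually_at by (intro exI[of _ h0]) (auto simp: dist_real_def)
  moreover have "at (0::real) within {0<..1} \<noteq> bot" by (simp add: at_within_eq_bot_iff)
  ultimately show ?thesis using tendsto_upperbound[OF lim] by blast
qed

lemma b_energy: "0 \<le> b * energy 0" "0 \<le> energy 0" "0 < b"
proof -
  show E: "0 \<le> energy 0" using energy_nonneg[of 0] T_pos unfolding energy_def by auto
  show b: "0 < b" using \<beta>_pos[of 0] \<beta>_le[of 0] T_pos by auto
  then show "0 \<le> b * energy 0" using E by simp
qed

lemma \<beta>_energy: "t \<in> {0..T} \<Longrightarrow> \<beta> t * energy 0 \<le> b * energy 0"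
  using \<beta>_le b_energy by (intro mult_right_mono) auto

text \<open>At a contact with the barrier the negative square is dropped, so the slope rises at rate
  at most \<open>b * energy 0 / 2 + 1 / 2\<close>, less than the barrier does. The offset 1 makes
  the initial comparison strict.\<close>

lemma upper_bound_v:
  assumes S: "\<And>x. vx 0 x \<le> S" and t: "t \<in> {0..T}"
  shows "vx t x \<le> S + 1 + (b * energy 0 + 1) * t"
proof -
  obtain h0 where h0: "h0 > 0" "\<And>h t x. h \<in> {0<..h0} \<Longrightarrow> t \<in> {0..T} \<Longrightarrow> vx t (x + h) = vx t x \<Longrightarrow>
    (\<exists>d. ((\<lambda>t. avg h (vx t) x) has_real_derivative d) (at t within {0..T}) \<and>
      d \<le> - \<beta> t * (avg h (vx t) x)\<^sup>2 / 2 + \<beta> t * energy 0 / 2 + 1 / 2)"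
    using touch_v[of "1 / 2"] by auto
  show ?thesis
  proof (rule avg_limit[OF vx_cont t h0(1)])
    fix h assume h: "h \<in> {0<..h0}"
    have "avg h (vx t) x < S + 1 + (b * energy 0 + 1) * t"
    proof (rule barrier_max[where w="\<lambda>t. avg h (vx t)" and \<psi>="\<lambda>t. S + 1 + (b * energy 0 + 1) * t" and \<psi>'="\<lambda>t. b * energy 0 + 1" and a=0 and c=T])
      show "joint_cont {0..T} (\<lambda>t x. avg h (vx t) x)"
        unfolding case_prod_beta' by (intro cts continuous_intros) auto
      show "((\<lambda>t. S + 1 + (b * energy 0 + 1) * t) has_real_derivative b * energy 0 + 1) (at t within {0..T})" for t
        by (auto intro!: derivative_eq_intros)
      show "avg h (vx 0) x < S + 1 + (b * energy 0 + 1) * 0" for x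
        using avg_le[of "vx 0" S h x] S slice_cont(2)[of 0] T_pos by simp
      fix t x assume t': "t \<in> {0<..T}" and eq: "avg h (vx t) x = S + 1 + (b * energy 0 + 1) * t"
        and mx: "\<And>y. avg h (vx t) y \<le> S + 1 + (b * energy 0 + 1) * t"
      have t: "t \<in> {0..T}" using t' by auto
      have "vx t (x + h) = vx t x" using mx h by (intro extremum_v[OF t]) (auto simp: eq)
      then obtain d where d: "((\<lambda>t. avg h (vx t) x) has_real_derivative d) (at t within {0..T})"
        "d \<le> - \<beta> t * (avg h (vx t) x)\<^sup>2 / 2 + \<beta> t * energy 0 / 2 + 1 / 2"
        using h0(2)[OF h t] by blast
      have "0 \<le> \<beta> t * (avg h (vx t) x)\<^sup>2" using \<beta>_pos[OF t] by simp
      then have "d < b * energy 0 + 1" using d(2) \<beta>_energy[OF t] b_energy(1) by (simp add: field_simps)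
      then show "\<exists>d. ((\<lambda>t. avg h (vx t) x) has_real_derivative d) (at t within {0..T}) \<and> d < b * energy 0 + 1"
        using d(1) by blast
    qed (use t avg_per in auto)
    then show "avg h (vx t) x \<le> S + 1 + (b * energy 0 + 1) * t" by simp
  qed
qed

lemma bound_e:
  assumes S: "\<And>x. \<bar>ex 0 x\<bar> \<le> S" and t: "t \<in> {0..T}"
  shows "\<bar>ex t x\<bar> \<le> S + 1 + (b * energy 0 + 1) * t"
proof -
  obtain h0 where h0: "h0 > 0" "\<And>h t x. h \<in> {0<..h0} \<Longrightarrow> t \<in> {0..T} \<Longrightarrow> ex t (x + h) = ex t x \<Longrightarrow>
    (\<exists>d. ((\<lambda>t. avg h (ex t) x) has_real_derivative d) (at t within {0..T}) \<and> \<bar>d\<bar> \<le> b * energy 0 + 1 / 2)"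
    using touch_e[of "1 / 2"] by auto
  have both: "\<sigma> * ex t x \<le> S + 1 + (b * energy 0 + 1) * t" if \<sigma>: "\<sigma> = 1 \<or> \<sigma> = - 1" for \<sigma>
  proof (rule avg_limit[of "\<lambda>t x. \<sigma> * ex t x", OF _ t h0(1)])
    show "joint_cont {0..T} (\<lambda>t x. \<sigma> * ex t x)"
      unfolding case_prod_beta' by (intro cts continuous_intros) auto
    have av: "avg h (\<lambda>x. \<sigma> * ex t x) x = \<sigma> * avg h (ex t) x" for h t x
      by (simp add: avg_def)
    fix h assume h: "h \<in> {0<..h0}"
    have "\<sigma> * avg h (ex t) x < S + 1 + (b * energy 0 + 1) * t"
    proof (rule barrier_max[where w="\<lambda>t x. \<sigma> * avg h (ex t) x" and \<psi>="\<lambda>t. S + 1 + (b * energy 0 + 1) * t" and \<psi>'="\<lambda>t. b * energy 0 + 1" and a=0 and c=T])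
      show "joint_cont {0..T} (\<lambda>t x. \<sigma> * avg h (ex t) x)"
        unfolding case_prod_beta' by (intro cts continuous_intros) auto
      show "((\<lambda>t. S + 1 + (b * energy 0 + 1) * t) has_real_derivative b * energy 0 + 1) (at t within {0..T})" for t
        by (auto intro!: derivative_eq_intros)
      show "\<sigma> * avg h (ex 0) x < S + 1 + (b * energy 0 + 1) * 0" for x
      proof -
        have "\<sigma> * ex 0 y \<le> S" for y using S[of y] \<sigma> by (auto simp: abs_le_iff)
        then show ?thesis
          using avg_le[of "\<lambda>x. \<sigma> * ex 0 x" S h x] slice_cont(4)[of 0] T_pos unfolding av by (simp add: continuous_on_mult_left)
      qed
      fix t x assume t': "t \<in> {0<..T}" and eq: "\<sigma> * avg h (ex t) x = S + 1 + (b * energy 0 + 1) * t"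
        and mx: "\<And>y. \<sigma> * avg h (ex t) y \<le> S + 1 + (b * energy 0 + 1) * t"
      have t: "t \<in> {0..T}" using t' by auto
      have mx': "\<sigma> * avg h (ex t) y \<le> \<sigma> * avg h (ex t) x" for y using mx[of y] eq by simp
      have "ex t (x + h) = ex t x"
        using \<sigma> by (rule disjE) (use mx' h in \<open>intro extremum_e[OF t]; auto\<close>)+
      then obtain d where d: "((\<lambda>t. avg h (ex t) x) has_real_derivative d) (at t within {0..T})"
        "\<bar>d\<bar> \<le> b * energy 0 + 1 / 2"
        using h0(2)[OF h t] by blast
      have "((\<lambda>t. \<sigma> * avg h (ex t) x) has_real_derivative \<sigma> * d) (at t within {0..T})"
        by (rule DERIV_cmult[OF d(1)])
      moreover have "\<sigma> * d < b * energy 0 + 1" using d(2) \<sigma> by auto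
      ultimately show "\<exists>d. ((\<lambda>t. \<sigma> * avg h (ex t) x) has_real_derivative d) (at t within {0..T}) \<and> d < b * energy 0 + 1"
        by blast
    qed (use t avg_per in auto)
    then show "avg h (\<lambda>x. \<sigma> * ex t x) x \<le> S + 1 + (b * energy 0 + 1) * t" unfolding av by simp
  qed
  show ?thesis using both[of 1] both[of "-1"] by (simp add: abs_le_iff)
qed

text \<open>A very negative minimal slope can recover only at a bounded rate. This is what later
  turns slopes that are unbounded below into a limit \<open>-\<infinity>\<close>. The summand 1 pays
  for replacing \<open>vx s x\<close> by its average.\<close>

lemma min_growth:
  assumes s: "s \<in> {0..T}" and t: "t \<in> {s..T}"
  shows "\<exists>y. vx t y \<le> vx s x + 1 + (b * energy 0 + 1) * (t - s)"
proof -
  obtain h0 where h0: "h0 > 0" "\<And>h t x. h \<in> {0<..h0} \<Longrightarrow> t \<in> {0..T} \<Longrightarrow> vx t (x + h) = vx t x \<Longrightarrow>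
    (\<exists>d. ((\<lambda>t. avg h (vx t) x) has_real_derivative d) (at t within {0..T}) \<and>
      d \<le> - \<beta> t * (avg h (vx t) x)\<^sup>2 / 2 + \<beta> t * energy 0 / 2 + 1 / 2)"
    using touch_v[of "1 / 2"] by auto
  have c: "continuous_on ({0..1} \<times> {s}) (\<lambda>(h, k). avg h (vx k) x - vx k x)"
    unfolding case_prod_beta' using s by (intro cts continuous_intros) auto
  obtain h1 where h1: "h1 > 0" "\<And>h. h \<in> {0..h1} \<Longrightarrow> avg h (vx s) x - vx s x \<le> 1"
    using small_parameter[OF _ c, of 1] by auto
  define h where "h = min h0 h1"
  have h: "h \<in> {0<..h0}" "h \<in> {0..h1}" "h \<noteq> 0" using h0(1) h1(1) by (auto simp: h_def)
  have sub: "{s..T} \<subseteq> {0..T}" using s by auto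
  have "\<exists>y. avg h (vx t) y \<le> vx s x + 1 + (b * energy 0 + 1) * (t - s)"
  proof (rule barrier_min[where w="\<lambda>t. avg h (vx t)" and \<psi>="\<lambda>t. vx s x + 1 + (b * energy 0 + 1) * (t - s)" and \<psi>'="\<lambda>t. b * energy 0 + 1" and a=s and c=T])
    show "joint_cont {s..T} (\<lambda>t x. avg h (vx t) x)"
      unfolding case_prod_beta' using s by (intro cts continuous_intros) auto
    show "((\<lambda>t. vx s x + 1 + (b * energy 0 + 1) * (t - s)) has_real_derivative b * energy 0 + 1) (at t within {s..T})" for t
      by (auto intro!: derivative_eq_intros)
    show "avg h (vx s) x \<le> vx s x + 1 + (b * energy 0 + 1) * (s - s)"
      using h1(2)[OF h(2)] by simp
    fix t z assume t': "t \<in> {s..<T}" and eq: "avg h (vx t) z = vx s x + 1 + (b * energy 0 + 1) * (t - s)"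
      and mx: "\<And>y. vx s x + 1 + (b * energy 0 + 1) * (t - s) \<le> avg h (vx t) y"
    have t: "t \<in> {0..T}" using t' s by auto
    have "vx t (z + h) = vx t z" using mx h by (intro extremum_v[OF t]) (auto simp: eq)
    then obtain d where d: "((\<lambda>t. avg h (vx t) z) has_real_derivative d) (at t within {0..T})"
      "d \<le> - \<beta> t * (avg h (vx t) z)\<^sup>2 / 2 + \<beta> t * energy 0 / 2 + 1 / 2"
      using h0(2)[OF h(1) t] by blast
    have "0 \<le> \<beta> t * (avg h (vx t) z)\<^sup>2" using \<beta>_pos[OF t] by simp
    then have "d < b * energy 0 + 1" using d(2) \<beta>_energy[OF t] b_energy(1) by (simp add: field_simps)
    then show "\<exists>d. ((\<lambda>t. avg h (vx t) z) has_real_derivative d) (at t within {s..T}) \<and> d < b * energy 0 + 1"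
      using DERIV_subset[OF d(1) sub] by blast
  qed (use t sub avg_per in auto)
  then obtain y where "avg h (vx t) y \<le> vx s x + 1 + (b * energy 0 + 1) * (t - s)" by blast
  then show ?thesis using slice_cont(2)[of t UNIV] t s by (intro avg_le_ex[of "vx t" h y]) auto
qed

subsection \<open>Blow-up\<close>

text \<open>The comparison function \<open>- \<mu> / (1 - a B)\<close> with \<open>B = \<integral> \<beta>\<close> solves \<open>\<psi>' = - (a / \<mu>) \<beta> \<psi>\<^sup>2\<close>. It is a
  supersolution of \<open>\<psi>' = - \<beta> (\<psi>\<^sup>2 - energy) / 2\<close> because \<open>\<mu>\<^sup>2 - 2 a \<mu> > energy\<close>, and it explodes when \<open>B = 1 / a\<close>.\<close>

lemma blow_up:
  assumes a: "a > 0" and N: "energy 0 \<le> N" and init: "vx 0 x0 < - a - sqrt (a\<^sup>2 + N)"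
  shows "integral {0..T} \<beta> \<le> 1 / a"
proof (rule ccontr)
  assume neg: "\<not> integral {0..T} \<beta> \<le> 1 / a"
  define B where "B t = integral {0..t} \<beta>" for t
  have Bd: "(B has_real_derivative \<beta> t) (at t within {0..T})" if "t \<in> {0..T}" for t
    unfolding B_def by (rule integral_has_real_derivative[OF \<beta>_cont that])
  have Bc: "continuous_on {0..T} B" using Bd by (rule DERIV_continuous_on)
  have Bmono: "B s \<le> B t" if "s \<in> {0..T}" "t \<in> {0..T}" "s \<le> t" for s t
    unfolding B_def
    using that \<beta>_pos by (intro integral_subset_le integrable_continuous_real continuous_on_subset[OF \<beta>_cont])
      (auto simp: less_imp_le)
  have aB: "a * B T > 1" "B 0 = 0" using neg a by (auto simp: B_def field_simps)
  \<comment> \<open>The midpoint between \<open>a + sqrt (a\<^sup>2 + N)\<close> and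
    \<open>- vx 0 x0\<close>. The lower inequality yields the gap below, the upper one lets the
    averaged initial slope start below \<open>- \<mu>\<close>.\<close>
  define \<mu> where "\<mu> = (- vx 0 x0 + (a + sqrt (a\<^sup>2 + N))) / 2"
  have N0: "0 \<le> N" using N b_energy by linarith
  have sq: "a \<le> sqrt (a\<^sup>2 + N)" using N0 a by (intro real_le_rsqrt) auto
  have \<mu>: "a + sqrt (a\<^sup>2 + N) < \<mu>" "vx 0 x0 < - \<mu>" using init unfolding \<mu>_def by (simp_all add: field_simps)
  have \<mu>2: "\<mu> > 2 * a" "\<mu> > 0" using \<mu> sq a by auto
  have "(sqrt (a\<^sup>2 + N))\<^sup>2 < (\<mu> - a)\<^sup>2" using \<mu> N0 by (intro power_strict_mono) auto
  then have gap: "\<mu>\<^sup>2 - 2 * a * \<mu> > N" using N0 by (simp add: power2_diff algebra_simps)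
  obtain m where m: "m \<in> {0..T}" "\<And>t. t \<in> {0..T} \<Longrightarrow> \<beta> m \<le> \<beta> t"
    using continuous_attains_inf[OF compact_Icc _ \<beta>_cont] T_pos by auto
  \<comment> \<open>Half of the least surplus with which the Riccati inequality beats the comparison
    function, so the error from averaging cannot consume it.\<close>
  define \<epsilon> where "\<epsilon> = \<beta> m * (\<mu>\<^sup>2 - 2 * a * \<mu> - N) / 4"
  have \<epsilon>: "\<epsilon> > 0" using \<beta>_pos[OF m(1)] gap by (simp add: \<epsilon>_def)
  obtain h0 where h0: "h0 > 0" "\<And>h t x. h \<in> {0<..h0} \<Longrightarrow> t \<in> {0..T} \<Longrightarrow> vx t (x + h) = vx t x \<Longrightarrow>
    (\<exists>d. ((\<lambda>t. avg h (vx t) x) has_real_derivative d) (at t within {0..T}) \<and>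
      d \<le> - \<beta> t * (avg h (vx t) x)\<^sup>2 / 2 + \<beta> t * energy 0 / 2 + \<epsilon>)"
    using touch_v[OF \<epsilon>] by auto
  have c: "continuous_on ({0..1} \<times> {0}) (\<lambda>(h, k). avg h (vx k) x0 - vx k x0)"
    unfolding case_prod_beta' using T_pos by (intro cts continuous_intros) auto
  obtain h1 where h1: "h1 > 0" "\<And>h. h \<in> {0..h1} \<Longrightarrow> avg h (vx 0) x0 - vx 0 x0 \<le> - \<mu> - vx 0 x0"
    using small_parameter[OF _ c, of "- \<mu> - vx 0 x0"] \<mu> by auto
  define h where "h = min h0 h1"
  have h: "h \<in> {0<..h0}" "h \<in> {0..h1}" "h \<noteq> 0" using h0(1) h1(1) by (auto simp: h_def)
  have key: "\<exists>y. avg h (vx t) y \<le> - \<mu> / (1 - a * B t)" if t: "t \<in> {0..T}" and Bt: "a * B t < 1" for t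
  proof -
    have sub: "{0..t} \<subseteq> {0..T}" using t by auto
    have pos: "1 - a * B r > 0" if "r \<in> {0..t}" for r
    proof -
      have "a * B r \<le> a * B t" using that t a by (intro mult_left_mono Bmono) auto
      then show ?thesis using Bt by simp
    qed
    show ?thesis
    proof (rule barrier_min[where w="\<lambda>t. avg h (vx t)" and \<psi>="\<lambda>t. - \<mu> / (1 - a * B t)" and \<psi>'="\<lambda>t. - (a / \<mu>) * \<beta> t * (- \<mu> / (1 - a * B t))\<^sup>2" and a=0 and c=t])
      show "joint_cont {0..t} (\<lambda>t x. avg h (vx t) x)"
        unfolding case_prod_beta' using t by (intro cts continuous_intros) auto
      fix r assume r: "r \<in> {0..t}"
      then have r': "r \<in> {0..T}" using sub by auto
      show "((\<lambda>t. - \<mu> / (1 - a * B t)) has_real_derivative - (a / \<mu>) * \<beta> r * (- \<mu> / (1 - a * B r))\<^sup>2) (at r within {0..t})"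
      proof -
        have "((\<lambda>t. - \<mu> / (1 - a * B t)) has_real_derivative
            (0 * (1 - a * B r) - (- \<mu>) * (0 - a * \<beta> r)) / ((1 - a * B r) * (1 - a * B r))) (at r within {0..t})"
          using pos[OF r] by (intro DERIV_divide DERIV_const DERIV_diff DERIV_cmult DERIV_subset[OF Bd[OF r'] sub]) auto
        moreover have "(0 * D - (- \<mu>) * (0 - a * \<beta> r)) / (D * D) = - (a / \<mu>) * \<beta> r * (- \<mu> / D)\<^sup>2" if "D > 0" for D
          using that \<mu>2(2) by (simp add: power2_eq_square)
        ultimately show ?thesis using pos[OF r] by (simp only:)
      qed
    next
      show "avg h (vx 0) x0 \<le> - \<mu> / (1 - a * B 0)"
        using h1(2)[OF h(2)] aB by simp
    next
      fix r z assume r: "r \<in> {0..<t}" and eq: "avg h (vx r) z = - \<mu> / (1 - a * B r)"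
        and mx: "\<And>y. - \<mu> / (1 - a * B r) \<le> avg h (vx r) y"
      have r': "r \<in> {0..T}" "r \<in> {0..t}" using r t by auto
      let ?\<psi> = "- \<mu> / (1 - a * B r)"
      have "vx r (z + h) = vx r z" using mx h by (intro extremum_v[OF r'(1)]) (auto simp: eq)
      from h0(2)[OF h(1) r'(1) this, unfolded eq]
      obtain d where d: "((\<lambda>t. avg h (vx t) z) has_real_derivative d) (at r within {0..T})"
        "d \<le> - \<beta> r * ?\<psi>\<^sup>2 / 2 + \<beta> r * energy 0 / 2 + \<epsilon>"
        by (elim exE conjE)
      have "0 \<le> B r" using Bmono[of 0 r] r' aB T_pos by auto
      then have "1 - a * B r \<le> 1" using a by simp
      then have "\<mu> \<le> \<mu> / (1 - a * B r)" using pos[OF r'(2)] \<mu>2 a by (simp add: pos_le_divide_eq)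
      then have "\<mu>\<^sup>2 \<le> ?\<psi>\<^sup>2" using \<mu>2 power_mono[of \<mu> "\<mu> / (1 - a * B r)" 2] by simp
      \<comment> \<open>The surplus is proportional to the square of the comparison function with
        the positive factor \<open>1 / 2 - a / \<mu>\<close>; hence it is smallest at the start,
        where this function equals \<open>- \<mu>\<close>.\<close>
      then have 1: "\<mu>\<^sup>2 * (1 / 2 - a / \<mu>) \<le> ?\<psi>\<^sup>2 * (1 / 2 - a / \<mu>)"
        using \<mu>2 by (intro mult_right_mono) (auto simp: field_simps)
      define P where "P = ?\<psi>\<^sup>2"
      define g where "g = (\<mu>\<^sup>2 - 2 * a * \<mu> - N) / 2"
      have "\<mu>\<^sup>2 * (1 / 2 - a / \<mu>) = g + N / 2" using \<mu>2 by (simp add: g_def field_simps power2_eq_square)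
      then have "g \<le> P * (1 / 2 - a / \<mu>) - energy 0 / 2" using 1 N unfolding P_def by linarith
      then have 2: "\<beta> r * g \<le> \<beta> r * (P * (1 / 2 - a / \<mu>) - energy 0 / 2)"
        using \<beta>_pos[OF r'(1)] by (intro mult_left_mono) auto
      have "2 * \<epsilon> = \<beta> m * g" by (simp add: \<epsilon>_def g_def)
      also have "\<dots> \<le> \<beta> r * g" using gap by (intro mult_right_mono m(2)[OF r'(1)]) (simp add: g_def)
      finally have "\<epsilon> < \<beta> r * (P * (1 / 2 - a / \<mu>) - energy 0 / 2)" using 2 \<epsilon> by linarith
      also have "\<dots> = \<beta> r * P / 2 - \<beta> r * energy 0 / 2 - (a / \<mu>) * \<beta> r * P" by (simp add: algebra_simps)
      finally have "d < - (a / \<mu>) * \<beta> r * ?\<psi>\<^sup>2" using d(2) unfolding P_def[symmetric] by linarith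
      then show "\<exists>d. ((\<lambda>t. avg h (vx t) z) has_real_derivative d) (at r within {0..t}) \<and> d < - (a / \<mu>) * \<beta> r * ?\<psi>\<^sup>2"
        using DERIV_subset[OF d(1) sub] by blast
    qed (use t sub avg_per in auto)
  qed
  have "compact ((\<lambda>(t, x). vx t x) ` ({0..T} \<times> {0..2 * pi}))"
    by (intro compact_continuous_image continuous_on_subset[OF vx_cont] compact_Times compact_Icc) auto
  then obtain V where "\<forall>y \<in> (\<lambda>(t, x). vx t x) ` ({0..T} \<times> {0..2 * pi}). norm y \<le> V"
    using compact_imp_bounded bounded_iff by metis
  then have V: "\<And>t x. t \<in> {0..T} \<Longrightarrow> x \<in> {0..2 * pi} \<Longrightarrow> \<bar>vx t x\<bar> \<le> V"
    by auto
  have V': "- V \<le> vx t x" if "t \<in> {0..T}" for t x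
    using periodic_reduce[of "vx t" x] vx_per[OF that] V[OF that] by (metis abs_le_D2 minus_le_iff)
  \<comment> \<open>The comparison is stopped when \<open>1 - a * B t = \<theta>\<close>, shortly
    before the explosion but late enough for \<open>- \<mu> / \<theta>\<close> to lie below the
    minimum of \<open>vx\<close> over the compact time interval.\<close>
  define \<theta> where "\<theta> = min (1 / 2) (\<mu> / (2 * (\<bar>V\<bar> + 1)))"
  have \<theta>: "0 < \<theta>" "\<theta> < 1" using \<mu>2 by (auto simp: \<theta>_def add_nonneg_pos)
  have V\<theta>: "V < \<mu> / \<theta>"
  proof -
    have "0 < 2 * (\<bar>V\<bar> + 1)" "\<theta> \<le> \<mu> / (2 * (\<bar>V\<bar> + 1))" by (simp_all add: \<theta>_def)
    then have "\<theta> * (2 * (\<bar>V\<bar> + 1)) \<le> \<mu>" by (simp only: pos_le_divide_eq)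
    moreover have "\<theta> * (2 * (\<bar>V\<bar> + 1)) = 2 * (\<bar>V\<bar> * \<theta>) + 2 * \<theta>" by (simp add: algebra_simps)
    moreover have "V * \<theta> \<le> \<bar>V\<bar> * \<theta>" "0 \<le> \<bar>V\<bar> * \<theta>" using \<theta> by (auto intro: mult_right_mono)
    ultimately have "V * \<theta> < \<mu>" using \<theta> by linarith
    then show ?thesis using \<theta> by (simp add: pos_less_divide_eq)
  qed
  have "\<exists>t\<ge>0. t \<le> T \<and> B t = (1 - \<theta>) / a"
    using aB \<theta> a T_pos by (intro IVT' Bc) (auto simp: field_simps)
  then obtain t where t: "t \<in> {0..T}" "a * B t = 1 - \<theta>" using a by (auto simp: field_simps)
  obtain y where "avg h (vx t) y \<le> - \<mu> / \<theta>" using key[OF t(1)] t(2) \<theta> by auto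
  then obtain z where "vx t z \<le> - \<mu> / \<theta>" using avg_le_ex[OF slice_cont(2)[OF t(1)]] by blast
  then show False using V'[OF t(1), of z] V\<theta> by simp
qed

end

section \<open>Gaussian increments\<close>

text \<open>Completing the square: an exponential weight shifts the mean of a centred Gaussian by
  \<open>\<theta> * \<sigma>\<^sup>2\<close>, which reduces exponentially weighted moments to
  ordinary ones.\<close>

lemma normal_density_exp:
  assumes "\<sigma> > 0"
  shows "normal_density 0 \<sigma> x * exp (\<theta> * x) = exp (\<theta>\<^sup>2 * \<sigma>\<^sup>2 / 2) * normal_density (\<theta> * \<sigma>\<^sup>2) \<sigma> x"
proof -
  have "- (x - 0)\<^sup>2 / (2 * \<sigma>\<^sup>2) + \<theta> * x = \<theta>\<^sup>2 * \<sigma>\<^sup>2 / 2 + - (x - \<theta> * \<sigma>\<^sup>2)\<^sup>2 / (2 * \<sigma>\<^sup>2)"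
    using assms by (simp add: field_simps power2_eq_square)
  then have "exp (- (x - 0)\<^sup>2 / (2 * \<sigma>\<^sup>2)) * exp (\<theta> * x) = exp (\<theta>\<^sup>2 * \<sigma>\<^sup>2 / 2) * exp (- (x - \<theta> * \<sigma>\<^sup>2)\<^sup>2 / (2 * \<sigma>\<^sup>2))"
    by (simp only: exp_add[symmetric])
  then show ?thesis unfolding normal_density_def by (simp add: mult_ac)
qed

lemma normal_second_moment:
  assumes s: "\<sigma> > 0"
  shows "integrable lborel (\<lambda>x. normal_density \<mu> \<sigma> x * x\<^sup>2)" "(\<integral>x. normal_density \<mu> \<sigma> x * x\<^sup>2 \<partial>lborel) = \<mu>\<^sup>2 + \<sigma>\<^sup>2"
proof -
  have e: "normal_density \<mu> \<sigma> x * x\<^sup>2 = normal_density \<mu> \<sigma> x * (x - \<mu>)\<^sup>2 + 2 * \<mu> * (normal_density \<mu> \<sigma> x * x) - \<mu>\<^sup>2 * normal_density \<mu> \<sigma> x" for x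
    by (simp add: power2_eq_square algebra_simps)
  note i = integrable_normal_moment[OF s, of \<mu> 2] integrable_normal_moment_nz_1[OF s, of \<mu>] integrable_normal_density[OF s, of \<mu>]
  show "integrable lborel (\<lambda>x. normal_density \<mu> \<sigma> x * x\<^sup>2)" unfolding e using i by auto
  have m2: "(\<integral>x. normal_density \<mu> \<sigma> x * (x - \<mu>)\<^sup>2 \<partial>lborel) = \<sigma>\<^sup>2"
    using integral_normal_moment_even[OF s, of \<mu> 1] s by (simp add: fact_numeral)
  have "(\<integral>x. normal_density \<mu> \<sigma> x * x\<^sup>2 \<partial>lborel) = \<sigma>\<^sup>2 + 2 * \<mu> * \<mu> - \<mu>\<^sup>2 * 1"
    unfolding e using i m2 integral_normal_moment_nz_1[OF s, of \<mu>] integral_normal_density[OF s, of \<mu>] by simp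
  then show "(\<integral>x. normal_density \<mu> \<sigma> x * x\<^sup>2 \<partial>lborel) = \<mu>\<^sup>2 + \<sigma>\<^sup>2" by (simp add: power2_eq_square)
qed

lemma normal_exp_moments:
  fixes \<theta> :: real
  assumes s: "\<sigma> > 0"
  shows "has_bochner_integral lborel (\<lambda>x. normal_density 0 \<sigma> x * exp (\<theta> * x)) (exp (\<theta>\<^sup>2 * \<sigma>\<^sup>2 / 2))"
    and "has_bochner_integral lborel (\<lambda>x. normal_density 0 \<sigma> x * (exp (\<theta> * x) * x)) (exp (\<theta>\<^sup>2 * \<sigma>\<^sup>2 / 2) * (\<theta> * \<sigma>\<^sup>2))"
    and "has_bochner_integral lborel (\<lambda>x. normal_density 0 \<sigma> x * (exp (\<theta> * x) * x\<^sup>2)) (exp (\<theta>\<^sup>2 * \<sigma>\<^sup>2 / 2) * ((\<theta> * \<sigma>\<^sup>2)\<^sup>2 + \<sigma>\<^sup>2))"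
proof -
  let ?E = "exp (\<theta>\<^sup>2 * \<sigma>\<^sup>2 / 2)" and ?n = "normal_density (\<theta> * \<sigma>\<^sup>2) \<sigma>"
  note e = normal_density_exp[OF s, of _ \<theta>]
  have "has_bochner_integral lborel (\<lambda>x. ?E * ?n x) (?E * 1)"
    by (intro has_bochner_integral_mult_right) (use s in \<open>simp add: has_bochner_integral_iff\<close>)
  then show "has_bochner_integral lborel (\<lambda>x. normal_density 0 \<sigma> x * exp (\<theta> * x)) ?E"
    by (simp add: e)
  have "has_bochner_integral lborel (\<lambda>x. ?E * (?n x * x)) (?E * (\<theta> * \<sigma>\<^sup>2))"
    by (intro has_bochner_integral_mult_right normal_moment_nz_1 s)
  then show "has_bochner_integral lborel (\<lambda>x. normal_density 0 \<sigma> x * (exp (\<theta> * x) * x)) (?E * (\<theta> * \<sigma>\<^sup>2))"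
    by (simp only: e mult.assoc[symmetric])
  have "has_bochner_integral lborel (\<lambda>x. ?E * (?n x * x\<^sup>2)) (?E * ((\<theta> * \<sigma>\<^sup>2)\<^sup>2 + \<sigma>\<^sup>2))"
    by (intro has_bochner_integral_mult_right) (use normal_second_moment[OF s] in \<open>simp add: has_bochner_integral_iff\<close>)
  then show "has_bochner_integral lborel (\<lambda>x. normal_density 0 \<sigma> x * (exp (\<theta> * x) * x\<^sup>2)) (?E * ((\<theta> * \<sigma>\<^sup>2)\<^sup>2 + \<sigma>\<^sup>2))"
    by (simp only: e mult.assoc[symmetric])
qed

text \<open>With \<open>Z = exp (- c W + c\<^sup>2 t / 2)\<close>, an increment of \<open>Z Y\<close> for \<open>dY = X dW\<close> is
  \<open>Z (Y Q + (X - c Y) V)\<close>, where \<open>Q = R (1 + c dW) - 1\<close>, \<open>V = R dW\<close> and \<open>R\<close> is the quotient of the two values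
  of \<open>Z\<close>.\<close>

definition Qinc :: "real \<Rightarrow> real \<Rightarrow> real \<Rightarrow> real" where
  "Qinc c h w = exp (- c * w + c\<^sup>2 * h / 2) * (1 + c * w) - 1"

definition Vinc :: "real \<Rightarrow> real \<Rightarrow> real \<Rightarrow> real" where
  "Vinc c h w = exp (- c * w + c\<^sup>2 * h / 2) * w"

lemma inc_measurable [measurable]: "Qinc c h \<in> borel_measurable borel" "Vinc c h \<in> borel_measurable borel"
  unfolding Qinc_def[abs_def] Vinc_def[abs_def] by measurable

text \<open>One constant for all bounds of \<open>inc_moments\<close> with steps of length at most
  1: \<open>c ^ 4\<close> for the two moments of \<open>Qinc\<close>, \<open>\<bar>c\<bar>\<close>
  for the mean of \<open>Vinc\<close>, and 1 for its second moment. The exponential covers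
  \<open>(1 + 4 * x) * exp (3 * x) \<le> exp (7 * x)\<close> with
  \<open>x = c\<^sup>2 * h\<close>.\<close>

definition Kinc :: "real \<Rightarrow> real" where
  "Kinc c = (6 * c ^ 4 + \<bar>c\<bar> + 1) * exp (7 * c\<^sup>2)"

context brownian_basis
begin

abbreviation borel_at :: "real \<Rightarrow> ('w \<Rightarrow> real) set" where
  "borel_at t \<equiv> borel_measurable (F (ennreal t))"

abbreviation increment :: "(nat \<Rightarrow> real) \<Rightarrow> nat \<Rightarrow> 'w \<Rightarrow> real" ("\<Delta>W") where
  "\<Delta>W t j \<omega> \<equiv> W (t (Suc j)) \<omega> - W (t j) \<omega>"

lemma F_measurable_M: "f \<in> borel_measurable (F t) \<Longrightarrow> f \<in> borel_measurable M"
  using F_subalgebra[of t] measurable_from_subalg by blast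

lemma F_mono_measurable:
  assumes "s \<le> t" and f: "f \<in> measurable (F s) N"
  shows "f \<in> measurable (F t) N"
proof (rule measurableI)
  show "f x \<in> space N" if "x \<in> space (F t)" for x
    using measurable_space[OF f, of x] that unfolding space_F .
  show "f -` A \<inter> space (F t) \<in> sets (F t)" if "A \<in> sets N" for A
    using measurable_sets[OF f that] sets_F_mono[OF assms(1)] unfolding space_F by blast
qed

lemma increment_exp_moments:
  assumes ab: "0 \<le> s" "s < t"
  shows "integrable M (\<lambda>\<omega>. exp (\<theta> * (W t \<omega> - W s \<omega>)))"
    "(\<integral>\<omega>. exp (\<theta> * (W t \<omega> - W s \<omega>)) \<partial>M) = exp (\<theta>\<^sup>2 * (t - s) / 2)"
    "integrable M (\<lambda>\<omega>. exp (\<theta> * (W t \<omega> - W s \<omega>)) * (W t \<omega> - W s \<omega>))"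
    "(\<integral>\<omega>. exp (\<theta> * (W t \<omega> - W s \<omega>)) * (W t \<omega> - W s \<omega>) \<partial>M) = exp (\<theta>\<^sup>2 * (t - s) / 2) * (\<theta> * (t - s))"
    "integrable M (\<lambda>\<omega>. exp (\<theta> * (W t \<omega> - W s \<omega>)) * (W t \<omega> - W s \<omega>)\<^sup>2)"
    "(\<integral>\<omega>. exp (\<theta> * (W t \<omega> - W s \<omega>)) * (W t \<omega> - W s \<omega>)\<^sup>2 \<partial>M) = exp (\<theta>\<^sup>2 * (t - s) / 2) * ((\<theta> * (t - s))\<^sup>2 + (t - s))"
proof -
  have s: "sqrt (t - s) > 0" "(sqrt (t - s))\<^sup>2 = t - s" using ab by auto
  note d = W_increment[OF ab]
  note m = normal_exp_moments[OF s(1), of \<theta>, unfolded s(2)]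
  have *: "integrable M (\<lambda>\<omega>. g (W t \<omega> - W s \<omega>)) \<and> (\<integral>\<omega>. g (W t \<omega> - W s \<omega>) \<partial>M) = r"
    if "has_bochner_integral lborel (\<lambda>x. normal_density 0 (sqrt (t - s)) x * g x) r" "g \<in> borel_measurable lborel" for g r
    using that distributed_integrable[OF d that(2)] distributed_integral[OF d that(2)]
    by (simp add: has_bochner_integral_iff)
  show "integrable M (\<lambda>\<omega>. exp (\<theta> * (W t \<omega> - W s \<omega>)))"
    "(\<integral>\<omega>. exp (\<theta> * (W t \<omega> - W s \<omega>)) \<partial>M) = exp (\<theta>\<^sup>2 * (t - s) / 2)"
    using *[OF m(1)] by auto
  show "integrable M (\<lambda>\<omega>. exp (\<theta> * (W t \<omega> - W s \<omega>)) * (W t \<omega> - W s \<omega>))"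
    "(\<integral>\<omega>. exp (\<theta> * (W t \<omega> - W s \<omega>)) * (W t \<omega> - W s \<omega>) \<partial>M) = exp (\<theta>\<^sup>2 * (t - s) / 2) * (\<theta> * (t - s))"
    using *[OF m(2)] by auto
  show "integrable M (\<lambda>\<omega>. exp (\<theta> * (W t \<omega> - W s \<omega>)) * (W t \<omega> - W s \<omega>)\<^sup>2)"
    "(\<integral>\<omega>. exp (\<theta> * (W t \<omega> - W s \<omega>)) * (W t \<omega> - W s \<omega>)\<^sup>2 \<partial>M) = exp (\<theta>\<^sup>2 * (t - s) / 2) * ((\<theta> * (t - s))\<^sup>2 + (t - s))"
    using *[OF m(3)] by auto
qed

lemma increment_measurable [measurable]:
  assumes "0 \<le> s" "0 \<le> t"
  shows "(\<lambda>\<omega>. W t \<omega> - W s \<omega>) \<in> borel_measurable M"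
  by (rule borel_measurable_diff[OF F_measurable_M[OF W_adapted[OF assms(2)]] F_measurable_M[OF W_adapted[OF assms(1)]]])

lemma increment_indep:
  fixes G :: "'w \<Rightarrow> real" and g :: "real \<Rightarrow> real"
  assumes ab: "0 \<le> s" "s < t" and G: "G \<in> borel_at s" and iG: "integrable M G"
    and g: "g \<in> borel_measurable borel" and ig: "integrable M (\<lambda>\<omega>. g (W t \<omega> - W s \<omega>))"
  shows "integrable M (\<lambda>\<omega>. G \<omega> * g (W t \<omega> - W s \<omega>))"
    "(\<integral>\<omega>. G \<omega> * g (W t \<omega> - W s \<omega>) \<partial>M) = (\<integral>\<omega>. G \<omega> \<partial>M) * (\<integral>\<omega>. g (W t \<omega> - W s \<omega>) \<partial>M)"
proof -
  let ?D = "\<lambda>\<omega>. W t \<omega> - W s \<omega>"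
  have "indep_var borel G borel ?D"
    unfolding indep_var_eq
  proof (intro conjI)
    show "random_variable borel G" by (rule F_measurable_M[OF G])
    show "random_variable borel ?D" using ab by (intro increment_measurable) auto
    have 1: "sigma_sets (space M) {G -` A \<inter> space M |A. A \<in> sets borel} \<subseteq> sets (F (ennreal s))"
    proof -
      have "{G -` A \<inter> space M |A. A \<in> sets borel} \<subseteq> sets (F (ennreal s))"
        using measurable_sets[OF G] space_F[of "ennreal s"] by auto
      from sets.sigma_sets_subset[OF this] show ?thesis unfolding space_F .
    qed
    have 2: "sigma_sets (space M) {?D -` A \<inter> space M |A. A \<in> sets borel} = sets (vimage_algebra (space M) ?D borel)"
      by (simp add: sets_vimage_algebra)
    show "indep_set (sigma_sets (space M) {G -` A \<inter> space M |A. A \<in> sets borel})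
       (sigma_sets (space M) {?D -` A \<inter> space M |A. A \<in> sets borel})"
      unfolding 2 using W_indep[OF ab] 1 unfolding indep_sets2_eq by blast
  qed
  then have "indep_var borel (id \<circ> G) borel (g \<circ> ?D)" using g by (intro indep_var_compose) auto
  then have "indep_var borel G borel (\<lambda>\<omega>. g (?D \<omega>))" by (simp add: comp_def)
  then show "integrable M (\<lambda>\<omega>. G \<omega> * g (?D \<omega>))" "(\<integral>\<omega>. G \<omega> * g (?D \<omega>) \<partial>M) = (\<integral>\<omega>. G \<omega> \<partial>M) * (\<integral>\<omega>. g (?D \<omega>) \<partial>M)"
    by (rule indep_var_integrable[OF _ iG ig], rule indep_var_lebesgue_integral[OF _ iG ig])
qed

section \<open>Square sums of martingale differences\<close>

lemma integrable_bounded_adapted: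
  assumes "a \<in> borel_at s" "\<And>\<omega>. \<omega> \<in> space M \<Longrightarrow> \<bar>a \<omega>\<bar> \<le> B"
  shows "integrable M (a :: 'w \<Rightarrow> real)"
  by (rule integrable_const_bound[of _ B]) (use assms F_measurable_M in auto)

text \<open>Martingale differences are orthogonal. The adaptedness of the partial sum is part of the
  claim because the induction step multiplies it with an increment that is independent of the
  past.\<close>

lemma martingale_square_sum:
  fixes t :: "nat \<Rightarrow> real" and a :: "nat \<Rightarrow> 'w \<Rightarrow> real" and g :: "nat \<Rightarrow> real \<Rightarrow> real"
  assumes t0: "0 \<le> t 0" and t: "\<And>j. j < m \<Longrightarrow> t j < t (Suc j)"
    and a: "\<And>j. j < m \<Longrightarrow> a j \<in> borel_at (t j)"
    and bnd: "\<And>j \<omega>. j < m \<Longrightarrow> \<omega> \<in> space M \<Longrightarrow> \<bar>a j \<omega>\<bar> \<le> B j"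
    and g: "\<And>j. j < m \<Longrightarrow> g j \<in> borel_measurable borel"
    and g2: "\<And>j. j < m \<Longrightarrow> integrable M (\<lambda>\<omega>. (g j (\<Delta>W t j \<omega>))\<^sup>2)"
    and g0: "\<And>j. j < m \<Longrightarrow> (\<integral>\<omega>. g j (\<Delta>W t j \<omega>) \<partial>M) = 0"
  shows "(\<lambda>\<omega>. \<Sum>j<m. a j \<omega> * g j (\<Delta>W t j \<omega>)) \<in> borel_at (t m)
    \<and> integrable M (\<lambda>\<omega>. (\<Sum>j<m. a j \<omega> * g j (\<Delta>W t j \<omega>))\<^sup>2)
    \<and> (\<integral>\<omega>. (\<Sum>j<m. a j \<omega> * g j (\<Delta>W t j \<omega>))\<^sup>2 \<partial>M)
      = (\<Sum>j<m. (\<integral>\<omega>. (a j \<omega>)\<^sup>2 \<partial>M) * (\<integral>\<omega>. (g j (\<Delta>W t j \<omega>))\<^sup>2 \<partial>M))"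
  using t a bnd g g2 g0
proof (induction m)
  case 0
  then show ?case by simp
next
  case (Suc m)
  define D where "D j \<omega> = \<Delta>W t j \<omega>" for j \<omega>
  define S where "S \<omega> = (\<Sum>j<m. a j \<omega> * g j (D j \<omega>))" for \<omega>
  have tpos: "0 \<le> t j" if "j \<le> Suc m" for j
    using that
  proof (induction j)
    case 0
    then show ?case using t0 by simp
  next
    case (Suc j)
    then show ?case using Suc.prems Suc.IH \<open>\<And>j. j < Suc m \<Longrightarrow> t j < t (Suc j)\<close>[of j] by linarith
  qed
  have tm: "0 \<le> t m" "t m < t (Suc m)" using tpos[of m] Suc.prems(1)[of m] by simp_all
  have IH: "S \<in> borel_at (t m)" "integrable M (\<lambda>\<omega>. (S \<omega>)\<^sup>2)"
    "(\<integral>\<omega>. (S \<omega>)\<^sup>2 \<partial>M) = (\<Sum>j<m. (\<integral>\<omega>. (a j \<omega>)\<^sup>2 \<partial>M) * (\<integral>\<omega>. (g j (D j \<omega>))\<^sup>2 \<partial>M))"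
  proof -
    have "(\<lambda>\<omega>. \<Sum>j<m. a j \<omega> * g j (\<Delta>W t j \<omega>)) \<in> borel_at (t m)
      \<and> integrable M (\<lambda>\<omega>. (\<Sum>j<m. a j \<omega> * g j (\<Delta>W t j \<omega>))\<^sup>2)
      \<and> (\<integral>\<omega>. (\<Sum>j<m. a j \<omega> * g j (\<Delta>W t j \<omega>))\<^sup>2 \<partial>M)
        = (\<Sum>j<m. (\<integral>\<omega>. (a j \<omega>)\<^sup>2 \<partial>M) * (\<integral>\<omega>. (g j (\<Delta>W t j \<omega>))\<^sup>2 \<partial>M))"
      by (rule Suc.IH) (rule Suc.prems; simp)+
    note IH0 = this[THEN conjunct1] this[THEN conjunct2, THEN conjunct1] this[THEN conjunct2, THEN conjunct2]
    show "S \<in> borel_at (t m)" "integrable M (\<lambda>\<omega>. (S \<omega>)\<^sup>2)"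
      "(\<integral>\<omega>. (S \<omega>)\<^sup>2 \<partial>M) = (\<Sum>j<m. (\<integral>\<omega>. (a j \<omega>)\<^sup>2 \<partial>M) * (\<integral>\<omega>. (g j (D j \<omega>))\<^sup>2 \<partial>M))"
      unfolding S_def[abs_def] D_def[abs_def] by (rule IH0)+
  qed
  have am: "a m \<in> borel_at (t m)" and gm: "g m \<in> borel_measurable borel"
    and bm: "\<And>\<omega>. \<omega> \<in> space M \<Longrightarrow> \<bar>a m \<omega>\<bar> \<le> B m"
    by (rule Suc.prems; simp)+
  have SM [measurable]: "S \<in> borel_measurable M" and aM [measurable]: "a m \<in> borel_measurable M"
    by (rule F_measurable_M[OF IH(1)], rule F_measurable_M[OF am])
  have DM [measurable]: "D m \<in> borel_measurable M"
    unfolding D_def[abs_def] using tpos[of m] tpos[of "Suc m"] by (intro increment_measurable) auto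
  have gM [measurable]: "g m \<in> borel_measurable borel" by (rule gm)
  have g2m: "integrable M (\<lambda>\<omega>. (g m (D m \<omega>))\<^sup>2)" using Suc.prems(5)[of m] by (simp add: D_def)
  have gi: "integrable M (\<lambda>\<omega>. g m (D m \<omega>))"
    by (rule square_integrable_imp_integrable[OF _ g2m]) measurable
  have Si: "integrable M S" by (rule square_integrable_imp_integrable[OF SM IH(2)])
  have Sa: "integrable M (\<lambda>\<omega>. S \<omega> * a m \<omega>)"
  proof (rule Bochner_Integration.integrable_bound[of _ "\<lambda>\<omega>. B m * S \<omega>"])
    show "AE \<omega> in M. norm (S \<omega> * a m \<omega>) \<le> norm (B m * S \<omega>)"
    proof (intro AE_I2)
      fix \<omega> assume "\<omega> \<in> space M"
      then have "\<bar>a m \<omega>\<bar> \<le> \<bar>B m\<bar>" using bm by force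
      then show "norm (S \<omega> * a m \<omega>) \<le> norm (B m * S \<omega>)"
        using mult_left_mono[of "\<bar>a m \<omega>\<bar>" "\<bar>B m\<bar>" "\<bar>S \<omega>\<bar>"] by (simp add: abs_mult mult.commute)
    qed
  qed (use Si in auto)
  have a2: "integrable M (\<lambda>\<omega>. (a m \<omega>)\<^sup>2)"
  proof (rule integrable_bounded_adapted[where s="t m" and B="(B m)\<^sup>2"])
    show "\<bar>(a m \<omega>)\<^sup>2\<bar> \<le> (B m)\<^sup>2" if "\<omega> \<in> space M" for \<omega>
      using power_mono[OF bm[OF that], of 2] by simp
  qed (use am in measurable)
  \<comment> \<open>Independence factors the expectation, and the factor of the new increment is
    zero by \<open>g0\<close>.\<close>
  have cross: "integrable M (\<lambda>\<omega>. (S \<omega> * a m \<omega>) * g m (D m \<omega>))" "(\<integral>\<omega>. (S \<omega> * a m \<omega>) * g m (D m \<omega>) \<partial>M) = 0"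
    using increment_indep[OF tm borel_measurable_times[OF IH(1) am] Sa gm] gi Suc.prems(6)[of m]
    by (simp_all add: D_def)
  have sq: "integrable M (\<lambda>\<omega>. (a m \<omega>)\<^sup>2 * (g m (D m \<omega>))\<^sup>2)"
    "(\<integral>\<omega>. (a m \<omega>)\<^sup>2 * (g m (D m \<omega>))\<^sup>2 \<partial>M) = (\<integral>\<omega>. (a m \<omega>)\<^sup>2 \<partial>M) * (\<integral>\<omega>. (g m (D m \<omega>))\<^sup>2 \<partial>M)"
    using increment_indep[OF tm borel_measurable_power[OF am, of 2] a2, of "\<lambda>x. (g m x)\<^sup>2"] g2m
    by (simp_all add: D_def)
  have e: "(\<Sum>j<Suc m. a j \<omega> * g j (D j \<omega>))\<^sup>2 = (S \<omega>)\<^sup>2 + 2 * ((S \<omega> * a m \<omega>) * g m (D m \<omega>)) + (a m \<omega>)\<^sup>2 * (g m (D m \<omega>))\<^sup>2" for \<omega>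
    by (simp add: S_def power2_eq_square algebra_simps)
  have "(\<lambda>\<omega>. \<Sum>j<Suc m. a j \<omega> * g j (D j \<omega>)) \<in> borel_at (t (Suc m))"
  proof -
    have [measurable]: "S \<in> borel_at (t (Suc m))" "a m \<in> borel_at (t (Suc m))"
      "W (t m) \<in> borel_at (t (Suc m))" "W (t (Suc m)) \<in> borel_at (t (Suc m))"
      using tm tpos[of "Suc m"] by (auto intro!: F_mono_measurable[OF ennreal_leI[OF less_imp_le[OF tm(2)]]] IH(1) am W_adapted)
    have "(\<lambda>\<omega>. S \<omega> + a m \<omega> * g m (D m \<omega>)) \<in> borel_at (t (Suc m))"
      unfolding D_def by measurable
    then show ?thesis by (simp add: S_def)
  qed
  moreover have "integrable M (\<lambda>\<omega>. (\<Sum>j<Suc m. a j \<omega> * g j (D j \<omega>))\<^sup>2)"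
    unfolding e using IH(2) cross(1) sq(1) by auto
  moreover have "(\<integral>\<omega>. (\<Sum>j<Suc m. a j \<omega> * g j (D j \<omega>))\<^sup>2 \<partial>M)
      = (\<Sum>j<Suc m. (\<integral>\<omega>. (a j \<omega>)\<^sup>2 \<partial>M) * (\<integral>\<omega>. (g j (D j \<omega>))\<^sup>2 \<partial>M))"
    unfolding e using IH(2) cross sq by (simp add: IH(3))
  ultimately show ?case by (simp add: D_def)
qed

text \<open>The integrating factor is made so that in \<open>Qinc\<close> the linear terms in
  \<open>w\<close> cancel and the leading part is \<open>c\<^sup>2 * (h - w\<^sup>2) / 2\<close>, of
  mean zero. Hence both moments of \<open>Qinc\<close> are of order \<open>h\<^sup>2\<close>, so a
  sum over a partition vanishes in mean square, while those of \<open>Vinc\<close> are only of order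
  \<open>h\<close>.\<close>

lemma inc_moments:
  assumes ab: "0 \<le> s" "s < t" "t - s \<le> 1"
  defines "h \<equiv> t - s"
  defines "D \<equiv> \<lambda>\<omega>. W t \<omega> - W s \<omega>"
  shows "integrable M (\<lambda>\<omega>. (Qinc c h (D \<omega>))\<^sup>2)" "(\<integral>\<omega>. (Qinc c h (D \<omega>))\<^sup>2 \<partial>M) \<le> Kinc c * h\<^sup>2"
    "integrable M (\<lambda>\<omega>. Qinc c h (D \<omega>))" "\<bar>\<integral>\<omega>. Qinc c h (D \<omega>) \<partial>M\<bar> \<le> Kinc c * h\<^sup>2"
    "integrable M (\<lambda>\<omega>. (Vinc c h (D \<omega>))\<^sup>2)" "(\<integral>\<omega>. (Vinc c h (D \<omega>))\<^sup>2 \<partial>M) \<le> Kinc c * h"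
    "integrable M (\<lambda>\<omega>. Vinc c h (D \<omega>))" "\<bar>\<integral>\<omega>. Vinc c h (D \<omega>) \<partial>M\<bar> \<le> Kinc c * h"
proof -
  define x where "x = c\<^sup>2 * h"
  have h: "0 < h" "h \<le> 1" using ab by (auto simp: h_def)
  have x: "0 \<le> x" "x \<le> c\<^sup>2" using h mult_left_mono[of h 1 "c\<^sup>2"] by (auto simp: x_def)
  note m1 = increment_exp_moments[OF ab(1,2), of "- c", folded h_def D_def]
  note m2 = increment_exp_moments[OF ab(1,2), of "- 2 * c", folded h_def D_def]
  have mm1: "(\<integral>\<omega>. exp (- c * D \<omega>) \<partial>M) = exp (x / 2)" "(\<integral>\<omega>. exp (- c * D \<omega>) * D \<omega> \<partial>M) = exp (x / 2) * (- c * h)"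
    using m1(2,4) by (simp_all add: x_def D_def h_def)
  have mm2: "(\<integral>\<omega>. exp (- 2 * c * D \<omega>) \<partial>M) = exp (2 * x)" "(\<integral>\<omega>. exp (- 2 * c * D \<omega>) * D \<omega> \<partial>M) = exp (2 * x) * (- 2 * c * h)"
    "(\<integral>\<omega>. exp (- 2 * c * D \<omega>) * (D \<omega>)\<^sup>2 \<partial>M) = exp (2 * x) * (4 * c\<^sup>2 * h\<^sup>2 + h)"
    using m2(2,4,6) by (simp_all add: x_def D_def h_def power_mult_distrib)
  have r: "exp (- c * w + c\<^sup>2 * h / 2) = exp (x / 2) * exp (- c * w)" for w
    by (simp only: x_def exp_add[symmetric] add.commute)
  have Qe: "Qinc c h w = exp (x / 2) * exp (- c * w) + c * exp (x / 2) * (exp (- c * w) * w) - 1" for w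
    unfolding Qinc_def r by (simp add: algebra_simps)
  have Ve: "Vinc c h w = exp (x / 2) * (exp (- c * w) * w)" for w
    unfolding Vinc_def r by (simp add: algebra_simps)
  have sqe: "exp (- c * w) * exp (- c * w) = exp (- 2 * c * w)" "exp (x / 2) * exp (x / 2) = exp x" for w
    by (simp_all flip: exp_add)
  have Q2: "(Qinc c h w)\<^sup>2 = exp x * exp (- 2 * c * w) + 2 * c * exp x * (exp (- 2 * c * w) * w) + c\<^sup>2 * exp x * (exp (- 2 * c * w) * w\<^sup>2)
      - 2 * exp (x / 2) * exp (- c * w) - 2 * c * exp (x / 2) * (exp (- c * w) * w) + 1" for w
  proof -
    have "(Qinc c h w)\<^sup>2 = (exp (x / 2) * exp (x / 2)) * (exp (- c * w) * exp (- c * w)) * (1 + c * w)\<^sup>2 - 2 * exp (x / 2) * exp (- c * w) * (1 + c * w) + 1"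
      unfolding Qe by (simp add: power2_eq_square algebra_simps)
    then show ?thesis unfolding sqe by (simp add: power2_eq_square algebra_simps)
  qed
  have V2: "(Vinc c h w)\<^sup>2 = exp x * (exp (- 2 * c * w) * w\<^sup>2)" for w
  proof -
    have "(Vinc c h w)\<^sup>2 = (exp (x / 2) * exp (x / 2)) * (exp (- c * w) * exp (- c * w)) * w\<^sup>2"
      unfolding Ve by (simp add: power2_eq_square)
    then show ?thesis unfolding sqe by simp
  qed
  note i = m1(1,3) m2(1,3,5)
  show "integrable M (\<lambda>\<omega>. (Qinc c h (D \<omega>))\<^sup>2)" unfolding Q2 using i by (auto simp: D_def)
  show "integrable M (\<lambda>\<omega>. Qinc c h (D \<omega>))" unfolding Qe using i by (auto simp: D_def)
  show "integrable M (\<lambda>\<omega>. (Vinc c h (D \<omega>))\<^sup>2)" unfolding V2 using i by (auto simp: D_def)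
  show "integrable M (\<lambda>\<omega>. Vinc c h (D \<omega>))" unfolding Ve using i by (auto simp: D_def)
  have EQ: "(\<integral>\<omega>. Qinc c h (D \<omega>) \<partial>M) = exp x * (1 - x) - 1"
  proof -
    have "(\<integral>\<omega>. Qinc c h (D \<omega>) \<partial>M) = exp (x / 2) * exp (x / 2) + c * exp (x / 2) * (exp (x / 2) * (- c * h)) - 1"
      unfolding Qe using i mm1 by (simp add: D_def prob_space)
    also have "\<dots> = (exp (x / 2) * exp (x / 2)) * (1 - x) - 1" by (simp add: x_def power2_eq_square algebra_simps)
    finally show ?thesis unfolding sqe .
  qed
  have EV: "(\<integral>\<omega>. Vinc c h (D \<omega>) \<partial>M) = - c * h * exp x"
  proof -
    have "(\<integral>\<omega>. Vinc c h (D \<omega>) \<partial>M) = exp (x / 2) * (exp (x / 2) * (- c * h))"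
      unfolding Ve using i mm1 by (simp add: D_def)
    also have "\<dots> = - c * h * (exp (x / 2) * exp (x / 2))" by (simp add: algebra_simps)
    finally show ?thesis unfolding sqe .
  qed
  have e3: "exp x * exp (2 * x) = exp (3 * x)" by (simp flip: exp_add)
  have EV2: "(\<integral>\<omega>. (Vinc c h (D \<omega>))\<^sup>2 \<partial>M) = h * ((1 + 4 * x) * exp (3 * x))"
  proof -
    have "(\<integral>\<omega>. (Vinc c h (D \<omega>))\<^sup>2 \<partial>M) = exp x * (exp (2 * x) * (4 * c\<^sup>2 * h\<^sup>2 + h))"
      unfolding V2 using i mm2 by (simp add: D_def)
    also have "\<dots> = h * ((1 + 4 * x) * (exp x * exp (2 * x)))" by (simp add: x_def power2_eq_square algebra_simps)
    finally show ?thesis unfolding e3 .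
  qed
  have EQ2: "(\<integral>\<omega>. (Qinc c h (D \<omega>))\<^sup>2 \<partial>M) = exp (3 * x) * (1 - 3 * x + 4 * x\<^sup>2) - 2 * (exp x * (1 - x)) + 1"
  proof -
    have "(\<integral>\<omega>. (Qinc c h (D \<omega>))\<^sup>2 \<partial>M) = exp x * exp (2 * x) + 2 * c * exp x * (exp (2 * x) * (- 2 * c * h)) + c\<^sup>2 * exp x * (exp (2 * x) * (4 * c\<^sup>2 * h\<^sup>2 + h))
      - 2 * exp (x / 2) * exp (x / 2) - 2 * c * exp (x / 2) * (exp (x / 2) * (- c * h)) + 1"
      unfolding Q2 using i mm1 mm2 by (simp add: D_def prob_space)
    also have "\<dots> = (exp x * exp (2 * x)) * (1 - 3 * x + 4 * x\<^sup>2) - 2 * ((exp (x / 2) * exp (x / 2)) * (1 - x)) + 1"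
      by (simp add: x_def power2_eq_square algebra_simps)
    finally show ?thesis unfolding sqe e3 .
  qed
  have ex1: "exp x * (1 - x) \<le> 1"
  proof -
    have "1 - x \<le> exp (- x)" using exp_ge_add_one_self[of "- x"] by simp
    then have "exp x * (1 - x) \<le> exp x * exp (- x)" by (intro mult_left_mono) auto
    then show ?thesis by (simp flip: exp_add)
  qed
  have ex3: "exp (3 * x) * (1 - 3 * x) \<le> 1"
  proof -
    have "1 - 3 * x \<le> exp (- (3 * x))" using exp_ge_add_one_self[of "- (3 * x)"] by simp
    then have "exp (3 * x) * (1 - 3 * x) \<le> exp (3 * x) * exp (- (3 * x))" by (intro mult_left_mono) auto
    then show ?thesis by (simp flip: exp_add)
  qed
  \<comment> \<open>Follows from \<open>(1 + x) * (1 - x + x\<^sup>2) = 1 + x ^ 3 \<ge> 1\<close>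
    and \<open>1 + x \<le> exp x\<close>; it makes the error quadratic in \<open>x\<close>.\<close>
  have ex2: "1 - x\<^sup>2 * exp x \<le> exp x * (1 - x)"
  proof -
    have "0 \<le> x ^ 3" using x by simp
    then have "1 \<le> (1 + x) * (1 - x + x\<^sup>2)" by (simp add: power2_eq_square power3_eq_cube algebra_simps)
    also have "\<dots> \<le> exp x * (1 - x + x\<^sup>2)"
    proof (intro mult_right_mono exp_ge_add_one_self)
      have "0 \<le> (x - 1 / 2)\<^sup>2" by simp
      then show "0 \<le> 1 - x + x\<^sup>2" by (simp add: power2_eq_square algebra_simps)
    qed
    finally show ?thesis by (simp add: algebra_simps)
  qed
  have E7: "exp x \<le> exp (7 * c\<^sup>2)" "exp (3 * x) \<le> exp (7 * c\<^sup>2)" "(1 + 4 * x) * exp (3 * x) \<le> exp (7 * c\<^sup>2)"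
  proof -
    show "exp x \<le> exp (7 * c\<^sup>2)" "exp (3 * x) \<le> exp (7 * c\<^sup>2)" using x by auto
    have "(1 + 4 * x) * exp (3 * x) \<le> exp (4 * x) * exp (3 * x)" by (intro mult_right_mono exp_ge_add_one_self) auto
    also have "\<dots> = exp (7 * x)" by (simp flip: exp_add)
    also have "\<dots> \<le> exp (7 * c\<^sup>2)" using x by simp
    finally show "(1 + 4 * x) * exp (3 * x) \<le> exp (7 * c\<^sup>2)" .
  qed
  have x2: "x\<^sup>2 = c ^ 4 * h\<^sup>2" by (simp add: x_def power_mult_distrib)
  have K: "c ^ 4 * exp (7 * c\<^sup>2) \<le> Kinc c" "6 * c ^ 4 * exp (7 * c\<^sup>2) \<le> Kinc c" "\<bar>c\<bar> * exp (7 * c\<^sup>2) \<le> Kinc c" "exp (7 * c\<^sup>2) \<le> Kinc c"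
    unfolding Kinc_def distrib_right by auto
  have "\<bar>exp x * (1 - x) - 1\<bar> \<le> x\<^sup>2 * exp x" using ex1 ex2 by linarith
  also have "\<dots> \<le> x\<^sup>2 * exp (7 * c\<^sup>2)" by (intro mult_left_mono E7) auto
  also have "\<dots> = (c ^ 4 * exp (7 * c\<^sup>2)) * h\<^sup>2" by (simp add: x2 algebra_simps)
  also have "\<dots> \<le> Kinc c * h\<^sup>2" by (intro mult_right_mono K) auto
  finally show "\<bar>\<integral>\<omega>. Qinc c h (D \<omega>) \<partial>M\<bar> \<le> Kinc c * h\<^sup>2" unfolding EQ .
  have "\<bar>- c * h * exp x\<bar> = \<bar>c\<bar> * exp x * h" using h by (simp add: abs_mult)
  also have "\<dots> \<le> \<bar>c\<bar> * exp (7 * c\<^sup>2) * h" using h by (intro mult_right_mono mult_left_mono E7) auto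
  also have "\<dots> \<le> Kinc c * h" using h by (intro mult_right_mono K) auto
  finally show "\<bar>\<integral>\<omega>. Vinc c h (D \<omega>) \<partial>M\<bar> \<le> Kinc c * h" unfolding EV .
  have "h * ((1 + 4 * x) * exp (3 * x)) \<le> h * Kinc c" using h E7(3) K(4) by (intro mult_left_mono) auto
  then show "(\<integral>\<omega>. (Vinc c h (D \<omega>))\<^sup>2 \<partial>M) \<le> Kinc c * h" unfolding EV2 by (simp add: mult.commute)
  have "exp (3 * x) * (1 - 3 * x + 4 * x\<^sup>2) - 2 * (exp x * (1 - x)) + 1 \<le> 4 * x\<^sup>2 * exp (3 * x) + 2 * x\<^sup>2 * exp x"
    using ex3 ex2 by (simp add: algebra_simps)
  also have "\<dots> \<le> 4 * x\<^sup>2 * exp (7 * c\<^sup>2) + 2 * x\<^sup>2 * exp (7 * c\<^sup>2)" by (intro add_mono mult_left_mono E7) auto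
  also have "\<dots> = (6 * c ^ 4 * exp (7 * c\<^sup>2)) * h\<^sup>2" by (simp add: x2 algebra_simps)
  also have "\<dots> \<le> Kinc c * h\<^sup>2" by (intro mult_right_mono K) auto
  finally show "(\<integral>\<omega>. (Qinc c h (D \<omega>))\<^sup>2 \<partial>M) \<le> Kinc c * h\<^sup>2" unfolding EQ2 .
qed

end

section \<open>Partitions\<close>

text \<open>The points of \<open>S\<close> are the jump times of an elementary integrand; no cell
  may contain one in its interior. The partition is a uniform grid together with \<open>S\<close>,
  in increasing order.\<close>

lemma partition_exists:
  fixes R \<delta> :: real
  assumes S: "finite S" and R: "0 < R" and \<delta>: "0 < \<delta>"
  obtains m and t :: "nat \<Rightarrow> real" where "t 0 = 0" "t m = R" "\<And>j. j < m \<Longrightarrow> t j < t (Suc j)"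
    "\<And>j. j < m \<Longrightarrow> t (Suc j) - t j \<le> \<delta>" "\<And>j s. j < m \<Longrightarrow> s \<in> S \<Longrightarrow> s \<le> t j \<or> t (Suc j) \<le> s"
proof -
  obtain n :: nat where n: "R / \<delta> < n" using reals_Archimedean2 by blast
  then have n0: "0 < n" using R \<delta> by (metis divide_pos_pos less_trans of_nat_0_less_iff)
  define D where "D = (\<lambda>i. R * real i / real n) ` {..n} \<union> (S \<inter> {0..R})"
  have fin: "finite D" using S by (simp add: D_def)
  have "R * real 0 / real n \<in> D" "R * real n / real n \<in> D" unfolding D_def by blast+
  then have D0: "0 \<in> D" "R \<in> D" using n0 by simp_all
  have DR: "D \<subseteq> {0..R}" using n0 R by (auto simp: D_def field_simps)
  define xs where "xs = sorted_list_of_set D"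
  have set: "set xs = D" and sorted: "sorted_wrt (<) xs" using fin by (auto simp: xs_def strict_sorted_iff)
  have ne: "xs \<noteq> []" using set D0 by auto
  define t where "t j = xs ! j" for j
  define m where "m = length xs - 1"
  have len: "length xs = Suc m" using ne by (simp add: m_def)
  have less: "t i < t j" if "i < j" "j \<le> m" for i j
    using sorted_wrt_nth_less[OF sorted] that len by (simp add: t_def)
  have inD: "t j \<in> D" if "j \<le> m" for j using that len set nth_mem[of j xs] by (simp add: t_def)
  have ex: "\<exists>j\<le>m. t j = x" if "x \<in> D" for x
    using that set len unfolding t_def by (metis in_set_conv_nth less_Suc_eq_le)
  have gap: "x \<le> t j \<or> t (Suc j) \<le> x" if j: "j < m" and x: "x \<in> D" for x j
  proof -
    obtain i where i: "i \<le> m" "t i = x" using ex[OF x] by blast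
    show ?thesis
    proof (cases "i \<le> j")
      case True
      then show ?thesis using less[of i j] i j by (cases "i = j") auto
    next
      case False
      then show ?thesis using less[of "Suc j" i] i by (cases "i = Suc j") auto
    qed
  qed
  show thesis
  proof (rule that[of t m])
    show "t 0 = 0"
    proof -
      obtain i where i: "i \<le> m" "t i = 0" using ex[OF D0(1)] by blast
      have "t 0 \<le> t i" using less[of 0 i] i by (cases "i = 0") auto
      then show ?thesis using i inD[of 0] DR by force
    qed
    show "t m = R"
    proof -
      obtain i where i: "i \<le> m" "t i = R" using ex[OF D0(2)] by blast
      have "t i \<le> t m" using less[of i m] i by (cases "i = m") auto
      then show ?thesis using i inD[of m] DR by force
    qed
    show "t j < t (Suc j)" if "j < m" for j using less[of j "Suc j"] that by simp
    show "s \<le> t j \<or> t (Suc j) \<le> s" if "j < m" "s \<in> S" for j s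
    proof (cases "s \<in> {0..R}")
      case True
      then show ?thesis using gap[OF that(1), of s] that by (auto simp: D_def)
    next
      case False
      then show ?thesis using inD[of j] inD[of "Suc j"] DR that by force
    qed
    show "t (Suc j) - t j \<le> \<delta>" if j: "j < m" for j
    proof (rule ccontr)
      assume "\<not> t (Suc j) - t j \<le> \<delta>"
      then have g: "t (Suc j) > t j + R / n"
      proof -
        have "R / n < \<delta>" using n n0 \<delta> R by (simp add: field_simps)
        then show ?thesis using \<open>\<not> t (Suc j) - t j \<le> \<delta>\<close> by linarith
      qed
      \<comment> \<open>The index of the first grid point after \<open>t j\<close>. It lies at most
        \<open>R / n\<close> to the right and hence strictly inside the supposedly long
        cell.\<close>
      define i where "i = nat \<lfloor>t j * n / R\<rfloor> + 1"
      have tj: "0 \<le> t j" "t (Suc j) \<le> R" using inD[of j] inD[of "Suc j"] DR j by auto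
      have pos: "0 \<le> t j * n / R" using tj R by simp
      have i1: "t j * n / R < real i" "real i \<le> t j * n / R + 1"
        using pos unfolding i_def by linarith+
      have "t j < R * real i / n" using i1(1) R n0 by (simp add: field_simps)
      moreover have i2: "R * real i / n \<le> t j + R / n"
      proof -
        have "R * real i \<le> R * (t j * n / R + 1)" using i1(2) R by (intro mult_left_mono) auto
        also have "\<dots> = t j * n + R" using R by (simp add: field_simps)
        finally show ?thesis using n0 by (simp add: field_simps)
      qed
      moreover have "R * real i / n \<in> D"
      proof -
        have "R * real i / n < R" using i2 g tj by linarith
        then have "i \<le> n" using R n0 by (simp add: field_simps)
        then show ?thesis by (auto simp: D_def)
      qed
      ultimately show False using gap[OF j, of "R * real i / n"] g by linarith
    qed
  qed
qed

section \<open>The path-wise limit of the discretised product rule\<close>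

text \<open>The scalar counterparts of \<open>elementary_process\<close> and
  \<open>elementary_integral\<close> for a fixed path and a fixed point of the torus.\<close>

definition step_value :: "nat \<Rightarrow> (nat \<Rightarrow> real) \<Rightarrow> (nat \<Rightarrow> real) \<Rightarrow> real \<Rightarrow> real" where
  "step_value N p \<xi> s = (\<Sum>i<N. indicator {p i<..p (Suc i)} s * \<xi> i)"

definition step_integral :: "(real \<Rightarrow> real) \<Rightarrow> nat \<Rightarrow> (nat \<Rightarrow> real) \<Rightarrow> (nat \<Rightarrow> real) \<Rightarrow> real \<Rightarrow> real" where
  "step_integral w N p \<xi> s = (\<Sum>i<N. (w (min (p (Suc i)) s) - w (min (p i) s)) * \<xi> i)"

lemma step_cell:
  assumes p: "\<And>i. i < N \<Longrightarrow> p i \<le> p (Suc i)" and ab: "a < b"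
    and cell: "\<And>i. i \<le> N \<Longrightarrow> p i \<le> a \<or> b \<le> p i"
  shows "step_integral w N p \<xi> b - step_integral w N p \<xi> a = step_value N p \<xi> b * (w b - w a)"
    and "s \<in> {a<..b} \<Longrightarrow> step_value N p \<xi> s = step_value N p \<xi> b"
proof -
  have 1: "(w (min (p (Suc i)) b) - w (min (p i) b)) * \<xi> i - (w (min (p (Suc i)) a) - w (min (p i) a)) * \<xi> i
     = indicator {p i<..p (Suc i)} b * \<xi> i * (w b - w a)" if i: "i < N" for i
  proof -
    have c: "p i \<le> a \<or> b \<le> p i" "p (Suc i) \<le> a \<or> b \<le> p (Suc i)" "p i \<le> p (Suc i)"
      using cell[of i] cell[of "Suc i"] p[OF i] i by auto
    consider "p i \<le> a" "p (Suc i) \<le> a" | "p i \<le> a" "b \<le> p (Suc i)" | "b \<le> p i" "b \<le> p (Suc i)"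
      using c ab by linarith
    then show ?thesis
      by cases (use ab in \<open>auto simp: indicator_def min_def algebra_simps\<close>)
  qed
  show "step_integral w N p \<xi> b - step_integral w N p \<xi> a = step_value N p \<xi> b * (w b - w a)"
    unfolding step_integral_def step_value_def sum_subtractf[symmetric] sum_distrib_right
    by (intro sum.cong refl 1) simp
  show "step_value N p \<xi> s = step_value N p \<xi> b" if s: "s \<in> {a<..b}"
    unfolding step_value_def
  proof (intro sum.cong refl)
    fix i assume "i \<in> {..<N}"
    then have "p i \<le> a \<or> b \<le> p i" "p (Suc i) \<le> a \<or> b \<le> p (Suc i)" using cell[of i] cell[of "Suc i"] by auto
    then show "indicator {p i<..p (Suc i)} s * \<xi> i = indicator {p i<..p (Suc i)} b * \<xi> i"
      using s by (auto simp: indicator_def)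
  qed
qed

lemma partition_mono:
  fixes t :: "nat \<Rightarrow> real"
  assumes "\<And>j. j < m \<Longrightarrow> t j < t (Suc j)" "i \<le> j" "j \<le> m"
  shows "t i \<le> t j"
  using assms(2,3)
proof (induction j)
  case (Suc j)
  then show ?case using assms(1)[of j] by (cases "i = Suc j") (auto intro: order_trans less_imp_le)
qed simp

text \<open>One fixed path: \<open>w\<close> is the Brownian path, \<open>Y\<close> the stopped
  solution at a fixed point, \<open>I\<close> its stochastic integral, \<open>\<rho>\<close> the
  stopping time capped at \<open>R\<close>, and \<open>k\<close> numbers the approximations. The
  mesh \<open>\<delta> k\<close> is small relative to the bound \<open>C k\<close> so that a single
  cell never matters.\<close>

locale discretised_path =
  fixes R \<rho> c a0 :: real and w Y I b :: "real \<Rightarrow> real"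
    and m :: "nat \<Rightarrow> nat" and t :: "nat \<Rightarrow> nat \<Rightarrow> real"
    and N :: "nat \<Rightarrow> nat" and p :: "nat \<Rightarrow> nat \<Rightarrow> real" and \<xi> :: "nat \<Rightarrow> nat \<Rightarrow> real"
    and C \<delta> :: "nat \<Rightarrow> real"
  assumes \<rho>: "0 < \<rho>" "\<rho> \<le> R"
    and w: "continuous_on {0..R} w" "w 0 = 0"
    and Y: "continuous_on {0..R} Y" "\<And>s. s \<in> {\<rho>..R} \<Longrightarrow> Y s = Y \<rho>"
    and b: "continuous_on {0..\<rho>} b"
    and A: "\<And>s. s \<in> {0..R} \<Longrightarrow> Y s - I s = a0 - integral {0..min s \<rho>} b"
    and t0: "\<And>k. t k 0 = 0" and tm: "\<And>k. t k (m k) = R"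
    and t_less: "\<And>k j. j < m k \<Longrightarrow> t k j < t k (Suc j)"
    and mesh: "\<And>k j. j < m k \<Longrightarrow> t k (Suc j) - t k j \<le> \<delta> k"
    and cell: "\<And>k j i. j < m k \<Longrightarrow> i \<le> N k \<Longrightarrow> p k i \<le> t k j \<or> t k (Suc j) \<le> p k i"
    and p: "\<And>k. 0 \<le> p k 0" "\<And>k i. i < N k \<Longrightarrow> p k i \<le> p k (Suc i)"
    and C: "\<And>k s. \<bar>step_value (N k) (p k) (\<xi> k) s\<bar> \<le> C k"
    and \<delta>: "(\<lambda>k. \<delta> k * (1 + C k)\<^sup>2) \<longlonglongrightarrow> 0" "\<And>k. 0 < \<delta> k"
    and conv_I: "\<And>e. e > 0 \<Longrightarrow> \<forall>\<^sub>F k in sequentially. \<forall>s\<in>{0..R}. \<bar>step_integral w (N k) (p k) (\<xi> k) s - I s\<bar> \<le> e"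
    and conv_X: "\<And>e. e > 0 \<Longrightarrow> \<forall>\<^sub>F k in sequentially.
      (\<integral>\<^sup>+s\<in>{0..R}. ennreal ((step_value (N k) (p k) (\<xi> k) s - (if s \<le> \<rho> then c * Y s else 0))\<^sup>2) \<partial>lborel) \<le> ennreal e"
begin

definition Z where "Z s = exp (- c * w s + c\<^sup>2 * s / 2)"
text \<open>\<open>Y\<close> with its stochastic integral replaced by the elementary one, so that
  the increments over cells are explicit. In \<open>err\<close> the elementary integrand is
  evaluated at the right end because its steps are open on the left.\<close>

definition Yn where "Yn k s = Y s + step_integral w (N k) (p k) (\<xi> k) s - I s"
definition err where "err k j = step_value (N k) (p k) (\<xi> k) (t k (Suc j)) - c * Yn k (t k j)"

lemma C_nonneg: "0 \<le> C k"
  using C[of k 0] by linarith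

lemma t_mono: "i \<le> j \<Longrightarrow> j \<le> m k \<Longrightarrow> t k i \<le> t k j"
  by (rule partition_mono[where t="t k" and m="m k"]) (auto intro: t_less)

lemma t_range:
  assumes "j \<le> m k"
  shows "t k j \<in> {0..R}"
  using t_mono[of 0 j k] t_mono[of j "m k" k] assms
  by (simp add: t0 tm)

lemma \<delta>_tendsto: "\<delta> \<longlonglongrightarrow> 0"
proof (rule tendsto_sandwich[OF _ _ tendsto_const \<delta>(1)])
  show "\<forall>\<^sub>F k in sequentially. 0 \<le> \<delta> k" using \<delta>(2) by (intro always_eventually allI less_imp_le)
  have "\<delta> k * 1 \<le> \<delta> k * (1 + C k)\<^sup>2" for k
    using \<delta>(2)[of k] C_nonneg[of k] by (intro mult_left_mono) (auto simp: one_le_power)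
  then show "\<forall>\<^sub>F k in sequentially. \<delta> k \<le> \<delta> k * (1 + C k)\<^sup>2" by simp
qed

lemma Z_cont: "continuous_on {0..R} Z"
  unfolding Z_def by (intro continuous_intros w) auto

lemma bounded_cont:
  fixes f :: "real \<Rightarrow> real"
  assumes "continuous_on {x..y} f"
  shows "\<exists>B>0. \<forall>s\<in>{x..y}. \<bar>f s\<bar> \<le> B"
proof -
  have "bounded (f ` {x..y})" by (intro compact_imp_bounded compact_continuous_image assms) simp
  then show ?thesis by (auto simp: bounded_pos)
qed

lemma modulus:
  fixes f :: "real \<Rightarrow> real"
  assumes f: "continuous_on {0..R} f" and e: "e > 0"
  shows "\<forall>\<^sub>F k in sequentially. \<forall>r\<in>{0..R}. \<forall>s\<in>{0..R}. \<bar>r - s\<bar> \<le> \<delta> k \<longrightarrow> \<bar>f r - f s\<bar> \<le> e"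
proof -
  have "uniformly_continuous_on {0..R} f" by (intro compact_uniformly_continuous f) simp
  then obtain d where d: "d > 0" "\<And>r s. r \<in> {0..R} \<Longrightarrow> s \<in> {0..R} \<Longrightarrow> dist s r < d \<Longrightarrow> dist (f s) (f r) < e"
    using e unfolding uniformly_continuous_on_def by metis
  have "\<forall>\<^sub>F k in sequentially. \<delta> k < d" using \<delta>_tendsto d(1) by (simp add: order_tendsto_iff)
  then show ?thesis
  proof eventually_elim
    case (elim k)
    show ?case
    proof (intro ballI impI)
      fix r s assume "r \<in> {0..R}" "s \<in> {0..R}" "\<bar>r - s\<bar> \<le> \<delta> k"
      then show "\<bar>f r - f s\<bar> \<le> e" using d(2)[of s r] elim by (simp add: dist_real_def)
    qed
  qed
qed

lemma Y_meas: "(\<lambda>s. indicator {0..R} s * Y s) \<in> borel_measurable borel"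
  using borel_measurable_continuous_on_indicator[OF _ Y(1)] by simp

text \<open>In a cell before \<open>\<rho>\<close> the error consists of the deviation of the
  integrand, the oscillation of \<open>Y\<close> over the cell and the deviation of the integral.
  The first is summed through the time integral in \<open>conv_X\<close>, the others are uniformly
  small; 3 and 6 come from squaring three summands.\<close>

lemma err_full_cells:
  assumes \<kappa>: "\<kappa> > 0"
  shows "\<forall>\<^sub>F k in sequentially. (\<Sum>j | j < m k \<and> t k (Suc j) \<le> \<rho>. (t k (Suc j) - t k j) * (err k j)\<^sup>2) \<le> 3 * \<kappa> + 6 * c\<^sup>2 * \<kappa>\<^sup>2 * R"
  using conv_X[OF \<kappa>] conv_I[OF \<kappa>] modulus[OF Y(1) \<kappa>]
proof eventually_elim
  case (elim k)
  let ?v = "step_value (N k) (p k) (\<xi> k)"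
  let ?J = "{j. j < m k \<and> t k (Suc j) \<le> \<rho>}"
  let ?c = "\<lambda>j. {t k j<..t k (Suc j)}"
  let ?f = "\<lambda>s. (?v s - (if s \<le> \<rho> then c * Y s else 0))\<^sup>2"
  have fin: "finite ?J" by simp
  have rng: "t k j \<in> {0..R}" "t k (Suc j) \<in> {0..R}" if "j < m k" for j
    using t_range[of j k] t_range[of "Suc j" k] that by auto
  have pt: "(err k j)\<^sup>2 \<le> 3 * ?f s + 6 * c\<^sup>2 * \<kappa>\<^sup>2" if j: "j \<in> ?J" and s: "s \<in> ?c j" for j s
  proof -
    have jm: "j < m k" "t k (Suc j) \<le> \<rho>" using j by auto
    have sR: "s \<in> {0..R}" "s \<le> \<rho>" using s rng[OF jm(1)] jm(2) by auto
    have v: "?v s = ?v (t k (Suc j))"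
      by (rule step_cell(2)[where a="t k j" and b="t k (Suc j)"]) (use p(2) t_less[OF jm(1)] cell[OF jm(1)] s in auto)
    define x y z where "x = ?v s - c * Y s" and "y = c * (Y s - Y (t k j))"
      and "z = - c * (step_integral w (N k) (p k) (\<xi> k) (t k j) - I (t k j))"
    have e: "err k j = x + y + z" unfolding err_def Yn_def x_def y_def z_def v by (simp add: algebra_simps)
    have "\<bar>s - t k j\<bar> \<le> \<delta> k" using mesh[OF jm(1)] s by auto
    then have "\<bar>Y s - Y (t k j)\<bar> \<le> \<kappa>" using elim(3) sR rng[OF jm(1)] by blast
    then have y: "y\<^sup>2 \<le> c\<^sup>2 * \<kappa>\<^sup>2"
      unfolding y_def power_mult_distrib by (intro mult_left_mono) (auto simp: abs_le_square_iff[symmetric])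
    have "\<bar>step_integral w (N k) (p k) (\<xi> k) (t k j) - I (t k j)\<bar> \<le> \<kappa>" using elim(2) rng[OF jm(1)] by blast
    then have z: "z\<^sup>2 \<le> c\<^sup>2 * \<kappa>\<^sup>2"
      unfolding z_def power_mult_distrib by (simp add: mult_left_mono abs_le_square_iff[symmetric])
    have "(x + y + z)\<^sup>2 \<le> 3 * x\<^sup>2 + 3 * y\<^sup>2 + 3 * z\<^sup>2"
      using zero_le_power2[of "x - y"] zero_le_power2[of "x - z"] zero_le_power2[of "y - z"]
      by (simp add: power2_eq_square algebra_simps)
    then show ?thesis unfolding e using y z sR(2) by (simp add: x_def)
  qed
  have e3: "ennreal (3 * x + y) = 3 * ennreal x + ennreal y" if "0 \<le> x" "0 \<le> y" for x y
    using that by (simp add: ennreal_mult)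
  have fm: "(\<lambda>s. indicator {0..R} s * ?f s) \<in> borel_measurable borel"
  proof -
    have "(\<lambda>s. indicator {0..R} s * ?f s) = (\<lambda>s. indicator {0..R} s * (?v s - (if s \<le> \<rho> then c * (indicator {0..R} s * Y s) else 0))\<^sup>2)"
      by (auto simp: fun_eq_iff indicator_def)
    moreover have "\<dots> \<in> borel_measurable borel"
      unfolding step_value_def using Y_meas by measurable
    ultimately show ?thesis by simp
  qed
  have "ennreal (\<Sum>j\<in>?J. (t k (Suc j) - t k j) * (err k j)\<^sup>2) = (\<Sum>j\<in>?J. \<integral>\<^sup>+s. ennreal ((err k j)\<^sup>2) * indicator (?c j) s \<partial>lborel)"
  proof -
    have i: "(\<integral>\<^sup>+s. ennreal ((err k j)\<^sup>2) * indicator (?c j) s \<partial>lborel) = ennreal ((t k (Suc j) - t k j) * (err k j)\<^sup>2)" if "j \<in> ?J" for j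
      using t_less[of j k] that by (subst nn_integral_cmult_indicator) (auto simp: ennreal_mult[symmetric] mult.commute)
    have nn: "0 \<le> (t k (Suc j) - t k j) * (err k j)\<^sup>2" if "j \<in> ?J" for j
      using t_less[of j k] that by simp
    have "ennreal (\<Sum>j\<in>?J. (t k (Suc j) - t k j) * (err k j)\<^sup>2) = (\<Sum>j\<in>?J. ennreal ((t k (Suc j) - t k j) * (err k j)\<^sup>2))"
      by (rule sum_ennreal[symmetric]) (rule nn)
    also have "\<dots> = (\<Sum>j\<in>?J. \<integral>\<^sup>+s. ennreal ((err k j)\<^sup>2) * indicator (?c j) s \<partial>lborel)"
      by (rule sum.cong[OF refl]) (rule i[symmetric])
    finally show ?thesis .
  qed
  also have "\<dots> = (\<integral>\<^sup>+s. (\<Sum>j\<in>?J. ennreal ((err k j)\<^sup>2) * indicator (?c j) s) \<partial>lborel)"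
    by (rule nn_integral_sum[symmetric]) auto
  also have "\<dots> \<le> (\<integral>\<^sup>+s. 3 * ennreal (indicator {0..R} s * ?f s) + ennreal (6 * c\<^sup>2 * \<kappa>\<^sup>2) * indicator {0..R} s \<partial>lborel)"
  proof (intro nn_integral_mono)
    fix s :: real
    show "(\<Sum>j\<in>?J. ennreal ((err k j)\<^sup>2) * indicator (?c j) s) \<le> 3 * ennreal (indicator {0..R} s * ?f s) + ennreal (6 * c\<^sup>2 * \<kappa>\<^sup>2) * indicator {0..R} s"
    proof (cases "\<exists>j\<in>?J. s \<in> ?c j")
      case True
      then obtain j where j: "j \<in> ?J" "s \<in> ?c j" by blast
      have uniq: "i = j" if "i \<in> ?J" "s \<in> ?c i" for i
      proof (rule ccontr)
        assume "i \<noteq> j"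
        then consider "Suc i \<le> j" | "Suc j \<le> i" by linarith
        then show False
          using t_mono[of "Suc i" j k] t_mono[of "Suc j" i k] j that
          by cases auto
      qed
      have "(\<Sum>i\<in>?J. ennreal ((err k i)\<^sup>2) * indicator (?c i) s) = (\<Sum>i\<in>{j}. ennreal ((err k i)\<^sup>2) * indicator (?c i) s)"
      proof (rule sum.mono_neutral_right[OF fin])
        show "{j} \<subseteq> ?J" using j(1) by blast
        show "\<forall>i\<in>?J - {j}. ennreal ((err k i)\<^sup>2) * indicator (?c i) s = 0"
        proof
          fix i assume "i \<in> ?J - {j}"
          then have "s \<notin> ?c i" using uniq[of i] by blast
          then show "ennreal ((err k i)\<^sup>2) * indicator (?c i) s = 0" by simp
        qed
      qed
      also have "\<dots> = ennreal ((err k j)\<^sup>2)" using j by simp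
      also have "\<dots> \<le> ennreal (3 * ?f s + 6 * c\<^sup>2 * \<kappa>\<^sup>2)" by (intro ennreal_leI pt j)
      also have "\<dots> = 3 * ennreal (?f s) + ennreal (6 * c\<^sup>2 * \<kappa>\<^sup>2)"
        by (rule e3) simp_all
      also have "s \<in> {0..R}" using j rng[of j] by auto
      then have "3 * ennreal (?f s) + ennreal (6 * c\<^sup>2 * \<kappa>\<^sup>2) = 3 * ennreal (indicator {0..R} s * ?f s) + ennreal (6 * c\<^sup>2 * \<kappa>\<^sup>2) * indicator {0..R} s"
        by simp
      finally show ?thesis .
    next
      case False
      then have "(\<Sum>i\<in>?J. ennreal ((err k i)\<^sup>2) * indicator (?c i) s) = 0" by (intro sum.neutral) (auto simp: indicator_def)
      then show ?thesis by simp
    qed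
  qed
  also have "\<dots> = 3 * (\<integral>\<^sup>+s. ennreal (indicator {0..R} s * ?f s) \<partial>lborel) + ennreal (6 * c\<^sup>2 * \<kappa>\<^sup>2) * emeasure lborel {0..R}"
    using fm by (subst nn_integral_add) (auto simp: nn_integral_cmult nn_integral_cmult_indicator)
  also have "(\<integral>\<^sup>+s. ennreal (indicator {0..R} s * ?f s) \<partial>lborel) = (\<integral>\<^sup>+s\<in>{0..R}. ennreal (?f s) \<partial>lborel)"
    by (intro nn_integral_cong) (auto simp: indicator_def)
  also have "3 * \<dots> + ennreal (6 * c\<^sup>2 * \<kappa>\<^sup>2) * emeasure lborel {0..R} \<le> 3 * ennreal \<kappa> + ennreal (6 * c\<^sup>2 * \<kappa>\<^sup>2) * ennreal R"
    using elim(1) \<rho> by (intro add_mono mult_left_mono) auto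
  also have "\<dots> = ennreal (3 * \<kappa> + 6 * c\<^sup>2 * \<kappa>\<^sup>2 * R)"
  proof -
    have "ennreal (6 * c\<^sup>2 * \<kappa>\<^sup>2) * ennreal R = ennreal (6 * c\<^sup>2 * \<kappa>\<^sup>2 * R)"
      using \<rho> by (intro ennreal_mult[symmetric]) auto
    then show ?thesis using e3[of \<kappa> "6 * c\<^sup>2 * \<kappa>\<^sup>2 * R"] \<kappa> \<rho> by simp
  qed
  finally show ?case using \<kappa> \<rho> by (subst (asm) ennreal_le_iff) auto
qed

text \<open>At most one cell has \<open>\<rho>\<close> in its interior. The integrand is meant to
  approximate \<open>0\<close> behind \<open>\<rho>\<close>, so \<open>conv_X\<close> is of no use
  there; the crude bound \<open>C k\<close> times the mesh is.\<close>

lemma err_partial_cell: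
  assumes \<kappa>: "\<kappa> > 0" "\<kappa> \<le> 1" and V: "\<And>s. s \<in> {0..R} \<Longrightarrow> \<bar>Y s\<bar> \<le> V"
  shows "\<forall>\<^sub>F k in sequentially. (\<Sum>j | j < m k \<and> t k j < \<rho> \<and> \<rho> < t k (Suc j). (t k (Suc j) - t k j) * (err k j)\<^sup>2)
    \<le> 2 * \<kappa> * (1 + c\<^sup>2 * (V + 1)\<^sup>2)"
proof -
  have "\<forall>\<^sub>F k in sequentially. \<delta> k * (1 + C k)\<^sup>2 < \<kappa>" using \<delta>(1) \<kappa> by (simp add: order_tendsto_iff)
  then show ?thesis
    using conv_I[OF \<kappa>(1)]
  proof eventually_elim
    case (elim k)
    let ?P = "{j. j < m k \<and> t k j < \<rho> \<and> \<rho> < t k (Suc j)}"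
    have b: "(t k (Suc j) - t k j) * (err k j)\<^sup>2 \<le> 2 * \<kappa> * (1 + c\<^sup>2 * (V + 1)\<^sup>2)" if j: "j \<in> ?P" for j
    proof -
      have jR: "t k j \<in> {0..R}" using j t_range[of j k] by auto
      define x where "x = step_value (N k) (p k) (\<xi> k) (t k (Suc j))"
      define y where "y = Yn k (t k j)"
      have x: "x\<^sup>2 \<le> (C k)\<^sup>2" using C[of k "t k (Suc j)"] C_nonneg[of k] by (simp add: x_def abs_le_square_iff[symmetric])
      have "\<bar>y\<bar> \<le> V + \<kappa>" using elim(2) jR V[OF jR] unfolding y_def Yn_def by (smt (verit, best))
      then have y: "y\<^sup>2 \<le> (V + 1)\<^sup>2" using \<kappa> by (intro abs_le_square_iff[THEN iffD1]) linarith
      have "(err k j)\<^sup>2 = (x - c * y)\<^sup>2" by (simp add: err_def x_def y_def)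
      also have "\<dots> \<le> 2 * x\<^sup>2 + 2 * (c * y)\<^sup>2"
        using zero_le_power2[of "x + c * y"] by (simp add: power2_eq_square algebra_simps)
      also have "\<dots> \<le> 2 * (C k)\<^sup>2 + 2 * (c\<^sup>2 * (V + 1)\<^sup>2)"
        unfolding power_mult_distrib by (intro add_mono mult_left_mono x y) auto
      finally have e: "(err k j)\<^sup>2 \<le> 2 * (C k)\<^sup>2 + 2 * (c\<^sup>2 * (V + 1)\<^sup>2)" .
      have "(t k (Suc j) - t k j) * (err k j)\<^sup>2 \<le> \<delta> k * (2 * (C k)\<^sup>2 + 2 * (c\<^sup>2 * (V + 1)\<^sup>2))"
        using j mesh[of j k] \<delta>(2)[of k] e by (intro mult_mono) (auto simp: less_imp_le)
      also have "\<dots> = 2 * (\<delta> k * (C k)\<^sup>2) + 2 * (\<delta> k * (c\<^sup>2 * (V + 1)\<^sup>2))" by (simp add: algebra_simps)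
      also have "\<dots> \<le> 2 * \<kappa> + 2 * (\<kappa> * (c\<^sup>2 * (V + 1)\<^sup>2))"
      proof (intro add_mono mult_left_mono mult_right_mono)
        have "(C k)\<^sup>2 \<le> (1 + C k)\<^sup>2" "1 \<le> (1 + C k)\<^sup>2" using C_nonneg[of k] by (auto intro: power_mono simp: one_le_power)
        then have "\<delta> k * (C k)\<^sup>2 \<le> \<delta> k * (1 + C k)\<^sup>2" "\<delta> k * 1 \<le> \<delta> k * (1 + C k)\<^sup>2"
          using \<delta>(2)[of k] by (auto intro: mult_left_mono simp del: mult_1_right)
        then show "\<delta> k * (C k)\<^sup>2 \<le> \<kappa>" "\<delta> k \<le> \<kappa>" using elim(1) by auto
      qed auto
      finally show ?thesis by (simp add: algebra_simps)
    qed
    have nonneg: "0 \<le> 2 * \<kappa> * (1 + c\<^sup>2 * (V + 1)\<^sup>2)" using \<kappa> by simp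
    have uniq: "i = j" if "i \<in> ?P" "j \<in> ?P" for i j
    proof (rule ccontr)
      assume "i \<noteq> j"
      then consider "Suc i \<le> j" | "Suc j \<le> i" by linarith
      then show False
        using t_mono[of "Suc i" j k] t_mono[of "Suc j" i k] that
        by cases auto
    qed
    show ?case
    proof (cases "?P = {}")
      case True
      then show ?thesis using nonneg by (simp only: sum.empty)
    next
      case False
      then obtain j where "?P = {j}" using uniq by blast
      then show ?thesis using b[of j] by (metis (mono_tags, lifting) finite.emptyI insertI1 sum.empty sum.insert empty_iff add_0_right)
    qed
  qed
qed

text \<open>This weighted sum of squares is exactly what controls the \<open>Vinc\<close> part of
  the discretised rule in mean square.\<close>

lemma err_sum_tendsto: "(\<lambda>k. \<Sum>j | j < m k \<and> t k j < \<rho>. (t k (Suc j) - t k j) * (err k j)\<^sup>2) \<longlonglongrightarrow> 0"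
proof (rule tendstoI)
  fix \<epsilon> :: real assume \<epsilon>: "\<epsilon> > 0"
  obtain V where V: "V > 0" "\<And>s. s \<in> {0..R} \<Longrightarrow> \<bar>Y s\<bar> \<le> V" using bounded_cont[OF Y(1)] by blast
  define K where "K = 3 + 6 * c\<^sup>2 * R + 2 * (1 + c\<^sup>2 * (V + 1)\<^sup>2)"
  have K: "K > 0" using \<rho> by (simp add: K_def add_pos_nonneg)
  define \<kappa> where "\<kappa> = min 1 (\<epsilon> / (2 * K))"
  have \<kappa>: "\<kappa> > 0" "\<kappa> \<le> 1" using \<epsilon> K by (auto simp: \<kappa>_def)
  have p2: "\<forall>\<^sub>F k in sequentially. (\<Sum>j | j < m k \<and> t k j < \<rho> \<and> \<rho> < t k (Suc j). (t k (Suc j) - t k j) * (err k j)\<^sup>2)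
    \<le> 2 * \<kappa> * (1 + c\<^sup>2 * (V + 1)\<^sup>2)"
    by (rule err_partial_cell[OF \<kappa>]) (rule V(2))
  show "\<forall>\<^sub>F k in sequentially. dist (\<Sum>j | j < m k \<and> t k j < \<rho>. (t k (Suc j) - t k j) * (err k j)\<^sup>2) 0 < \<epsilon>"
    using err_full_cells[OF \<kappa>(1)] p2
  proof eventually_elim
    case (elim k)
    let ?s = "\<lambda>j. (t k (Suc j) - t k j) * (err k j)\<^sup>2"
    let ?A = "{j. j < m k \<and> t k (Suc j) \<le> \<rho>}" and ?B = "{j. j < m k \<and> t k j < \<rho> \<and> \<rho> < t k (Suc j)}"
    have "{j. j < m k \<and> t k j < \<rho>} = ?A \<union> ?B" using t_less[of _ k] by force
    then have "(\<Sum>j | j < m k \<and> t k j < \<rho>. ?s j) = sum ?s (?A \<union> ?B)" by simp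
    also have "\<dots> = sum ?s ?A + sum ?s ?B" by (intro sum.union_disjoint) auto
    also have "\<dots> \<le> (3 * \<kappa> + 6 * c\<^sup>2 * \<kappa>\<^sup>2 * R) + 2 * \<kappa> * (1 + c\<^sup>2 * (V + 1)\<^sup>2)" using elim by linarith
    also have "\<dots> \<le> (3 * \<kappa> + 6 * c\<^sup>2 * \<kappa> * R) + 2 * \<kappa> * (1 + c\<^sup>2 * (V + 1)\<^sup>2)"
    proof -
      have "\<kappa>\<^sup>2 \<le> \<kappa>" using \<kappa> by (simp add: power2_eq_square mult_left_le)
      then have "6 * c\<^sup>2 * \<kappa>\<^sup>2 * R \<le> 6 * c\<^sup>2 * \<kappa> * R" using \<rho> by (intro mult_right_mono mult_left_mono) auto
      then show ?thesis by simp
    qed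
    also have "\<dots> = \<kappa> * K" by (simp add: K_def algebra_simps)
    also have "\<dots> \<le> \<epsilon> / (2 * K) * K" using K by (intro mult_right_mono) (auto simp: \<kappa>_def)
    also have "\<dots> < \<epsilon>" using K \<epsilon> by simp
    finally have "(\<Sum>j | j < m k \<and> t k j < \<rho>. ?s j) < \<epsilon>" .
    moreover have "0 \<le> (\<Sum>j | j < m k \<and> t k j < \<rho>. ?s j)"
      using t_less[of _ k] by (intro sum_nonneg) (auto simp: less_imp_le)
    ultimately show ?case by (simp add: dist_real_def)
  qed
qed

text \<open>The part of \<open>Y\<close> of finite variation has density \<open>- b\<close> up to
  \<open>\<rho>\<close>. \<open>Z\<close> stands at the right ends of the cells because that is
  where the exact product rule for increments puts it.\<close>

lemma riemann_stieltjes: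
  assumes \<epsilon>: "\<epsilon> > 0"
  shows "\<forall>\<^sub>F k in sequentially. \<bar>(\<Sum>j | j < m k \<and> t k j < \<rho>. Z (t k (Suc j)) * ((Y (t k (Suc j)) - I (t k (Suc j))) - (Y (t k j) - I (t k j))))
    + integral {0..\<rho>} (\<lambda>s. Z s * b s)\<bar> \<le> \<epsilon>"
proof -
  obtain B where B: "B > 0" "\<And>s. s \<in> {0..\<rho>} \<Longrightarrow> \<bar>b s\<bar> \<le> B" using bounded_cont[OF b] by blast
  define \<kappa> where "\<kappa> = \<epsilon> / (B * \<rho>)"
  have \<kappa>: "\<kappa> > 0" using \<epsilon> B \<rho> by (simp add: \<kappa>_def)
  have Zb: "continuous_on {0..\<rho>} (\<lambda>s. Z s * b s)"
    using \<rho> by (intro continuous_intros b continuous_on_subset[OF Z_cont]) auto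
  show ?thesis using modulus[OF Z_cont \<kappa>]
  proof eventually_elim
    case (elim k)
    \<comment> \<open>Partition times capped at \<open>\<rho>\<close>: nothing is assumed about
      \<open>b\<close> behind \<open>\<rho>\<close>, and cells beyond it become empty.\<close>
    define r where "r j = min (t k j) \<rho>" for j
    have r: "0 \<le> r j" "r j \<le> \<rho>" if "j \<le> m k" for j using t_range[OF that] \<rho> by (auto simp: r_def)
    have rle: "r j \<le> r (Suc j)" if "j < m k" for j using t_less[OF that] by (auto simp: r_def)
    have comb: "integral {r j..r (Suc j)} f = integral {0..r (Suc j)} f - integral {0..r j} f"
      if j: "j < m k" and f: "continuous_on {0..\<rho>} f" for j and f :: "real \<Rightarrow> real"
    proof -
      have "integral {0..r j} f + integral {r j..r (Suc j)} f = integral {0..r (Suc j)} f"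
        using r[of j] r[of "Suc j"] rle[OF j] j
        by (intro Henstock_Kurzweil_Integration.integral_combine integrable_continuous_real continuous_on_subset[OF f]) auto
      then show ?thesis by simp
    qed
    have dA: "(Y (t k (Suc j)) - I (t k (Suc j))) - (Y (t k j) - I (t k j)) = - integral {r j..r (Suc j)} b" if j: "j < m k" for j
      using A[OF t_range[of j k]] A[OF t_range[of "Suc j" k]] j comb[OF j b] by (simp add: r_def)
    let ?S = "\<Sum>j | j < m k \<and> t k j < \<rho>. Z (t k (Suc j)) * ((Y (t k (Suc j)) - I (t k (Suc j))) - (Y (t k j) - I (t k j)))"
    have "?S = (\<Sum>j | j < m k \<and> t k j < \<rho>. - (Z (t k (Suc j)) * integral {r j..r (Suc j)} b))"
      by (intro sum.cong refl) (simp add: dA)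
    also have "\<dots> = (\<Sum>j<m k. - (Z (t k (Suc j)) * integral {r j..r (Suc j)} b))"
    proof (rule sum.mono_neutral_left)
      show "\<forall>j\<in>{..<m k} - {j. j < m k \<and> t k j < \<rho>}. - (Z (t k (Suc j)) * integral {r j..r (Suc j)} b) = 0"
      proof
        fix j assume "j \<in> {..<m k} - {j. j < m k \<and> t k j < \<rho>}"
        then have "r j = r (Suc j)" using t_less[of j k] by (auto simp: r_def)
        then show "- (Z (t k (Suc j)) * integral {r j..r (Suc j)} b) = 0" by simp
      qed
    qed auto
    finally have S: "?S = - (\<Sum>j<m k. Z (t k (Suc j)) * integral {r j..r (Suc j)} b)" by (simp add: sum_negf)
    have "(\<Sum>j<m k. integral {r j..r (Suc j)} (\<lambda>s. Z s * b s)) = (\<Sum>j<m k. integral {0..r (Suc j)} (\<lambda>s. Z s * b s) - integral {0..r j} (\<lambda>s. Z s * b s))"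
      by (intro sum.cong refl comb Zb) auto
    also have "\<dots> = integral {0..r (m k)} (\<lambda>s. Z s * b s) - integral {0..r 0} (\<lambda>s. Z s * b s)"
      by (rule sum_lessThan_telescope)
    also have "\<dots> = integral {0..\<rho>} (\<lambda>s. Z s * b s)" using \<rho> by (simp add: r_def tm t0)
    finally have I: "integral {0..\<rho>} (\<lambda>s. Z s * b s) = (\<Sum>j<m k. integral {r j..r (Suc j)} (\<lambda>s. Z s * b s))" by simp
    have diff: "\<bar>integral {r j..r (Suc j)} (\<lambda>s. Z s * b s) - Z (t k (Suc j)) * integral {r j..r (Suc j)} b\<bar> \<le> \<kappa> * B * (r (Suc j) - r j)"
      if j: "j < m k" for j
    proof (cases "t k j \<le> \<rho>")
      case False
      then have "r j = r (Suc j)" using t_less[OF j] by (auto simp: r_def)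
      then show ?thesis by simp
    next
      case True
      have sub: "{r j..r (Suc j)} \<subseteq> {0..\<rho>}" using r[of j] r[of "Suc j"] j by auto
      have eq: "integral {r j..r (Suc j)} (\<lambda>s. Z s * b s) - Z (t k (Suc j)) * integral {r j..r (Suc j)} b
         = integral {r j..r (Suc j)} (\<lambda>s. Z s * b s - Z (t k (Suc j)) * b s)"
      proof -
        have "(\<lambda>s. Z s * b s) integrable_on {r j..r (Suc j)}" "(\<lambda>s. Z (t k (Suc j)) * b s) integrable_on {r j..r (Suc j)}"
          by (intro integrable_continuous_real continuous_intros continuous_on_subset[OF Zb sub] continuous_on_subset[OF b sub])+
        then show ?thesis by (simp add: Henstock_Kurzweil_Integration.integral_diff)
      qed
      have "norm (integral {r j..r (Suc j)} (\<lambda>s. Z s * b s - Z (t k (Suc j)) * b s)) \<le> integral {r j..r (Suc j)} (\<lambda>s. \<kappa> * B)"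
      proof (rule Henstock_Kurzweil_Integration.integral_norm_bound_integral)
        show "(\<lambda>s. Z s * b s - Z (t k (Suc j)) * b s) integrable_on {r j..r (Suc j)}"
          by (intro integrable_continuous_real continuous_intros continuous_on_subset[OF Zb sub] continuous_on_subset[OF b sub])
        fix s assume s: "s \<in> {r j..r (Suc j)}"
        have sR: "s \<in> {0..\<rho>}" using s sub by auto
        show "norm (Z s * b s - Z (t k (Suc j)) * b s) \<le> \<kappa> * B"
        proof -
          have "\<bar>s - t k (Suc j)\<bar> \<le> \<delta> k"
          proof -
            have "t k j \<le> s" "s \<le> t k (Suc j)" using s True by (auto simp: r_def)
            then show ?thesis using mesh[OF j] by linarith
          qed
          moreover have "s \<in> {0..R}" "t k (Suc j) \<in> {0..R}" using sR \<rho> t_range[of "Suc j" k] j by auto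
          ultimately have "\<bar>Z s - Z (t k (Suc j))\<bar> \<le> \<kappa>"
            using elim by blast
          then have "\<bar>Z s - Z (t k (Suc j))\<bar> * \<bar>b s\<bar> \<le> \<kappa> * B" using B(2)[OF sR] \<kappa> by (intro mult_mono) auto
          then show ?thesis unfolding real_norm_def left_diff_distrib[symmetric] abs_mult .
        qed
      qed auto
      then show ?thesis unfolding eq using rle[OF j] by (simp add: mult.commute mult.left_commute)
    qed
    have eq: "?S + integral {0..\<rho>} (\<lambda>s. Z s * b s) = (\<Sum>j<m k. integral {r j..r (Suc j)} (\<lambda>s. Z s * b s) - Z (t k (Suc j)) * integral {r j..r (Suc j)} b)"
      unfolding S I by (simp add: sum_subtractf)
    have "\<bar>\<Sum>j<m k. integral {r j..r (Suc j)} (\<lambda>s. Z s * b s) - Z (t k (Suc j)) * integral {r j..r (Suc j)} b\<bar> \<le> (\<Sum>j<m k. \<kappa> * B * (r (Suc j) - r j))"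
      by (intro order_trans[OF sum_abs] sum_mono diff) auto
    also have "\<dots> = \<kappa> * B * (\<Sum>j<m k. r (Suc j) - r j)"
      by (rule sum_distrib_left[symmetric])
    also have "\<dots> = \<kappa> * B * (r (m k) - r 0)" by (simp only: sum_lessThan_telescope)
    also have "\<dots> = \<epsilon>" using \<rho> B by (simp add: \<kappa>_def r_def tm t0)
    finally show ?case unfolding eq .
  qed
qed

lemma Yn_0: "Yn k 0 = a0"
proof -
  have pos: "0 \<le> p k i" if "i \<le> N k" for i
    using that
  proof (induction i)
    case (Suc i)
    then show ?case using p(2)[of i k] by simp
  qed (use p in simp)
  have "step_integral w (N k) (p k) (\<xi> k) 0 = 0"
    unfolding step_integral_def
  proof (intro sum.neutral ballI)
    fix i assume "i \<in> {..<N k}"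
    then have "0 \<le> p k i" "0 \<le> p k (Suc i)" using pos[of i] pos[of "Suc i"] by auto
    then show "(w (min (p k (Suc i)) 0) - w (min (p k i) 0)) * \<xi> k i = 0" by (simp add: min_absorb2)
  qed
  then show ?thesis using A[of 0] \<rho> by (simp add: Yn_def)
qed

lemma Z_0: "Z 0 = 1"
  by (simp add: Z_def w)

text \<open>Exact algebra without a remainder. The noise terms on the left have small moments; the
  right side is a telescoping difference minus the drift part.\<close>

lemma increment_formula:
  assumes j: "j < m k"
  shows "Z (t k j) * (Yn k (t k j) * Qinc c (t k (Suc j) - t k j) (w (t k (Suc j)) - w (t k j))
      + err k j * Vinc c (t k (Suc j) - t k j) (w (t k (Suc j)) - w (t k j)))
    = Z (t k (Suc j)) * Yn k (t k (Suc j)) - Z (t k j) * Yn k (t k j)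
      - Z (t k (Suc j)) * ((Y (t k (Suc j)) - I (t k (Suc j))) - (Y (t k j) - I (t k j)))"
proof -
  define h where "h = t k (Suc j) - t k j"
  define d where "d = w (t k (Suc j)) - w (t k j)"
  define r where "r = exp (- c * d + c\<^sup>2 * h / 2)"
  define x where "x = step_value (N k) (p k) (\<xi> k) (t k (Suc j))"
  have Z: "Z (t k (Suc j)) = Z (t k j) * r"
    unfolding Z_def r_def exp_add[symmetric] h_def d_def by (simp add: field_simps)
  have s: "step_integral w (N k) (p k) (\<xi> k) (t k (Suc j)) - step_integral w (N k) (p k) (\<xi> k) (t k j) = x * d"
    unfolding x_def d_def by (rule step_cell(1)) (use p t_less[OF j] cell[OF j] in auto)
  have Yn: "Yn k (t k (Suc j)) = Yn k (t k j) + x * d + ((Y (t k (Suc j)) - I (t k (Suc j))) - (Y (t k j) - I (t k j)))"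
    unfolding Yn_def using s by simp
  have e: "x = err k j + c * Yn k (t k j)" by (simp add: err_def x_def)
  show ?thesis
    unfolding Z Yn Qinc_def Vinc_def h_def[symmetric] d_def[symmetric] r_def[symmetric]
    by (simp add: e algebra_simps)
qed

text \<open>\<open>J\<close> is the first partition time at or after \<open>\<rho>\<close>. It
  overshoots \<open>\<rho>\<close> by at most the mesh, and \<open>Y\<close> is constant
  there.\<close>

lemma stop_index:
  obtains J where "J \<le> m k" "{j. j < m k \<and> t k j < \<rho>} = {..<J}" "t k J \<in> {\<rho>..R}" "t k J \<le> \<rho> + \<delta> k"
proof -
  define J where "J = (LEAST j. \<rho> \<le> t k j)"
  have ex: "\<rho> \<le> t k (m k)" using tm \<rho> by simp
  have J: "\<rho> \<le> t k J" unfolding J_def by (rule LeastI[of "\<lambda>j. \<rho> \<le> t k j", OF ex])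
  have Jm: "J \<le> m k" unfolding J_def by (rule Least_le[of "\<lambda>j. \<rho> \<le> t k j", OF ex])
  have before: "t k j < \<rho>" if "j < J" for j
    using not_less_Least[of j "\<lambda>j. \<rho> \<le> t k j"] that unfolding J_def by simp
  have "J \<noteq> 0" using J t0[of k] \<rho> by (cases J) auto
  then obtain i where i: "J = Suc i" by (cases J) auto
  have "{j. j < m k \<and> t k j < \<rho>} = {..<J}"
  proof (intro set_eqI iffI)
    fix j assume "j \<in> {j. j < m k \<and> t k j < \<rho>}"
    then show "j \<in> {..<J}" using t_mono[of J j k] J by (cases "j < J") auto
  next
    fix j assume "j \<in> {..<J}"
    then show "j \<in> {j. j < m k \<and> t k j < \<rho>}" using before Jm by auto
  qed
  moreover have "t k J \<le> \<rho> + \<delta> k" using before[of i] mesh[of i k] Jm i by simp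
  ultimately show thesis using that[OF Jm] J t_range[OF Jm] by auto
qed

text \<open>The sum telescopes up to the Riemann-Stieltjes sum. Its limit is the amount by which the
  product rule could fail on this path; that it vanishes is not a property of single paths and
  follows from the second moments.\<close>

lemma product_rule_limit:
  "(\<lambda>k. \<Sum>j | j < m k \<and> t k j < \<rho>. Z (t k j) * (Yn k (t k j) * Qinc c (t k (Suc j) - t k j) (w (t k (Suc j)) - w (t k j))
      + err k j * Vinc c (t k (Suc j) - t k j) (w (t k (Suc j)) - w (t k j))))
    \<longlonglongrightarrow> Z \<rho> * Y \<rho> - a0 + integral {0..\<rho>} (\<lambda>s. Z s * b s)" (is "?S \<longlonglongrightarrow> ?L")
proof (rule tendstoI)
  fix \<epsilon> :: real assume \<epsilon>: "\<epsilon> > 0"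
  obtain B where B: "B > 0" "\<And>s. s \<in> {0..R} \<Longrightarrow> \<bar>Z s\<bar> \<le> B" using bounded_cont[OF Z_cont] by blast
  define \<kappa> where "\<kappa> = \<epsilon> / (2 * (\<bar>Y \<rho>\<bar> + B + 1))"
  have \<kappa>: "\<kappa> > 0" using \<epsilon> B by (simp add: \<kappa>_def)
  show "\<forall>\<^sub>F k in sequentially. dist (?S k) ?L < \<epsilon>"
    using modulus[OF Z_cont \<kappa>] conv_I[OF \<kappa>] riemann_stieltjes[OF \<kappa>]
  proof eventually_elim
    case (elim k)
    obtain J where J: "J \<le> m k" "{j. j < m k \<and> t k j < \<rho>} = {..<J}" "t k J \<in> {\<rho>..R}" "t k J \<le> \<rho> + \<delta> k"
      by (rule stop_index)
    let ?R = "\<Sum>j | j < m k \<and> t k j < \<rho>. Z (t k (Suc j)) * ((Y (t k (Suc j)) - I (t k (Suc j))) - (Y (t k j) - I (t k j)))"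
    have "?S k = (\<Sum>j | j < m k \<and> t k j < \<rho>. (Z (t k (Suc j)) * Yn k (t k (Suc j)) - Z (t k j) * Yn k (t k j))
        - Z (t k (Suc j)) * ((Y (t k (Suc j)) - I (t k (Suc j))) - (Y (t k j) - I (t k j))))"
      by (intro sum.cong refl increment_formula) auto
    also have "\<dots> = (\<Sum>j<J. Z (t k (Suc j)) * Yn k (t k (Suc j)) - Z (t k j) * Yn k (t k j)) - ?R"
      by (simp only: sum_subtractf J(2))
    also have "\<dots> = Z (t k J) * Yn k (t k J) - a0 - ?R"
      unfolding sum_lessThan_telescope[of "\<lambda>j. Z (t k j) * Yn k (t k j)"] by (simp add: t0 Z_0 Yn_0)
    finally have S: "?S k = Z (t k J) * Yn k (t k J) - a0 - ?R" .
    define d where "d = step_integral w (N k) (p k) (\<xi> k) (t k J) - I (t k J)"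
    have JR: "t k J \<in> {0..R}" using t_range[OF J(1)] .
    have d: "\<bar>d\<bar> \<le> \<kappa>" using elim(2) JR unfolding d_def by blast
    have Yn: "Yn k (t k J) = Y \<rho> + d" using Y(2)[OF J(3)] by (simp add: Yn_def d_def)
    have dZ: "\<bar>Z (t k J) - Z \<rho>\<bar> \<le> \<kappa>"
    proof -
      have "\<rho> \<in> {0..R}" "\<bar>t k J - \<rho>\<bar> \<le> \<delta> k" using J \<rho> by auto
      then show ?thesis using elim(1) JR by blast
    qed
    have eq: "?S k - ?L = (Z (t k J) - Z \<rho>) * Y \<rho> + Z (t k J) * d - (?R + integral {0..\<rho>} (\<lambda>s. Z s * b s))"
      unfolding S Yn by (simp add: algebra_simps)
    have "\<bar>(Z (t k J) - Z \<rho>) * Y \<rho> + Z (t k J) * d - (?R + integral {0..\<rho>} (\<lambda>s. Z s * b s))\<bar> \<le> \<bar>Z (t k J) - Z \<rho>\<bar> * \<bar>Y \<rho>\<bar> + \<bar>Z (t k J)\<bar> * \<bar>d\<bar> + \<bar>?R + integral {0..\<rho>} (\<lambda>s. Z s * b s)\<bar>"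
      unfolding abs_mult[symmetric] by (intro order_trans[OF abs_triangle_ineq4] add_mono abs_triangle_ineq order_refl)
    also have "\<dots> \<le> \<kappa> * \<bar>Y \<rho>\<bar> + B * \<kappa> + \<kappa>"
      using dZ d B(2)[OF JR] B(1) elim(3) by (intro add_mono mult_mono) auto
    also have "\<dots> = \<kappa> * (\<bar>Y \<rho>\<bar> + B + 1)" by (simp add: algebra_simps)
    also have "\<dots> < \<epsilon>"
    proof -
      have "\<epsilon> / (2 * X) * X < \<epsilon>" if "X > 0" for X using that \<epsilon> by simp
      from this[of "\<bar>Y \<rho>\<bar> + B + 1"] show ?thesis using B(1) unfolding \<kappa>_def by simp
    qed
    finally show ?case unfolding dist_real_def eq .
  qed
qed

text \<open>Supplies a level, depending on the path, at which the later cutoff of \<open>Z\<close>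
  and \<open>Yn\<close> never acts for large \<open>k\<close>.\<close>

lemma eventually_bounded:
  obtains K :: real where "\<forall>\<^sub>F k in sequentially. \<forall>j\<le>m k. \<bar>Z (t k j)\<bar> \<le> K \<and> \<bar>Yn k (t k j)\<bar> \<le> K"
proof -
  obtain B where B: "B > 0" "\<And>s. s \<in> {0..R} \<Longrightarrow> \<bar>Z s\<bar> \<le> B" using bounded_cont[OF Z_cont] by blast
  obtain V where V: "V > 0" "\<And>s. s \<in> {0..R} \<Longrightarrow> \<bar>Y s\<bar> \<le> V" using bounded_cont[OF Y(1)] by blast
  have "\<forall>\<^sub>F k in sequentially. \<forall>j\<le>m k. \<bar>Z (t k j)\<bar> \<le> B + V + 1 \<and> \<bar>Yn k (t k j)\<bar> \<le> B + V + 1"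
    using conv_I[OF zero_less_one]
  proof eventually_elim
    case (elim k)
    show ?case
    proof (intro allI impI)
      fix j assume "j \<le> m k"
      then have r: "t k j \<in> {0..R}" by (rule t_range)
      have "\<bar>step_integral w (N k) (p k) (\<xi> k) (t k j) - I (t k j)\<bar> \<le> 1" using elim r by blast
      then show "\<bar>Z (t k j)\<bar> \<le> B + V + 1 \<and> \<bar>Yn k (t k j)\<bar> \<le> B + V + 1"
        using B(2)[OF r] V(2)[OF r] B(1) V(1) unfolding Yn_def by linarith
    qed
  qed
  then show thesis by (rule that)
qed

end

section \<open>The product rule with the exponential integrating factor\<close>

text \<open>Borel-Cantelli with thresholds and probabilities of size \<open>(1 / 2) ^ k\<close>,
  applied to the enlarged events because the quantities themselves need not be measurable. One
  subsequence serves both sequences.\<close>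

lemma (in prob_space) tends_to_0_subsequence:
  assumes 1: "tends_to_0_in_prob M Z1" and 2: "tends_to_0_in_prob M Z2"
  obtains n :: "nat \<Rightarrow> nat" where
    "AE \<omega> in M. \<forall>e>0. \<forall>\<^sub>F k in sequentially. Z1 (n k) \<omega> \<le> ennreal e \<and> Z2 (n k) \<omega> \<le> ennreal e"
proof -
  have ex: "\<exists>n B. B \<in> sets M \<and> measure M B \<le> 2 * (1 / 2) ^ k \<and>
      {\<omega> \<in> space M. ennreal ((1 / 2) ^ k) < Z1 n \<omega> \<or> ennreal ((1 / 2) ^ k) < Z2 n \<omega>} \<subseteq> B" for k :: nat
  proof -
    let ?e = "(1 / 2 :: real) ^ k"
    have e: "0 < ?e" by simp
    obtain A1 where A1: "\<And>n. A1 n \<in> sets M" "\<And>n. {\<omega> \<in> space M. ennreal ?e < Z1 n \<omega>} \<subseteq> A1 n" "(\<lambda>n. measure M (A1 n)) \<longlonglongrightarrow> 0"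
      using 1 e unfolding tends_to_0_in_prob_def by meson
    obtain A2 where A2: "\<And>n. A2 n \<in> sets M" "\<And>n. {\<omega> \<in> space M. ennreal ?e < Z2 n \<omega>} \<subseteq> A2 n" "(\<lambda>n. measure M (A2 n)) \<longlonglongrightarrow> 0"
      using 2 e unfolding tends_to_0_in_prob_def by meson
    have "\<forall>\<^sub>F n in sequentially. measure M (A1 n) < ?e \<and> measure M (A2 n) < ?e"
      using order_tendstoD(2)[OF A1(3) e] order_tendstoD(2)[OF A2(3) e] by eventually_elim simp
    then obtain n where n: "measure M (A1 n) < ?e" "measure M (A2 n) < ?e"
      using eventually_happens'[OF sequentially_bot] by blast
    have "measure M (A1 n \<union> A2 n) \<le> measure M (A1 n) + measure M (A2 n)"
      by (rule measure_Un_le[OF A1(1) A2(1)])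
    then have "measure M (A1 n \<union> A2 n) \<le> 2 * ?e" using n by linarith
    then show ?thesis
      using A1(1,2)[of n] A2(1,2)[of n] by (intro exI[of _ n] exI[of _ "A1 n \<union> A2 n"]) auto
  qed
  from choice[OF allI[OF ex]] obtain n where n: "\<forall>k. \<exists>B. B \<in> sets M \<and> measure M B \<le> 2 * (1 / 2) ^ k \<and>
      {\<omega> \<in> space M. ennreal ((1 / 2) ^ k) < Z1 (n k) \<omega> \<or> ennreal ((1 / 2) ^ k) < Z2 (n k) \<omega>} \<subseteq> B"
    by (rule exE)
  from choice[OF n] obtain B where B: "\<forall>k. B k \<in> sets M \<and> measure M (B k) \<le> 2 * (1 / 2) ^ k \<and>
      {\<omega> \<in> space M. ennreal ((1 / 2) ^ k) < Z1 (n k) \<omega> \<or> ennreal ((1 / 2) ^ k) < Z2 (n k) \<omega>} \<subseteq> B k"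
    by (rule exE)
  have nB: "B k \<in> sets M" "measure M (B k) \<le> 2 * (1 / 2) ^ k"
    "{\<omega> \<in> space M. ennreal ((1 / 2) ^ k) < Z1 (n k) \<omega> \<or> ennreal ((1 / 2) ^ k) < Z2 (n k) \<omega>} \<subseteq> B k" for k
    by (rule B[THEN spec[of _ k], THEN conjunct1], rule B[THEN spec[of _ k], THEN conjunct2, THEN conjunct1],
        rule B[THEN spec[of _ k], THEN conjunct2, THEN conjunct2])
  have "AE \<omega> in M. eventually (\<lambda>k. \<omega> \<in> space M - B k) sequentially"
  proof (rule borel_cantelli_AE1)
    show "summable (\<lambda>k. measure M (B k))"
      by (rule summable_comparison_test'[of "\<lambda>k. 2 * (1 / 2) ^ k" 0])
         (use nB(2) in \<open>auto intro!: summable_mult summable_geometric\<close>)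
  qed (auto simp: nB(1) less_top[symmetric])
  then have "AE \<omega> in M. \<forall>e>0. \<forall>\<^sub>F k in sequentially. Z1 (n k) \<omega> \<le> ennreal e \<and> Z2 (n k) \<omega> \<le> ennreal e"
  proof eventually_elim
    case (elim \<omega>)
    show ?case
    proof (intro allI impI)
      fix e :: real assume "e > 0"
      have "(\<lambda>k. (1 / 2 :: real) ^ k) \<longlonglongrightarrow> 0" by (rule LIMSEQ_realpow_zero) auto
      then have "\<forall>\<^sub>F k in sequentially. (1 / 2 :: real) ^ k < e" using \<open>e > 0\<close> by (simp add: order_tendsto_iff)
      then show "\<forall>\<^sub>F k in sequentially. Z1 (n k) \<omega> \<le> ennreal e \<and> Z2 (n k) \<omega> \<le> ennreal e"
        using elim
      proof eventually_elim
        case (elim k)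
        then have "Z1 (n k) \<omega> \<le> ennreal ((1 / 2) ^ k)" "Z2 (n k) \<omega> \<le> ennreal ((1 / 2) ^ k)"
          using nB(3)[of k] by (auto simp: not_less[symmetric])
        moreover have "ennreal ((1 / 2) ^ k) \<le> ennreal e" using elim(1) by (intro ennreal_leI) simp
        ultimately show ?case using order_trans by blast
      qed
    qed
  qed
  then show thesis by (rule that)
qed

context brownian_basis
begin

text \<open>The sum splits into two martingales \<open>S1\<close>, \<open>S2\<close> and the two
  compensators \<open>S3\<close>, \<open>S4\<close>. The parts with \<open>Qinc\<close> are small
  with the mesh because \<open>a\<close> is bounded by \<open>A\<close>; those with
  \<open>Vinc\<close> are controlled by the weighted square sum of \<open>b\<close> alone.\<close>

lemma discrete_sum_estimate:
  fixes c :: real and t :: "nat \<Rightarrow> real" and a b :: "nat \<Rightarrow> 'w \<Rightarrow> real"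
  assumes t0: "t 0 = 0" and tm: "t m = R" and t: "\<And>j. j < m \<Longrightarrow> t j < t (Suc j)"
    and mesh: "\<And>j. j < m \<Longrightarrow> t (Suc j) - t j \<le> \<delta>" "\<delta> \<le> 1" "0 < \<delta>"
    and a: "\<And>j. j < m \<Longrightarrow> a j \<in> borel_at (t j)" "\<And>j \<omega>. \<bar>a j \<omega>\<bar> \<le> A"
    and b: "\<And>j. j < m \<Longrightarrow> b j \<in> borel_at (t j)" "\<And>j \<omega>. \<omega> \<in> space M \<Longrightarrow> \<bar>b j \<omega>\<bar> \<le> B"
  defines "S \<equiv> \<lambda>\<omega>. \<Sum>j<m. a j \<omega> * Qinc c (t (Suc j) - t j) (\<Delta>W t j \<omega>)
      + b j \<omega> * Vinc c (t (Suc j) - t j) (\<Delta>W t j \<omega>)"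
  defines "K \<equiv> Kinc c"
  shows "S \<in> borel_measurable M" "integrable M (\<lambda>\<omega>. (S \<omega>)\<^sup>2)"
    "(\<integral>\<omega>. (S \<omega>)\<^sup>2 \<partial>M) \<le> 4 * (A\<^sup>2 * K * \<delta> * R + (A * K * \<delta> * R)\<^sup>2
       + (K + K\<^sup>2 * R) * (\<integral>\<omega>. (\<Sum>j<m. (t (Suc j) - t j) * (b j \<omega>)\<^sup>2) \<partial>M))"
proof -
  define h where "h j = t (Suc j) - t j" for j
  define D where "D j \<omega> = \<Delta>W t j \<omega>" for j \<omega>
  define q where "q j = (\<integral>\<omega>. Qinc c (h j) (D j \<omega>) \<partial>M)" for j
  define v where "v j = (\<integral>\<omega>. Vinc c (h j) (D j \<omega>) \<partial>M)" for j
  have K0: "0 \<le> K" by (simp add: K_def Kinc_def)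
  have A0: "0 \<le> A" using a(2) abs_ge_zero order_trans by blast
  have tpos: "0 \<le> t j" if "j \<le> m" for j
    using partition_mono[of m t 0 j] t that t0 by simp
  have h: "0 < h j" "h j \<le> \<delta>" "h j \<le> 1" if "j < m" for j
    using t[OF that] mesh(1)[OF that] mesh(2) by (auto simp: h_def)
  have hsum: "(\<Sum>j<m. h j) = R" unfolding h_def sum_lessThan_telescope by (simp add: t0 tm)
  have mom: "integrable M (\<lambda>\<omega>. (Qinc c (h j) (D j \<omega>))\<^sup>2)" "(\<integral>\<omega>. (Qinc c (h j) (D j \<omega>))\<^sup>2 \<partial>M) \<le> K * (h j)\<^sup>2"
    "integrable M (\<lambda>\<omega>. Qinc c (h j) (D j \<omega>))" "\<bar>q j\<bar> \<le> K * (h j)\<^sup>2"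
    "integrable M (\<lambda>\<omega>. (Vinc c (h j) (D j \<omega>))\<^sup>2)" "(\<integral>\<omega>. (Vinc c (h j) (D j \<omega>))\<^sup>2 \<partial>M) \<le> K * h j"
    "integrable M (\<lambda>\<omega>. Vinc c (h j) (D j \<omega>))" "\<bar>v j\<bar> \<le> K * h j" if "j < m" for j
    using inc_moments[of "t j" "t (Suc j)" c, folded h_def[of j] D_def[of j] K_def] tpos[of j] t[OF that] h[OF that] that
    unfolding q_def v_def by auto
  define S1 where "S1 \<omega> = (\<Sum>j<m. a j \<omega> * (Qinc c (h j) (D j \<omega>) - q j))" for \<omega>
  define S2 where "S2 \<omega> = (\<Sum>j<m. b j \<omega> * (Vinc c (h j) (D j \<omega>) - v j))" for \<omega>
  define S3 where "S3 \<omega> = (\<Sum>j<m. a j \<omega> * q j)" for \<omega>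
  define S4 where "S4 \<omega> = (\<Sum>j<m. b j \<omega> * v j)" for \<omega>
  define H where "H \<omega> = (\<Sum>j<m. h j * (b j \<omega>)\<^sup>2)" for \<omega>
  have S: "S \<omega> = S1 \<omega> + S2 \<omega> + S3 \<omega> + S4 \<omega>" for \<omega>
    unfolding S_def S1_def S2_def S3_def S4_def h_def D_def by (simp add: sum.distrib[symmetric] algebra_simps)
  have am: "a j \<in> borel_measurable M" and bm: "b j \<in> borel_measurable M" if "j < m" for j
    using F_measurable_M[OF a(1)[OF that]] F_measurable_M[OF b(1)[OF that]] by auto
  have var: "integrable M (\<lambda>\<omega>. (f \<omega> - (\<integral>\<omega>. f \<omega> \<partial>M))\<^sup>2)"
    "(\<integral>\<omega>. (f \<omega> - (\<integral>\<omega>. f \<omega> \<partial>M))\<^sup>2 \<partial>M) \<le> (\<integral>\<omega>. (f \<omega>)\<^sup>2 \<partial>M)" "(\<integral>\<omega>. f \<omega> - (\<integral>\<omega>. f \<omega> \<partial>M) \<partial>M) = 0"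
    if f: "integrable M f" "integrable M (\<lambda>\<omega>. (f \<omega>)\<^sup>2)" for f :: "'w \<Rightarrow> real"
  proof -
    let ?\<mu> = "\<integral>\<omega>. f \<omega> \<partial>M"
    have e: "(f \<omega> - ?\<mu>)\<^sup>2 = (f \<omega>)\<^sup>2 - 2 * ?\<mu> * f \<omega> + ?\<mu>\<^sup>2" for \<omega> by (simp add: power2_eq_square algebra_simps)
    show "integrable M (\<lambda>\<omega>. (f \<omega> - ?\<mu>)\<^sup>2)" unfolding e using f by auto
    have "(\<integral>\<omega>. (f \<omega> - ?\<mu>)\<^sup>2 \<partial>M) = (\<integral>\<omega>. (f \<omega>)\<^sup>2 \<partial>M) - 2 * ?\<mu> * ?\<mu> + ?\<mu>\<^sup>2"
      unfolding e using f by (simp add: prob_space)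
    then show "(\<integral>\<omega>. (f \<omega> - ?\<mu>)\<^sup>2 \<partial>M) \<le> (\<integral>\<omega>. (f \<omega>)\<^sup>2 \<partial>M)" by (simp add: power2_eq_square)
    show "(\<integral>\<omega>. f \<omega> - ?\<mu> \<partial>M) = 0" using f by (simp add: prob_space)
  qed
  have S1: "S1 \<in> borel_at (t m) \<and> integrable M (\<lambda>\<omega>. (S1 \<omega>)\<^sup>2)
    \<and> (\<integral>\<omega>. (S1 \<omega>)\<^sup>2 \<partial>M) = (\<Sum>j<m. (\<integral>\<omega>. (a j \<omega>)\<^sup>2 \<partial>M) * (\<integral>\<omega>. (Qinc c (h j) (D j \<omega>) - q j)\<^sup>2 \<partial>M))"
    unfolding S1_def[abs_def] D_def
  proof (rule martingale_square_sum[where g="\<lambda>j w. Qinc c (h j) w - q j" and B="\<lambda>_. A"])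
    fix j assume j: "j < m"
    show "integrable M (\<lambda>\<omega>. (Qinc c (h j) (\<Delta>W t j \<omega>) - q j)\<^sup>2)"
      using var(1)[OF mom(3,1)[OF j]] by (simp add: q_def D_def)
    show "(\<integral>\<omega>. Qinc c (h j) (\<Delta>W t j \<omega>) - q j \<partial>M) = 0"
      using var(3)[OF mom(3,1)[OF j]] by (simp add: q_def D_def)
  qed (use t0 t a in auto)
  note S1m = S1[THEN conjunct1, THEN F_measurable_M] and S1i = S1[THEN conjunct2, THEN conjunct1] and S1e = S1[THEN conjunct2, THEN conjunct2]
  have S2: "S2 \<in> borel_at (t m) \<and> integrable M (\<lambda>\<omega>. (S2 \<omega>)\<^sup>2)
    \<and> (\<integral>\<omega>. (S2 \<omega>)\<^sup>2 \<partial>M) = (\<Sum>j<m. (\<integral>\<omega>. (b j \<omega>)\<^sup>2 \<partial>M) * (\<integral>\<omega>. (Vinc c (h j) (D j \<omega>) - v j)\<^sup>2 \<partial>M))"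
    unfolding S2_def[abs_def] D_def
  proof (rule martingale_square_sum[where g="\<lambda>j w. Vinc c (h j) w - v j" and B="\<lambda>_. B"])
    fix j assume j: "j < m"
    show "integrable M (\<lambda>\<omega>. (Vinc c (h j) (\<Delta>W t j \<omega>) - v j)\<^sup>2)"
      using var(1)[OF mom(7,5)[OF j]] by (simp add: v_def D_def)
    show "(\<integral>\<omega>. Vinc c (h j) (\<Delta>W t j \<omega>) - v j \<partial>M) = 0"
      using var(3)[OF mom(7,5)[OF j]] by (simp add: v_def D_def)
  qed (use t0 t b in auto)
  note S2m = S2[THEN conjunct1, THEN F_measurable_M] and S2i = S2[THEN conjunct2, THEN conjunct1] and S2e = S2[THEN conjunct2, THEN conjunct2]
  have S3m: "S3 \<in> borel_measurable M" and S4m: "S4 \<in> borel_measurable M"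
    unfolding S3_def[abs_def] S4_def[abs_def]
    by (intro borel_measurable_sum borel_measurable_times borel_measurable_power borel_measurable_const am bm; simp)+
  show Sm: "S \<in> borel_measurable M"
    unfolding S[abs_def] by (intro borel_measurable_add S1m S2m S3m S4m)
  have a2: "integrable M (\<lambda>\<omega>. (a j \<omega>)\<^sup>2)" "(\<integral>\<omega>. (a j \<omega>)\<^sup>2 \<partial>M) \<le> A\<^sup>2" if j: "j < m" for j
  proof -
    have le: "(a j \<omega>)\<^sup>2 \<le> A\<^sup>2" for \<omega> using power_mono[OF a(2)[of j \<omega>], of 2] by simp
    show i: "integrable M (\<lambda>\<omega>. (a j \<omega>)\<^sup>2)"
      by (rule integrable_const_bound[of _ "A\<^sup>2"]) (use le am[OF j] in auto)
    have "(\<integral>\<omega>. (a j \<omega>)\<^sup>2 \<partial>M) \<le> (\<integral>\<omega>. A\<^sup>2 \<partial>M)" by (intro integral_mono i le) auto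
    then show "(\<integral>\<omega>. (a j \<omega>)\<^sup>2 \<partial>M) \<le> A\<^sup>2" by (simp add: prob_space)
  qed
  have b2: "integrable M (\<lambda>\<omega>. (b j \<omega>)\<^sup>2)" if j: "j < m" for j
  proof (rule integrable_const_bound[of _ "B\<^sup>2"])
    have "(b j \<omega>)\<^sup>2 \<le> B\<^sup>2" if "\<omega> \<in> space M" for \<omega> using power_mono[OF b(2)[OF that, of j], of 2] by simp
    then show "AE \<omega> in M. norm ((b j \<omega>)\<^sup>2) \<le> B\<^sup>2" by auto
  qed (use bm[OF j] in auto)
  have Hi: "integrable M H" unfolding H_def[abs_def] using b2 by auto
  have He: "(\<integral>\<omega>. H \<omega> \<partial>M) = (\<Sum>j<m. h j * (\<integral>\<omega>. (b j \<omega>)\<^sup>2 \<partial>M))"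
    unfolding H_def using b2 by (subst Bochner_Integration.integral_sum) auto
  have E1: "(\<integral>\<omega>. (S1 \<omega>)\<^sup>2 \<partial>M) \<le> A\<^sup>2 * K * \<delta> * R"
  proof -
    have "(\<integral>\<omega>. (S1 \<omega>)\<^sup>2 \<partial>M) \<le> (\<Sum>j<m. A\<^sup>2 * (K * (\<delta> * h j)))"
      unfolding S1e
    proof (intro sum_mono mult_mono)
      fix j assume "j \<in> {..<m}"
      then have j: "j < m" by simp
      show "(\<integral>\<omega>. (a j \<omega>)\<^sup>2 \<partial>M) \<le> A\<^sup>2" by (rule a2(2)[OF j])
      have "(\<integral>\<omega>. (Qinc c (h j) (D j \<omega>) - q j)\<^sup>2 \<partial>M) \<le> K * (h j)\<^sup>2"
        using var(2)[OF mom(3,1)[OF j]] mom(2)[OF j] unfolding q_def by linarith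
      also have "\<dots> \<le> K * (\<delta> * h j)"
        unfolding power2_eq_square using h[OF j] K0 by (intro mult_left_mono mult_right_mono) auto
      finally show "(\<integral>\<omega>. (Qinc c (h j) (D j \<omega>) - q j)\<^sup>2 \<partial>M) \<le> K * (\<delta> * h j)" .
    qed auto
    also have "\<dots> = A\<^sup>2 * K * \<delta> * (\<Sum>j<m. h j)" by (simp add: sum_distrib_left mult.assoc)
    finally show ?thesis unfolding hsum .
  qed
  have E2: "(\<integral>\<omega>. (S2 \<omega>)\<^sup>2 \<partial>M) \<le> K * (\<integral>\<omega>. H \<omega> \<partial>M)"
  proof -
    have "(\<integral>\<omega>. (S2 \<omega>)\<^sup>2 \<partial>M) \<le> (\<Sum>j<m. (\<integral>\<omega>. (b j \<omega>)\<^sup>2 \<partial>M) * (K * h j))"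
      unfolding S2e
    proof (intro sum_mono mult_left_mono)
      fix j assume "j \<in> {..<m}"
      then have j: "j < m" by simp
      show "(\<integral>\<omega>. (Vinc c (h j) (D j \<omega>) - v j)\<^sup>2 \<partial>M) \<le> K * h j"
        using var(2)[OF mom(7,5)[OF j]] mom(6)[OF j] unfolding v_def by linarith
    qed auto
    also have "\<dots> = K * (\<integral>\<omega>. H \<omega> \<partial>M)" unfolding He by (simp add: sum_distrib_left mult_ac)
    finally show ?thesis .
  qed
  have E3: "(S3 \<omega>)\<^sup>2 \<le> (A * K * \<delta> * R)\<^sup>2" for \<omega>
  proof -
    have "\<bar>S3 \<omega>\<bar> \<le> (\<Sum>j<m. \<bar>a j \<omega> * q j\<bar>)" unfolding S3_def by (rule sum_abs)
    also have "\<dots> \<le> (\<Sum>j<m. A * (K * (\<delta> * h j)))"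
    proof (intro sum_mono)
      fix j assume "j \<in> {..<m}"
      then have j: "j < m" by simp
      have "\<bar>q j\<bar> \<le> K * (h j * h j)" using mom(4)[OF j] by (simp add: power2_eq_square)
      also have "\<dots> \<le> K * (\<delta> * h j)" using h[OF j] K0 by (intro mult_left_mono mult_right_mono) auto
      finally show "\<bar>a j \<omega> * q j\<bar> \<le> A * (K * (\<delta> * h j))"
        unfolding abs_mult using a(2) A0 by (intro mult_mono) auto
    qed
    also have "\<dots> = A * K * \<delta> * (\<Sum>j<m. h j)" by (simp add: sum_distrib_left mult.assoc)
    finally have "\<bar>S3 \<omega>\<bar> \<le> A * K * \<delta> * R" unfolding hsum .
    then have "\<bar>S3 \<omega>\<bar>\<^sup>2 \<le> (A * K * \<delta> * R)\<^sup>2" by (intro power_mono) auto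
    then show ?thesis by simp
  qed
  have E4: "(S4 \<omega>)\<^sup>2 \<le> K\<^sup>2 * R * H \<omega>" for \<omega>
  proof -
    have "\<bar>S4 \<omega>\<bar> \<le> (\<Sum>j<m. \<bar>b j \<omega> * v j\<bar>)" unfolding S4_def by (rule sum_abs)
    \<comment> \<open>Splitting \<open>h j\<close> into two roots prepares Cauchy-Schwarz, so that
      the result contains the sum of \<open>h j * (b j \<omega>)\<^sup>2\<close>.\<close>
    also have "\<dots> \<le> (\<Sum>j<m. K * (sqrt (h j) * (sqrt (h j) * \<bar>b j \<omega>\<bar>)))"
    proof (intro sum_mono)
      fix j assume "j \<in> {..<m}"
      then have j: "j < m" by simp
      have "\<bar>b j \<omega>\<bar> * \<bar>v j\<bar> \<le> \<bar>b j \<omega>\<bar> * (K * h j)" by (intro mult_left_mono mom(8)[OF j]) auto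
      moreover have s: "sqrt (h j) * sqrt (h j) = h j" using h[OF j] by simp
      have "sqrt (h j) * (sqrt (h j) * \<bar>b j \<omega>\<bar>) = h j * \<bar>b j \<omega>\<bar>" unfolding mult.assoc[symmetric] s ..
      moreover have "\<bar>b j \<omega>\<bar> * (K * h j) = K * (h j * \<bar>b j \<omega>\<bar>)" by simp
      ultimately show "\<bar>b j \<omega> * v j\<bar> \<le> K * (sqrt (h j) * (sqrt (h j) * \<bar>b j \<omega>\<bar>))"
        by (simp only: abs_mult)
    qed
    also have "\<dots> = K * (\<Sum>j<m. sqrt (h j) * (sqrt (h j) * \<bar>b j \<omega>\<bar>))" by (rule sum_distrib_left[symmetric])
    finally have 1: "\<bar>S4 \<omega>\<bar> \<le> K * (\<Sum>j<m. sqrt (h j) * (sqrt (h j) * \<bar>b j \<omega>\<bar>))" .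
    have "\<bar>S4 \<omega>\<bar>\<^sup>2 \<le> (K * (\<Sum>j<m. sqrt (h j) * (sqrt (h j) * \<bar>b j \<omega>\<bar>)))\<^sup>2" by (intro power_mono 1) auto
    also have "\<dots> \<le> K\<^sup>2 * ((\<Sum>j<m. (sqrt (h j))\<^sup>2) * (\<Sum>j<m. (sqrt (h j) * \<bar>b j \<omega>\<bar>)\<^sup>2))"
      unfolding power_mult_distrib[of K] by (intro mult_left_mono Cauchy_Schwarz_ineq_sum) auto
    also have "(\<Sum>j<m. (sqrt (h j))\<^sup>2) = (\<Sum>j<m. h j)" using h by (intro sum.cong) (auto simp: less_imp_le)
    also have "(\<Sum>j<m. (sqrt (h j) * \<bar>b j \<omega>\<bar>)\<^sup>2) = H \<omega>"
      unfolding H_def using h by (intro sum.cong) (auto simp: less_imp_le power_mult_distrib)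
    finally show ?thesis unfolding hsum by simp
  qed
  have sq4: "(x + y + z + w)\<^sup>2 \<le> 4 * (x\<^sup>2 + y\<^sup>2 + z\<^sup>2 + w\<^sup>2)" for x y z w :: real
    using zero_le_power2[of "x - y"] zero_le_power2[of "x - z"] zero_le_power2[of "x - w"]
      zero_le_power2[of "y - z"] zero_le_power2[of "y - w"] zero_le_power2[of "z - w"]
    by (simp add: power2_eq_square algebra_simps)
  define U where "U \<omega> = 4 * ((S1 \<omega>)\<^sup>2 + (S2 \<omega>)\<^sup>2 + (A * K * \<delta> * R)\<^sup>2 + K\<^sup>2 * R * H \<omega>)" for \<omega>
  have SU: "(S \<omega>)\<^sup>2 \<le> U \<omega>" for \<omega>
  proof -
    have "(S \<omega>)\<^sup>2 \<le> 4 * ((S1 \<omega>)\<^sup>2 + (S2 \<omega>)\<^sup>2 + (S3 \<omega>)\<^sup>2 + (S4 \<omega>)\<^sup>2)" unfolding S by (rule sq4)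
    also have "\<dots> \<le> U \<omega>" unfolding U_def by (intro mult_left_mono add_mono order_refl E3 E4) simp
    finally show ?thesis .
  qed
  have Ui: "integrable M U" unfolding U_def[abs_def] using S1i S2i Hi by auto
  show Si: "integrable M (\<lambda>\<omega>. (S \<omega>)\<^sup>2)"
  proof (rule Bochner_Integration.integrable_bound[OF Ui])
    show "AE \<omega> in M. norm ((S \<omega>)\<^sup>2) \<le> norm (U \<omega>)"
      using SU by (intro AE_I2) (simp add: order_trans[OF _ abs_ge_self])
  qed (use Sm in auto)
  have "(\<integral>\<omega>. (S \<omega>)\<^sup>2 \<partial>M) \<le> (\<integral>\<omega>. U \<omega> \<partial>M)" by (intro integral_mono Si Ui SU)
  also have "\<dots> = 4 * ((\<integral>\<omega>. (S1 \<omega>)\<^sup>2 \<partial>M) + (\<integral>\<omega>. (S2 \<omega>)\<^sup>2 \<partial>M) + (A * K * \<delta> * R)\<^sup>2 + K\<^sup>2 * R * (\<integral>\<omega>. H \<omega> \<partial>M))"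
    unfolding U_def using S1i S2i Hi by (simp add: prob_space)
  also have "\<dots> \<le> 4 * (A\<^sup>2 * K * \<delta> * R + (A * K * \<delta> * R)\<^sup>2 + (K + K\<^sup>2 * R) * (\<integral>\<omega>. H \<omega> \<partial>M))"
    using E1 E2 by (simp add: algebra_simps)
  finally show "(\<integral>\<omega>. (S \<omega>)\<^sup>2 \<partial>M) \<le> 4 * (A\<^sup>2 * K * \<delta> * R + (A * K * \<delta> * R)\<^sup>2
       + (K + K\<^sup>2 * R) * (\<integral>\<omega>. (\<Sum>j<m. (t (Suc j) - t j) * (b j \<omega>)\<^sup>2) \<partial>M))"
    by (simp add: H_def h_def)
qed

end

section \<open>Deterministic times capped by an extended stopping time, and the cutoff of the
  sums\<close>

lemma ennreal_stopped:
  assumes "0 \<le> t"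
  shows "ennreal (stopped T t \<omega>) = min (ennreal t) (T \<omega>)"
proof -
  have "min (ennreal t) (T \<omega>) < top" by (simp add: min_less_iff_disj)
  then show ?thesis unfolding stopped_def by simp
qed

lemma stopped_nonneg: "0 \<le> stopped T t \<omega>"
  unfolding stopped_def by simp

lemma stopped_le:
  assumes "0 \<le> t"
  shows "stopped T t \<omega> \<le> t"
  using ennreal_stopped[OF assms, of T \<omega>] assms stopped_nonneg[of T t \<omega>]
  by (metis ennreal_le_iff min.cobounded1)

lemma stopped_le_time: "0 \<le> t \<Longrightarrow> ennreal (stopped T t \<omega>) \<le> T \<omega>"
  by (simp add: ennreal_stopped)

lemma le_stopped_iff:
  assumes "0 \<le> s" "s \<le> t"
  shows "s \<le> stopped T t \<omega> \<longleftrightarrow> ennreal s \<le> T \<omega>"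
proof -
  have "s \<le> stopped T t \<omega> \<longleftrightarrow> ennreal s \<le> ennreal (stopped T t \<omega>)"
    by (simp add: ennreal_le_iff[OF stopped_nonneg])
  then show ?thesis using assms by (simp add: ennreal_stopped ennreal_leI)
qed

lemma less_stopped_iff:
  assumes "0 \<le> s" "s < t"
  shows "s < stopped T t \<omega> \<longleftrightarrow> ennreal s < T \<omega>"
proof -
  have "s < stopped T t \<omega> \<longleftrightarrow> ennreal s < ennreal (stopped T t \<omega>)"
    using assms by (simp add: ennreal_less_iff)
  then show ?thesis using assms by (simp add: ennreal_stopped ennreal_less_iff)
qed

lemma stopped_eq_min:
  assumes "0 \<le> s" "s \<le> t"
  shows "stopped T s \<omega> = min s (stopped T t \<omega>)"
proof (cases "ennreal s \<le> T \<omega>")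
  case True
  then show ?thesis using le_stopped_iff[OF assms, of T \<omega>] assms(1) by (simp add: stopped_def min_def)
next
  case False
  then have s: "T \<omega> \<le> ennreal s" by simp
  then have "T \<omega> \<le> ennreal t" using ennreal_leI[OF assms(2)] by (rule order_trans)
  note s this
  moreover have "\<not> s \<le> stopped T t \<omega>" using False le_stopped_iff[OF assms, of T \<omega>] by simp
  ultimately show ?thesis by (simp add: stopped_def min_def)
qed

lemma stopped_eq: "0 \<le> t \<Longrightarrow> ennreal t \<le> T \<omega> \<Longrightarrow> stopped T t \<omega> = t"
  unfolding stopped_def by (simp add: min_def)

text \<open>Stopping the sums when \<open>Z\<close>, \<open>Y\<close> or the approximation error of the integrand becomes large keeps the
  summands bounded and adapted; along almost every path the cutoff is eventually inactive for large \<open>K\<close>.\<close>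

definition cutoff :: "(nat \<Rightarrow> real) \<Rightarrow> ennreal \<Rightarrow> real \<Rightarrow> (nat \<Rightarrow> real) \<Rightarrow> (nat \<Rightarrow> real) \<Rightarrow> (nat \<Rightarrow> real) \<Rightarrow> nat \<Rightarrow> bool" where
  "cutoff t T K z y e j \<longleftrightarrow> ennreal (t j) < T \<and> (\<forall>i\<le>j. \<bar>z i\<bar> \<le> K \<and> \<bar>y i\<bar> \<le> K) \<and>
     (\<Sum>i\<le>j. (t (Suc i) - t i) * (e i)\<^sup>2) \<le> 1"

text \<open>All surviving indices are at most the largest one, at which the cutoff bounds the error
  sum by 1. The first bound provides a dominating constant, the second the convergence to zero along
  a path.\<close>

lemma cutoff_error_sum:
  assumes t: "\<And>j. j < m \<Longrightarrow> t j < t (Suc j)" "t 0 = 0"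
  shows "(\<Sum>j<m. (t (Suc j) - t j) * (if cutoff t T K z y e j then z j * e j else 0)\<^sup>2) \<le> K\<^sup>2"
    and "(\<Sum>j<m. (t (Suc j) - t j) * (if cutoff t T K z y e j then z j * e j else 0)\<^sup>2)
      \<le> K\<^sup>2 * (\<Sum>j | j < m \<and> ennreal (t j) < T. (t (Suc j) - t j) * (e j)\<^sup>2)"
proof -
  let ?h = "\<lambda>j. t (Suc j) - t j" and ?g = "cutoff t T K z y e"
  let ?G = "{j. j < m \<and> ?g j}"
  have h: "0 \<le> ?h j" if "j < m" for j using t(1)[OF that] by simp
  have z2: "(z j)\<^sup>2 \<le> K\<^sup>2" if "?g j" for j
  proof -
    have "\<bar>z j\<bar> \<le> K" using that unfolding cutoff_def by blast
    then have "\<bar>z j\<bar>\<^sup>2 \<le> K\<^sup>2" by (intro power_mono) auto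
    then show ?thesis by simp
  qed
  have "(\<Sum>j<m. ?h j * (if ?g j then z j * e j else 0)\<^sup>2) = (\<Sum>j\<in>?G. ?h j * (z j * e j)\<^sup>2)"
    by (rule sum.mono_neutral_cong_right) auto
  also have "\<dots> \<le> (\<Sum>j\<in>?G. K\<^sup>2 * (?h j * (e j)\<^sup>2))"
  proof (intro sum_mono)
    fix j assume j: "j \<in> ?G"
    have "?h j * (z j * e j)\<^sup>2 = (z j)\<^sup>2 * (?h j * (e j)\<^sup>2)" by (simp add: power_mult_distrib)
    also have "\<dots> \<le> K\<^sup>2 * (?h j * (e j)\<^sup>2)" using j z2[of j] h[of j] by (intro mult_right_mono) auto
    finally show "?h j * (z j * e j)\<^sup>2 \<le> K\<^sup>2 * (?h j * (e j)\<^sup>2)" .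
  qed
  also have "\<dots> = K\<^sup>2 * (\<Sum>j\<in>?G. ?h j * (e j)\<^sup>2)" by (rule sum_distrib_left[symmetric])
  finally have 1: "(\<Sum>j<m. ?h j * (if ?g j then z j * e j else 0)\<^sup>2) \<le> K\<^sup>2 * (\<Sum>j\<in>?G. ?h j * (e j)\<^sup>2)" .
  have "(\<Sum>j\<in>?G. ?h j * (e j)\<^sup>2) \<le> 1"
  proof (cases "?G = {}")
    case False
    define J where "J = Max ?G"
    have J: "J \<in> ?G" unfolding J_def by (rule Max_in) (use False in auto)
    have "(\<Sum>j\<in>?G. ?h j * (e j)\<^sup>2) \<le> (\<Sum>j\<le>J. ?h j * (e j)\<^sup>2)"
      by (rule sum_mono2) (use J h in \<open>auto simp: J_def intro!: Max_ge\<close>)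
    also have "\<dots> \<le> 1" using J unfolding cutoff_def by blast
    finally show ?thesis .
  next
    case True
    show ?thesis unfolding True by simp
  qed
  then have "K\<^sup>2 * (\<Sum>j\<in>?G. ?h j * (e j)\<^sup>2) \<le> K\<^sup>2 * 1" by (intro mult_left_mono) auto
  then show "(\<Sum>j<m. ?h j * (if ?g j then z j * e j else 0)\<^sup>2) \<le> K\<^sup>2" using 1 by linarith
  have "(\<Sum>j\<in>?G. ?h j * (e j)\<^sup>2) \<le> (\<Sum>j | j < m \<and> ennreal (t j) < T. ?h j * (e j)\<^sup>2)"
    by (rule sum_mono2) (use h in \<open>auto simp: cutoff_def\<close>)
  then have "K\<^sup>2 * (\<Sum>j\<in>?G. ?h j * (e j)\<^sup>2) \<le> K\<^sup>2 * (\<Sum>j | j < m \<and> ennreal (t j) < T. ?h j * (e j)\<^sup>2)"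
    by (intro mult_left_mono) auto
  then show "(\<Sum>j<m. ?h j * (if ?g j then z j * e j else 0)\<^sup>2) \<le> K\<^sup>2 * (\<Sum>j | j < m \<and> ennreal (t j) < T. ?h j * (e j)\<^sup>2)"
    using 1 by linarith
qed

context brownian_basis
begin

text \<open>The decision at index \<open>j\<close> uses only data known at time \<open>t j\<close>;
  the lengths of the cells are deterministic.\<close>

lemma cutoff_measurable:
  fixes z y e :: "nat \<Rightarrow> 'w \<Rightarrow> real"
  assumes T: "stopping_time F T" and t: "\<And>i j. i \<le> j \<Longrightarrow> j < m \<Longrightarrow> t i \<le> t j"
    and m: "\<And>j. j < m \<Longrightarrow> z j \<in> borel_at (t j)"
      "\<And>j. j < m \<Longrightarrow> y j \<in> borel_at (t j)"
      "\<And>j. j < m \<Longrightarrow> e j \<in> borel_at (t j)"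
    and j: "j < m"
  shows "Measurable.pred (F (ennreal (t j))) (\<lambda>\<omega>. cutoff t (T \<omega>) K (\<lambda>i. z i \<omega>) (\<lambda>i. y i \<omega>) (\<lambda>i. e i \<omega>) j)"
proof -
  have mm: "f i \<in> borel_at (t j)"
    if "\<And>j. j < m \<Longrightarrow> f j \<in> borel_at (t j)" "i \<le> j" for f :: "nat \<Rightarrow> 'w \<Rightarrow> real" and i
    by (rule F_mono_measurable[of "ennreal (t i)"]) (use that t(1)[OF that(2) j] j in \<open>auto intro!: ennreal_leI that(1)\<close>)
  have 1: "Measurable.pred (F (ennreal (t j))) (\<lambda>\<omega>. ennreal (t j) < T \<omega>)" by (rule stopping_timeD2[OF T])
  have 2: "Measurable.pred (F (ennreal (t j))) (\<lambda>\<omega>. \<bar>f i \<omega>\<bar> \<le> K)"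
    if "\<And>j. j < m \<Longrightarrow> f j \<in> borel_at (t j)" "i \<le> j" for f :: "nat \<Rightarrow> 'w \<Rightarrow> real" and i
    using mm[OF that] by measurable
  have 3: "(\<lambda>\<omega>. \<Sum>i\<le>j. (t (Suc i) - t i) * (e i \<omega>)\<^sup>2) \<in> borel_at (t j)"
    by (intro borel_measurable_sum borel_measurable_times borel_measurable_power borel_measurable_const mm m) auto
  have 4: "Measurable.pred (F (ennreal (t j))) (\<lambda>\<omega>. \<forall>i\<in>{..j}. \<bar>z i \<omega>\<bar> \<le> K \<and> \<bar>y i \<omega>\<bar> \<le> K)"
    by (intro pred_intros_finite pred_intros_logic 2 m) auto
  have "Measurable.pred (F (ennreal (t j))) (\<lambda>\<omega>. ennreal (t j) < T \<omega> \<and> (\<forall>i\<in>{..j}. \<bar>z i \<omega>\<bar> \<le> K \<and> \<bar>y i \<omega>\<bar> \<le> K) \<and>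
     (\<Sum>i\<le>j. (t (Suc i) - t i) * (e i \<omega>)\<^sup>2) \<le> 1)"
    by (intro pred_intros_logic 1 4) (use 3 in measurable)
  then show ?thesis unfolding cutoff_def by (simp add: Ball_def)
qed

text \<open>The bound on the \<open>Vinc\<close> coefficients, which involves \<open>C\<close>, only
  secures integrability and is absent from the estimate. Hence the bounds of the elementary
  integrands may grow along the approximation.\<close>

lemma cutoff_estimate:
  fixes c K :: real and z y e :: "nat \<Rightarrow> 'w \<Rightarrow> real"
  assumes T: "stopping_time F T" and t0: "t 0 = 0" and tm: "t m = R" and t: "\<And>j. j < m \<Longrightarrow> t j < t (Suc j)"
    and mesh: "\<And>j. j < m \<Longrightarrow> t (Suc j) - t j \<le> \<delta>" "\<delta> \<le> 1" "0 < \<delta>" and K: "0 \<le> K"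
    and m: "\<And>j. j < m \<Longrightarrow> z j \<in> borel_at (t j)"
      "\<And>j. j < m \<Longrightarrow> y j \<in> borel_at (t j)"
      "\<And>j. j < m \<Longrightarrow> e j \<in> borel_at (t j)"
    and e: "\<And>j \<omega>. \<omega> \<in> space M \<Longrightarrow> \<bar>e j \<omega>\<bar> \<le> C + \<bar>c\<bar> * \<bar>y j \<omega>\<bar>"
  defines "g \<equiv> \<lambda>j \<omega>. cutoff t (T \<omega>) K (\<lambda>i. z i \<omega>) (\<lambda>i. y i \<omega>) (\<lambda>i. e i \<omega>) j"
  defines "S \<equiv> \<lambda>\<omega>. \<Sum>j<m. (if g j \<omega> then z j \<omega> * y j \<omega> else 0) * Qinc c (t (Suc j) - t j) (\<Delta>W t j \<omega>)
      + (if g j \<omega> then z j \<omega> * e j \<omega> else 0) * Vinc c (t (Suc j) - t j) (\<Delta>W t j \<omega>)"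
  defines "H \<equiv> \<lambda>\<omega>. \<Sum>j<m. (t (Suc j) - t j) * (if g j \<omega> then z j \<omega> * e j \<omega> else 0)\<^sup>2"
  shows "S \<in> borel_measurable M" "integrable M (\<lambda>\<omega>. (S \<omega>)\<^sup>2)" "H \<in> borel_measurable M"
    "(\<integral>\<omega>. (S \<omega>)\<^sup>2 \<partial>M) \<le> 4 * ((K * K)\<^sup>2 * Kinc c * \<delta> * R + (K * K * Kinc c * \<delta> * R)\<^sup>2
       + (Kinc c + (Kinc c)\<^sup>2 * R) * (\<integral>\<omega>. H \<omega> \<partial>M))"
proof -
  have tmono: "t i \<le> t j" if "i \<le> j" "j \<le> m" for i j by (rule partition_mono[of m t]) (use t that in auto)
  have gm: "Measurable.pred (F (ennreal (t j))) (g j)" if j: "j < m" for j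
    unfolding g_def by (rule cutoff_measurable[OF T _ m j]) (use tmono in auto)
  have am: "(\<lambda>\<omega>. if g j \<omega> then z j \<omega> * y j \<omega> else 0) \<in> borel_at (t j)" if j: "j < m" for j
    using m(1,2)[OF j] gm[OF j] by measurable
  have bm: "(\<lambda>\<omega>. if g j \<omega> then z j \<omega> * e j \<omega> else 0) \<in> borel_at (t j)" if j: "j < m" for j
    using m(1,3)[OF j] gm[OF j] by measurable
  have ab: "\<bar>if g j \<omega> then z j \<omega> * y j \<omega> else 0\<bar> \<le> K * K" for j \<omega>
    using K by (auto simp: g_def cutoff_def abs_mult intro!: mult_mono)
  have bb: "\<bar>if g j \<omega> then z j \<omega> * e j \<omega> else 0\<bar> \<le> K * (\<bar>C\<bar> + \<bar>c\<bar> * K)" if w: "\<omega> \<in> space M" for j \<omega>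
  proof (cases "g j \<omega>")
    case True
    then have *: "\<bar>z j \<omega>\<bar> \<le> K" "\<bar>y j \<omega>\<bar> \<le> K" by (auto simp: g_def cutoff_def)
    have "\<bar>e j \<omega>\<bar> \<le> C + \<bar>c\<bar> * \<bar>y j \<omega>\<bar>" by (rule e[OF w])
    also have "\<dots> \<le> \<bar>C\<bar> + \<bar>c\<bar> * K" using *(2) by (intro add_mono mult_left_mono) auto
    finally show ?thesis using * True K by (simp add: abs_mult mult_mono)
  qed (use K in simp)
  note E = discrete_sum_estimate[where t=t and m=m and c=c and A="K * K" and B="K * (\<bar>C\<bar> + \<bar>c\<bar> * K)" and \<delta>=\<delta> and R=R
      and a="\<lambda>j \<omega>. if g j \<omega> then z j \<omega> * y j \<omega> else 0" and b="\<lambda>j \<omega>. if g j \<omega> then z j \<omega> * e j \<omega> else 0",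
      OF t0 tm t mesh am ab bm bb]
  show "S \<in> borel_measurable M" unfolding S_def by (rule E(1))
  show "integrable M (\<lambda>\<omega>. (S \<omega>)\<^sup>2)" unfolding S_def by (rule E(2))
  show "H \<in> borel_measurable M" unfolding H_def
    by (intro borel_measurable_sum borel_measurable_times borel_measurable_power borel_measurable_const F_measurable_M[OF bm]) auto
  show "(\<integral>\<omega>. (S \<omega>)\<^sup>2 \<partial>M) \<le> 4 * ((K * K)\<^sup>2 * Kinc c * \<delta> * R + (K * K * Kinc c * \<delta> * R)\<^sup>2
       + (Kinc c + (Kinc c)\<^sup>2 * R) * (\<integral>\<omega>. H \<omega> \<partial>M))"
    unfolding S_def H_def by (rule E(3))
qed

text \<open>On almost every path the sums with cutoff level \<open>K\<close> converge, for all large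
  \<open>K\<close>, to the possible failure \<open>L\<close> of the product rule. For fixed
  \<open>K\<close> they tend to zero in mean square, so by Fatou the lower limit of their squares
  vanishes almost surely, and \<open>L = 0\<close>.\<close>

lemma product_rule:
  fixes c R :: real and Y I b :: "real \<Rightarrow> 'w \<Rightarrow> real" and p :: "nat \<Rightarrow> nat \<Rightarrow> real" and \<xi> :: "nat \<Rightarrow> nat \<Rightarrow> 'w \<Rightarrow> real"
  assumes R: "0 < R" and T: "stopping_time F T" "AE \<omega> in M. 0 < T \<omega>"
    and p: "\<And>n. 0 \<le> p n 0" "\<And>n i. i < N n \<Longrightarrow> p n i \<le> p n (Suc i)"
    and \<xi>: "\<And>n i. i < N n \<Longrightarrow> \<xi> n i \<in> borel_at (p n i)"
      "\<And>n i \<omega>. i < N n \<Longrightarrow> \<omega> \<in> space M \<Longrightarrow> \<bar>\<xi> n i \<omega>\<bar> \<le> C n"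
    and Ym: "\<And>s. 0 \<le> s \<Longrightarrow> (\<lambda>\<omega>. if ennreal s < T \<omega> then Y s \<omega> else 0) \<in> borel_at s"
    and Im: "\<And>s. 0 \<le> s \<Longrightarrow> I s \<in> borel_at s"
    and Y: "AE \<omega> in M. continuous_on {0..R} (\<lambda>s. Y s \<omega>)"
      "AE \<omega> in M. \<forall>s\<in>{0..R}. Y s \<omega> = Y (stopped T s \<omega>) \<omega>"
    and b: "AE \<omega> in M. continuous_on {0..stopped T R \<omega>} (\<lambda>s. b s \<omega>)"
    and eq: "AE \<omega> in M. \<forall>s\<in>{0..R}. Y s \<omega> - I s \<omega> = a0 \<omega> - integral {0..stopped T s \<omega>} (\<lambda>r. b r \<omega>)"
    and cX: "tends_to_0_in_prob M (\<lambda>n \<omega>. \<integral>\<^sup>+s\<in>{0..R}.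
        ennreal ((step_value (N n) (p n) (\<lambda>i. \<xi> n i \<omega>) s - (if ennreal s \<le> T \<omega> then c * Y s \<omega> else 0))\<^sup>2) \<partial>lborel)"
    and cI: "tends_to_0_in_prob M (\<lambda>n \<omega>. SUP s\<in>{0..R}.
        ennreal \<bar>step_integral (\<lambda>s. W s \<omega>) (N n) (p n) (\<lambda>i. \<xi> n i \<omega>) s - I s \<omega>\<bar>)"
  defines "Z \<equiv> \<lambda>s \<omega>. exp (- c * W s \<omega> + c\<^sup>2 * s / 2)"
  shows "AE \<omega> in M. Z (stopped T R \<omega>) \<omega> * Y R \<omega> - a0 \<omega> + integral {0..stopped T R \<omega>} (\<lambda>s. Z s \<omega> * b s \<omega>) = 0"
proof -
  obtain n where n: "AE \<omega> in M. \<forall>e>0. \<forall>\<^sub>F k in sequentially.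
      (\<integral>\<^sup>+s\<in>{0..R}. ennreal ((step_value (N (n k)) (p (n k)) (\<lambda>i. \<xi> (n k) i \<omega>) s - (if ennreal s \<le> T \<omega> then c * Y s \<omega> else 0))\<^sup>2) \<partial>lborel) \<le> ennreal e \<and>
      (SUP s\<in>{0..R}. ennreal \<bar>step_integral (\<lambda>s. W s \<omega>) (N (n k)) (p (n k)) (\<lambda>i. \<xi> (n k) i \<omega>) s - I s \<omega>\<bar>) \<le> ennreal e"
    using tends_to_0_subsequence[OF cX cI] by blast
  define N' p' \<xi>' where "N' k = N (n k)" and "p' k = p (n k)" and "\<xi>' k i \<omega> = \<xi> (n k) i \<omega>" for k i \<omega>
  \<comment> \<open>A bound for the elementary integrand: the number of steps times the bound of a
    coefficient. The mesh is chosen after it, small enough to make the cell cut by the stopping time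
    negligible.\<close>
  define C' where "C' k = real (N' k) * \<bar>C (n k)\<bar>" for k
  define \<delta> where "\<delta> k = 1 / (real (Suc k) * (1 + C' k)\<^sup>2)" for k
  have C'0: "0 \<le> C' k" for k by (simp add: C'_def)
  have C'2: "1 \<le> (1 + C' k)\<^sup>2" for k using C'0[of k] by (simp add: one_le_power)
  have \<delta>0: "0 < \<delta> k" for k unfolding \<delta>_def using C'2[of k] by (intro divide_pos_pos mult_pos_pos) auto
  have \<delta>e: "\<delta> k * (1 + C' k)\<^sup>2 = 1 / real (Suc k)" for k
  proof -
    have "(1 + C' k)\<^sup>2 \<noteq> 0" using C'2[of k] by linarith
    then show ?thesis unfolding \<delta>_def by simp
  qed
  have \<delta>k: "\<delta> k \<le> 1 / real (Suc k)" for k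
    using mult_left_mono[OF C'2[of k], of "\<delta> k"] \<delta>0[of k] \<delta>e[of k] by simp
  have \<delta>1: "\<delta> k \<le> 1" for k
    using \<delta>k[of k] by (rule order_trans) simp
  have lim0: "(\<lambda>k. 1 / real (Suc k)) \<longlonglongrightarrow> 0" using LIMSEQ_inverse_real_of_nat by (simp add: inverse_eq_divide)
  have \<delta>lim: "\<delta> \<longlonglongrightarrow> 0"
    by (rule tendsto_sandwich[OF _ _ tendsto_const lim0]) (use \<delta>0 \<delta>k in \<open>auto intro!: always_eventually less_imp_le\<close>)
  let ?v = "\<lambda>k \<omega>. step_value (N' k) (p' k) (\<lambda>i. \<xi>' k i \<omega>)"
  let ?i = "\<lambda>k \<omega>. step_integral (\<lambda>s. W s \<omega>) (N' k) (p' k) (\<lambda>i. \<xi>' k i \<omega>)"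
  have ex: "\<exists>m t. t 0 = 0 \<and> t m = R \<and> (\<forall>j<m. t j < t (Suc j)) \<and> (\<forall>j<m. t (Suc j) - t j \<le> \<delta> k) \<and>
      (\<forall>j<m. \<forall>s\<in>p' k ` {..N' k}. s \<le> t j \<or> t (Suc j) \<le> s)" for k
  proof -
    obtain m t where "t 0 = 0" "t m = R" "\<And>j. j < m \<Longrightarrow> t j < t (Suc j)"
      "\<And>j. j < m \<Longrightarrow> t (Suc j) - t j \<le> \<delta> k" "\<And>j s. j < m \<Longrightarrow> s \<in> p' k ` {..N' k} \<Longrightarrow> s \<le> t j \<or> t (Suc j) \<le> s"
      using partition_exists[of "p' k ` {..N' k}" R "\<delta> k"] R \<delta>0 by (metis finite_atMost finite_imageI)
    then show ?thesis by (intro exI[of _ m] exI[of _ t]) blast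
  qed
  from choice[OF allI[OF ex]] obtain m where "\<forall>k. \<exists>t. t 0 = 0 \<and> t (m k) = R \<and> (\<forall>j<m k. t j < t (Suc j)) \<and> (\<forall>j<m k. t (Suc j) - t j \<le> \<delta> k) \<and>
      (\<forall>j<m k. \<forall>s\<in>p' k ` {..N' k}. s \<le> t j \<or> t (Suc j) \<le> s)" by (rule exE)
  from choice[OF this] obtain t where t: "\<forall>k. t k 0 = 0 \<and> t k (m k) = R \<and> (\<forall>j<m k. t k j < t k (Suc j)) \<and> (\<forall>j<m k. t k (Suc j) - t k j \<le> \<delta> k) \<and>
      (\<forall>j<m k. \<forall>s\<in>p' k ` {..N' k}. s \<le> t k j \<or> t k (Suc j) \<le> s)" by (rule exE)
  have t0: "t k 0 = 0" and tm: "t k (m k) = R" and tl: "j < m k \<Longrightarrow> t k j < t k (Suc j)"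
    and mesh: "j < m k \<Longrightarrow> t k (Suc j) - t k j \<le> \<delta> k"
    and cell: "j < m k \<Longrightarrow> i \<le> N' k \<Longrightarrow> p' k i \<le> t k j \<or> t k (Suc j) \<le> p' k i" for k j i
    using t by auto
  have tmono: "t k i \<le> t k j" if "i \<le> j" "j \<le> m k" for k i j
    by (rule partition_mono[where t="t k" and m="m k"]) (use tl that in auto)
  have tpos: "0 \<le> t k j" "t k j \<le> R" if "j \<le> m k" for k j using tmono[of 0 j k] tmono[of j "m k" k] that t0 tm by auto
  let ?err = "\<lambda>\<omega>. discretised_path.err c (\<lambda>s. W s \<omega>) (\<lambda>s. Y s \<omega>) (\<lambda>s. I s \<omega>) t N' p' (\<lambda>k i. \<xi>' k i \<omega>)" and ?Yn = "\<lambda>\<omega>. discretised_path.Yn (\<lambda>s. W s \<omega>) (\<lambda>s. Y s \<omega>) (\<lambda>s. I s \<omega>) N' p' (\<lambda>k i. \<xi>' k i \<omega>)"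
  let ?Q = "\<lambda>k j \<omega>. Qinc c (t k (Suc j) - t k j) (W (t k (Suc j)) \<omega> - W (t k j) \<omega>)" and ?V = "\<lambda>k j \<omega>. Vinc c (t k (Suc j) - t k j) (W (t k (Suc j)) \<omega> - W (t k j) \<omega>)"
  \<comment> \<open>An adapted substitute for \<open>Yn\<close>: \<open>Y\<close> is set to
    \<open>0\<close> from \<open>T\<close> on, where its adaptedness is not assumed. It agrees with
    \<open>Yn\<close> at all partition times before \<open>T\<close>, and the cutoff removes the
    others.\<close>
  define y where "y k j \<omega> = (if ennreal (t k j) < T \<omega> then Y (t k j) \<omega> else 0) +
    ?i k \<omega> (t k j) - I (t k j) \<omega>" for k j \<omega>
  define e where "e k j \<omega> = ?v k \<omega> (t k (Suc j)) - c * y k j \<omega>" for k j \<omega>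
  have p'0: "0 \<le> p' k i" if "i \<le> N' k" for k i
  proof -
    have "p' k 0 \<le> p' k i" using that
    proof (induction i)
      case (Suc i)
      then show ?case using p(2)[of i "n k"] by (simp add: p'_def N'_def)
    qed simp
    then show ?thesis using p(1)[of "n k"] by (simp add: p'_def)
  qed
  have Zm: "Z s \<in> borel_at s" if "0 \<le> s" for s
    unfolding Z_def using W_adapted[OF that] by measurable
  have ym: "y k j \<in> borel_at (t k j)" if j: "j < m k" for k j
  proof -
    have s0: "0 \<le> t k j" using tpos[of j k] j by simp
    have "(\<lambda>\<omega>. (W (min (p' k (Suc i)) (t k j)) \<omega> - W (min (p' k i) (t k j)) \<omega>) * \<xi>' k i \<omega>) \<in> borel_at (t k j)"
      if i: "i < N' k" for i
    proof (cases "p' k i \<le> t k j")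
      case True
      have "\<xi>' k i \<in> borel_at (t k j)"
        by (rule F_mono_measurable[of "ennreal (p' k i)"])
           (use True \<xi>(1)[of i "n k"] i in \<open>auto simp: p'_def \<xi>'_def[abs_def] N'_def intro!: ennreal_leI\<close>)
      moreover have "W (min (p' k l) (t k j)) \<in> borel_at (t k j)" if "l \<le> N' k" for l
        by (rule F_mono_measurable[OF _ W_adapted]) (use p'0[OF that] s0 in \<open>auto intro!: ennreal_leI\<close>)
      ultimately show ?thesis using i by (intro borel_measurable_times borel_measurable_diff) auto
    next
      case False
      then have "min (p' k (Suc i)) (t k j) = t k j" "min (p' k i) (t k j) = t k j"
        using p(2)[of i "n k"] i by (auto simp: p'_def N'_def)
      then show ?thesis by simp
    qed
    then have "(\<lambda>\<omega>. ?i k \<omega> (t k j)) \<in> borel_at (t k j)"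
      unfolding step_integral_def by (intro borel_measurable_sum) auto
    then show ?thesis unfolding y_def[abs_def]
      by (intro borel_measurable_add borel_measurable_diff Ym[OF s0] Im[OF s0])
  qed
  have em: "e k j \<in> borel_at (t k j)" if j: "j < m k" for k j
  proof -
    have "(\<lambda>\<omega>. indicator {p' k i<..p' k (Suc i)} (t k (Suc j)) * \<xi>' k i \<omega>) \<in> borel_at (t k j)"
      if i: "i < N' k" for i
    proof (cases "p' k i \<le> t k j")
      case True
      have "\<xi>' k i \<in> borel_at (t k j)"
        by (rule F_mono_measurable[of "ennreal (p' k i)"])
           (use True \<xi>(1)[of i "n k"] i in \<open>auto simp: p'_def \<xi>'_def[abs_def] N'_def intro!: ennreal_leI\<close>)
      then show ?thesis by (intro borel_measurable_times) auto
    next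
      case False
      then have "t k (Suc j) \<le> p' k i" using cell[OF j, of i] i by simp
      then show ?thesis by simp
    qed
    then have "(\<lambda>\<omega>. ?v k \<omega> (t k (Suc j))) \<in> borel_at (t k j)"
      unfolding step_value_def by (intro borel_measurable_sum) auto
    then show ?thesis unfolding e_def[abs_def]
      by (intro borel_measurable_diff borel_measurable_times borel_measurable_const ym[OF j])
  qed
  have stepC: "\<bar>?v k \<omega> s\<bar> \<le> C' k" if w: "\<omega> \<in> space M" for k s \<omega>
  proof -
    have "\<bar>?v k \<omega> s\<bar> \<le> (\<Sum>i<N' k. \<bar>indicator {p' k i<..p' k (Suc i)} s * \<xi>' k i \<omega>\<bar>)"
      unfolding step_value_def by (rule sum_abs)
    also have "\<dots> \<le> (\<Sum>i<N' k. \<bar>C (n k)\<bar>)"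
    proof (intro sum_mono)
      fix i assume "i \<in> {..<N' k}"
      then have "\<bar>\<xi>' k i \<omega>\<bar> \<le> \<bar>C (n k)\<bar>" using \<xi>(2)[of i "n k" \<omega>] w by (simp add: \<xi>'_def N'_def)
      then show "\<bar>indicator {p' k i<..p' k (Suc i)} s * \<xi>' k i \<omega>\<bar> \<le> \<bar>C (n k)\<bar>" by (simp add: indicator_def)
    qed
    finally show ?thesis by (simp add: C'_def)
  qed
  have ebound: "\<bar>e k j \<omega>\<bar> \<le> C' k + \<bar>c\<bar> * \<bar>y k j \<omega>\<bar>" if w: "\<omega> \<in> space M" for k j \<omega>
    unfolding e_def using stepC[OF w, of k "t k (Suc j)"] abs_triangle_ineq4[of _ "c * y k j \<omega>"]
    by (simp add: abs_mult) (smt (verit))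
  define g where "g k K j \<omega> = cutoff (t k) (T \<omega>) K (\<lambda>i. Z (t k i) \<omega>) (\<lambda>i. y k i \<omega>) (\<lambda>i. e k i \<omega>) j" for k K j \<omega>
  define S where "S k K \<omega> = (\<Sum>j<m k. (if g k K j \<omega> then Z (t k j) \<omega> * y k j \<omega> else 0) * ?Q k j \<omega>
      + (if g k K j \<omega> then Z (t k j) \<omega> * e k j \<omega> else 0) * ?V k j \<omega>)" for k K \<omega>
  define H where "H k K \<omega> = (\<Sum>j<m k. (t k (Suc j) - t k j) * (if g k K j \<omega> then Z (t k j) \<omega> * e k j \<omega> else 0)\<^sup>2)" for k K \<omega>
  have Zmt: "Z (t k j) \<in> borel_at (t k j)" if "j < m k" for k j
    using Zm[of "t k j"] tpos[of j k] that by simp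
  have est: "S k K \<in> borel_measurable M" "integrable M (\<lambda>\<omega>. (S k K \<omega>)\<^sup>2)" "H k K \<in> borel_measurable M"
    "(\<integral>\<omega>. (S k K \<omega>)\<^sup>2 \<partial>M) \<le> 4 * ((K * K)\<^sup>2 * Kinc c * \<delta> k * R + (K * K * Kinc c * \<delta> k * R)\<^sup>2
       + (Kinc c + (Kinc c)\<^sup>2 * R) * (\<integral>\<omega>. H k K \<omega> \<partial>M))" if "0 \<le> K" for k K
    unfolding S_def[abs_def] H_def[abs_def] g_def
    by (rule cutoff_estimate[where t="t k" and m="m k" and R=R and \<delta>="\<delta> k" and K=K and c=c and C="C' k"
      and z="\<lambda>j. Z (t k j)" and y="y k" and e="e k", OF T(1) t0 tm tl mesh \<delta>1 \<delta>0 that Zmt ym em ebound], assumption+)+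
  let ?P = "\<lambda>\<omega>. discretised_path R (stopped T R \<omega>) c (a0 \<omega>) (\<lambda>s. W s \<omega>) (\<lambda>s. Y s \<omega>) (\<lambda>s. I s \<omega>) (\<lambda>s. b s \<omega>) m t N' p' (\<lambda>k i. \<xi>' k i \<omega>) C' \<delta>"
  have path: "AE \<omega> in M. ?P \<omega>"
    using n T(2) Y b eq W_zero W_continuous AE_space
  proof eventually_elim
    case (elim \<omega>)
    have cn: "\<forall>\<^sub>F k in sequentially.
      (\<integral>\<^sup>+s\<in>{0..R}. ennreal ((?v k \<omega> s - (if ennreal s \<le> T \<omega> then c * Y s \<omega> else 0))\<^sup>2) \<partial>lborel) \<le> ennreal e \<and>
      (SUP s\<in>{0..R}. ennreal \<bar>?i k \<omega> s - I s \<omega>\<bar>) \<le> ennreal e" if "e > 0" for e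
      using elim(1) that unfolding N'_def p'_def \<xi>'_def by blast
    show ?case
    proof
      show "0 < stopped T R \<omega>" using less_stopped_iff[of 0 R T \<omega>] R elim(2) by simp
      show "stopped T R \<omega> \<le> R" using R by (simp add: stopped_le)
      show "continuous_on {0..R} (\<lambda>s. W s \<omega>)" using elim(8) by (rule continuous_on_subset) auto
      show "Y s \<omega> = Y (stopped T R \<omega>) \<omega>" if "s \<in> {stopped T R \<omega>..R}" for s
      proof -
        have "0 \<le> s" "s \<le> R" using that stopped_nonneg[of T R \<omega>] by auto
        then have "stopped T s \<omega> = stopped T R \<omega>" using stopped_eq_min[of s R T \<omega>] that by simp
        then show ?thesis using elim(4) \<open>0 \<le> s\<close> \<open>s \<le> R\<close> by auto
      qed
      show "Y s \<omega> - I s \<omega> = a0 \<omega> - integral {0..min s (stopped T R \<omega>)} (\<lambda>r. b r \<omega>)" if "s \<in> {0..R}" for s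
        using elim(6) that stopped_eq_min[of s R T \<omega>] by auto
      show "\<bar>?v k \<omega> s\<bar> \<le> C' k" for k s using stepC elim(9) .
      show "(\<lambda>k. \<delta> k * (1 + C' k)\<^sup>2) \<longlonglongrightarrow> 0" unfolding \<delta>e by (rule lim0)
      show "0 \<le> p' k 0" for k using p(1) by (simp add: p'_def)
      show "p' k i \<le> p' k (Suc i)" if "i < N' k" for k i using p(2) that by (simp add: p'_def N'_def)
      show "\<forall>\<^sub>F k in sequentially. \<forall>s\<in>{0..R}. \<bar>?i k \<omega> s - I s \<omega>\<bar> \<le> e" if "e > 0" for e
        using cn[OF that]
      proof eventually_elim
        case (elim k)
        then have "\<forall>s\<in>{0..R}. ennreal \<bar>?i k \<omega> s - I s \<omega>\<bar> \<le> ennreal e"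
          by (simp add: SUP_le_iff)
        then show ?case using that by (simp add: ennreal_le_iff)
      qed
      show "\<forall>\<^sub>F k in sequentially. (\<integral>\<^sup>+s\<in>{0..R}. ennreal ((?v k \<omega> s - (if s \<le> stopped T R \<omega> then c * Y s \<omega> else 0))\<^sup>2) \<partial>lborel) \<le> ennreal e"
        if "e > 0" for e
        using cn[OF that]
      proof eventually_elim
        case (elim k)
        have "(\<integral>\<^sup>+s\<in>{0..R}. ennreal ((?v k \<omega> s - (if s \<le> stopped T R \<omega> then c * Y s \<omega> else 0))\<^sup>2) \<partial>lborel)
          = (\<integral>\<^sup>+s\<in>{0..R}. ennreal ((?v k \<omega> s - (if ennreal s \<le> T \<omega> then c * Y s \<omega> else 0))\<^sup>2) \<partial>lborel)"
        proof (rule nn_integral_cong)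
          fix s :: real
          show "ennreal ((?v k \<omega> s - (if s \<le> stopped T R \<omega> then c * Y s \<omega> else 0))\<^sup>2) * indicator {0..R} s =
            ennreal ((?v k \<omega> s - (if ennreal s \<le> T \<omega> then c * Y s \<omega> else 0))\<^sup>2) * indicator {0..R} s"
          proof (cases "s \<in> {0..R}")
            case True
            then have "s \<le> stopped T R \<omega> \<longleftrightarrow> ennreal s \<le> T \<omega>" by (intro le_stopped_iff) auto
            then show ?thesis by (simp only:)
          qed simp
        qed
        then show ?case using elim by simp
      qed
    qed (use elim t0 tm tl mesh cell \<delta>0 in auto)
  qed
  have same: "y k j \<omega> = ?Yn \<omega> k (t k j)"
    "e k j \<omega> = ?err \<omega> k j"
    if P: "?P \<omega>" and j: "ennreal (t k j) < T \<omega>" for k j \<omega>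
  proof -
    show 1: "y k j \<omega> = ?Yn \<omega> k (t k j)"
      unfolding discretised_path.Yn_def[OF P] y_def using j by simp
    show "e k j \<omega> = ?err \<omega> k j"
      unfolding discretised_path.err_def[OF P] e_def 1 ..
  qed
  have before: "{j. j < m k \<and> ennreal (t k j) < T \<omega>} = {j. j < m k \<and> t k j < stopped T R \<omega>}" for k \<omega>
  proof -
    have "t k j < R" if "j < m k" for j
      using tl[OF that] tpos(2)[of "Suc j" k] that by simp
    then show ?thesis using less_stopped_iff[of "t k j" R T \<omega> for j] tpos(1)[of _ k] by auto
  qed
  have Hlim: "(\<lambda>k. H k K \<omega>) \<longlonglongrightarrow> 0" if P: "?P \<omega>" for K \<omega>
  proof (rule tendsto_sandwich[OF _ _ tendsto_const])
    show "\<forall>\<^sub>F k in sequentially. 0 \<le> H k K \<omega>"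
      unfolding H_def using tl by (intro always_eventually allI sum_nonneg mult_nonneg_nonneg) (auto intro: less_imp_le)
    show "\<forall>\<^sub>F k in sequentially. H k K \<omega> \<le> K\<^sup>2 * (\<Sum>j | j < m k \<and> t k j < stopped T R \<omega>. (t k (Suc j) - t k j) *
        (?err \<omega> k j)\<^sup>2)"
    proof (intro always_eventually allI)
      fix k
      have "H k K \<omega> \<le> K\<^sup>2 * (\<Sum>j | j < m k \<and> ennreal (t k j) < T \<omega>. (t k (Suc j) - t k j) * (e k j \<omega>)\<^sup>2)"
        unfolding H_def g_def by (rule cutoff_error_sum(2)[OF tl t0])
      also have "(\<Sum>j | j < m k \<and> ennreal (t k j) < T \<omega>. (t k (Suc j) - t k j) * (e k j \<omega>)\<^sup>2)
        = (\<Sum>j | j < m k \<and> t k j < stopped T R \<omega>. (t k (Suc j) - t k j) *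
        (?err \<omega> k j)\<^sup>2)"
        unfolding before[symmetric] by (intro sum.cong refl) (use same(2)[OF P] in simp)
      finally show "H k K \<omega> \<le> K\<^sup>2 * (\<Sum>j | j < m k \<and> t k j < stopped T R \<omega>. (t k (Suc j) - t k j) *
        (?err \<omega> k j)\<^sup>2)" .
    qed
    show "(\<lambda>k. K\<^sup>2 * (\<Sum>j | j < m k \<and> t k j < stopped T R \<omega>. (t k (Suc j) - t k j) *
        (?err \<omega> k j)\<^sup>2)) \<longlonglongrightarrow> 0"
      using tendsto_mult_left[OF discretised_path.err_sum_tendsto[OF P], of "K\<^sup>2"] by simp
  qed
  have ES: "(\<lambda>k. \<integral>\<omega>. (S k K \<omega>)\<^sup>2 \<partial>M) \<longlonglongrightarrow> 0" if K: "0 \<le> K" for K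
  proof -
    \<comment> \<open>Convergence in probability of the integrands provides no moments; the cutoff
      supplies the dominating constant \<open>K\<^sup>2\<close>.\<close>
    have HE: "(\<lambda>k. \<integral>\<omega>. H k K \<omega> \<partial>M) \<longlonglongrightarrow> (\<integral>\<omega>. 0 \<partial>M)"
    proof (rule integral_dominated_convergence[where w="\<lambda>_. K\<^sup>2"])
      show "H k K \<in> borel_measurable M" for k by (rule est(3)[OF K])
      show "AE \<omega> in M. (\<lambda>k. H k K \<omega>) \<longlonglongrightarrow> 0" using path by eventually_elim (rule Hlim)
      show "AE \<omega> in M. norm (H k K \<omega>) \<le> K\<^sup>2" for k
      proof (rule AE_I2)
        fix \<omega>
        have "0 \<le> H k K \<omega>"
          unfolding H_def using tl by (intro sum_nonneg mult_nonneg_nonneg) (auto intro: less_imp_le)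
        moreover have "H k K \<omega> \<le> K\<^sup>2" unfolding H_def g_def by (rule cutoff_error_sum(1)[OF tl t0])
        ultimately show "norm (H k K \<omega>) \<le> K\<^sup>2" by simp
      qed
    qed auto
    define U where "U k = 4 * ((K * K)\<^sup>2 * Kinc c * \<delta> k * R + (K * K * Kinc c * \<delta> k * R)\<^sup>2
       + (Kinc c + (Kinc c)\<^sup>2 * R) * (\<integral>\<omega>. H k K \<omega> \<partial>M))" for k
    have "U \<longlonglongrightarrow> 4 * ((K * K)\<^sup>2 * Kinc c * 0 * R + (K * K * Kinc c * 0 * R)\<^sup>2 + (Kinc c + (Kinc c)\<^sup>2 * R) * (\<integral>\<omega>. 0 \<partial>M))"
      unfolding U_def by (intro tendsto_intros \<delta>lim HE)
    then have "U \<longlonglongrightarrow> 0" by simp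
    then show ?thesis
      by (rule tendsto_sandwich[OF _ _ tendsto_const, rotated 2]) (use est(4)[OF K] in \<open>auto simp: U_def\<close>)
  qed
  \<comment> \<open>Levels that are natural numbers are countably many, so the exceptional set can
    be chosen before the level, which later depends on the path.\<close>
  have "AE \<omega> in M. liminf (\<lambda>k. ennreal ((S k (real K) \<omega>)\<^sup>2)) = 0" for K :: nat
  proof -
    have Sm: "S k (real K) \<in> borel_measurable M" for k by (rule est(1)) simp
    have "(\<integral>\<^sup>+\<omega>. liminf (\<lambda>k. ennreal ((S k (real K) \<omega>)\<^sup>2)) \<partial>M) \<le> liminf (\<lambda>k. \<integral>\<^sup>+\<omega>. ennreal ((S k (real K) \<omega>)\<^sup>2) \<partial>M)"
      by (rule nn_integral_liminf) (use Sm in measurable)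
    also have "(\<lambda>k. \<integral>\<^sup>+\<omega>. ennreal ((S k (real K) \<omega>)\<^sup>2) \<partial>M) = (\<lambda>k. ennreal (\<integral>\<omega>. (S k (real K) \<omega>)\<^sup>2 \<partial>M))"
      by (intro ext nn_integral_eq_integral est(2)) auto
    also have "liminf \<dots> = 0"
      using lim_imp_Liminf[OF sequentially_bot tendsto_ennrealI[OF ES[of "real K"]]] by simp
    finally have "(\<integral>\<^sup>+\<omega>. liminf (\<lambda>k. ennreal ((S k (real K) \<omega>)\<^sup>2)) \<partial>M) = 0" by simp
    then show ?thesis by (subst (asm) nn_integral_0_iff_AE) (use Sm in measurable)
  qed
  then have "AE \<omega> in M. \<forall>K::nat. liminf (\<lambda>k. ennreal ((S k (real K) \<omega>)\<^sup>2)) = 0" by (simp add: AE_all_countable)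
  with path show ?thesis
  proof eventually_elim
    case (elim \<omega>)
    note P = elim(1)
    define L where "L = Z (stopped T R \<omega>) \<omega> * Y R \<omega> - a0 \<omega> + integral {0..stopped T R \<omega>} (\<lambda>s. Z s \<omega> * b s \<omega>)"
    have YR: "Y R \<omega> = Y (stopped T R \<omega>) \<omega>"
      using discretised_path.Y(2)[OF P, of R] discretised_path.\<rho>[OF P] by simp
    obtain K0 where K0: "\<forall>\<^sub>F k in sequentially. \<forall>j\<le>m k. \<bar>discretised_path.Z c (\<lambda>s. W s \<omega>) (t k j)\<bar> \<le> K0 \<and>
      \<bar>?Yn \<omega> k (t k j)\<bar> \<le> K0"
      using discretised_path.eventually_bounded[OF P] by blast
    obtain K :: nat where K: "K0 \<le> real K" using real_arch_simple by blast
    have Zs: "discretised_path.Z c (\<lambda>s. W s \<omega>) s = Z s \<omega>" for s unfolding discretised_path.Z_def[OF P] Z_def ..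
    have "\<forall>\<^sub>F k in sequentially. (\<Sum>j | j < m k \<and> t k j < stopped T R \<omega>. (t k (Suc j) - t k j) *
        (?err \<omega> k j)\<^sup>2) < 1"
      by (rule order_tendstoD(2)[OF discretised_path.err_sum_tendsto[OF P]]) simp
    with K0 have ev: "\<forall>\<^sub>F k in sequentially. (\<Sum>j | j < m k \<and> t k j < stopped T R \<omega>. Z (t k j) \<omega> *
       (?Yn \<omega> k (t k j) * ?Q k j \<omega>
      + ?err \<omega> k j * ?V k j \<omega>)) = S k (real K) \<omega>"
    proof eventually_elim
      case (elim k)
      have good: "g k (real K) j \<omega> \<longleftrightarrow> ennreal (t k j) < T \<omega>" if j: "j < m k" for j
      proof
        assume "g k (real K) j \<omega>" then show "ennreal (t k j) < T \<omega>" by (simp add: g_def cutoff_def)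
      next
        assume jT: "ennreal (t k j) < T \<omega>"
        have iT: "ennreal (t k i) < T \<omega>" if "i \<le> j" for i
          using tmono[OF that, of k] j jT by (meson ennreal_leI le_less_trans less_imp_le)
        have "(\<Sum>i\<le>j. (t k (Suc i) - t k i) * (e k i \<omega>)\<^sup>2) \<le> (\<Sum>i | i < m k \<and> ennreal (t k i) < T \<omega>. (t k (Suc i) - t k i) * (e k i \<omega>)\<^sup>2)"
          by (rule sum_mono2) (use iT j in \<open>auto intro!: mult_nonneg_nonneg less_imp_le[OF tl]\<close>)
        also have "\<dots> = (\<Sum>j | j < m k \<and> t k j < stopped T R \<omega>. (t k (Suc j) - t k j) *
            (?err \<omega> k j)\<^sup>2)"
          unfolding before[symmetric] by (intro sum.cong refl) (use same(2)[OF P] in simp)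
        finally have "(\<Sum>i\<le>j. (t k (Suc i) - t k i) * (e k i \<omega>)\<^sup>2) \<le> 1" using elim(2) by linarith
        moreover have "\<bar>Z (t k i) \<omega>\<bar> \<le> real K \<and> \<bar>y k i \<omega>\<bar> \<le> real K" if "i \<le> j" for i
        proof -
          have "i \<le> m k" using that j by simp
          then have "\<bar>Z (t k i) \<omega>\<bar> \<le> K0 \<and> \<bar>y k i \<omega>\<bar> \<le> K0"
            using elim(1) same(1)[OF P iT[OF that]] unfolding Zs by simp
          then show ?thesis using K by linarith
        qed
        ultimately show "g k (real K) j \<omega>" using jT unfolding g_def cutoff_def by blast
      qed
      show ?case unfolding before[symmetric] S_def
        by (rule sum.mono_neutral_cong_left) (use good same[OF P] in \<open>auto simp: algebra_simps\<close>)
    qed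
    have lim: "(\<lambda>k. S k (real K) \<omega>) \<longlonglongrightarrow> L"
      using Lim_transform_eventually[OF discretised_path.product_rule_limit[OF P, unfolded Zs] ev] unfolding L_def YR .
    have "(\<lambda>k. ennreal ((S k (real K) \<omega>)\<^sup>2)) \<longlonglongrightarrow> ennreal (L\<^sup>2)"
      by (intro tendsto_ennrealI tendsto_power lim)
    then have "liminf (\<lambda>k. ennreal ((S k (real K) \<omega>)\<^sup>2)) = ennreal (L\<^sup>2)"
      by (rule lim_imp_Liminf[OF sequentially_bot])
    then have "L\<^sup>2 = 0" using elim(2) by (simp add: ennreal_eq_0_iff)
    then show ?case unfolding L_def by simp
  qed
qed

end

section \<open>Solution paths\<close>

definition sobolev_path :: "real \<Rightarrow> real set \<Rightarrow> (real \<Rightarrow> real \<Rightarrow> real) \<Rightarrow> bool" where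
  "sobolev_path s A u \<longleftrightarrow> (\<forall>t\<in>A. u t \<in> sobolev_space s \<and> ((\<lambda>r. sobolev_dist s (u r) (u t)) \<longlongrightarrow> 0) (at t within A))"

lemma sobolev_dist_nonneg: "0 \<le> sobolev_dist s f g"
  by (simp add: sobolev_dist_def)

lemma sobolev_dist_bounds:
  assumes s: "s > 3 / 2" and f: "f \<in> sobolev_space s" "g \<in> sobolev_space s"
  shows "\<bar>f x - g x\<bar> \<le> sobolev_const s * sobolev_dist s f g"
    and "\<bar>deriv f x - deriv g x\<bar> \<le> sobolev_const s * sobolev_dist s f g"
proof -
  note d = sobolev_space_diff[OF f]
  show "\<bar>f x - g x\<bar> \<le> sobolev_const s * sobolev_dist s f g"
    using sobolev_bound[OF s d] by (simp add: sobolev_dist_def)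
  have "((\<lambda>x. f x - g x) has_real_derivative deriv f x - deriv g x) (at x)"
    by (intro DERIV_diff sobolev_has_deriv[OF s] f)
  then show "\<bar>deriv f x - deriv g x\<bar> \<le> sobolev_const s * sobolev_dist s f g"
    using sobolev_deriv_bound[OF s d, of x] DERIV_imp_deriv by (fastforce simp: sobolev_dist_def)
qed

lemma sobolev_deriv_measurable:
  assumes "s > 3 / 2"
  shows "(\<lambda>f. deriv f x) \<in> borel_measurable (sobolev_borel s)"
  by (rule measurable_sobolev_borel_Lipschitz[where C="sobolev_const s"]) (rule sobolev_dist_bounds(2)[OF assms])

lemma joint_cont_Lipschitz:
  fixes \<phi> :: "real \<Rightarrow> real \<Rightarrow> real"
  assumes c: "\<And>t. t \<in> A \<Longrightarrow> continuous_on UNIV (\<phi> t)"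
    and L: "\<And>r t x. r \<in> A \<Longrightarrow> t \<in> A \<Longrightarrow> \<bar>\<phi> r x - \<phi> t x\<bar> \<le> C * d r t"
    and d: "\<And>t. t \<in> A \<Longrightarrow> ((\<lambda>r. d r t) \<longlongrightarrow> 0) (at t within A)"
  shows "joint_cont A \<phi>"
  unfolding continuous_on_iff
proof (intro ballI allI impI)
  fix p :: "real \<times> real" and \<epsilon> :: real assume p: "p \<in> A \<times> UNIV" and \<epsilon>: "0 < \<epsilon>"
  obtain t x where tx: "p = (t, x)" "t \<in> A" using p by auto
  have "((\<lambda>r. C * d r t) \<longlongrightarrow> C * 0) (at t within A)" by (intro tendsto_intros d tx)
  then have "\<forall>\<^sub>F r in at t within A. C * d r t < \<epsilon> / 2" by (rule order_tendstoD(2)) (use \<epsilon> in simp)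
  then obtain \<delta>1 where \<delta>1: "\<delta>1 > 0" "\<And>r. r \<in> A \<Longrightarrow> r \<noteq> t \<Longrightarrow> dist r t < \<delta>1 \<Longrightarrow> C * d r t < \<epsilon> / 2"
    unfolding eventually_at by blast
  have \<delta>1': "\<bar>\<phi> r y - \<phi> t y\<bar> < \<epsilon> / 2" if "r \<in> A" "dist r t < \<delta>1" for r y
  proof (cases "r = t")
    case False
    then show ?thesis using \<delta>1(2)[OF that(1) False that(2)] L[OF that(1) tx(2), of y] by linarith
  qed (use \<epsilon> in simp)
  obtain \<delta>2 where \<delta>2: "\<delta>2 > 0" "\<And>y. dist y x < \<delta>2 \<Longrightarrow> dist (\<phi> t y) (\<phi> t x) < \<epsilon> / 2"
    using c[OF tx(2)] \<epsilon> unfolding continuous_on_iff by (metis UNIV_I half_gt_zero)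
  show "\<exists>\<delta>>0. \<forall>p'\<in>A \<times> UNIV. dist p' p < \<delta> \<longrightarrow> dist (case p' of (t, x) \<Rightarrow> \<phi> t x) (case p of (t, x) \<Rightarrow> \<phi> t x) < \<epsilon>"
  proof (rule exI[of _ "min \<delta>1 \<delta>2"], intro conjI ballI impI)
    fix p' :: "real \<times> real" assume p': "p' \<in> A \<times> UNIV" "dist p' p < min \<delta>1 \<delta>2"
    obtain r y where ry: "p' = (r, y)" "r \<in> A" using p' by auto
    have "dist r t < \<delta>1" "dist y x < \<delta>2"
      using p'(2) dist_fst_le[of p' p] dist_snd_le[of p' p] by (auto simp: ry tx)
    then have "\<bar>\<phi> r y - \<phi> t y\<bar> < \<epsilon> / 2" "\<bar>\<phi> t y - \<phi> t x\<bar> < \<epsilon> / 2"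
      using \<delta>1'[OF ry(2)] \<delta>2(2) by (auto simp: dist_real_def)
    then show "dist (case p' of (t, x) \<Rightarrow> \<phi> t x) (case p of (t, x) \<Rightarrow> \<phi> t x) < \<epsilon>"
      unfolding ry tx prod.case dist_real_def by linarith
  qed (use \<delta>1 \<delta>2 in simp)
qed

lemma sobolev_path_joint_cont:
  assumes s: "s > 3 / 2" and u: "sobolev_path s A u"
  shows "joint_cont A u"
    and "joint_cont A (\<lambda>t x. deriv (u t) x)"
proof -
  have sp: "u t \<in> sobolev_space s" and d: "((\<lambda>r. sobolev_dist s (u r) (u t)) \<longlongrightarrow> 0) (at t within A)" if "t \<in> A" for t
    using u that unfolding sobolev_path_def by blast+
  show "joint_cont A u"
    by (rule joint_cont_Lipschitz[where d="\<lambda>r t. sobolev_dist s (u r) (u t)" and C="sobolev_const s"])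
      (use sp d sobolev_spaceD(2) sobolev_dist_bounds(1)[OF s] in auto)
  show "joint_cont A (\<lambda>t x. deriv (u t) x)"
    by (rule joint_cont_Lipschitz[where d="\<lambda>r t. sobolev_dist s (u r) (u t)" and C="sobolev_const s"])
      (use sp d sobolev_deriv_cont[OF s] sobolev_dist_bounds(2)[OF s] in auto)
qed

lemma drift_eqs:
  assumes s: "s > 3 / 2" and u: "u \<in> sobolev_space s" and g: "g \<in> sobolev_space s"
  shows "drift_u u g x = u x * deriv u x + Gd (\<lambda>y. (u y)\<^sup>2 + (deriv u y)\<^sup>2 / 2 + (g y)\<^sup>2 / 2 - (deriv g y)\<^sup>2 / 2) x"
    and "drift_g u g x = u x * deriv g x + (Gd (\<lambda>y. deriv u y * deriv g y) x + Gc (\<lambda>y. deriv u y * g y) x)"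
proof -
  note c = sobolev_spaceD(2)[OF u] sobolev_spaceD(2)[OF g] sobolev_deriv_cont[OF s u] sobolev_deriv_cont[OF s g]
  note p = sobolev_spaceD(3)[OF u] sobolev_spaceD(3)[OF g] sobolev_deriv_periodic[OF s u] sobolev_deriv_periodic[OF s g]
  show "drift_u u g x = u x * deriv u x + Gd (\<lambda>y. (u y)\<^sup>2 + (deriv u y)\<^sup>2 / 2 + (g y)\<^sup>2 / 2 - (deriv g y)\<^sup>2 / 2) x"
    unfolding drift_u_def by (subst deriv_green_conv) (auto simp: p intro!: continuous_intros c)
  show "drift_g u g x = u x * deriv g x + (Gd (\<lambda>y. deriv u y * deriv g y) x + Gc (\<lambda>y. deriv u y * g y) x)"
    unfolding drift_g_def
    by (subst deriv_green_conv; (subst green_conv_eq)?) (auto simp: p intro!: continuous_intros c)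
qed

lemma drift_joint_cont:
  assumes s: "s > 3 / 2" and u: "sobolev_path s A u" and g: "sobolev_path s A g"
  shows "joint_cont A (\<lambda>t x. drift_u (u t) (g t) x)"
    and "joint_cont A (\<lambda>t x. drift_g (u t) (g t) x)"
proof -
  note c = sobolev_path_joint_cont[OF s u, unfolded case_prod_beta'] sobolev_path_joint_cont[OF s g, unfolded case_prod_beta']
  have sp: "u t \<in> sobolev_space s" "g t \<in> sobolev_space s" if "t \<in> A" for t
    using u g that unfolding sobolev_path_def by blast+
  have f: "joint_cont A (\<lambda>t y. (u t y)\<^sup>2 + (deriv (u t) y)\<^sup>2 / 2 + (g t y)\<^sup>2 / 2 - (deriv (g t) y)\<^sup>2 / 2)"
    "joint_cont A (\<lambda>t y. deriv (u t) y * deriv (g t) y)"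
    "joint_cont A (\<lambda>t y. deriv (u t) y * g t y)"
    unfolding case_prod_beta' by (intro continuous_intros c; simp)+
  have 1: "joint_cont A (\<lambda>t x. u t x * deriv (u t) x +
      Gd (\<lambda>y. (u t y)\<^sup>2 + (deriv (u t) y)\<^sup>2 / 2 + (g t y)\<^sup>2 / 2 - (deriv (g t) y)\<^sup>2 / 2) x)"
    using Gc_joint_cont(2)[OF f(1)] unfolding case_prod_beta' by (intro continuous_on_add continuous_on_mult c)
  have 2: "joint_cont A (\<lambda>t x. u t x * deriv (g t) x +
      (Gd (\<lambda>y. deriv (u t) y * deriv (g t) y) x + Gc (\<lambda>y. deriv (u t) y * g t y) x))"
    using Gc_joint_cont(2)[OF f(2)] Gc_joint_cont(1)[OF f(3)]
    unfolding case_prod_beta' by (intro continuous_on_add continuous_on_mult c)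
  show "joint_cont A (\<lambda>t x. drift_u (u t) (g t) x)"
    by (rule continuous_on_eq[OF 1]) (auto simp: drift_eqs(1)[OF s sp])
  show "joint_cont A (\<lambda>t x. drift_g (u t) (g t) x)"
    by (rule continuous_on_eq[OF 2]) (auto simp: drift_eqs(2)[OF s sp])
qed

text \<open>Both sides are continuous, first in \<open>x\<close> for a fixed rational time and then
  in \<open>t\<close>, so the equation extends from the dense set. With a continuous integrand the
  integral equation can then be differentiated in time.\<close>

lemma mild_equation_dense:
  fixes Z f0 :: "real \<Rightarrow> real" and \<phi> d :: "real \<Rightarrow> real \<Rightarrow> real"
  assumes \<rho>: "0 < \<rho>" and Z: "continuous_on {0..\<rho>} Z"
    and \<phi>: "joint_cont {0..\<rho>} \<phi>"
    and d: "joint_cont {0..\<rho>} d"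
    and f0: "continuous_on UNIV f0"
    and eq: "\<And>t x. t \<in> {0<..<\<rho>} \<Longrightarrow> t \<in> \<rat> \<Longrightarrow> x \<in> \<rat> \<Longrightarrow> Z t * \<phi> t x - f0 x + integral {0..t} (\<lambda>r. Z r * d r x) = 0"
    and t: "t \<in> {0..\<rho>}"
  shows "Z t * \<phi> t x = f0 x - integral {0..t} (\<lambda>r. Z r * d r x)"
    and "((\<lambda>t. Z t * \<phi> t x) has_real_derivative - Z t * d t x) (at t within {0..\<rho>})"
proof -
  have Zd: "continuous_on {0..\<rho>} (\<lambda>r. Z r * d r x)" for x
    by (intro continuous_on_mult Z jcont[OF d] continuous_on_id continuous_on_const)
  have 1: "Z t * \<phi> t x - f0 x + integral {0..t} (\<lambda>r. Z r * d r x) = 0"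
    if t: "t \<in> {0<..<\<rho>}" "t \<in> \<rat>" for t x
  proof (rule continuous_constant_on_closure[where S="\<rat>" and f="\<lambda>x. Z t * \<phi> t x - f0 x + integral {0..t} (\<lambda>r. Z r * d r x)"])
    have "continuous_on (UNIV \<times> cbox 0 t) (\<lambda>(x, r). Z r * d r x)"
      unfolding case_prod_beta'
      by (intro continuous_on_mult continuous_on_compose2[OF Z] jcont[OF d] continuous_on_fst continuous_on_snd continuous_on_id)
         (use t in auto)
    then have "continuous_on UNIV (\<lambda>x. integral {0..t} (\<lambda>r. Z r * d r x))"
      using integral_continuous_on_param by fastforce
    then show "continuous_on (closure \<rat>) (\<lambda>x. Z t * \<phi> t x - f0 x + integral {0..t} (\<lambda>r. Z r * d r x))"
      unfolding Rats_closure_real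
      by (intro continuous_intros f0 jcont[OF \<phi>]) (use t in auto)
  qed (use eq t in \<open>auto simp: Rats_closure_real\<close>)
  have cl: "closure ({0<..<\<rho>} \<inter> \<rat>) = {0..\<rho>}"
    using \<rho> closure_open_Int_superset[of "{0<..<\<rho>}" \<rat>] by (simp add: Rats_closure_real)
  have 2: "Z t * \<phi> t x - f0 x + integral {0..t} (\<lambda>r. Z r * d r x) = 0" if t: "t \<in> {0..\<rho>}" for t x
  proof (rule continuous_constant_on_closure[where S="{0<..<\<rho>} \<inter> \<rat>" and f="\<lambda>t. Z t * \<phi> t x - f0 x + integral {0..t} (\<lambda>r. Z r * d r x)"])
    have "continuous_on {0..\<rho>} (\<lambda>t. integral {0..t} (\<lambda>r. Z r * d r x))"
      by (intro indefinite_integral_continuous_1 integrable_continuous_real Zd)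
    then show "continuous_on (closure ({0<..<\<rho>} \<inter> \<rat>)) (\<lambda>t. Z t * \<phi> t x - f0 x + integral {0..t} (\<lambda>r. Z r * d r x))"
      unfolding cl by (intro continuous_intros Z jcont[OF \<phi>]) auto
  qed (use 1 t cl in auto)
  then show "Z t * \<phi> t x = f0 x - integral {0..t} (\<lambda>r. Z r * d r x)" using t by (simp add: algebra_simps)
  have "((\<lambda>t. f0 x - integral {0..t} (\<lambda>r. Z r * d r x)) has_real_derivative 0 - Z t * d t x) (at t within {0..\<rho>})"
    by (intro DERIV_diff DERIV_const integral_has_real_derivative[OF Zd t])
  then have "((\<lambda>t. Z t * \<phi> t x) has_real_derivative 0 - Z t * d t x) (at t within {0..\<rho>})"
    by (rule has_field_derivative_transform_within[OF _ zero_less_one t]) (use 2 in \<open>auto simp: algebra_simps\<close>)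
  then show "((\<lambda>t. Z t * \<phi> t x) has_real_derivative - Z t * d t x) (at t within {0..\<rho>})" by simp
qed

lemma Gc_scale: "Gc (\<lambda>y. k * f y) x = k * Gc f x" and Gd_scale: "Gd (\<lambda>y. k * f y) x = k * Gd f x"
  unfolding Gc_def Gd_def by (simp_all add: mult.left_commute[of _ k])

text \<open>The equations are only required at rational times and points, where countably many applications
  of the product rule give them almost surely; continuity does the rest.\<close>

locale mild_path =
  fixes s c \<rho> :: real and w :: "real \<Rightarrow> real" and u g :: "real \<Rightarrow> real \<Rightarrow> real" and u0 g0 :: "real \<Rightarrow> real"
  assumes s: "s > 3 / 2" and \<rho>: "0 < \<rho>" and w: "continuous_on {0..\<rho>} w"
    and u: "sobolev_path s {0..\<rho>} u" and g: "sobolev_path s {0..\<rho>} g"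
    and u0: "u0 \<in> sobolev_space s" and g0: "g0 \<in> sobolev_space s"
    and u_mild: "\<And>t x. t \<in> {0<..<\<rho>} \<Longrightarrow> t \<in> \<rat> \<Longrightarrow> x \<in> \<rat> \<Longrightarrow>
      exp (- c * w t + c\<^sup>2 * t / 2) * u t x - u0 x + integral {0..t} (\<lambda>r. exp (- c * w r + c\<^sup>2 * r / 2) * drift_u (u r) (g r) x) = 0"
    and g_mild: "\<And>t x. t \<in> {0<..<\<rho>} \<Longrightarrow> t \<in> \<rat> \<Longrightarrow> x \<in> \<rat> \<Longrightarrow>
      exp (- c * w t + c\<^sup>2 * t / 2) * g t x - g0 x + integral {0..t} (\<lambda>r. exp (- c * w r + c\<^sup>2 * r / 2) * drift_g (u r) (g r) x) = 0"
begin

definition Z where "Z t = exp (- c * w t + c\<^sup>2 * t / 2)"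
definition \<beta> where "\<beta> t = exp (c * w t - c\<^sup>2 * t / 2)"

lemma Z_\<beta>: "Z t * \<beta> t = 1" "\<beta> t * Z t = 1" "Z t > 0" "\<beta> t > 0"
  unfolding Z_def \<beta>_def by (simp_all add: exp_add[symmetric])

lemma Z_cont: "continuous_on {0..\<rho>} Z" and \<beta>_cont: "continuous_on {0..\<rho>} \<beta>"
  unfolding Z_def \<beta>_def by (intro continuous_intros w; simp)+

lemma path_space: "t \<in> {0..\<rho>} \<Longrightarrow> u t \<in> sobolev_space s" "t \<in> {0..\<rho>} \<Longrightarrow> g t \<in> sobolev_space s"
  using u g unfolding sobolev_path_def by blast+

lemma u_eqs:
  assumes t: "t \<in> {0..\<rho>}"
  shows "Z t * u t x = u0 x - integral {0..t} (\<lambda>r. Z r * drift_u (u r) (g r) x)"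
    and "((\<lambda>t. Z t * u t x) has_real_derivative - Z t * drift_u (u t) (g t) x) (at t within {0..\<rho>})"
  by (rule mild_equation_dense[OF \<rho> Z_cont sobolev_path_joint_cont(1)[OF s u] drift_joint_cont(1)[OF s u g]
        sobolev_spaceD(2)[OF u0] _ t]; rule u_mild[folded Z_def]; assumption)+

lemma g_eqs:
  assumes t: "t \<in> {0..\<rho>}"
  shows "Z t * g t x = g0 x - integral {0..t} (\<lambda>r. Z r * drift_g (u r) (g r) x)"
    and "((\<lambda>t. Z t * g t x) has_real_derivative - Z t * drift_g (u t) (g t) x) (at t within {0..\<rho>})"
  by (rule mild_equation_dense[OF \<rho> Z_cont sobolev_path_joint_cont(1)[OF s g] drift_joint_cont(2)[OF s u g]
        sobolev_spaceD(2)[OF g0] _ t]; rule g_mild[folded Z_def]; assumption)+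

text \<open>Read off from the integral equation at time 0. The factor \<open>Z 0\<close> stays
  because the value of \<open>w\<close> at 0 is arbitrary here.\<close>

lemma initial: "Z 0 * u 0 x = u0 x" "Z 0 * g 0 x = g0 x" "Z 0 * deriv (u 0) x = deriv u0 x" "Z 0 * deriv (g 0) x = deriv g0 x"
proof -
  have z: "0 \<in> {0..\<rho>}" using \<rho> by simp
  show 1: "Z 0 * u 0 x = u0 x" "Z 0 * g 0 x = g0 x" for x using u_eqs(1)[OF z] g_eqs(1)[OF z] by simp_all
  have "((\<lambda>x. Z 0 * u 0 x) has_real_derivative Z 0 * deriv (u 0) x) (at x)"
    "((\<lambda>x. Z 0 * g 0 x) has_real_derivative Z 0 * deriv (g 0) x) (at x)"
    by (intro DERIV_cmult sobolev_has_deriv[OF s] path_space z)+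
  then show "Z 0 * deriv (u 0) x = deriv u0 x" "Z 0 * deriv (g 0) x = deriv g0 x"
    unfolding 1 by (simp_all add: DERIV_imp_deriv)
qed

text \<open>The drift is quadratic, so scaling the solution by \<open>Z t\<close> scales the drift
  by \<open>(Z t)\<^sup>2\<close>; as \<open>Z t = \<beta> t * (Z t)\<^sup>2\<close>, one factor
  \<open>\<beta> t\<close> is left over.\<close>

lemma flow:
  assumes b: "\<forall>t\<in>{0..\<rho>}. \<beta> t \<le> b"
  shows "torus_flow \<rho> b \<beta> (\<lambda>t x. Z t * u t x) (\<lambda>t x. Z t * deriv (u t) x) (\<lambda>t x. Z t * g t x) (\<lambda>t x. Z t * deriv (g t) x)"
proof
  show "((\<lambda>x. Z t * u t x) has_real_derivative Z t * deriv (u t) x) (at x)"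
    "((\<lambda>x. Z t * g t x) has_real_derivative Z t * deriv (g t) x) (at x)" if "t \<in> {0..\<rho>}" for t x
    by (intro DERIV_cmult sobolev_has_deriv[OF s] path_space that)+
  have Zc: "continuous_on ({0..\<rho>} \<times> UNIV) (\<lambda>p. Z (fst p))"
    by (intro continuous_on_compose2[OF Z_cont] continuous_on_fst continuous_on_id) auto
  show "joint_cont {0..\<rho>} (\<lambda>t x. Z t * u t x)" "joint_cont {0..\<rho>} (\<lambda>t x. Z t * deriv (u t) x)"
    "joint_cont {0..\<rho>} (\<lambda>t x. Z t * g t x)" "joint_cont {0..\<rho>} (\<lambda>t x. Z t * deriv (g t) x)"
    using sobolev_path_joint_cont[OF s u] sobolev_path_joint_cont[OF s g] Zc
    unfolding case_prod_beta' by (auto intro!: continuous_on_mult)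
  fix t x assume t: "t \<in> {0..\<rho>}"
  have Z2: "Z t = \<beta> t * (Z t)\<^sup>2" using Z_\<beta>(2)[of t] by (simp add: power2_eq_square mult.assoc[symmetric])
  have 1: "- Z t * drift_u (u t) (g t) x = - \<beta> t * (Z t * u t x * (Z t * deriv (u t) x) +
        Gd (\<lambda>y. (Z t * u t y)\<^sup>2 + (Z t * deriv (u t) y)\<^sup>2 / 2 + (Z t * g t y)\<^sup>2 / 2 - (Z t * deriv (g t) y)\<^sup>2 / 2) x)"
  proof -
    have "(\<lambda>y. (Z t * u t y)\<^sup>2 + (Z t * deriv (u t) y)\<^sup>2 / 2 + (Z t * g t y)\<^sup>2 / 2 - (Z t * deriv (g t) y)\<^sup>2 / 2)
      = (\<lambda>y. (Z t)\<^sup>2 * ((u t y)\<^sup>2 + (deriv (u t) y)\<^sup>2 / 2 + (g t y)\<^sup>2 / 2 - (deriv (g t) y)\<^sup>2 / 2))"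
      by (simp add: power_mult_distrib algebra_simps)
    then show ?thesis
      unfolding drift_eqs(1)[OF s path_space[OF t]] by (subst (1) Z2) (simp only: Gd_scale, simp add: power2_eq_square distrib_left mult_ac)
  qed
  have 2: "- Z t * drift_g (u t) (g t) x = - \<beta> t * (Z t * u t x * (Z t * deriv (g t) x) +
        (Gd (\<lambda>y. Z t * deriv (u t) y * (Z t * deriv (g t) y)) x + Gc (\<lambda>y. Z t * deriv (u t) y * (Z t * g t y)) x))"
  proof -
    have "(\<lambda>y. Z t * deriv (u t) y * (Z t * deriv (g t) y)) = (\<lambda>y. (Z t)\<^sup>2 * (deriv (u t) y * deriv (g t) y))"
      "(\<lambda>y. Z t * deriv (u t) y * (Z t * g t y)) = (\<lambda>y. (Z t)\<^sup>2 * (deriv (u t) y * g t y))"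
      by (simp_all add: power2_eq_square algebra_simps)
    then show ?thesis
      unfolding drift_eqs(2)[OF s path_space[OF t]] by (subst (1) Z2) (simp only: Gd_scale Gc_scale, simp add: power2_eq_square distrib_left mult_ac)
  qed
  show "((\<lambda>t. Z t * u t x) has_real_derivative
      - \<beta> t * (Z t * u t x * (Z t * deriv (u t) x) +
        Gd (\<lambda>y. (Z t * u t y)\<^sup>2 + (Z t * deriv (u t) y)\<^sup>2 / 2 + (Z t * g t y)\<^sup>2 / 2 - (Z t * deriv (g t) y)\<^sup>2 / 2) x)) (at t within {0..\<rho>})"
    using u_eqs(2)[OF t, of x] unfolding 1 .
  show "((\<lambda>t. Z t * g t x) has_real_derivative
      - \<beta> t * (Z t * u t x * (Z t * deriv (g t) x) +
        (Gd (\<lambda>y. Z t * deriv (u t) y * (Z t * deriv (g t) y)) x + Gc (\<lambda>y. Z t * deriv (u t) y * (Z t * g t y)) x))) (at t within {0..\<rho>})"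
    using g_eqs(2)[OF t, of x] unfolding 2 .
qed (use \<rho> b \<beta>_cont Z_\<beta>(4) path_space[THEN sobolev_spaceD(3)] path_space[THEN sobolev_deriv_periodic[OF s]] in auto)

end

section \<open>From the stochastic system to solution paths\<close>

text \<open>The section at time \<open>t\<close> of a generating rectangle over
  \<open>{a<..b}\<close> is empty unless \<open>a < t\<close>, and then its base set already belongs
  to \<open>F (ennreal t)\<close>.\<close>

lemma predictable_adapted:
  fixes X :: "real \<Rightarrow> 'w \<Rightarrow> real \<Rightarrow> real"
  assumes "brownian_basis M F W" and X: "sobolev_predictable F r X" and t: "0 \<le> t"
  shows "X t \<in> measurable (F (ennreal t)) (sobolev_borel r)"
proof -
  interpret brownian_basis M F W by fact
  have "(\<lambda>\<omega>. (t, \<omega>)) \<in> measurable (F (ennreal t)) (predictable_sigma F)"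
    unfolding predictable_sigma_def
  proof (rule measurable_measure_of)
    fix G assume "G \<in> {{0} \<times> A | A. A \<in> sets (F 0)} \<union> {{a<..b} \<times> A | a b A. 0 \<le> a \<and> a \<le> b \<and> A \<in> sets (F (ennreal a))}"
    then consider A where "G = {0} \<times> A" "A \<in> sets (F 0)"
      | a b A where "G = {a<..b} \<times> A" "0 \<le> a" "a \<le> b" "A \<in> sets (F (ennreal a))" by blast
    then show "(\<lambda>\<omega>. (t, \<omega>)) -` G \<inter> space (F (ennreal t)) \<in> sets (F (ennreal t))"
    proof cases
      case 1
      have "A \<in> sets (F (ennreal t))" using 1(2) sets_F_mono[of 0 "ennreal t"] by auto
      moreover have "(\<lambda>\<omega>. (t, \<omega>)) -` G = (if t = 0 then A else {})" unfolding 1 by auto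
      ultimately show ?thesis by auto
    next
      case 2
      show ?thesis
      proof (cases "t \<in> {a<..b}")
        case True
        then have "A \<in> sets (F (ennreal t))" using 2(4) sets_F_mono[of "ennreal a" "ennreal t"] ennreal_leI[of a t] by auto
        moreover have "(\<lambda>\<omega>. (t, \<omega>)) -` G = A" unfolding 2 using True by auto
        ultimately show ?thesis by auto
      next
        case False
        then have "(\<lambda>\<omega>. (t, \<omega>)) -` G = {}" unfolding 2 by auto
        then show ?thesis by simp
      qed
    qed
  next
    show "{{0} \<times> A | A. A \<in> sets (F 0)} \<union> {{a<..b} \<times> A | a b A. 0 \<le> a \<and> a \<le> b \<and> A \<in> sets (F (ennreal a))} \<subseteq> Pow ({0..} \<times> space (F 0))"
      using sets.sets_into_space[where M="F 0"] sets.sets_into_space[where M="F (ennreal a)" for a] unfolding space_F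
      by fastforce
  qed (use t in \<open>auto simp: space_F\<close>)
  from measurable_compose[OF this X[unfolded sobolev_predictable_def]] show ?thesis by simp
qed

lemma tends_to_0_in_prob_mono:
  assumes Z: "tends_to_0_in_prob M Z" and K: "0 < K"
    and le: "\<And>n \<omega>. \<omega> \<in> space M \<Longrightarrow> Z' n \<omega> \<le> ennreal K * Z n \<omega>"
  shows "tends_to_0_in_prob M Z'"
  unfolding tends_to_0_in_prob_def
proof (intro allI impI)
  fix e :: real assume e: "0 < e"
  then have "0 < e / K" using K by simp
  then obtain A where A: "\<forall>n. A n \<in> sets M \<and> {\<omega> \<in> space M. ennreal (e / K) < Z n \<omega>} \<subseteq> A n" "(\<lambda>n. measure M (A n)) \<longlonglongrightarrow> 0"
    using Z unfolding tends_to_0_in_prob_def by blast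
  have "ennreal (e / K) < Z n \<omega>" if "\<omega> \<in> space M" "ennreal e < Z' n \<omega>" for n \<omega>
  proof (rule ccontr)
    assume "\<not> ennreal (e / K) < Z n \<omega>"
    then have "ennreal K * Z n \<omega> \<le> ennreal K * ennreal (e / K)" by (intro mult_left_mono) auto
    also have "\<dots> = ennreal e" using K e by (simp add: ennreal_mult[symmetric])
    finally show False using le[OF that(1), of n] that(2) by (meson leD order_trans)
  qed
  then have "\<forall>n. A n \<in> sets M \<and> {\<omega> \<in> space M. ennreal e < Z' n \<omega>} \<subseteq> A n" using A(1) by blast
  then show "\<exists>A. (\<forall>n. A n \<in> sets M \<and> {\<omega> \<in> space M. ennreal e < Z' n \<omega>} \<subseteq> A n) \<and> (\<lambda>n. measure M (A n)) \<longlonglongrightarrow> 0"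
    using A(2) by blast
qed

text \<open>Proved through simple functions for arbitrary \<open>f\<close>: measurability in time of
  the distance between integrand and approximation is not at hand, and the integral is then a
  supremum over simple functions below.\<close>

lemma nn_integral_cmult_le:
  assumes K: "0 < K"
  shows "(\<integral>\<^sup>+x. ennreal K * f x \<partial>M) \<le> ennreal K * (\<integral>\<^sup>+x. f x \<partial>M)"
  unfolding nn_integral_def[of M "\<lambda>x. ennreal K * f x"]
proof (rule SUP_least)
  fix g assume "g \<in> {g. simple_function M g \<and> g \<le> (\<lambda>x. ennreal K * f x)}"
  then have g: "simple_function M g" "\<And>x. g x \<le> ennreal K * f x" by (auto simp: le_fun_def)
  have K1: "ennreal K * ennreal (1 / K) = 1" using K by (simp add: ennreal_mult[symmetric])
  define h where "h x = ennreal (1 / K) * g x" for x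
  have h: "simple_function M h" unfolding h_def using g(1) by auto
  have gh: "g x = ennreal K * h x" for x unfolding h_def by (simp add: mult.assoc[symmetric] K1)
  have "h x \<le> f x" for x
  proof -
    have "h x \<le> ennreal (1 / K) * (ennreal K * f x)" unfolding h_def by (intro mult_left_mono g) simp
    then show ?thesis using K1 by (simp add: mult.assoc[symmetric] mult.commute)
  qed
  then have "integral\<^sup>S M h \<le> (\<integral>\<^sup>+x. f x \<partial>M)"
    unfolding nn_integral_def by (intro SUP_upper) (use h in \<open>auto simp: le_fun_def\<close>)
  then have "ennreal K * integral\<^sup>S M h \<le> ennreal K * (\<integral>\<^sup>+x. f x \<partial>M)" by (intro mult_left_mono) auto
  moreover have "integral\<^sup>S M g = ennreal K * integral\<^sup>S M h"
    unfolding gh[abs_def] by (rule simple_integral_mult[OF h])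
  ultimately show "integral\<^sup>S M g \<le> ennreal K * (\<integral>\<^sup>+x. f x \<partial>M)" by simp
qed

lemma sobolev_space_zero: "(\<lambda>x. 0) \<in> sobolev_space r"
proof -
  have "is_bessel r (\<lambda>x. 0) (\<lambda>x. 0)"
    using torus_L2_cont[of "\<lambda>x. 0"] by (simp add: is_bessel_def fourier_coeff_torus)
  then show ?thesis using torus_L2_cont[of "\<lambda>x. 0"] unfolding sobolev_space_def by auto
qed

lemma sobolev_space_sum:
  fixes n :: nat
  assumes "\<And>i. i < n \<Longrightarrow> f i \<in> sobolev_space r"
  shows "(\<lambda>x. \<Sum>i<n. a i * f i x) \<in> sobolev_space r"
  using assms
proof (induction n)
  case 0
  show ?case using sobolev_space_zero by simp
next
  case (Suc n)
  then show ?case using sobolev_space_lincomb[of "\<lambda>x. \<Sum>i<n. a i * f i x" r "f n" 1 "a n"] by simp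
qed

text \<open>A set that is not measurable has measure 0, so measure 1 also certifies
  measurability.\<close>

lemma (in prob_space) AE_measure_1:
  assumes "measure M {\<omega> \<in> space M. P \<omega>} = 1"
  shows "AE \<omega> in M. P \<omega>"
proof -
  have "{\<omega> \<in> space M. P \<omega>} \<in> sets M" using assms measure_notin_sets by fastforce
  then show ?thesis using assms prob_Collect_eq_1 by blast
qed

context brownian_basis
begin

text \<open>Evaluation at \<open>x\<close> is Lipschitz on \<open>H\<^sup>s\<close>, so the
  approximations of integrand and integral in \<open>H\<^sup>s\<close> become approximations of real
  processes with the same elementary structure.\<close>

lemma component_product_rule:
  fixes y I b :: "real \<Rightarrow> 'w \<Rightarrow> real \<Rightarrow> real" and y0 :: "'w \<Rightarrow> real \<Rightarrow> real"
  assumes s: "s > 3 / 2" and R: "0 < R" and T: "stopping_time F T" "AE \<omega> in M. 0 < T \<omega>"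
    and y: "sobolev_predictable F s y"
    and ito: "is_ito_integral M F W s (\<lambda>t \<omega> x. if ennreal t \<le> T \<omega> then c * y t \<omega> x else 0) I"
    and cont: "AE \<omega> in M. \<forall>t\<ge>0. ((\<lambda>r. sobolev_dist s (y (stopped T r \<omega>) \<omega>) (y (stopped T t \<omega>) \<omega>)) \<longlongrightarrow> 0) (at t within {0..})"
    and b: "AE \<omega> in M. continuous_on {0..stopped T R \<omega>} (\<lambda>r. b r \<omega> x)"
    and eq: "AE \<omega> in M. \<forall>t\<ge>0. y (stopped T t \<omega>) \<omega> x - y0 \<omega> x + (LBINT r:{0..stopped T t \<omega>}. b r \<omega> x) = I t \<omega> x"
  shows "AE \<omega> in M. exp (- c * W (stopped T R \<omega>) \<omega> + c\<^sup>2 * stopped T R \<omega> / 2) * y (stopped T R \<omega>) \<omega> x - y0 \<omega> x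
    + integral {0..stopped T R \<omega>} (\<lambda>r. exp (- c * W r \<omega> + c\<^sup>2 * r / 2) * b r \<omega> x) = 0"
proof -
  from ito obtain N p \<xi> where Im: "\<And>t. 0 \<le> t \<Longrightarrow> I t \<in> measurable (F (ennreal t)) (sobolev_borel s)"
    and Xp: "sobolev_predictable F s (\<lambda>t \<omega> x. if ennreal t \<le> T \<omega> then c * y t \<omega> x else 0)"
    and el: "\<And>n. elementary F s (N n) (p n) (\<xi> n)"
    and cX: "\<And>T'. T' > 0 \<Longrightarrow> tends_to_0_in_prob M (\<lambda>n \<omega>. \<integral>\<^sup>+t\<in>{0..T'}.
           ennreal ((sobolev_dist s (elementary_process (N n) (p n) (\<xi> n) t \<omega>) (\<lambda>x. if ennreal t \<le> T \<omega> then c * y t \<omega> x else 0))\<^sup>2) \<partial>lborel)"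
    and cI: "\<And>T'. T' > 0 \<Longrightarrow> tends_to_0_in_prob M (\<lambda>n \<omega>. SUP t\<in>{0..T'}.
           ennreal (sobolev_dist s (elementary_integral W (N n) (p n) (\<xi> n) t \<omega>) (I t \<omega>)))"
    unfolding is_ito_integral_def by blast
  have sp: "f \<omega> \<in> sobolev_space s" if "f \<in> measurable (F t) (sobolev_borel s)" "\<omega> \<in> space M" for f :: "'w \<Rightarrow> real \<Rightarrow> real" and t \<omega>
    using measurable_space[OF that(1), of \<omega>] that(2) unfolding space_F space_sobolev_borel .
  note ym = predictable_adapted[OF brownian_basis_axioms y] and Xm = predictable_adapted[OF brownian_basis_axioms Xp]
  have \<xi>m: "\<xi> n i \<in> measurable (F (ennreal (p n i))) (sobolev_borel s)" and p: "0 \<le> p n 0" "p n i \<le> p n (Suc i)"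
    if "i < N n" for n i
    using el[of n] that unfolding elementary_def by auto
  have p0: "0 \<le> p n 0" for n using el[of n] unfolding elementary_def by auto
  have \<xi>s: "\<xi> n i \<omega> \<in> sobolev_space s" if "i < N n" "\<omega> \<in> space M" for n i \<omega>
    using measurable_space[OF \<xi>m[OF that(1)], of \<omega>] that(2) unfolding space_F space_sobolev_borel .
  have "\<forall>n. \<exists>C. \<forall>i<N n. \<forall>\<omega>\<in>space M. sobolev_norm s (\<xi> n i \<omega>) \<le> C"
    using el unfolding elementary_def space_F by blast
  from choice[OF this] obtain C where C: "\<forall>n. \<forall>i<N n. \<forall>\<omega>\<in>space M. sobolev_norm s (\<xi> n i \<omega>) \<le> C n" by (rule exE)
  \<comment> \<open>Raised by 1 so that it is strictly positive, as the comparison of convergence in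
    probability requires.\<close>
  define k where "k = sobolev_const s + 1"
  have k0: "0 \<le> sobolev_const s"
    unfolding sobolev_const_def by (intro divide_nonneg_nonneg mult_nonneg_nonneg real_sqrt_ge_zero suminf_nonneg sobolev_const_summable s) auto
  have k: "0 < k" "sobolev_const s \<le> k" using k0 by (auto simp: k_def)
  have ev: "\<bar>f x - g x\<bar> \<le> k * sobolev_dist s f g" if "f \<in> sobolev_space s" "g \<in> sobolev_space s" for f g
    using sobolev_dist_bounds(1)[OF s that, of x] mult_right_mono[OF k(2) sobolev_dist_nonneg[of s f g]] by linarith
  have idem: "stopped T (stopped T r \<omega>) \<omega> = stopped T r \<omega>" if "0 \<le> r" for r \<omega>
    by (intro stopped_eq stopped_nonneg stopped_le_time that)
  have ep: "elementary_process (N n) (p n) (\<xi> n) t \<omega> \<in> sobolev_space s"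
    and ei: "elementary_integral W (N n) (p n) (\<xi> n) t \<omega> \<in> sobolev_space s" if "\<omega> \<in> space M" for n t \<omega>
  proof -
    show "elementary_process (N n) (p n) (\<xi> n) t \<omega> \<in> sobolev_space s"
      unfolding elementary_process_def[abs_def] by (rule sobolev_space_sum) (use \<xi>s that in blast)
    show "elementary_integral W (N n) (p n) (\<xi> n) t \<omega> \<in> sobolev_space s"
      unfolding elementary_integral_def[abs_def] by (rule sobolev_space_sum) (use \<xi>s that in blast)
  qed
  let ?D = "\<lambda>n t \<omega>. step_value (N n) (p n) (\<lambda>i. \<xi> n i \<omega> x) t - (if ennreal t \<le> T \<omega> then c * y (stopped T t \<omega>) \<omega> x else 0)" and ?D' = "\<lambda>n t \<omega>. step_integral (\<lambda>t. W t \<omega>) (N n) (p n) (\<lambda>i. \<xi> n i \<omega> x) t - I t \<omega> x"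
  show ?thesis
  proof (rule product_rule[where Y="\<lambda>t \<omega>. y (stopped T t \<omega>) \<omega> x" and I="\<lambda>t \<omega>. I t \<omega> x" and N=N and p=p
        and \<xi>="\<lambda>n i \<omega>. \<xi> n i \<omega> x" and C="\<lambda>n. sobolev_const s * C n" and R=R and T=T, OF R T p0])
    show "p n i \<le> p n (Suc i)" if "i < N n" for n i using p(2)[OF that] .
    show "(\<lambda>\<omega>. \<xi> n i \<omega> x) \<in> borel_at (p n i)" if "i < N n" for n i
      by (rule measurable_compose[OF \<xi>m[OF that] sobolev_eval_measurable[OF s]])
    show "\<bar>\<xi> n i \<omega> x\<bar> \<le> sobolev_const s * C n" if "i < N n" "\<omega> \<in> space M" for n i \<omega>
      using sobolev_bound[OF s \<xi>s[OF that], of x] mult_left_mono[OF C[rule_format, OF that] k0] by linarith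
    \<comment> \<open>Before \<open>T\<close> the stopped value is the value at the deterministic
      time \<open>t\<close>, which is adapted by predictability.\<close>
    show "(\<lambda>\<omega>. if ennreal t < T \<omega> then y (stopped T t \<omega>) \<omega> x else 0) \<in> borel_at t" if t: "0 \<le> t" for t
    proof -
      have "(\<lambda>\<omega>. if ennreal t < T \<omega> then y (stopped T t \<omega>) \<omega> x else 0) = (\<lambda>\<omega>. if ennreal t < T \<omega> then y t \<omega> x else 0)"
        by (simp add: fun_eq_iff stopped_eq[OF t less_imp_le])
      moreover have "(\<lambda>\<omega>. y t \<omega> x) \<in> borel_at t"
        by (rule measurable_compose[OF ym[OF t] sobolev_eval_measurable[OF s]])
      ultimately show ?thesis using stopping_timeD2[OF T(1), of "ennreal t"] by simp
    qed
    show "(\<lambda>\<omega>. I t \<omega> x) \<in> borel_at t" if "0 \<le> t" for t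
      by (rule measurable_compose[OF Im[OF that] sobolev_eval_measurable[OF s]])
    show "AE \<omega> in M. continuous_on {0..R} (\<lambda>t. y (stopped T t \<omega>) \<omega> x)"
      using cont AE_space
    proof eventually_elim
      case (elim \<omega>)
      have ysp: "y (stopped T t \<omega>) \<omega> \<in> sobolev_space s" for t by (rule sp[OF ym[OF stopped_nonneg] elim(2)])
      have "continuous_on {0..} (\<lambda>t. y (stopped T t \<omega>) \<omega> x)"
        unfolding continuous_on_def
      proof
        fix t :: real assume "t \<in> {0..}"
        then have d: "((\<lambda>r. k * sobolev_dist s (y (stopped T r \<omega>) \<omega>) (y (stopped T t \<omega>) \<omega>)) \<longlongrightarrow> k * 0) (at t within {0..})"
          by (intro tendsto_intros) (use elim(1) in auto)
        have "((\<lambda>r. y (stopped T r \<omega>) \<omega> x - y (stopped T t \<omega>) \<omega> x) \<longlongrightarrow> 0) (at t within {0..})"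
          by (rule Lim_null_comparison[OF _ d[simplified]]) (intro always_eventually allI, unfold real_norm_def, rule ev[OF ysp ysp])
        then show "((\<lambda>t. y (stopped T t \<omega>) \<omega> x) \<longlongrightarrow> y (stopped T t \<omega>) \<omega> x) (at t within {0..})" by (simp add: LIM_zero_iff)
      qed
      then show ?case by (rule continuous_on_subset) auto
    qed
    show "AE \<omega> in M. \<forall>t\<in>{0..R}. y (stopped T t \<omega>) \<omega> x = y (stopped T (stopped T t \<omega>) \<omega>) \<omega> x"
      by (intro AE_I2 ballI) (simp add: idem)
    show "AE \<omega> in M. continuous_on {0..stopped T R \<omega>} (\<lambda>r. b r \<omega> x)" by (rule b)
    show "AE \<omega> in M. \<forall>t\<in>{0..R}. y (stopped T t \<omega>) \<omega> x - I t \<omega> x = y0 \<omega> x - integral {0..stopped T t \<omega>} (\<lambda>r. b r \<omega> x)"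
      using eq b
    proof eventually_elim
      case (elim \<omega>)
      show ?case
      proof
        fix t assume t: "t \<in> {0..R}"
        have "stopped T t \<omega> \<le> stopped T R \<omega>" using stopped_eq_min[of t R T \<omega>] t by simp
        then have "set_integrable lborel {0..stopped T t \<omega>} (\<lambda>r. b r \<omega> x)"
          by (intro borel_integrable_atLeastAtMost' continuous_on_subset[OF elim(2)]) auto
        then have "(LBINT r:{0..stopped T t \<omega>}. b r \<omega> x) = integral {0..stopped T t \<omega>} (\<lambda>r. b r \<omega> x)"
          by (rule set_borel_integral_eq_integral(2))
        then show "y (stopped T t \<omega>) \<omega> x - I t \<omega> x = y0 \<omega> x - integral {0..stopped T t \<omega>} (\<lambda>r. b r \<omega> x)"
          using elim(1)[rule_format, of t] t by (simp add: algebra_simps)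
      qed
    qed
    show "tends_to_0_in_prob M (\<lambda>n \<omega>. \<integral>\<^sup>+t\<in>{0..R}.
        ennreal ((step_value (N n) (p n) (\<lambda>i. \<xi> n i \<omega> x) t - (if ennreal t \<le> T \<omega> then c * y (stopped T t \<omega>) \<omega> x else 0))\<^sup>2) \<partial>lborel)"
    proof (rule tends_to_0_in_prob_mono[OF cX[OF R]])
      show "0 < k\<^sup>2" using k by simp
      fix n \<omega> assume w: "\<omega> \<in> space M"
      let ?d = "\<lambda>t. sobolev_dist s (elementary_process (N n) (p n) (\<xi> n) t \<omega>) (\<lambda>x. if ennreal t \<le> T \<omega> then c * y t \<omega> x else 0)"
      have "(\<integral>\<^sup>+t\<in>{0..R}. ennreal ((?D n t \<omega>)\<^sup>2) \<partial>lborel)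
        \<le> (\<integral>\<^sup>+t. ennreal (k\<^sup>2) * (ennreal ((?d t)\<^sup>2) * indicator {0..R} t) \<partial>lborel)"
      proof (rule nn_integral_mono)
        fix t :: real
        show "ennreal ((?D n t \<omega>)\<^sup>2) * indicator {0..R} t
          \<le> ennreal (k\<^sup>2) * (ennreal ((?d t)\<^sup>2) * indicator {0..R} t)"
        proof (cases "t \<in> {0..R}")
          case True
          have "step_value (N n) (p n) (\<lambda>i. \<xi> n i \<omega> x) t = elementary_process (N n) (p n) (\<xi> n) t \<omega> x"
            by (simp add: step_value_def elementary_process_def)
          moreover have "(if ennreal t \<le> T \<omega> then c * y (stopped T t \<omega>) \<omega> x else 0) = (if ennreal t \<le> T \<omega> then c * y t \<omega> x else 0)"
            using True stopped_eq[of t T \<omega>] by auto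
          ultimately have "\<bar>?D n t \<omega>\<bar> \<le> k * ?d t"
            using ev[OF ep[OF w, of n t] sp[OF Xm w, of t]] True by simp
          then have "(?D n t \<omega>)\<^sup>2 \<le> (k * ?d t)\<^sup>2"
            by (metis abs_ge_zero power2_abs power_mono)
          then have "ennreal ((?D n t \<omega>)\<^sup>2) \<le> ennreal (k\<^sup>2 * (?d t)\<^sup>2)"
            by (intro ennreal_leI) (simp add: power_mult_distrib)
          then show ?thesis using True by (simp add: ennreal_mult)
        qed simp
      qed
      also have "\<dots> \<le> ennreal (k\<^sup>2) * (\<integral>\<^sup>+t\<in>{0..R}. ennreal ((?d t)\<^sup>2) \<partial>lborel)"
        by (rule nn_integral_cmult_le) (use k in simp)
      finally show "(\<integral>\<^sup>+t\<in>{0..R}. ennreal ((?D n t \<omega>)\<^sup>2) \<partial>lborel)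
        \<le> ennreal (k\<^sup>2) * (\<integral>\<^sup>+t\<in>{0..R}. ennreal ((?d t)\<^sup>2) \<partial>lborel)" .
    qed
    show "tends_to_0_in_prob M (\<lambda>n \<omega>. SUP t\<in>{0..R}.
        ennreal \<bar>?D' n t \<omega>\<bar>)"
    proof (rule tends_to_0_in_prob_mono[OF cI[OF R] k(1)])
      fix n \<omega> assume w: "\<omega> \<in> space M"
      let ?d = "\<lambda>t. sobolev_dist s (elementary_integral W (N n) (p n) (\<xi> n) t \<omega>) (I t \<omega>)"
      show "(SUP t\<in>{0..R}. ennreal \<bar>?D' n t \<omega>\<bar>)
        \<le> ennreal k * (SUP t\<in>{0..R}. ennreal (?d t))"
      proof (rule SUP_least)
        fix t assume t: "t \<in> {0..R}"
        have "step_integral (\<lambda>t. W t \<omega>) (N n) (p n) (\<lambda>i. \<xi> n i \<omega> x) t = elementary_integral W (N n) (p n) (\<xi> n) t \<omega> x"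
          by (simp add: step_integral_def elementary_integral_def)
        then have "ennreal \<bar>?D' n t \<omega>\<bar> \<le> ennreal (k * ?d t)"
          using ev[OF ei[OF w] sp[OF Im w]] t by (intro ennreal_leI) auto
        also have "\<dots> = ennreal k * ennreal (?d t)" using k by (simp add: ennreal_mult sobolev_dist_nonneg)
        also have "\<dots> \<le> ennreal k * (SUP t\<in>{0..R}. ennreal (?d t))" by (intro mult_left_mono SUP_upper t) simp
        finally show "ennreal \<bar>?D' n t \<omega>\<bar> \<le> ennreal k * (SUP t\<in>{0..R}. ennreal (?d t))" .
      qed
    qed
  qed
qed

text \<open>The product rule holds almost surely for each single time and point; rational ones leave
  a single null set. For times below \<open>\<rho> \<le> T\<close> stopping has no effect, which
  frees the conclusion from \<open>stopped\<close>.\<close>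

lemma local_solution_mild:
  assumes s: "s > 3 / 2" and u0: "u0 \<in> measurable (F 0) (sobolev_borel s)" and g0: "g0 \<in> measurable (F 0) (sobolev_borel s)"
    and sol: "local_solution M F W s c u0 g0 u g T"
  shows "AE \<omega> in M. \<forall>\<rho>>0. ennreal \<rho> \<le> T \<omega> \<longrightarrow>
    mild_path s c \<rho> (\<lambda>t. W t \<omega>) (\<lambda>t. u t \<omega>) (\<lambda>t. g t \<omega>) (u0 \<omega>) (g0 \<omega>)"
proof -
  from sol obtain Iu Ig where T: "stopping_time F T" and T0: "measure M {\<omega> \<in> space M. 0 < T \<omega>} = 1"
    and pu: "sobolev_predictable F s u" and pg: "sobolev_predictable F s g"
    and cont: "stopped_L2_continuous M s u g T"
    and Iu: "is_ito_integral M F W s (\<lambda>t \<omega> x. if ennreal t \<le> T \<omega> then c * u t \<omega> x else 0) Iu"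
    and Ig: "is_ito_integral M F W s (\<lambda>t \<omega> x. if ennreal t \<le> T \<omega> then c * g t \<omega> x else 0) Ig"
    and eq: "AE \<omega> in M. \<forall>t\<ge>0. \<forall>x.
          u (stopped T t \<omega>) \<omega> x - u0 \<omega> x + (LBINT r:{0..stopped T t \<omega>}. drift_u (u r \<omega>) (g r \<omega>) x)
            = Iu t \<omega> x \<and>
          g (stopped T t \<omega>) \<omega> x - g0 \<omega> x + (LBINT r:{0..stopped T t \<omega>}. drift_g (u r \<omega>) (g r \<omega>) x)
            = Ig t \<omega> x"
    unfolding local_solution_def by blast
  have sp: "X t \<omega> \<in> sobolev_space s" if "sobolev_predictable F s X" "0 \<le> t" "\<omega> \<in> space M" for X :: "real \<Rightarrow> 'w \<Rightarrow> real \<Rightarrow> real" and t \<omega>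
    using measurable_space[OF predictable_adapted[OF brownian_basis_axioms that(1,2)], of \<omega>] that(3) unfolding space_F space_sobolev_borel .
  have cu: "AE \<omega> in M. \<forall>t\<ge>0. ((\<lambda>r. sobolev_dist s (u (stopped T r \<omega>) \<omega>) (u (stopped T t \<omega>) \<omega>)) \<longlongrightarrow> 0) (at t within {0..})"
    and cg: "AE \<omega> in M. \<forall>t\<ge>0. ((\<lambda>r. sobolev_dist s (g (stopped T r \<omega>) \<omega>) (g (stopped T t \<omega>) \<omega>)) \<longlongrightarrow> 0) (at t within {0..})"
    using cont unfolding stopped_L2_continuous_def by auto
  have path: "sobolev_path s {0..\<rho>} (\<lambda>t. X t \<omega>)"
    if X: "sobolev_predictable F s X" and w: "\<omega> \<in> space M" and \<rho>: "ennreal \<rho> \<le> T \<omega>"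
      and c: "\<forall>t\<ge>0. ((\<lambda>r. sobolev_dist s (X (stopped T r \<omega>) \<omega>) (X (stopped T t \<omega>) \<omega>)) \<longlongrightarrow> 0) (at t within {0..})"
    for X :: "real \<Rightarrow> 'w \<Rightarrow> real \<Rightarrow> real" and \<omega> \<rho>
    unfolding sobolev_path_def
  proof
    fix t assume t: "t \<in> {0..\<rho>}"
    have st: "stopped T r \<omega> = r" if "r \<in> {0..\<rho>}" for r
      using that order_trans[OF ennreal_leI[of r \<rho>] \<rho>] by (intro stopped_eq) auto
    have "((\<lambda>r. sobolev_dist s (X (stopped T r \<omega>) \<omega>) (X (stopped T t \<omega>) \<omega>)) \<longlongrightarrow> 0) (at t within {0..\<rho>})"
      by (rule tendsto_within_subset[of _ _ _ "{0..}"]) (use c t in auto)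
    then have "((\<lambda>r. sobolev_dist s (X r \<omega>) (X t \<omega>)) \<longlongrightarrow> 0) (at t within {0..\<rho>})"
      by (rule Lim_transform_eventually) (auto simp: eventually_at_filter st[OF t] st)
    then show "X t \<omega> \<in> sobolev_space s \<and> ((\<lambda>r. sobolev_dist s (X r \<omega>) (X t \<omega>)) \<longlongrightarrow> 0) (at t within {0..\<rho>})"
      using sp[OF X _ w, of t] t by simp
  qed
  have Tpos: "AE \<omega> in M. 0 < T \<omega>"
    by (rule AE_measure_1[OF T0])
  have drift: "AE \<omega> in M. continuous_on {0..stopped T R \<omega>} (\<lambda>r. drift_u (u r \<omega>) (g r \<omega>) x) \<and>
      continuous_on {0..stopped T R \<omega>} (\<lambda>r. drift_g (u r \<omega>) (g r \<omega>) x)" if R: "0 < R" for R x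
    using cu cg AE_space
  proof eventually_elim
    case (elim \<omega>)
    have p: "sobolev_path s {0..stopped T R \<omega>} (\<lambda>t. u t \<omega>)" "sobolev_path s {0..stopped T R \<omega>} (\<lambda>t. g t \<omega>)"
      using path[OF pu elim(3) _ elim(1)] path[OF pg elim(3) _ elim(2)] stopped_le_time[of R T \<omega>] R by auto
    show ?case
      using jcont[OF drift_joint_cont(1)[OF s p], of "{0..stopped T R \<omega>}" "\<lambda>r. r" "\<lambda>_. x"]
        jcont[OF drift_joint_cont(2)[OF s p], of "{0..stopped T R \<omega>}" "\<lambda>r. r" "\<lambda>_. x"] by auto
  qed
  have 1: "AE \<omega> in M. exp (- c * W (stopped T R \<omega>) \<omega> + c\<^sup>2 * stopped T R \<omega> / 2) * u (stopped T R \<omega>) \<omega> x - u0 \<omega> x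
    + integral {0..stopped T R \<omega>} (\<lambda>r. exp (- c * W r \<omega> + c\<^sup>2 * r / 2) * drift_u (u r \<omega>) (g r \<omega>) x) = 0"
    if "0 < R" for R x
    by (rule component_product_rule[OF s that T Tpos pu Iu cu]) (use drift[OF that, of x] eq in \<open>auto elim: AE_mp\<close>)
  have 2: "AE \<omega> in M. exp (- c * W (stopped T R \<omega>) \<omega> + c\<^sup>2 * stopped T R \<omega> / 2) * g (stopped T R \<omega>) \<omega> x - g0 \<omega> x
    + integral {0..stopped T R \<omega>} (\<lambda>r. exp (- c * W r \<omega> + c\<^sup>2 * r / 2) * drift_g (u r \<omega>) (g r \<omega>) x) = 0"
    if "0 < R" for R x
    by (rule component_product_rule[OF s that T Tpos pg Ig cg]) (use drift[OF that, of x] eq in \<open>auto elim: AE_mp\<close>)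
  have rat_u: "AE \<omega> in M. \<forall>R\<in>\<rat>. \<forall>x\<in>\<rat>. 0 < R \<longrightarrow> exp (- c * W (stopped T R \<omega>) \<omega> + c\<^sup>2 * stopped T R \<omega> / 2) * u (stopped T R \<omega>) \<omega> x - u0 \<omega> x
    + integral {0..stopped T R \<omega>} (\<lambda>r. exp (- c * W r \<omega> + c\<^sup>2 * r / 2) * drift_u (u r \<omega>) (g r \<omega>) x) = 0"
    by (intro AE_ball_countable' countable_rat) (use 1 in simp)
  have rat_g: "AE \<omega> in M. \<forall>R\<in>\<rat>. \<forall>x\<in>\<rat>. 0 < R \<longrightarrow> exp (- c * W (stopped T R \<omega>) \<omega> + c\<^sup>2 * stopped T R \<omega> / 2) * g (stopped T R \<omega>) \<omega> x - g0 \<omega> x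
    + integral {0..stopped T R \<omega>} (\<lambda>r. exp (- c * W r \<omega> + c\<^sup>2 * r / 2) * drift_g (u r \<omega>) (g r \<omega>) x) = 0"
    by (intro AE_ball_countable' countable_rat) (use 2 in simp)
  show ?thesis
    using rat_u rat_g cu cg W_continuous AE_space
  proof eventually_elim
    case (elim \<omega>)
    show ?case
    proof (intro allI impI)
      fix \<rho> :: real assume \<rho>: "\<rho> > 0" "ennreal \<rho> \<le> T \<omega>"
      have st: "stopped T t \<omega> = t" if "t \<in> {0<..<\<rho>}" for t
        using that order_trans[OF ennreal_leI[of t \<rho>] \<rho>(2)] by (intro stopped_eq) auto
      show "mild_path s c \<rho> (\<lambda>t. W t \<omega>) (\<lambda>t. u t \<omega>) (\<lambda>t. g t \<omega>) (u0 \<omega>) (g0 \<omega>)"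
      proof
        show "continuous_on {0..\<rho>} (\<lambda>t. W t \<omega>)" using elim(5) by (rule continuous_on_subset) auto
        show "sobolev_path s {0..\<rho>} (\<lambda>t. u t \<omega>)" by (rule path[OF pu elim(6) \<rho>(2) elim(3)])
        show "sobolev_path s {0..\<rho>} (\<lambda>t. g t \<omega>)" by (rule path[OF pg elim(6) \<rho>(2) elim(4)])
        show "u0 \<omega> \<in> sobolev_space s" "g0 \<omega> \<in> sobolev_space s"
          using measurable_space[OF u0, of \<omega>] measurable_space[OF g0, of \<omega>] elim(6) unfolding space_F space_sobolev_borel by auto
        show "exp (- c * W t \<omega> + c\<^sup>2 * t / 2) * u t \<omega> x - u0 \<omega> x + integral {0..t} (\<lambda>r. exp (- c * W r \<omega> + c\<^sup>2 * r / 2) * drift_u (u r \<omega>) (g r \<omega>) x) = 0"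
          if "t \<in> {0<..<\<rho>}" "t \<in> \<rat>" "x \<in> \<rat>" for t x
          using elim(1)[rule_format, OF that(2,3)] that(1) unfolding st[OF that(1)] by simp
        show "exp (- c * W t \<omega> + c\<^sup>2 * t / 2) * g t \<omega> x - g0 \<omega> x + integral {0..t} (\<lambda>r. exp (- c * W r \<omega> + c\<^sup>2 * r / 2) * drift_g (u r \<omega>) (g r \<omega>) x) = 0"
          if "t \<in> {0<..<\<rho>}" "t \<in> \<rat>" "x \<in> \<rat>" for t x
          using elim(2)[rule_format, OF that(2,3)] that(1) unfolding st[OF that(1)] by simp
      qed (use s \<rho> in auto)
    qed
  qed
qed

end

section \<open>The deterministic estimates read along a solution path\<close>

lemma sobolev_norm_1_integral:
  assumes s: "s > 3 / 2" and f: "f \<in> sobolev_space s"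
  shows "(sobolev_norm 1 f)\<^sup>2 = integral {0..2 * pi} (\<lambda>y. (f y)\<^sup>2 + (deriv f y)\<^sup>2)"
proof -
  note c = sobolev_spaceD(2)[OF f] sobolev_deriv_cont[OF s f]
  have 1: "(\<integral>x. h x \<partial>torus) = integral {0..2 * pi} h" if "continuous_on UNIV h" for h :: "real \<Rightarrow> real"
  proof -
    have "set_integrable lborel {0..2 * pi} h"
      by (rule borel_integrable_atLeastAtMost') (rule continuous_on_subset[OF that subset_UNIV])
    then show ?thesis unfolding integral_torus[symmetric] by (rule set_borel_integral_eq_integral(2))
  qed
  have i: "(\<lambda>y. (f y)\<^sup>2) integrable_on {0..2 * pi}" "(\<lambda>y. (deriv f y)\<^sup>2) integrable_on {0..2 * pi}"
    by (intro integrable_continuous_real continuous_on_power continuous_on_subset[OF c(1)] continuous_on_subset[OF c(2)]; simp)+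
  show ?thesis
    unfolding sobolev_norm_1[OF s f] Henstock_Kurzweil_Integration.integral_add[OF i]
    by (subst (1 2) 1) (auto intro!: continuous_on_power c)
qed

context mild_path
begin

definition N where "N = (sobolev_norm 1 u0)\<^sup>2 + (sobolev_norm 1 g0)\<^sup>2"

lemma flow_energy:
  assumes b: "\<forall>t\<in>{0..\<rho>}. \<beta> t \<le> b"
  shows "torus_flow.energy (\<lambda>t x. Z t * u t x) (\<lambda>t x. Z t * deriv (u t) x) (\<lambda>t x. Z t * g t x) (\<lambda>t x. Z t * deriv (g t) x) 0 = N"
  unfolding torus_flow.energy_def[OF flow[OF b]] initial N_def
  by (simp add: sobolev_norm_1_integral[OF s] u0 g0)

text \<open>A path that exists up to \<open>\<rho>\<close> cannot have used up its budget
  \<open>1 / a\<close>. Compared with the mean of the integral, this rules out that almost every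
  path lives forever.\<close>

lemma beta_integral_bound:
  assumes a: "a > 0" and init: "deriv u0 x0 < - a - sqrt (a\<^sup>2 + N)"
  shows "integral {0..\<rho>} (\<lambda>t. exp (c * w t - c\<^sup>2 * t / 2)) \<le> 1 / a"
proof -
  obtain b where b: "\<forall>t\<in>{0..\<rho>}. \<beta> t \<le> b"
    using compact_continuous_image[OF \<beta>_cont compact_Icc, THEN compact_imp_bounded, THEN bounded_imp_bdd_above]
    unfolding bdd_above_def by blast
  have "integral {0..\<rho>} \<beta> \<le> 1 / a"
    by (rule torus_flow.blow_up[OF flow[OF b] a, of N x0]) (use init flow_energy[OF b] in \<open>auto simp: initial\<close>)
  then show ?thesis unfolding \<beta>_def .
qed

lemma solution_bounds:
  assumes b: "\<And>t. t \<in> {0..\<rho>} \<Longrightarrow> exp (c * w t - c\<^sup>2 * t / 2) \<le> b"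
    and S: "\<And>x. deriv u0 x \<le> S" "\<And>x. \<bar>deriv g0 x\<bar> \<le> S" and t: "t \<in> {0..\<rho>}"
  shows "\<bar>u t x\<bar> \<le> b * sqrt (2 * N)" "\<bar>g t x\<bar> \<le> b * sqrt (2 * N)"
    and "deriv (u t) x \<le> b * (\<bar>S\<bar> + 1 + (b * N + 1) * \<rho>)" "\<bar>deriv (g t) x\<bar> \<le> b * (\<bar>S\<bar> + 1 + (b * N + 1) * \<rho>)"
proof -
  have b': "\<forall>t\<in>{0..\<rho>}. \<beta> t \<le> b" using b by (simp add: \<beta>_def)
  note fl = flow[OF b'] and en = flow_energy[OF b']
  have b0: "0 \<le> b" using b'[rule_format, OF t] Z_\<beta>(4)[of t] by linarith
  have N0: "0 \<le> N" by (simp add: N_def)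
  have scale: "\<beta> t * (Z t * z) = z" for z using Z_\<beta>(2)[of t] by (simp add: mult.assoc[symmetric])
  have up: "z \<le> b * B" if "Z t * z \<le> B" "0 \<le> B" for z B
  proof -
    have "\<beta> t * (Z t * z) \<le> \<beta> t * B" using that Z_\<beta>(4)[of t] by (intro mult_left_mono) auto
    also have "\<dots> \<le> b * B" using that b'[rule_format, OF t] by (intro mult_right_mono) auto
    finally show ?thesis unfolding scale .
  qed
  have ab: "\<bar>z\<bar> \<le> b * B" if "\<bar>Z t * z\<bar> \<le> B" for z B
  proof -
    have "0 \<le> B" "Z t * \<bar>z\<bar> \<le> B" using order_trans[OF abs_ge_zero that] that Z_\<beta>(3)[of t] by (auto simp: abs_mult)
    then show ?thesis by (intro up)
  qed
  have "(Z t * u t x)\<^sup>2 \<le> 2 * N" "(Z t * g t x)\<^sup>2 \<le> 2 * N"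
    using torus_flow.sup_v[OF fl t, of x] torus_flow.sup_e[OF fl t, of x] unfolding en by auto
  then show "\<bar>u t x\<bar> \<le> b * sqrt (2 * N)" "\<bar>g t x\<bar> \<le> b * sqrt (2 * N)"
    by (auto intro!: ab real_le_rsqrt)
  have mono: "(b * N + 1) * t \<le> (b * N + 1) * \<rho>" using t b0 N0 by (intro mult_left_mono) auto
  have B0: "0 \<le> \<bar>S\<bar> + 1 + (b * N + 1) * \<rho>" using \<rho> b0 N0 by simp
  have "Z t * deriv (u t) x \<le> \<bar>S\<bar> + 1 + (b * N + 1) * t"
    using torus_flow.upper_bound_v[OF fl, of "\<bar>S\<bar>" t x] S(1) t unfolding en initial by (meson abs_ge_self order_trans)
  then show "deriv (u t) x \<le> b * (\<bar>S\<bar> + 1 + (b * N + 1) * \<rho>)" using mono B0 by (intro up) auto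
  have "\<bar>Z t * deriv (g t) x\<bar> \<le> \<bar>S\<bar> + 1 + (b * N + 1) * t"
    using torus_flow.bound_e[OF fl, of "\<bar>S\<bar>" t x] S(2) t unfolding en initial by (meson abs_ge_self order_trans)
  then show "\<bar>deriv (g t) x\<bar> \<le> b * (\<bar>S\<bar> + 1 + (b * N + 1) * \<rho>)" using mono by (intro ab) auto
qed

text \<open>\<open>min_growth\<close> in terms of \<open>u\<close>: the factor \<open>b\<close>
  passes from the slope of \<open>u\<close> to that of \<open>v\<close> at time \<open>r\<close>,
  and the factor \<open>m\<close> passes back at time \<open>t\<close>.\<close>

lemma slope_persistence:
  assumes b: "\<And>t. t \<in> {0..\<rho>} \<Longrightarrow> exp (c * w t - c\<^sup>2 * t / 2) \<le> b"
    and m: "\<And>t. t \<in> {0..\<rho>} \<Longrightarrow> m \<le> exp (c * w t - c\<^sup>2 * t / 2)"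
    and r: "r \<in> {0..\<rho>}" and t: "t \<in> {r..\<rho>}" and X: "0 \<le> X"
    and x: "deriv (u r) x < - b * (X + 1 + (b * N + 1) * (t - r))"
  shows "\<exists>y. deriv (u t) y \<le> - m * X"
proof -
  have b': "\<forall>t\<in>{0..\<rho>}. \<beta> t \<le> b" using b by (simp add: \<beta>_def)
  note fl = flow[OF b'] and en = flow_energy[OF b']
  have b0: "0 \<le> b" using b'[rule_format, OF r] Z_\<beta>(4)[of r] by linarith
  have N0: "0 \<le> N" by (simp add: N_def)
  define B where "B = X + 1 + (b * N + 1) * (t - r)"
  have B0: "0 \<le> B" using X t b0 N0 by (simp add: B_def)
  have t': "t \<in> {0..\<rho>}" using r t by auto
  have "\<beta> r * B \<le> b * B" by (intro mult_right_mono b'[rule_format] r B0)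
  moreover have "deriv (u r) x < - (b * B)" using x by (simp add: B_def)
  ultimately have "deriv (u r) x \<le> - (\<beta> r * B)" by linarith
  then have "deriv (u r) x \<le> \<beta> r * - B" by simp
  then have "Z r * deriv (u r) x \<le> Z r * (\<beta> r * - B)" using Z_\<beta>(3)[of r] by (intro mult_left_mono) auto
  also have "\<dots> = - B" using Z_\<beta>(1)[of r] by (simp add: mult.assoc[symmetric])
  finally have r': "Z r * deriv (u r) x \<le> - B" .
  obtain y where "Z t * deriv (u t) y \<le> Z r * deriv (u r) x + 1 + (b * N + 1) * (t - r)"
    using torus_flow.min_growth[OF fl r t, of x] unfolding en by blast
  then have y: "Z t * deriv (u t) y \<le> - X" using r' by (simp add: B_def)
  have "deriv (u t) y = \<beta> t * (Z t * deriv (u t) y)" using Z_\<beta>(2)[of t] by (simp add: mult.assoc[symmetric])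
  also have "\<dots> \<le> \<beta> t * - X" using y Z_\<beta>(4)[of t] by (intro mult_left_mono) auto
  also have "\<dots> \<le> - m * X"
    using mult_right_mono[OF m[OF t'] X] by (simp add: \<beta>_def)
  finally show ?thesis by blast
qed

end

section \<open>Unbounded norms at the end of a finite lifespan\<close>

lemma W1inf_norm_le:
  assumes "\<And>x. \<bar>f x\<bar> \<le> A" "\<And>x. \<bar>deriv f x\<bar> \<le> B"
  shows "W1inf_norm f \<le> ennreal (A + B)"
proof -
  have "0 \<le> A" "0 \<le> B" using assms[of 0] by linarith+
  moreover have "W1inf_norm f \<le> ennreal A + ennreal B"
    unfolding W1inf_norm_def by (intro add_mono SUP_least ennreal_leI assms)
  ultimately show ?thesis by simp
qed

text \<open>If the slopes of \<open>u\<close> were bounded below, every other part of the norm being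
  bounded already, the norms could not exceed every level along \<open>\<tau>\<close>. Hence
  arbitrarily steep slopes occur, and \<open>slope_persistence\<close> carries a sufficiently steep
  one at a single time to all later times.\<close>

lemma slope_unbounded:
  fixes T :: real and \<tau> :: "nat \<Rightarrow> ennreal" and w :: "real \<Rightarrow> real" and u g :: "real \<Rightarrow> real \<Rightarrow> real"
  assumes s: "s > 3 / 2" and T: "0 < T" and w: "continuous_on {0..} w"
    and mild: "\<And>\<rho>. 0 < \<rho> \<Longrightarrow> \<rho> < T \<Longrightarrow> mild_path s c \<rho> w u g u0 g0"
    and mild_\<tau>: "\<And>n \<rho>. 0 < \<rho> \<Longrightarrow> ennreal \<rho> \<le> \<tau> n \<Longrightarrow> mild_path s c \<rho> w u g u0 g0"
    and \<tau>: "\<And>n. \<tau> n \<le> ennreal T"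
    and unbdd: "\<And>n. (SUP t\<in>{t. 0 \<le> t \<and> ennreal t \<le> \<tau> n}. W1inf_norm (u t) + W1inf_norm (g t)) > of_nat n"
  shows "\<exists>t0\<in>{0..<T}. \<forall>t\<in>{t0<..<T}. \<exists>x. deriv (u t) x < - L"
proof -
  let ?\<beta> = "\<lambda>t. exp (c * w t - c\<^sup>2 * t / 2)"
  have cont: "continuous_on {0..T} ?\<beta>"
    by (intro continuous_intros continuous_on_subset[OF w]) auto
  obtain b where "\<forall>t\<in>{0..T}. ?\<beta> t \<le> b"
    using compact_continuous_image[OF cont compact_Icc, THEN compact_imp_bounded, THEN bounded_imp_bdd_above]
    unfolding bdd_above_def by blast
  then have b: "?\<beta> t \<le> b" if "t \<in> {0..T}" for t using that by blast
  obtain tm where tm: "tm \<in> {0..T}" "\<And>t. t \<in> {0..T} \<Longrightarrow> ?\<beta> tm \<le> ?\<beta> t"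
    using continuous_attains_inf[OF compact_Icc _ cont] T by (metis atLeastAtMost_iff empty_iff less_imp_le order_refl)
  define m where "m = ?\<beta> tm"
  have m: "0 < m" "\<And>t. t \<in> {0..T} \<Longrightarrow> m \<le> ?\<beta> t" using tm by (auto simp: m_def)
  have b0: "0 < b" using b[OF tm(1)] m(1) unfolding m_def by linarith
  have half: "mild_path s c (T / 2) w u g u0 g0" using T by (intro mild) auto
  define S where "S = sobolev_const s * max (sobolev_norm s u0) (sobolev_norm s g0)"
  have k0: "0 \<le> sobolev_const s"
    unfolding sobolev_const_def by (intro divide_nonneg_nonneg mult_nonneg_nonneg real_sqrt_ge_zero suminf_nonneg sobolev_const_summable s) auto
  have S: "\<bar>deriv f x\<bar> \<le> S" if "f = u0 \<or> f = g0" for f x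
  proof -
    have "f \<in> sobolev_space s" using that mild_path.u0[OF half] mild_path.g0[OF half] by blast
    then have "\<bar>deriv f x\<bar> \<le> sobolev_const s * sobolev_norm s f" by (rule sobolev_deriv_bound[OF s])
    also have "\<dots> \<le> S" unfolding S_def using that k0 by (intro mult_left_mono) auto
    finally show ?thesis .
  qed
  define N where "N = (sobolev_norm 1 u0)\<^sup>2 + (sobolev_norm 1 g0)\<^sup>2"
  have N: "mild_path.N u0 g0 = N" unfolding mild_path.N_def[OF half] N_def ..
  have N0: "0 \<le> N" by (simp add: N_def)
  define D where "D = b * (\<bar>S\<bar> + 1 + (b * N + 1) * T)"
  have D: "b * (\<bar>S\<bar> + 1 + (b * N + 1) * \<rho>) \<le> D" if "\<rho> \<le> T" for \<rho>
    unfolding D_def using that b0 N0 by (intro mult_left_mono add_mono order_refl) auto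
  have steep: "\<exists>t\<in>{0..<T}. \<exists>x. deriv (u t) x < - L" for L
  proof (rule ccontr)
    assume "\<not> (\<exists>t\<in>{0..<T}. \<exists>x. deriv (u t) x < - L)"
    then have low: "- L \<le> deriv (u t) x" if "0 \<le> t" "t < T" for t x
      using that by (meson atLeastLessThan_iff not_le)
    define K where "K = 2 * (b * sqrt (2 * N)) + 2 * max D L"
    have bound: "W1inf_norm (u t) + W1inf_norm (g t) \<le> ennreal K"
      if P: "mild_path s c \<rho> w u g u0 g0" and \<rho>: "t \<in> {0..\<rho>}" "\<rho> \<le> T" for t \<rho>
    proof -
      \<comment> \<open>Some \<open>\<tau> n\<close> may equal \<open>T\<close>, so the endpoint
        \<open>t = T\<close> can occur; the lower bound reaches it by continuity of the slope in
        time.\<close>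
      have lt: "- L \<le> deriv (u t) x" for x
      proof (cases "t < T")
        case True
        then show ?thesis using low \<rho> by auto
      next
        case False
        then have tT: "t = T" "\<rho> = T" using \<rho> by auto
        have sp: "sobolev_path s {0..T} u" using mild_path.u[OF P] unfolding tT .
        have "continuous_on {0..T} (\<lambda>t. deriv (u t) x)"
          by (rule jcont[OF sobolev_path_joint_cont(2)[OF s sp]]) auto
        then have "((\<lambda>t. deriv (u t) x) \<longlongrightarrow> deriv (u T) x) (at T within {0..T})"
          using T unfolding continuous_on_def by auto
        then have "((\<lambda>t. deriv (u t) x) \<longlongrightarrow> deriv (u T) x) (at_left T)"
          by (metis T at_within_Icc_at_left)
        then show ?thesis unfolding tT
          by (rule tendsto_lowerbound) (use low T in \<open>auto simp: eventually_at_left[OF T] intro!: exI[of _ 0]\<close>)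
      qed
      note B = mild_path.solution_bounds[OF P b, of S t, unfolded N]
      have 1: "\<bar>u t x\<bar> \<le> b * sqrt (2 * N)" "\<bar>g t x\<bar> \<le> b * sqrt (2 * N)" "deriv (u t) x \<le> D" "\<bar>deriv (g t) x\<bar> \<le> D" for x
        using B(1)[of x] B(2)[of x] order_trans[OF B(3)[of x] D[OF \<rho>(2)]] order_trans[OF B(4)[of x] D[OF \<rho>(2)]] S \<rho>
        by (auto intro: order_trans[OF abs_ge_self])
      have 2: "\<bar>deriv (u t) x\<bar> \<le> max D L" "\<bar>deriv (g t) x\<bar> \<le> max D L" for x using 1[of x] lt[of x] by auto
      have "W1inf_norm (u t) + W1inf_norm (g t) \<le> ennreal (b * sqrt (2 * N) + max D L) + ennreal (b * sqrt (2 * N) + max D L)"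
        by (intro add_mono W1inf_norm_le 1 2)
      also have "\<dots> = ennreal K"
        using b0 N0 order_trans[OF abs_ge_zero 2(2)] by (subst ennreal_plus[symmetric]) (auto simp: K_def)
      finally show ?thesis .
    qed
    obtain n :: nat where n: "K \<le> n" using real_arch_simple by blast
    have "(SUP t\<in>{t. 0 \<le> t \<and> ennreal t \<le> \<tau> n}. W1inf_norm (u t) + W1inf_norm (g t)) \<le> ennreal K"
    proof (rule SUP_least)
      fix t assume t: "t \<in> {t. 0 \<le> t \<and> ennreal t \<le> \<tau> n}"
      show "W1inf_norm (u t) + W1inf_norm (g t) \<le> ennreal K"
      proof (cases "t = 0")
        case True
        then show ?thesis using bound[OF half, of t] T by auto
      next
        case False
        then have "0 < t" "t \<le> T" using t order_trans[OF _ \<tau>[of n], of "ennreal t"] T by (auto simp: ennreal_le_iff)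
        then show ?thesis using bound[OF mild_\<tau>[of t n], of t] t by auto
      qed
    qed
    also have "\<dots> \<le> ennreal (real n)" by (intro ennreal_leI n)
    finally show False using unbdd[of n] by (simp add: ennreal_of_nat_eq_real_of_nat)
  qed
  \<comment> \<open>Chosen so that \<open>- m * X = - (\<bar>L\<bar> + 1)\<close>, which is strictly
    below \<open>- L\<close>.\<close>
  define X where "X = (\<bar>L\<bar> + 1) / m"
  have X0: "0 \<le> X" using m by (simp add: X_def)
  \<comment> \<open>The steepness required by \<open>slope_persistence\<close> with the elapsed time
    replaced by its upper bound \<open>T\<close>, so one \<open>t0\<close> serves all later
    times.\<close>
  define C where "C = b * (X + 1 + (b * N + 1) * T)"
  obtain t0 x where t0: "0 \<le> t0" "t0 < T" and x: "deriv (u t0) x < - C"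
    using steep[of C] by auto
  show ?thesis
  proof (rule bexI[of _ t0], rule ballI)
    fix t assume t: "t \<in> {t0<..<T}"
    have P: "mild_path s c t w u g u0 g0" using t t0 by (intro mild) auto
    have "b * (X + 1 + (b * N + 1) * (t - t0)) \<le> C"
      unfolding C_def using b0 N0 t t0 by (intro mult_left_mono add_mono order_refl) auto
    then have "deriv (u t0) x < - b * (X + 1 + (b * mild_path.N u0 g0 + 1) * (t - t0))" using x unfolding N by simp
    then obtain y where y: "deriv (u t) y \<le> - m * X"
      using mild_path.slope_persistence[OF P, of b m t0 t X x] b m(2) t t0 X0 by auto
    have "- m * X = - (\<bar>L\<bar> + 1)" using m by (simp add: X_def)
    then show "\<exists>x. deriv (u t) x < - L" using y by (intro exI[of _ y]) linarith
  qed (use t0 in simp)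
qed

section \<open>Blow-up\<close>

text \<open>Used for the event of wave breaking: it agrees almost everywhere with a condition on
  countably many measurable quantities, and completeness makes the difference harmless.\<close>

lemma (in complete_measure) measurable_AE_iff:
  assumes Q: "{x \<in> space M. Q x} \<in> sets M" and AE: "AE x in M. P x \<longleftrightarrow> Q x"
  shows "{x \<in> space M. P x} \<in> sets M"
proof -
  obtain N where N: "{x \<in> space M. \<not> (P x \<longleftrightarrow> Q x)} \<subseteq> N" "emeasure M N = 0" "N \<in> sets M"
    using AE by (rule AE_E)
  then have "N \<in> null_sets M" by blast
  then have "{x \<in> space M. P x} \<inter> N \<in> sets M" by (rule complete[OF Int_lower2])
  then have "({x \<in> space M. Q x} - N) \<union> ({x \<in> space M. P x} \<inter> N) \<in> sets M" by (intro sets.Un sets.Diff Q N(3))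
  also have "({x \<in> space M. Q x} - N) \<union> ({x \<in> space M. P x} \<inter> N) = {x \<in> space M. P x}" using N(1) by blast
  finally show ?thesis .
qed

context brownian_basis
begin

lemma nn_integral_exponential_martingale:
  assumes t: "0 \<le> t"
  shows "(\<integral>\<^sup>+\<omega>. ennreal (exp (c * W t \<omega> - c\<^sup>2 * t / 2)) \<partial>M) = 1"
proof (cases "t = 0")
  case True
  have "(\<integral>\<^sup>+\<omega>. ennreal (exp (c * W t \<omega> - c\<^sup>2 * t / 2)) \<partial>M) = (\<integral>\<^sup>+\<omega>. 1 \<partial>M)"
  proof (rule nn_integral_cong_AE)
    show "AE \<omega> in M. ennreal (exp (c * W t \<omega> - c\<^sup>2 * t / 2)) = 1"
      using W_zero by eventually_elim (simp add: True)
  qed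
  then show ?thesis by (simp add: emeasure_space_1)
next
  case False
  then have t: "0 < t" using t by simp
  have "(\<integral>\<^sup>+\<omega>. ennreal (exp (c * W t \<omega> - c\<^sup>2 * t / 2)) \<partial>M)
    = (\<integral>\<^sup>+\<omega>. ennreal (exp (- (c\<^sup>2 * t / 2)) * exp (c * (W t \<omega> - W 0 \<omega>))) \<partial>M)"
  proof (rule nn_integral_cong_AE)
    show "AE \<omega> in M. ennreal (exp (c * W t \<omega> - c\<^sup>2 * t / 2)) = ennreal (exp (- (c\<^sup>2 * t / 2)) * exp (c * (W t \<omega> - W 0 \<omega>)))"
      using W_zero by eventually_elim (simp add: exp_add[symmetric])
  qed
  also have "\<dots> = ennreal (\<integral>\<omega>. exp (- (c\<^sup>2 * t / 2)) * exp (c * (W t \<omega> - W 0 \<omega>)) \<partial>M)"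
    by (rule nn_integral_eq_integral) (use increment_exp_moments(1)[of 0 t c] t in auto)
  also have "(\<integral>\<omega>. exp (- (c\<^sup>2 * t / 2)) * exp (c * (W t \<omega> - W 0 \<omega>)) \<partial>M) = exp (- (c\<^sup>2 * t / 2)) * exp (c\<^sup>2 * t / 2)"
    using increment_exp_moments(2)[of 0 t c] t by simp
  finally show ?thesis by (simp add: exp_add[symmetric])
qed

text \<open>Joint measurability of \<open>(t, \<omega>) \<mapsto> W t \<omega>\<close>, needed for Tonelli's theorem, is only available up to a
  null set: \<open>f\<close> is a jointly measurable modification obtained from the
  values of \<open>W\<close> at the multiples of \<open>1 / n\<close>.\<close>

lemma exponential_time_bound:
  assumes R: "0 < R" and A: "0 \<le> A"
    and bound: "AE \<omega> in M. integral {0..R} (\<lambda>t. exp (c * W t \<omega> - c\<^sup>2 * t / 2)) \<le> A"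
  shows "R \<le> A"
proof -
  define \<beta> where "\<beta> t \<omega> = exp (c * W t \<omega> - c\<^sup>2 * t / 2)" for t \<omega>
  \<comment> \<open>Grid times, clipped at 0 since \<open>W\<close> is controlled only for
    nonnegative times. The integer index takes countably many values, which gives joint
    measurability of the discretised process.\<close>
  define q where "q n i = max 0 (real_of_int i / real (Suc n))" for n i
  define f where "f t \<omega> = liminf (\<lambda>n. ennreal (\<beta> (q n \<lfloor>real (Suc n) * t\<rfloor>) \<omega>))" for t \<omega>
  have q0: "0 \<le> q n i" for n i by (simp add: q_def)
  have qlim: "(\<lambda>n. q n \<lfloor>real (Suc n) * t\<rfloor>) \<longlonglongrightarrow> t" if t: "0 \<le> t" for t
  proof (rule real_tendsto_sandwich)
    have q: "q n \<lfloor>real (Suc n) * t\<rfloor> = real_of_int \<lfloor>real (Suc n) * t\<rfloor> / real (Suc n)" for n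
      using t by (simp add: q_def)
    show "\<forall>\<^sub>F n in sequentially. t - inverse (real (Suc n)) \<le> q n \<lfloor>real (Suc n) * t\<rfloor>"
    proof (intro always_eventually allI)
      fix n
      have "real (Suc n) * t - 1 \<le> real_of_int \<lfloor>real (Suc n) * t\<rfloor>" by linarith
      then have "(real (Suc n) * t - 1) / real (Suc n) \<le> q n \<lfloor>real (Suc n) * t\<rfloor>"
        unfolding q by (intro divide_right_mono) auto
      then show "t - inverse (real (Suc n)) \<le> q n \<lfloor>real (Suc n) * t\<rfloor>"
        by (simp add: diff_divide_distrib inverse_eq_divide del: of_nat_Suc)
    qed
    show "\<forall>\<^sub>F n in sequentially. q n \<lfloor>real (Suc n) * t\<rfloor> \<le> t"
    proof (intro always_eventually allI)
      fix n
      have "q n \<lfloor>real (Suc n) * t\<rfloor> \<le> real (Suc n) * t / real (Suc n)"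
        unfolding q by (intro divide_right_mono) auto
      then show "q n \<lfloor>real (Suc n) * t\<rfloor> \<le> t" by (simp del: of_nat_Suc)
    qed
    show "(\<lambda>n. t - inverse (real (Suc n))) \<longlonglongrightarrow> t"
      using tendsto_diff[OF tendsto_const[of t] LIMSEQ_inverse_real_of_nat] by simp
  qed simp
  have f: "AE \<omega> in M. \<forall>t\<ge>0. f t \<omega> = ennreal (\<beta> t \<omega>)"
    using W_continuous
  proof eventually_elim
    case (elim \<omega>)
    show ?case
    proof (intro allI impI)
      fix t :: real assume t: "0 \<le> t"
      have "continuous_on {0..} (\<lambda>t. \<beta> t \<omega>)" unfolding \<beta>_def by (intro continuous_intros elim) auto
      then have "(\<lambda>n. \<beta> (q n \<lfloor>real (Suc n) * t\<rfloor>) \<omega>) \<longlonglongrightarrow> \<beta> t \<omega>"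
        by (rule continuous_on_tendsto_compose[OF _ qlim[OF t]]) (use t q0 in auto)
      then show "f t \<omega> = ennreal (\<beta> t \<omega>)"
        unfolding f_def by (intro lim_imp_Liminf[OF sequentially_bot] tendsto_ennrealI)
    qed
  qed
  have \<beta>m: "\<beta> t \<in> borel_measurable M" if "0 \<le> t" for t
    unfolding \<beta>_def[abs_def] using F_measurable_M[OF W_adapted[OF that]] by measurable
  have "(\<lambda>p. \<beta> (q n \<lfloor>real (Suc n) * fst p\<rfloor>) (snd p)) \<in> borel_measurable (lborel \<Otimes>\<^sub>M M)" for n
  proof (rule measurable_compose_countable)
    show "(\<lambda>p. \<beta> (q n i) (snd p)) \<in> borel_measurable (lborel \<Otimes>\<^sub>M M)" for i
      by (rule measurable_compose[OF measurable_snd \<beta>m[OF q0]])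
    show "(\<lambda>p. \<lfloor>real (Suc n) * fst p\<rfloor>) \<in> measurable (lborel \<Otimes>\<^sub>M M) (count_space UNIV)" by measurable
  qed
  then have fm: "(\<lambda>p. f (fst p) (snd p)) \<in> borel_measurable (lborel \<Otimes>\<^sub>M M)"
    unfolding f_def by (intro borel_measurable_liminf measurable_compose[OF _ measurable_ennreal])
  have psf: "pair_sigma_finite lborel M"
    by (intro pair_sigma_finite.intro sigma_finite_lborel sigma_finite_measure_axioms)
  have fm': "(\<lambda>(t, \<omega>). indicator {0..R} t * f t \<omega>) \<in> borel_measurable (lborel \<Otimes>\<^sub>M M)"
    unfolding case_prod_beta' by (intro borel_measurable_times_ennreal fm) measurable
  have "(\<integral>\<^sup>+\<omega>. (\<integral>\<^sup>+t. indicator {0..R} t * f t \<omega> \<partial>lborel) \<partial>M) = (\<integral>\<^sup>+t. (\<integral>\<^sup>+\<omega>. indicator {0..R} t * f t \<omega> \<partial>M) \<partial>lborel)"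
    by (rule pair_sigma_finite.Fubini'[OF psf fm'])
  also have "\<dots> = (\<integral>\<^sup>+t. indicator {0..R} t \<partial>lborel)"
  proof (rule nn_integral_cong)
    fix t :: real
    show "(\<integral>\<^sup>+\<omega>. indicator {0..R} t * f t \<omega> \<partial>M) = indicator {0..R} t"
    proof (cases "t \<in> {0..R}")
      case True
      have "(\<integral>\<^sup>+\<omega>. f t \<omega> \<partial>M) = (\<integral>\<^sup>+\<omega>. ennreal (\<beta> t \<omega>) \<partial>M)"
        by (rule nn_integral_cong_AE) (use f True in auto)
      then show ?thesis using True nn_integral_exponential_martingale[of t c] by (simp add: \<beta>_def)
    qed simp
  qed
  also have "\<dots> = ennreal R" using R by simp
  \<comment> \<open>The exponential martingale has mean 1 at every time, so the mean of its time
    integral is the length \<open>R\<close>.\<close>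
  finally have 1: "(\<integral>\<^sup>+\<omega>. (\<integral>\<^sup>+t. indicator {0..R} t * f t \<omega> \<partial>lborel) \<partial>M) = ennreal R" .
  have "(\<integral>\<^sup>+\<omega>. (\<integral>\<^sup>+t. indicator {0..R} t * f t \<omega> \<partial>lborel) \<partial>M) \<le> (\<integral>\<^sup>+\<omega>. ennreal A \<partial>M)"
  proof (rule nn_integral_mono_AE)
    show "AE \<omega> in M. (\<integral>\<^sup>+t. indicator {0..R} t * f t \<omega> \<partial>lborel) \<le> ennreal A"
      using f bound W_continuous
    proof eventually_elim
      case (elim \<omega>)
      have c: "continuous_on {0..R} (\<lambda>t. \<beta> t \<omega>)"
        unfolding \<beta>_def by (intro continuous_intros continuous_on_subset[OF elim(3)]) auto
      have "(\<integral>\<^sup>+t. indicator {0..R} t * f t \<omega> \<partial>lborel) = (\<integral>\<^sup>+t. ennreal (indicator {0..R} t * \<beta> t \<omega>) \<partial>lborel)"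
        by (intro nn_integral_cong) (use elim(1) in \<open>auto simp: indicator_def\<close>)
      also have "\<dots> = ennreal (integral {0..R} (\<lambda>t. \<beta> t \<omega>))"
      proof (rule nn_integral_has_integral_lborel)
        show "(\<lambda>t. indicator {0..R} t * \<beta> t \<omega>) \<in> borel_measurable borel"
          using borel_measurable_continuous_on_indicator[OF _ c] by simp
        have "((\<lambda>t. if t \<in> {0..R} then \<beta> t \<omega> else 0) has_integral integral {0..R} (\<lambda>t. \<beta> t \<omega>)) UNIV"
          unfolding has_integral_restrict_UNIV by (intro integrable_integral integrable_continuous_real c)
        moreover have "(\<lambda>t. if t \<in> {0..R} then \<beta> t \<omega> else 0) = (\<lambda>t. indicator {0..R} t * \<beta> t \<omega>)" by (auto simp: indicator_def)
        ultimately show "((\<lambda>t. indicator {0..R} t * \<beta> t \<omega>) has_integral integral {0..R} (\<lambda>t. \<beta> t \<omega>)) UNIV" by simp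
      qed (simp add: \<beta>_def)
      finally show ?case using elim(2) unfolding \<beta>_def by (simp add: ennreal_leI)
    qed
  qed
  then show ?thesis using A unfolding 1 by (simp add: emeasure_space_1 ennreal_le_iff)
qed

end

section \<open>Wave breaking as a limit, and a countable description of it for infinite
  lifespan\<close>

lemma at_left_ennreal_tendsto_MInfty:
  fixes h :: "real \<Rightarrow> real \<Rightarrow> real"
  assumes T: "0 < T" and h: "\<And>L. \<exists>t0\<in>{0..<T}. \<forall>t\<in>{t0<..<T}. \<exists>x. h t x < - L"
  shows "((\<lambda>t. INF x. ereal (h (enn2real t) x)) \<longlongrightarrow> -\<infinity>) (at_left (ennreal T))"
  unfolding tendsto_MInfty
proof
  fix r :: real
  obtain t0 where t0: "0 \<le> t0" "t0 < T" "\<And>t. t0 < t \<Longrightarrow> t < T \<Longrightarrow> \<exists>x. h t x < r" using h[of "- r"] by auto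
  have "(INF x. ereal (h (enn2real y) x)) < ereal r" if y: "ennreal t0 < y" "y < ennreal T" for y
  proof -
    obtain t where t: "y = ennreal t" "0 \<le> t" using y(2) by (cases y) auto
    then have "t0 < t" "t < T" using y t0(1) T by (auto simp: ennreal_less_iff)
    then obtain x where "h t x < r" using t0(3) by blast
    then show ?thesis using t by (auto simp: INF_less_iff)
  qed
  moreover have "ennreal t0 < ennreal T" "0 < ennreal T" using t0 T by (auto simp: ennreal_less_iff)
  ultimately show "\<forall>\<^sub>F x in at_left (ennreal T). (INF xa. ereal (h (enn2real x) xa)) < ereal r"
    by (subst eventually_at_left[of 0]) auto
qed

text \<open>On infinite lifespans the limit at infinity must be expressed by countably many slopes.
  Continuity of the slope in space yields a rational point; continuity in time, uniform in space,
  compares a real time with a nearby rational one.\<close>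

lemma at_left_top_tendsto_MInfty_iff:
  fixes u :: "real \<Rightarrow> real \<Rightarrow> real"
  assumes s: "s > 3 / 2" and u: "\<And>\<rho>. 0 < \<rho> \<Longrightarrow> sobolev_path s {0..\<rho>} u"
  shows "((\<lambda>t. INF x. ereal (deriv (u (enn2real t)) x)) \<longlongrightarrow> -\<infinity>) (at_left \<infinity>) \<longleftrightarrow>
    (\<forall>K::nat. \<exists>m::nat. \<forall>q\<in>\<rat>. real m \<le> q \<longrightarrow> (\<exists>x\<in>\<rat>. deriv (u q) x < - real K))" (is "?L \<longleftrightarrow> ?R")
proof -
  have sp: "u t \<in> sobolev_space s" if "0 \<le> t" for t
    using u[of "t + 1"] that unfolding sobolev_path_def by auto
  have top: "(\<infinity>::ennreal) > 0" by simp
  show ?thesis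
  proof
    assume ?L
    show ?R
    proof
      fix K :: nat
      have "\<forall>\<^sub>F t in at_left \<infinity>. (INF x. ereal (deriv (u (enn2real t)) x)) < ereal (- real K)"
        using \<open>?L\<close> unfolding tendsto_MInfty by blast
      then obtain b where b: "b < (\<infinity>::ennreal)" "\<And>y. b < y \<Longrightarrow> y < \<infinity> \<Longrightarrow> (INF x. ereal (deriv (u (enn2real y)) x)) < ereal (- real K)"
        unfolding eventually_at_left[OF top] by blast
      obtain b' where b': "b = ennreal b'" "0 \<le> b'" using b(1) by (cases b) auto
      obtain m :: nat where m: "b' < m" using reals_Archimedean2 by blast
      show "\<exists>m::nat. \<forall>q\<in>\<rat>. real m \<le> q \<longrightarrow> (\<exists>x\<in>\<rat>. deriv (u q) x < - real K)"
      proof (intro exI[of _ m] ballI impI)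
        fix q :: real assume q: "q \<in> \<rat>" "real m \<le> q"
        then have q0: "0 \<le> q" "b' < q" using m b' by auto
        have "(INF x. ereal (deriv (u (enn2real (ennreal q))) x)) < ereal (- real K)"
          by (rule b(2)) (use q0 b' in \<open>auto simp: ennreal_less_iff\<close>)
        then obtain x where x: "deriv (u q) x < - real K" using q0 by (auto simp: INF_less_iff)
        have "open {x. deriv (u q) x < - real K}"
          by (intro open_Collect_less sobolev_deriv_cont[OF s sp] q0 continuous_on_const)
        then have "{x. deriv (u q) x < - real K} \<inter> \<rat> \<noteq> {}"
          using open_Int_closure_eq_empty[of "{x. deriv (u q) x < - real K}" \<rat>] x unfolding Rats_closure_real by blast
        then show "\<exists>x\<in>\<rat>. deriv (u q) x < - real K" by blast
      qed
    qed
  next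
    assume R: ?R
    show ?L
      unfolding tendsto_MInfty
    proof
      fix r :: real
      \<comment> \<open>The slack 1 absorbs the change of the slope between the real time
        \<open>t\<close> and the rational time \<open>q\<close>.\<close>
      obtain K :: nat where K: "1 - r \<le> K" using real_arch_simple by blast
      obtain m :: nat where m: "\<And>q. q \<in> \<rat> \<Longrightarrow> real m \<le> q \<Longrightarrow> \<exists>x\<in>\<rat>. deriv (u q) x < - real K" using R by blast
      have "(INF x. ereal (deriv (u (enn2real y)) x)) < ereal r" if y: "ennreal (real m) < y" "y < \<infinity>" for y
      proof -
        obtain t where t: "y = ennreal t" "0 \<le> t" using y(2) by (cases y) auto
        then have mt: "real m < t" using y by (auto simp: ennreal_less_iff)
        have "((\<lambda>q. sobolev_const s * sobolev_dist s (u q) (u t)) \<longlongrightarrow> sobolev_const s * 0) (at t within {0..t + 1})"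
          using u[of "t + 1"] t(2) unfolding sobolev_path_def by (intro tendsto_intros) auto
        then have "\<forall>\<^sub>F q in at t within {0..t + 1}. sobolev_const s * sobolev_dist s (u q) (u t) < 1"
          by (rule order_tendstoD(2)) simp
        then obtain d where d: "d > 0" "\<And>q. q \<in> {0..t + 1} \<Longrightarrow> q \<noteq> t \<Longrightarrow> dist q t < d \<Longrightarrow> sobolev_const s * sobolev_dist s (u q) (u t) < 1"
          unfolding eventually_at by blast
        obtain q where q: "q \<in> \<rat>" "t < q" "q < min (t + 1) (t + d)"
          using Rats_dense_in_real[of t "min (t + 1) (t + d)"] d(1) by auto
        obtain x where x: "deriv (u q) x < - real K" using m[OF q(1)] q(2) mt by auto
        have "sobolev_const s * sobolev_dist s (u q) (u t) < 1"
          by (rule d(2)) (use q t in \<open>auto simp: dist_real_def\<close>)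
        then have "\<bar>deriv (u q) x - deriv (u t) x\<bar> < 1"
          using sobolev_dist_bounds(2)[OF s sp[of q] sp[of t], of x] q t by linarith
        then have "deriv (u t) x < r" using x K by linarith
        then show ?thesis using t by (auto simp: INF_less_iff)
      qed
      then show "\<forall>\<^sub>F x in at_left \<infinity>. (INF xa. ereal (deriv (u (enn2real x)) xa)) < ereal r"
        unfolding eventually_at_left[OF top] by (intro exI[of _ "ennreal (real m)"]) auto
    qed
  qed
qed

theorem theorem1p10:
  fixes M :: "'w measure" and F :: "ennreal \<Rightarrow> 'w measure" and W :: "real \<Rightarrow> 'w \<Rightarrow> real"
    and s c lam x0 :: real
    and u0 \<gamma>0 :: "'w \<Rightarrow> real \<Rightarrow> real"
    and u \<gamma> :: "real \<Rightarrow> 'w \<Rightarrow> real \<Rightarrow> real"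
    and T :: "'w \<Rightarrow> ennreal"
  assumes "brownian_basis M F W"
    and "s > 3 / 2" and "c \<noteq> 0" and "0 < lam" and "lam < 1"
    and "u0 \<in> measurable (F 0) (sobolev_borel s)"
    and "\<gamma>0 \<in> measurable (F 0) (sobolev_borel s)"
    and "integrable M (\<lambda>\<omega>. (sobolev_norm s (u0 \<omega>))\<^sup>2 + (sobolev_norm s (\<gamma>0 \<omega>))\<^sup>2)"
    and "maximal_solution M F W s c u0 \<gamma>0 u \<gamma> T"
    and "measure M {\<omega> \<in> space M. deriv (u0 \<omega>) x0 <
           - (c\<^sup>2 / (2 * lam)) -
             sqrt (c ^ 4 / (4 * lam\<^sup>2) + (sobolev_norm 1 (u0 \<omega>))\<^sup>2 + (sobolev_norm 1 (\<gamma>0 \<omega>))\<^sup>2)} = 1"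
  shows "measure M {\<omega> \<in> space M. T \<omega> < \<infinity>} > 0 \<and>
    measure M {\<omega> \<in> space M.
      ((\<lambda>t. INF x. ereal (deriv (u (enn2real t) \<omega>) x)) \<longlongrightarrow> -\<infinity>) (at_left (T \<omega>))} > 0"
proof -
  interpret brownian_basis M F W by fact
  note s = assms(2) and init = AE_measure_1[OF assms(10)]
  obtain \<tau> where T: "stopping_time F T" "measure M {\<omega> \<in> space M. 0 < T \<omega>} = 1"
    and sol: "\<And>n. local_solution M F W s c u0 \<gamma>0 u \<gamma> (\<tau> n)"
    and \<tau>: "AE \<omega> in M. incseq (\<lambda>n. \<tau> n \<omega>) \<and> (\<lambda>n. \<tau> n \<omega>) \<longlonglongrightarrow> T \<omega>"
    and unbdd: "AE \<omega> in M. T \<omega> < \<infinity> \<longrightarrow> (\<forall>n.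
          (SUP t\<in>{t. 0 \<le> t \<and> ennreal t \<le> \<tau> n \<omega>}. W1inf_norm (u t \<omega>) + W1inf_norm (\<gamma> t \<omega>)) > of_nat n)"
    using assms(9) unfolding maximal_solution_def by blast
  let ?lim = "\<lambda>\<omega>. ((\<lambda>t. INF x. ereal (deriv (u (enn2real t) \<omega>) x)) \<longlongrightarrow> -\<infinity>) (at_left (T \<omega>))"
  let ?mild = "\<lambda>\<rho> \<omega>. mild_path s c \<rho> (\<lambda>t. W t \<omega>) (\<lambda>t. u t \<omega>) (\<lambda>t. \<gamma> t \<omega>) (u0 \<omega>) (\<gamma>0 \<omega>)"
  have mild_\<tau>: "AE \<omega> in M. \<forall>n. \<forall>\<rho>>0. ennreal \<rho> \<le> \<tau> n \<omega> \<longrightarrow> ?mild \<rho> \<omega>"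
    unfolding AE_all_countable using local_solution_mild[OF s assms(6,7) sol] by blast
  have mild: "AE \<omega> in M. \<forall>\<rho>>0. ennreal \<rho> < T \<omega> \<longrightarrow> ?mild \<rho> \<omega>"
    using mild_\<tau> \<tau>
  proof eventually_elim
    case (elim \<omega>)
    show ?case
    proof (intro allI impI)
      fix \<rho> :: real assume \<rho>: "\<rho> > 0" "ennreal \<rho> < T \<omega>"
      have "\<forall>\<^sub>F n in sequentially. ennreal \<rho> < \<tau> n \<omega>" using elim(2) \<rho>(2) by (intro order_tendstoD(1)) auto
      then obtain n where "ennreal \<rho> < \<tau> n \<omega>" using eventually_happens'[OF sequentially_bot] by blast
      then show "?mild \<rho> \<omega>" using elim(1) \<rho>(1) by (meson less_imp_le)
    qed
  qed
  have Tm: "{\<omega> \<in> space M. T \<omega> < \<infinity>} \<in> sets M"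
  proof -
    have "{\<omega> \<in> space M. T \<omega> \<le> ennreal (real n)} \<in> sets M" for n
    proof -
      have "{\<omega> \<in> space (F (ennreal (real n))). T \<omega> \<le> ennreal (real n)} \<in> sets (F (ennreal (real n)))"
        using stopping_timeD[OF T(1), of "ennreal (real n)"] by (simp add: pred_def)
      then show ?thesis using F_subalgebra[of "ennreal (real n)"] unfolding subalgebra_def by auto
    qed
    then have "(\<Union>n. {\<omega> \<in> space M. T \<omega> \<le> ennreal (real n)}) \<in> sets M" by blast
    also have "(\<Union>n. {\<omega> \<in> space M. T \<omega> \<le> ennreal (real n)}) = {\<omega> \<in> space M. T \<omega> < \<infinity>}"
    proof (intro set_eqI iffI)
      fix \<omega> assume "\<omega> \<in> {\<omega> \<in> space M. T \<omega> < \<infinity>}"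
      moreover from this obtain t where "T \<omega> = ennreal t" "0 \<le> t" by (cases "T \<omega>") auto
      moreover obtain n :: nat where "t \<le> n" using real_arch_simple by blast
      ultimately show "\<omega> \<in> (\<Union>n. {\<omega> \<in> space M. T \<omega> \<le> ennreal (real n)})" by (auto intro!: exI[of _ n] ennreal_leI)
    qed (auto intro: le_less_trans)
    finally show ?thesis .
  qed
  have finite_pos: "measure M {\<omega> \<in> space M. T \<omega> < \<infinity>} > 0"
  proof (rule ccontr)
    assume "\<not> ?thesis"
    then have "measure M {\<omega> \<in> space M. T \<omega> < \<infinity>} = 0" by (simp add: zero_less_measure_iff)
    then have inf: "AE \<omega> in M. \<not> T \<omega> < \<infinity>" using prob_Collect_eq_0[OF Tm] by simp
    define a where "a = c\<^sup>2 / (2 * lam)"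
    have a: "0 < a" using assms(3,4) by (simp add: a_def)
    have a2: "a\<^sup>2 = c ^ 4 / (4 * lam\<^sup>2)" by (simp add: a_def power_divide power_mult_distrib flip: power_mult)
    \<comment> \<open>Any horizon beyond \<open>1 / a\<close> would do: if almost all paths lived
      forever, the time integral up to it would be at most \<open>1 / a\<close> almost surely, while
      its mean is the horizon.\<close>
    have "1 / a + 1 \<le> 1 / a"
    proof (rule exponential_time_bound)
      show "AE \<omega> in M. integral {0..1 / a + 1} (\<lambda>t. exp (c * W t \<omega> - c\<^sup>2 * t / 2)) \<le> 1 / a"
        using mild inf init
      proof eventually_elim
        case (elim \<omega>)
        have "0 < 1 / a + 1" using a by (simp add: add_pos_pos)
        moreover have "T \<omega> = \<infinity>" using elim(2) less_top[of "T \<omega>"] by auto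
        ultimately have P: "?mild (1 / a + 1) \<omega>" using elim(1)[rule_format, of "1 / a + 1"] by simp
        show ?case
          by (rule mild_path.beta_integral_bound[OF P a, of x0])
             (use elim(3) in \<open>simp add: mild_path.N_def[OF P] a2[symmetric] a_def[symmetric] add.assoc\<close>)
      qed
    qed (use a in \<open>auto simp: add_pos_pos\<close>)
    then show False by simp
  qed
  have broken: "AE \<omega> in M. T \<omega> < \<infinity> \<longrightarrow>
    ?lim \<omega>"
    using mild mild_\<tau> \<tau> unbdd AE_measure_1[OF T(2)] W_continuous
  proof eventually_elim
    case (elim \<omega>)
    show ?case
    proof
      assume fin: "T \<omega> < \<infinity>"
      then obtain T' where T': "T \<omega> = ennreal T'" "0 \<le> T'" by (cases "T \<omega>") auto
      then have pos: "0 < T'" using elim(5) by simp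
      show "?lim \<omega>"
        unfolding T'(1)
      proof (rule at_left_ennreal_tendsto_MInfty[OF pos])
        fix L
        show "\<exists>t0\<in>{0..<T'}. \<forall>t\<in>{t0<..<T'}. \<exists>x. deriv (u t \<omega>) x < - L"
        proof (rule slope_unbounded[OF s pos elim(6), where \<tau>="\<lambda>n. \<tau> n \<omega>"])
          show "?mild \<rho> \<omega>" if "0 < \<rho>" "\<rho> < T'" for \<rho> using elim(1) that T' by (auto simp: ennreal_less_iff)
          show "?mild \<rho> \<omega>" if "0 < \<rho>" "ennreal \<rho> \<le> \<tau> n \<omega>" for n \<rho> using elim(2) that by blast
          show "\<tau> n \<omega> \<le> ennreal T'" for n using elim(3) incseq_le[of "\<lambda>n. \<tau> n \<omega>"] unfolding T'(1) by blast
          show "of_nat n < (SUP t\<in>{t. 0 \<le> t \<and> ennreal t \<le> \<tau> n \<omega>}. W1inf_norm (u t \<omega>) + W1inf_norm (\<gamma> t \<omega>))" for n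
            using elim(4) fin by blast
        qed
      qed
    qed
  qed
  \<comment> \<open>On finite lifespans the limit holds almost surely by \<open>broken\<close>, so
    the event can be replaced by \<open>T \<omega> < \<infinity>\<close>; on infinite ones it is
    replaced by the condition over rationals.\<close>
  let ?Q = "\<lambda>\<omega>. T \<omega> < \<infinity> \<or> (\<forall>K::nat. \<exists>m::nat. \<forall>q\<in>\<rat>. real m \<le> q \<longrightarrow> (\<exists>x\<in>\<rat>. deriv (u q \<omega>) x < - real K))"
  have "{\<omega> \<in> space M. ?lim \<omega>} \<in> sets M"
  proof (rule measurable_AE_iff[where Q="?Q"])
    have pu: "sobolev_predictable F s u" using sol[of 0] unfolding local_solution_def by blast
    have "{\<omega> \<in> space M. real m \<le> q \<longrightarrow> (\<exists>x\<in>\<rat>. deriv (u q \<omega>) x < - real K)} \<in> sets M" for m K :: nat and q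
    proof (cases "real m \<le> q")
      case True
      then have "0 \<le> q" by (meson of_nat_0_le_iff order_trans)
      then have "(\<lambda>\<omega>. deriv (u q \<omega>) x) \<in> borel_measurable M" for x
        by (intro F_measurable_M[of _ "ennreal q"] measurable_compose[OF predictable_adapted[OF assms(1) pu] sobolev_deriv_measurable[OF s]])
      then have "{\<omega> \<in> space M. deriv (u q \<omega>) x < - real K} \<in> sets M" for x by measurable
      then have "{\<omega> \<in> space M. \<exists>x\<in>\<rat>. deriv (u q \<omega>) x < - real K} \<in> sets M"
        by (intro sets.sets_Collect_countable_Ex' countable_rat)
      then show ?thesis using True by simp
    qed simp
    then show "{\<omega> \<in> space M. ?Q \<omega>} \<in> sets M"
      by (intro sets.sets_Collect_disj Tm sets.sets_Collect_countable_All sets.sets_Collect_countable_Ex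
          sets.sets_Collect_countable_All' countable_rat)
    show "AE \<omega> in M. ?lim \<omega> \<longleftrightarrow> ?Q \<omega>"
      using broken mild
    proof eventually_elim
      case (elim \<omega>)
      show ?case
      proof (cases "T \<omega> < \<infinity>")
        case True
        then show ?thesis using elim(1) by simp
      next
        case False
        then have inf: "T \<omega> = \<infinity>" by (simp add: less_top[symmetric])
        have "sobolev_path s {0..\<rho>} (\<lambda>t. u t \<omega>)" if "0 < \<rho>" for \<rho>
          by (rule mild_path.u[where c=c and w="\<lambda>t. W t \<omega>" and g="\<lambda>t. \<gamma> t \<omega>" and ?u0.0="u0 \<omega>" and ?g0.0="\<gamma>0 \<omega>"])
             (use elim(2) that inf in auto)
        from at_left_top_tendsto_MInfty_iff[OF s this] show ?thesis unfolding inf by simp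
      qed
    qed
  qed
  \<comment> \<open>Only now, with the event known to be measurable, does monotonicity of the
    measure apply.\<close>
  then have "measure M {\<omega> \<in> space M. T \<omega> < \<infinity>} \<le> measure M {\<omega> \<in> space M.
      ?lim \<omega>}"
    by (intro finite_measure_mono_AE) (use broken in auto)
  then show ?thesis using finite_pos by linarith
qed

end
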